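(* Let $n\ge 1$, $Q=2n+2$, let $V>0$, and define $R>0$ by $$R=\left(\frac{(Q-2)\,\Gamma\left(\frac{Q+2}{2}\right)\Gamma\left(\frac{Q-2}{2}\right)}{\pi^{\frac{Q-1}{2}}\,\Gamma\left(\frac{Q+1}{2}\right)}\right)^{1/Q}V^{1/Q}.$$ Then the variational problem $$\min_{E\in\mathcal E,\ |E|=V}P_H(E;\mathbb H^n)$$ has a unique solution $E_R=\delta_R(E_o)\in\mathcal E$, where $E_o$ is the bounded open set whose boundary $\partial E_o$ is described by the graphs $t=\pm u_o(z)$, $|z|\le 1$, with $$u_o(z)=\frac{\pi}{8}+\frac{|z|}{4}\sqrt{1-|z|^2}-\frac14\sin^{-1}(|z|),\qquad |z|\le 1,$$ (sign $+$ for the part in $\mathbb H^n_+$, sign $-$ for the part in $\mathbb H^n_-$). Moreover, the boundary $\partial E_R=\delta_R(\partial E_o)$ of the bounded open set $E_R$ is of class $C^2$, but not of class $C^3$, near its two characteristic points $\left(0,\pm\frac{\pi R^2}{8}\right)$, it is $C^\infty$ away from them, and $S_R=\partial E_R$ has positive constant $H$-mean curvature given by $$\mathcal H=\frac{Q-2}{R}.$$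
   Context: Heisenberg group: $\mathbb H^n=\mathbb R^{2n+1}$ with points $g=(z,t)=(x,y,t)$, $x,y\in\mathbb R^n$, $t\in\mathbb R$, and group law $(x,y,t)(x',y',t')=(x+x',y+y',t+t'+\frac12(\langle x,y'\rangle-\langle x',y\rangle))$. Left-invariant horizontal vector fields: $X_i=\partial_{x_i}-\frac{y_i}{2}\partial_t$, $X_{n+i}=\partial_{y_i}+\frac{x_i}{2}\partial_t$, $i=1,\dots,n$; also $T=\partial_t$. $\mathbb H^n$ carries the left-invariant Riemannian metric for which $X_1,\dots,X_{2n},T$ are orthonormal. Dilations: $\delta_\lambda(z,t)=(\lambda z,\lambda^2t)$. $|E|$ is Lebesgue measure. $\mathbb H^n_{+}=\{t>0\}$, $\mathbb H^n_-=\{t<0\}$. $B(0,R)$ is the Euclidean ball in $\mathbb R^{2n}$. $H$-perimeter: for a measurable set $E$ and an open set $\Omega$, $P_H(E;\Omega)=\sup\int_E\sum_{i=1}^{2n}X_i\zeta_i\,dg$, the supremum over $\zeta=(\zeta_1,\dots,\zeta_{2n})$ with $\zeta_i$ and $X_j\zeta_i$ continuous and compactly supported in $\Omega$ for all $i,j$, and $\sup_\Omega(\sum_i\zeta_i^2)^{1/2}\le1$. Class $\mathcal E$: the collection of sets $E\subset\mathbb H^n$ satisfying: (i) $|E\cap\mathbb H^n_+|=|E\cap\mathbb H^n_-|$; (ii) there exist $R>0$ (depending on $E$) and functions $u,v:\overline B(0,R)\to[0,\infty)$ with $u,v\in C^2(B(0,R))\cap C(\overline B(0,R))$, $u=v=0$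 on $\partial B(0,R)$, such that $\partial E\cap\mathbb H^n_+=\{(z,t)\in\mathbb H^n_+: |z|<R,\ t=u(z)\}$ and $\partial E\cap\mathbb H^n_-=\{(z,t)\in\mathbb H^n_-: |z|<R,\ t=-v(z)\}$; (iii) $\{z\in B(0,R):u(z)=0\}\cap\{z\in B(0,R):v(z)=0\}=\varnothing$. Members of $\mathcal E$ are understood as the bounded open sets between the two graphs, $E=\{(z,t):|z|<R,\ -v(z)<t<u(z)\}$. $H$-mean curvature: let $\mathcal S=\partial E$ be a $C^2$ hypersurface with Riemannian outer normal $N$ (not necessarily unit). Put $p_i=\langle N,X_i\rangle$, $i=1,\dots,2n$, $W=(p_1^2+\dots+p_{2n}^2)^{1/2}$. A point of $\mathcal S$ is characteristic if $W=0$ there. At non-characteristic points put $\overline p_i=p_i/W$ and $\mathcal H=\sum_{i=1}^{2n}X_i\overline p_i$ (where locally $\mathcal S=\{\phi=0\}$, $N=\nabla\phi$, and $p_i=X_i\phi$ are extended off $\mathcal S$ in this way). At a characteristic point $g_0$, $\mathcal H(g_0)$ is the limit of $\mathcal H(g)$ as $g\to g_0$ through non-characteristic points, if it exists. $\mathcal S$ has constant $H$-mean curvature if $\mathcal H$ is defined everywhere on $\mathcal S$ and constant. *)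

theory Defs
  imports "HOL-Analysis.Analysis" "HOL-Library.Extended_Nat"
begin

section \<open>Heisenberg group, horizontal frame and Riemannian metric\<close>

text \<open>
  A point of the Heisenberg group of dimension \<open>2n + 1\<close>, \<open>n = CARD('n)\<close>, is written
  \<open>((x, y), t)\<close>.  The norm, topology and Lebesgue measure of the product type are the Euclidean
  ones; in particular \<open>norm (x, y)\<close> is the Euclidean norm of \<open>z = (x, y)\<close>.
\<close>

type_synonym 'n horiz = "(real ^ 'n) \<times> (real ^ 'n)"
type_synonym 'n heis = "'n horiz \<times> real"

definition upper_half :: "'n::finite heis set" where
  "upper_half = {(z, t). t > 0}"

definition lower_half :: "'n::finite heis set" where
  "lower_half = {(z, t). t < 0}"

definition dilation :: "real \<Rightarrow> 'n::finite heis \<Rightarrow> 'n heis" where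
  "dilation r = (\<lambda>(z, t). (r *\<^sub>R z, r\<^sup>2 * t))"

text \<open>
  The index \<open>Inl k\<close> stands for \<open>X\<^sub>k\<close> and \<open>Inr k\<close> for \<open>X\<^bsub>n+k\<^esub>\<close>; \<open>hX i g\<close> is the value at \<open>g\<close> of the
  vector field, i.e. its coefficient vector with respect to the coordinates \<open>((x, y), t)\<close>.
\<close>

definition hX :: "'n + 'n \<Rightarrow> 'n::finite heis \<Rightarrow> 'n heis" where
  "hX i = (\<lambda>((x, y), t). case i of
      Inl k \<Rightarrow> ((axis k 1, 0), - (y $ k) / 2)
    | Inr k \<Rightarrow> ((0, axis k 1), (x $ k) / 2))"

definition hT :: "'n::finite heis \<Rightarrow> 'n heis" where
  "hT g = (0, 1)"

text \<open>
  \<open>X\<^sub>i f\<close> is the derivative along the field \<open>X\<^sub>i\<close> alone (its integral curves are the straight lines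
  \<open>s \<mapsto> g + s X\<^sub>i(g)\<close>).  It may exist although \<open>f\<close> is not differentiable in the \<open>t\<close> direction.
\<close>

definition X_differentiable :: "'n + 'n \<Rightarrow> ('n::finite heis \<Rightarrow> real) \<Rightarrow> 'n heis \<Rightarrow> bool" where
  "X_differentiable i f g \<longleftrightarrow> (\<lambda>s::real. f (g + s *\<^sub>R hX i g)) field_differentiable (at 0)"

definition Xd :: "'n + 'n \<Rightarrow> ('n::finite heis \<Rightarrow> real) \<Rightarrow> 'n heis \<Rightarrow> real" where
  "Xd i f g = deriv (\<lambda>s::real. f (g + s *\<^sub>R hX i g)) 0"

text \<open>
  The 1-form dual to \<open>T\<close>, and the Riemannian metric in which \<open>X\<^sub>1, \<dots>, X\<^bsub>2n\<^esub>, T\<close> are orthonormal;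
  \<open>v\<close>, \<open>w\<close> are tangent vectors at \<open>g\<close>, given by coordinates.
\<close>

definition contact_form :: "'n::finite heis \<Rightarrow> 'n heis \<Rightarrow> real" where
  "contact_form g v =
     snd v + (inner (snd (fst g)) (fst (fst v)) - inner (fst (fst g)) (snd (fst v))) / 2"

definition heis_metric :: "'n::finite heis \<Rightarrow> 'n heis \<Rightarrow> 'n heis \<Rightarrow> real" where
  "heis_metric g v w = inner (fst v) (fst w) + contact_form g v * contact_form g w"

lemma contact_form_hX [simp]: "contact_form g (hX i g) = 0"
  by (cases g; cases "fst g"; cases i)
     (auto simp: contact_form_def hX_def inner_axis)

lemma contact_form_hT [simp]: "contact_form g (hT g) = 1"
  by (simp add: contact_form_def hT_def)

lemma heis_metric_frame:
  "heis_metric g (hX i g) (hX j g) = (if i = j then 1 else 0)"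
  "heis_metric g (hX i g) (hT g) = 0"
  "heis_metric g (hT g) (hT g) = 1"
proof -
  obtain x y t where g: "g = ((x, y), t)"
    by (metis surj_pair)
  show "heis_metric g (hX i g) (hX j g) = (if i = j then 1 else 0)"
    unfolding heis_metric_def contact_form_hX
    by (cases i; cases j) (auto simp: g hX_def inner_axis_axis)
qed (simp_all add: heis_metric_def, simp_all add: hT_def)

definition heis_grad :: "('n::finite heis \<Rightarrow> real) \<Rightarrow> 'n heis \<Rightarrow> 'n heis" where
  "heis_grad \<phi> g = (THE N. \<forall>v. heis_metric g N v = frechet_derivative \<phi> (at g) v)"


section \<open>Horizontal perimeter\<close>

definition compactly_supported_in :: "'n::finite heis set \<Rightarrow> ('n heis \<Rightarrow> real) \<Rightarrow> bool" where
  "compactly_supported_in \<Omega> f \<longleftrightarrow>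
     compact (closure {g. f g \<noteq> 0}) \<and> closure {g. f g \<noteq> 0} \<subseteq> \<Omega>"

text \<open>Test fields on \<open>\<Omega>\<close> are extended by zero to the whole group.\<close>

definition horizontal_test_fields :: "'n::finite heis set \<Rightarrow> ('n + 'n \<Rightarrow> 'n heis \<Rightarrow> real) set" where
  "horizontal_test_fields \<Omega> =
     {\<zeta>. (\<forall>i. continuous_on UNIV (\<zeta> i) \<and> compactly_supported_in \<Omega> (\<zeta> i)) \<and>
         (\<forall>i j. (\<forall>g. X_differentiable j (\<zeta> i) g) \<and>
                continuous_on UNIV (Xd j (\<zeta> i)) \<and> compactly_supported_in \<Omega> (Xd j (\<zeta> i))) \<and>
         (\<forall>g\<in>\<Omega>. sqrt (\<Sum>i\<in>UNIV. (\<zeta> i g)\<^sup>2) \<le> 1)}"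

definition H_perimeter :: "'n::finite heis set \<Rightarrow> 'n heis set \<Rightarrow> ereal" where
  "H_perimeter E \<Omega> =
     (SUP \<zeta>\<in>horizontal_test_fields \<Omega>.
        ereal (set_lebesgue_integral lebesgue E (\<lambda>g. \<Sum>i\<in>UNIV. Xd i (\<zeta> i) g)))"


section \<open>Functions and hypersurfaces of class \<open>C\<^sup>k\<close>\<close>

text \<open>Meant for open \<open>U\<close>.\<close>

primrec Cn_on :: "nat \<Rightarrow> ('a::euclidean_space \<Rightarrow> real) \<Rightarrow> 'a set \<Rightarrow> bool" where
  "Cn_on 0 = (\<lambda>f U. continuous_on U f)"
| "Cn_on (Suc k) = (\<lambda>f U. f differentiable_on U \<and>
     (\<forall>b\<in>Basis. Cn_on k (\<lambda>x. frechet_derivative f (at x) b) U))"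

definition C_on :: "enat \<Rightarrow> ('a::euclidean_space \<Rightarrow> real) \<Rightarrow> 'a set \<Rightarrow> bool" where
  "C_on k f U \<longleftrightarrow> (\<forall>m. enat m \<le> k \<longrightarrow> Cn_on m f U)"

definition defining_function ::
    "enat \<Rightarrow> 'a::euclidean_space set \<Rightarrow> 'a set \<Rightarrow> ('a \<Rightarrow> real) \<Rightarrow> bool" where
  "defining_function k S U \<phi> \<longleftrightarrow>
     open U \<and> C_on k \<phi> U \<and> (\<forall>g\<in>U. frechet_derivative \<phi> (at g) \<noteq> (\<lambda>_. 0)) \<and>
     S \<inter> U = {g \<in> U. \<phi> g = 0}"

definition hypersurface_near :: "enat \<Rightarrow> 'a::euclidean_space set \<Rightarrow> 'a \<Rightarrow> bool" where
  "hypersurface_near k S g \<longleftrightarrow> (\<exists>U \<phi>. g \<in> U \<and> defining_function k S U \<phi>)"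


section \<open>The class of competitors\<close>

definition between_graphs ::
    "real \<Rightarrow> ('n horiz \<Rightarrow> real) \<Rightarrow> ('n horiz \<Rightarrow> real) \<Rightarrow> 'n::finite heis set" where
  "between_graphs R u v = {(z, t). norm z < R \<and> - v z < t \<and> t < u z}"

definition graph_profile :: "real \<Rightarrow> ('n::finite horiz \<Rightarrow> real) \<Rightarrow> bool" where
  "graph_profile R u \<longleftrightarrow>
     (\<forall>z\<in>cball 0 R. 0 \<le> u z) \<and> C_on 2 u (ball 0 R) \<and> continuous_on (cball 0 R) u \<and>
     (\<forall>z\<in>sphere 0 R. u z = 0)"

definition class_E :: "'n::finite heis set set" where
  "class_E = {E.
     emeasure lebesgue (E \<inter> upper_half) = emeasure lebesgue (E \<inter> lower_half) \<and>
     (\<exists>R>0. \<exists>u v. graph_profile R u \<and> graph_profile R v \<and>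
        frontier E \<inter> upper_half = {(z, t) \<in> upper_half. norm z < R \<and> t = u z} \<and>
        frontier E \<inter> lower_half = {(z, t) \<in> lower_half. norm z < R \<and> t = - v z} \<and>
        {z \<in> ball 0 R. u z = 0} \<inter> {z \<in> ball 0 R. v z = 0} = {} \<and>
        E = between_graphs R u v)}"


section \<open>Horizontal mean curvature of a boundary\<close>

text \<open>
  The condition \<open>E \<inter> U = {\<phi> < 0}\<close> makes the gradient of \<open>\<phi>\<close> an outer normal along the boundary of \<open>E\<close>.
\<close>

definition outer_defining_function ::
    "'n::finite heis set \<Rightarrow> 'n heis set \<Rightarrow> ('n heis \<Rightarrow> real) \<Rightarrow> bool" where
  "outer_defining_function E U \<phi> \<longleftrightarrow>
     defining_function 2 (frontier E) U \<phi> \<and> E \<inter> U = {g \<in> U. \<phi> g < 0}"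

definition hp :: "('n::finite heis \<Rightarrow> real) \<Rightarrow> 'n + 'n \<Rightarrow> 'n heis \<Rightarrow> real" where
  "hp \<phi> i g = heis_metric g (heis_grad \<phi> g) (hX i g)"

definition hW :: "('n::finite heis \<Rightarrow> real) \<Rightarrow> 'n heis \<Rightarrow> real" where
  "hW \<phi> g = sqrt (\<Sum>i\<in>UNIV. (hp \<phi> i g)\<^sup>2)"

lemma heis_metric_grad:
  fixes \<phi> :: "'n::finite heis \<Rightarrow> real"
  assumes "\<phi> differentiable (at g)"
  shows "heis_metric g (heis_grad \<phi> g) v = frechet_derivative \<phi> (at g) v"
proof -
  define D where "D = frechet_derivative \<phi> (at g)"
  define J :: "'n horiz" where "J = (snd (fst g), - fst (fst g))"
  have c: "contact_form g w = snd w + inner J (fst w) / 2" for w :: "'n heis"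
    by (cases w; cases "fst w") (auto simp: contact_form_def J_def)
  have lin: "linear D"
    unfolding D_def using assms by (rule linear_frechet_derivative)
  define a where "a = adjoint D 1"
  have a: "D w = inner a w" for w
    using adjoint_works[OF lin, of w 1] by (simp add: a_def inner_commute)
  define p where "p = fst a - (snd a / 2) *\<^sub>R J"
  define N where "N = (p, snd a - inner J p / 2)"
  have N: "heis_metric g N w = D w" for w
    by (cases w) (simp add: heis_metric_def c a N_def p_def inner_prod_def algebra_simps)
  have unique: "M = N" if M: "\<forall>w. heis_metric g M w = D w" for M
  proof -
    have 0: "heis_metric g (M - N) w = 0" for w
    proof -
      have "heis_metric g (M - N) w = heis_metric g M w - heis_metric g N w"
        by (simp add: heis_metric_def c inner_diff_left inner_diff_right field_simps)
      then show ?thesis using M N by simp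
    qed
    have "inner (fst (M - N)) (fst (M - N)) + (contact_form g (M - N))\<^sup>2 = 0"
      using 0[of "M - N"] by (simp add: heis_metric_def power2_eq_square)
    then have "inner (fst (M - N)) (fst (M - N)) = 0" "contact_form g (M - N) = 0"
      by (metis add_nonneg_eq_0_iff inner_ge_zero zero_le_power2, 
          metis add_nonneg_eq_0_iff inner_ge_zero zero_le_power2 zero_eq_power2)
    then have "fst (M - N) = 0" "snd (M - N) = 0"
      by (auto simp: c)
    then show ?thesis by (simp add: prod_eq_iff)
  qed
  have "heis_grad \<phi> g = N"
    unfolding heis_grad_def using N unique unfolding D_def by (intro the_equality) auto
  then show ?thesis using N by (simp add: D_def)
qed

lemma hp_eq_Xd:
  fixes \<phi> :: "'n::finite heis \<Rightarrow> real"
  assumes "\<phi> differentiable (at g)"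
  shows "hp \<phi> i g = Xd i \<phi> g"
proof -
  let ?D = "frechet_derivative \<phi> (at g)"
  have D: "(\<phi> has_derivative ?D) (at g)"
    using assms by (simp add: frechet_derivative_works)
  have L: "((\<lambda>s::real. g + s *\<^sub>R hX i g) has_derivative (\<lambda>s. s *\<^sub>R hX i g)) (at 0)"
    by (auto intro!: derivative_eq_intros)
  have "((\<lambda>s::real. \<phi> (g + s *\<^sub>R hX i g)) has_derivative (\<lambda>s. ?D (s *\<^sub>R hX i g))) (at 0)"
    using has_derivative_compose[OF L, of \<phi> ?D] D by simp
  moreover have "?D (s *\<^sub>R hX i g) = ?D (hX i g) * s" for s
    using linear_scale[OF linear_frechet_derivative[OF assms], of s "hX i g"] by simp
  ultimately have "((\<lambda>s::real. \<phi> (g + s *\<^sub>R hX i g)) has_field_derivative ?D (hX i g)) (at 0)"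
    by (simp add: has_field_derivative_def)
  then show ?thesis
    unfolding hp_def Xd_def heis_metric_grad[OF assms] by (simp add: DERIV_imp_deriv)
qed

definition characteristic :: "'n::finite heis set \<Rightarrow> 'n heis \<Rightarrow> bool" where
  "characteristic E g \<longleftrightarrow> g \<in> frontier E \<and>
     (\<exists>U \<phi>. g \<in> U \<and> outer_defining_function E U \<phi> \<and> hW \<phi> g = 0)"

definition noncharacteristic :: "'n::finite heis set \<Rightarrow> 'n heis \<Rightarrow> bool" where
  "noncharacteristic E g \<longleftrightarrow> g \<in> frontier E \<and>
     (\<exists>U \<phi>. g \<in> U \<and> outer_defining_function E U \<phi> \<and> hW \<phi> g \<noteq> 0)"

text \<open>
  The value of \<open>\<Sum>\<^sub>i X\<^sub>i (p\<^sub>i / W)\<close> at a non-characteristic point of the boundary is the same for all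
  defining functions, which is what the definite description relies on.
\<close>

definition H_curv :: "'n::finite heis set \<Rightarrow> 'n heis \<Rightarrow> real" where
  "H_curv E g = (THE h. \<exists>U \<phi>. g \<in> U \<and> outer_defining_function E U \<phi> \<and>
     h = (\<Sum>i\<in>UNIV. Xd i (\<lambda>g'. hp \<phi> i g' / hW \<phi> g') g))"

definition has_H_mean_curvature :: "'n::finite heis set \<Rightarrow> 'n heis \<Rightarrow> real \<Rightarrow> bool" where
  "has_H_mean_curvature E g h \<longleftrightarrow>
     (noncharacteristic E g \<and> h = H_curv E g) \<or>
     (characteristic E g \<and> g islimpt Collect (noncharacteristic E) \<and>
        (H_curv E \<longlongrightarrow> h) (at g within Collect (noncharacteristic E)))"

definition constant_H_mean_curvature :: "'n::finite heis set \<Rightarrow> real \<Rightarrow> bool" where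
  "constant_H_mean_curvature E h \<longleftrightarrow>
     (\<forall>g\<in>frontier E. \<exists>U \<phi>. g \<in> U \<and> outer_defining_function E U \<phi>) \<and>
     (\<forall>g\<in>frontier E. has_H_mean_curvature E g h)"


section \<open>The isoperimetric profile\<close>

definition u_o :: "'n::finite horiz \<Rightarrow> real" where
  "u_o z = pi / 8 + norm z / 4 * sqrt (1 - (norm z)\<^sup>2) - 1 / 4 * arcsin (norm z)"

definition E_o :: "'n::finite heis set" where
  "E_o = between_graphs 1 u_o u_o"

end

theory Submission
  imports Defs "HOL-Computational_Algebra.Polynomial"
begin

text \<open>
  Let \<open>E\<close> be a competitor of volume \<open>V\<close> lying over the ball of radius \<open>r\<close>.  Testing the perimeter with
  horizontal fields that equal \<open>z / r + a z\<close> near the upper graph and \<open>z / r + b z\<close> near the lower one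
  gives \<open>2 n V / r\<close>, from the divergence \<open>2 n\<close> of \<open>z\<close>, plus one linear pairing for each graph.  When
  \<open>a\<close> and \<open>b\<close> approach the horizontal normals of the extremal profile over the same ball minus \<open>z / r\<close>,
  they become multiples of the rotated position vector, and the pairings become independent of the graphs.
  Hence the perimeter is at least \<open>2 n V / r + C * r ^ (2 n + 1)\<close>, which is minimal exactly at \<open>r = R\<close>
  by Bernoulli's inequality.  The pairing can be increased further wherever the horizontal normal of a
  graph differs from the calibrating one, so in the case of equality the derivatives of the graph and of
  the extremal profile agree along the horizontal geodesics from the centre to the boundary sphere, where
  both vanish.

  For the regularity, the boundary off the poles is \<open>\<bar>z\<bar>\<^sup>2 = h t\<close> with \<open>h\<close> smooth, while at the poles the
  profile has the expansion \<open>\<pi> R\<^sup>2 / 8 - \<bar>z\<bar>\<^sup>3 / (6 R) + \<dots>\<close>.  The mean curvature is the trace of a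
  Hessian over horizontal tangent directions, and this is determined by curves in the boundary, so any
  outer defining function may be compared with \<open>\<bar>z\<bar>\<^sup>2 - h t\<close>.
\<close>

section \<open>Continuously differentiable functions and the horizontal frame\<close>

text \<open>The perimeter is reached only through test fields and integration by parts, never
  through a surface measure. A competitor is \<open>C^2\<close> only in the open ball, so its slope
  may blow up at the sphere; the extremal normal minus \<open>z / r\<close> is discontinuous at the
  centre and not differentiable at the sphere. Hence the corrections \<open>a\<close>,
  \<open>b\<close> have compact support in the open ball and the calibrating ones occur only as
  limits. One field must also serve both graphs: by condition (iii) they are uniformly separated
  over that support, so the field can switch from \<open>b\<close> to \<open>a\<close> in a layer
  around their midpoint surface, and what the switch contributes cancels after integration by parts.
  The pairing forgets the graph because a radial multiple of the rotated position vector is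
  divergence free. That the bound is attained needs an opposite estimate, obtained by smoothing the
  indicator of the extremal set. All integrals reduce to the volume \<open>k\<close> of the extremal
  set of radius 1: \<open>V = k * R ^ (2 n + 2)\<close> and \<open>C = 2 n k / (2 n + 1)\<close>,
  which places the minimum over \<open>r\<close> at \<open>R\<close>.\<close>

definition rotJ :: "'n::finite horiz \<Rightarrow> 'n horiz" where
  "rotJ z = (snd z, - fst z)"

definition bvec :: "'n + 'n \<Rightarrow> 'n::finite horiz" where
  "bvec i = (case i of Inl k \<Rightarrow> (axis k 1, 0) | Inr k \<Rightarrow> (0, axis k 1))"

lemma linear_rotJ: "linear rotJ"
  by (auto simp: rotJ_def linear_iff)

lemma bounded_linear_rotJ: "bounded_linear rotJ"
  by (simp add: linear_rotJ linear_conv_bounded_linear[symmetric])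

lemma rotJ_simps [simp]:
  "rotJ (rotJ z) = - z" "rotJ (c *\<^sub>R z) = c *\<^sub>R rotJ z" "rotJ (z + w) = rotJ z + rotJ w"
  "rotJ (- z) = - rotJ z" "rotJ 0 = 0" "rotJ (z - w) = rotJ z - rotJ w"
  by (auto simp: rotJ_def prod_eq_iff)

lemma inner_rotJ [simp]:
  "inner (rotJ z) z = 0" "inner z (rotJ z) = 0" "inner (rotJ z) (rotJ w) = inner z w"
  by (auto simp: rotJ_def inner_prod_def inner_commute)

lemma inner_rotJ_left: "inner (rotJ z) w = - inner z (rotJ w)"
  by (auto simp: rotJ_def inner_prod_def inner_commute)

lemma norm_rotJ [simp]: "norm (rotJ z) = norm z"
  by (simp add: norm_eq_sqrt_inner)

text \<open>One formula for both halves of the frame: the \<open>t\<close>-coefficient is a pairing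
  with \<open>rotJ z\<close>. It spares most later computations the splitting into x and y.\<close>

lemma hX_eq: "hX i g = (bvec i, - inner (rotJ (fst g)) (bvec i) / 2)"
  by (cases g; cases "fst g"; cases i)
     (auto simp: hX_def bvec_def rotJ_def inner_axis)

text \<open>Carries sums over the frame index to sums over \<open>Basis\<close>, where expansions in
  an orthonormal basis are available.\<close>

lemma bij_bvec: "bij_betw bvec (UNIV :: ('n + 'n) set) (Basis :: 'n::finite horiz set)"
proof -
  have inj: "inj (bvec :: 'n + 'n \<Rightarrow> 'n horiz)"
    by (auto simp: inj_def bvec_def axis_eq_axis split: sum.splits)
  have "range (bvec :: 'n + 'n \<Rightarrow> 'n horiz) = Basis"
    unfolding Basis_prod_def Basis_vec_def by (auto simp: bvec_def UNIV_sum image_image image_Un)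
  then show ?thesis using inj by (simp add: bij_betw_def)
qed

lemma sum_bvec: "(\<Sum>i\<in>UNIV. f (bvec i)) = (\<Sum>b\<in>(Basis :: 'n::finite horiz set). f b)"
  by (rule sum.reindex_bij_betw[OF bij_bvec])

lemma bvec_Basis [simp]: "bvec i \<in> Basis"
  using bij_bvec by (auto simp: bij_betw_def)

lemma sum_bvec_inner:
  "(\<Sum>i\<in>UNIV. inner a (bvec i) * inner b (bvec i)) = inner a (b :: 'n::finite horiz)"
  using sum_bvec[of "\<lambda>e. inner a e * inner b e"] by (simp add: euclidean_inner[symmetric])

lemma sum_bvec_square: "(\<Sum>i\<in>UNIV. (inner a (bvec i))\<^sup>2) = (norm (a :: 'n::finite horiz))\<^sup>2"
  using sum_bvec_inner[of a a] by (simp add: power2_eq_square dot_square_norm)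

text \<open>The gradient is an explicit argument, so that the closure rules below compute it and
  frame derivatives and divergences can be read off.\<close>

definition C1_on :: "'a::euclidean_space set \<Rightarrow> ('a \<Rightarrow> real) \<Rightarrow> ('a \<Rightarrow> 'a) \<Rightarrow> bool" where
  "C1_on A f G \<longleftrightarrow> (\<forall>x\<in>A. (f has_derivative inner (G x)) (at x)) \<and> continuous_on A G"

lemma C1_on_subset: "C1_on A f G \<Longrightarrow> B \<subseteq> A \<Longrightarrow> C1_on B f G"
  unfolding C1_on_def using continuous_on_subset by blast

lemma C1_on_deriv: "C1_on A f G \<Longrightarrow> x \<in> A \<Longrightarrow> (f has_derivative inner (G x)) (at x)"
  by (simp add: C1_on_def)

lemma C1_on_cont_grad: "C1_on A f G \<Longrightarrow> continuous_on A G"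
  by (simp add: C1_on_def)

lemma C1_on_cont: "C1_on A f G \<Longrightarrow> continuous_on A f"
  by (meson C1_on_def continuous_at_imp_continuous_on has_derivative_continuous)

lemma C1_on_const: "C1_on A (\<lambda>x. c) (\<lambda>x. 0)"
  by (auto simp: C1_on_def intro!: derivative_eq_intros)

lemma C1_on_inner: "C1_on A (\<lambda>x. inner a x) (\<lambda>x. a)"
  by (auto simp: C1_on_def intro!: derivative_eq_intros)

lemma C1_on_add: "C1_on A f F \<Longrightarrow> C1_on A g G \<Longrightarrow> C1_on A (\<lambda>x. f x + g x) (\<lambda>x. F x + G x)"
  by (auto simp: C1_on_def inner_add_left intro!: derivative_eq_intros continuous_intros)

lemma C1_on_diff: "C1_on A f F \<Longrightarrow> C1_on A g G \<Longrightarrow> C1_on A (\<lambda>x. f x - g x) (\<lambda>x. F x - G x)"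
  by (auto simp: C1_on_def inner_diff_left intro!: derivative_eq_intros continuous_intros)

lemma C1_on_mult:
  assumes f: "C1_on A f F" and g: "C1_on A g G"
  shows "C1_on A (\<lambda>x. f x * g x) (\<lambda>x. f x *\<^sub>R G x + g x *\<^sub>R F x)"
  unfolding C1_on_def
proof safe
  fix x assume "x \<in> A"
  then show "((\<lambda>x. f x * g x) has_derivative inner (f x *\<^sub>R G x + g x *\<^sub>R F x)) (at x)"
    using C1_on_deriv[OF f] C1_on_deriv[OF g]
    by (auto intro!: derivative_eq_intros simp: fun_eq_iff inner_add_left algebra_simps)
qed (intro continuous_intros C1_on_cont C1_on_cont_grad, use assms in auto)

lemma C1_on_cmult: "C1_on A f F \<Longrightarrow> C1_on A (\<lambda>x. c * f x) (\<lambda>x. c *\<^sub>R F x)"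
  using C1_on_mult[OF C1_on_const[of A c]] by simp

lemma C1_on_compose:
  assumes f: "C1_on A f F" and h: "\<And>x. x \<in> A \<Longrightarrow> (h has_real_derivative h' (f x)) (at (f x))"
    and h': "continuous_on (f ` A) h'"
  shows "C1_on A (\<lambda>x. h (f x)) (\<lambda>x. h' (f x) *\<^sub>R F x)"
  unfolding C1_on_def
proof safe
  fix x assume x: "x \<in> A"
  show "((\<lambda>x. h (f x)) has_derivative inner (h' (f x) *\<^sub>R F x)) (at x)"
    by (rule has_derivative_eq_rhs[OF has_derivative_compose[OF C1_on_deriv[OF f x]
          h[OF x, unfolded has_field_derivative_def]]]) (simp add: fun_eq_iff)
next
  show "continuous_on A (\<lambda>x. h' (f x) *\<^sub>R F x)"
    by (intro continuous_intros C1_on_cont_grad[OF f]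
        continuous_on_compose2[OF h' C1_on_cont[OF f]]) auto
qed

lemma C1_on_norm_square: "C1_on A (\<lambda>x. (norm x)\<^sup>2) (\<lambda>x. 2 *\<^sub>R x)"
  by (auto simp: C1_on_def power2_norm_eq_inner inner_commute
      intro!: derivative_eq_intros continuous_intros)

lemma C1_on_fst:
  assumes "C1_on A f F"
  shows "C1_on (A \<times> UNIV) (\<lambda>g. f (fst g)) (\<lambda>g. (F (fst g), 0))"
  unfolding C1_on_def
proof safe
  fix z and t :: 'b assume "z \<in> A"
  then have "(f has_derivative inner (F z)) (at (fst (z, t)))"
    using assms by (simp add: C1_on_def)
  from has_derivative_compose[OF has_derivative_fst[OF has_derivative_ident] this]
  show "((\<lambda>g. f (fst g)) has_derivative inner (F (fst (z, t)), 0)) (at (z, t))"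
    by (rule has_derivative_eq_rhs) (simp add: inner_prod_def fun_eq_iff)
next
  show "continuous_on (A \<times> UNIV) (\<lambda>g. (F (fst g), 0))"
    by (intro continuous_intros continuous_on_compose2[OF C1_on_cont_grad[OF assms]]) auto
qed

lemma C1_on_fst_UNIV: "C1_on UNIV f F \<Longrightarrow> C1_on UNIV (\<lambda>g. f (fst g)) (\<lambda>g. (F (fst g), 0))"
  using C1_on_fst[of UNIV f F] by simp

lemma C1_on_snd: "C1_on A (\<lambda>g. snd g :: real) (\<lambda>g. (0, 1))"
  by (auto simp: C1_on_def inner_prod_def intro!: derivative_eq_intros)

text \<open>On \<open>A - K\<close> the function is locally zero, hence so is its gradient. The
  gradient on \<open>A\<close> and the zero field on the complement of \<open>K\<close> therefore
  agree on the overlap and glue continuously.\<close>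

lemma C1_on_extend:
  assumes f: "C1_on A f G" and A: "open A" and K: "closed K" "K \<subseteq> A"
    and 0: "\<And>x. x \<notin> K \<Longrightarrow> f x = 0"
  shows "C1_on UNIV f (\<lambda>x. if x \<in> K then G x else 0)"
proof -
  have dz: "(f has_derivative inner 0) (at x)" if "x \<notin> K" for x
    unfolding inner_zero_left[abs_def]
    by (rule has_derivative_transform_within_open[where f="\<lambda>_. 0" and s="-K"]) (use that K 0 in auto)
  have G0: "G x = 0" if "x \<in> A" "x \<notin> K" for x
  proof -
    have "inner (G x) = inner 0"
      using has_derivative_unique[OF C1_on_deriv[OF f] dz] that by auto
    then have "inner (G x) (G x) = inner 0 (G x)" by metis
    then show ?thesis by simp
  qed
  have "continuous_on (A \<union> - K) (\<lambda>x. if x \<in> K then G x else 0)"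
  proof (rule continuous_on_open_Un)
    show "continuous_on A (\<lambda>x. if x \<in> K then G x else 0)"
      by (rule continuous_on_eq[OF C1_on_cont_grad[OF f]]) (use G0 in auto)
    show "continuous_on (- K) (\<lambda>x. if x \<in> K then G x else 0)"
      by (rule continuous_on_eq[of _ "\<lambda>x. 0"]) auto
  qed (use A K in auto)
  moreover have "A \<union> - K = UNIV" using K by auto
  moreover have "(f has_derivative inner (if x \<in> K then G x else 0)) (at x)" for x
    using dz C1_on_deriv[OF f] K by (cases "x \<in> K") auto
  ultimately show ?thesis by (simp add: C1_on_def)
qed

lemma C1_on_Xd:
  assumes "C1_on A f G" "g \<in> A"
  shows "((\<lambda>s. f (g + s *\<^sub>R hX i g)) has_real_derivative inner (G g) (hX i g)) (at 0)"
proof -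
  have L: "((\<lambda>s::real. g + s *\<^sub>R hX i g) has_derivative (\<lambda>s. s *\<^sub>R hX i g)) (at 0)"
    by (auto intro!: derivative_eq_intros)
  have "((\<lambda>s::real. f (g + s *\<^sub>R hX i g)) has_derivative (\<lambda>s. inner (G g) (s *\<^sub>R hX i g))) (at 0)"
    using has_derivative_compose[OF L, of f "inner (G g)"] C1_on_deriv[OF assms] by simp
  then show ?thesis
    by (simp add: has_field_derivative_def mult.commute[of _ "inner (G g) (hX i g)"])
qed

lemma Xd_eq: 
  "C1_on A f G \<Longrightarrow> g \<in> A \<Longrightarrow> Xd i f g = inner (G g) (hX i g)"
  "C1_on A f G \<Longrightarrow> g \<in> A \<Longrightarrow> X_differentiable i f g"
  using C1_on_Xd unfolding Xd_def X_differentiable_def field_differentiable_def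
  by (metis DERIV_imp_deriv, metis)

section \<open>Cutoff functions with continuous first derivative\<close>

definition pos2 :: "real \<Rightarrow> real" where
  "pos2 x = (max 0 x)\<^sup>2"

lemma pos2_deriv: "(pos2 has_real_derivative 2 * max 0 x) (at x)"
proof (cases x "0 :: real" rule: linorder_cases)
  case less
  have "(pos2 has_real_derivative 0) (at x)"
    by (rule has_field_derivative_transform_within[where f="\<lambda>_. 0" and d="-x"])
       (use less in \<open>auto simp: pos2_def dist_real_def max_def\<close>)
  then show ?thesis using less by simp
next
  case greater
  have "((\<lambda>x. x\<^sup>2) has_real_derivative 2 * x) (at x)"
    by (auto intro!: derivative_eq_intros)
  then have "(pos2 has_real_derivative 2 * x) (at x)"
    by (rule has_field_derivative_transform_within[where d="x"])
       (use greater in \<open>auto simp: pos2_def dist_real_def max_def\<close>)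
  then show ?thesis using greater by simp
next
  case equal
  have "((\<lambda>h. (pos2 h - pos2 0) / h) \<longlongrightarrow> 0) (at 0)"
  proof (rule Lim_null_comparison[where g="\<lambda>h. \<bar>h\<bar>"])
    show "\<forall>\<^sub>F h in at 0. norm ((pos2 h - pos2 0) / h) \<le> \<bar>h\<bar>"
      by (rule eventuallyI) (auto simp: pos2_def max_def power2_eq_square)
    show "((\<lambda>h::real. \<bar>h\<bar>) \<longlongrightarrow> 0) (at 0)"
      by (auto intro!: tendsto_eq_intros)
  qed
  then show ?thesis using equal by (simp add: DERIV_def)
qed

lemma pos2_cont: "continuous_on A (\<lambda>x. 2 * max 0 (x::real))"
  by (intro continuous_intros)

lemma pos2_nonneg [simp]: "0 \<le> pos2 x" by (simp add: pos2_def)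

lemma pos2_eq_0 [simp]: "pos2 x = 0 \<longleftrightarrow> x \<le> 0" by (auto simp: pos2_def max_def)

lemma pos2_0: "x \<le> 0 \<Longrightarrow> pos2 x = 0" by simp

lemma pos2_mono: "x \<le> y \<Longrightarrow> pos2 x \<le> pos2 y" by (auto simp: pos2_def max_def intro!: power_mono)

lemma pos2_one [simp]: "pos2 1 = 1" by (simp add: pos2_def)

lemma C1_on_pos2: "C1_on A f F \<Longrightarrow> C1_on A (\<lambda>x. pos2 (f x)) (\<lambda>x. (2 * max 0 (f x)) *\<^sub>R F x)"
  by (rule C1_on_compose[where h'="\<lambda>x. 2 * max 0 x"]) (auto intro: pos2_deriv pos2_cont)

text \<open>The inner \<open>pos2\<close> flattens the step at 0 and the outer one at 1. The result
  is once continuously differentiable, which is all that test fields require.\<close>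

definition smoothstep :: "real \<Rightarrow> real" where
  "smoothstep x = 1 - pos2 (1 - pos2 x)"

lemma smoothstep_bounds: "0 \<le> smoothstep x" "smoothstep x \<le> 1"
  using pos2_mono[of "1 - pos2 x" 1] by (auto simp: smoothstep_def)

lemma smoothstep_0: "x \<le> 0 \<Longrightarrow> smoothstep x = 0"
  by (simp add: smoothstep_def pos2_0)

lemma smoothstep_1: "1 \<le> x \<Longrightarrow> smoothstep x = 1"
  using pos2_mono[of 1 x] by (simp add: smoothstep_def)

lemma smoothstep_deriv:
  "(smoothstep has_real_derivative 4 * max 0 (1 - pos2 x) * max 0 x) (at x)"
proof -
  have "((\<lambda>x. pos2 (1 - pos2 x)) has_real_derivative 2 * max 0 (1 - pos2 x) * (- (2 * max 0 x))) (at x)"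
    by (rule DERIV_chain2[OF pos2_deriv]) (auto intro!: derivative_eq_intros pos2_deriv)
  then have "((\<lambda>x. 1 - pos2 (1 - pos2 x)) has_real_derivative 4 * max 0 (1 - pos2 x) * max 0 x) (at x)"
    by (auto intro!: derivative_eq_intros)
  then show ?thesis by (simp add: smoothstep_def[abs_def])
qed

lemma smoothstep_deriv_cont: "continuous_on A (\<lambda>x. 4 * max 0 (1 - pos2 x) * max 0 x)"
  unfolding pos2_def by (intro continuous_intros)

section \<open>Integration by parts along measure preserving flows\<close>

lemma lborel_integral_compact_support:
  fixes f :: "'a::euclidean_space \<Rightarrow> real"
  assumes "continuous_on UNIV f" "compact K" "\<And>x. x \<notin> K \<Longrightarrow> f x = 0"
  shows "integrable lborel f"
proof -
  have "integrable lborel (\<lambda>x. indicator K x *\<^sub>R f x)"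
    using assms by (intro borel_integrable_compact) (auto intro: continuous_on_subset)
  moreover have "(\<lambda>x. indicator K x *\<^sub>R f x) = f"
    using assms(3) by (auto simp: indicator_def fun_eq_iff)
  ultimately show ?thesis by simp
qed

text \<open>Since \<open>X\<close> is constant along its own lines, \<open>x + s X(x)\<close> is its
  flow. The flow preserves Lebesgue measure, so the difference quotients of \<open>w\<close> along
  it have integral zero, and dominated convergence hands this to \<open>w'\<close>.
  Differentiability is assumed along \<open>X\<close> alone, because the components of a test field
  offer no more.\<close>

lemma flow_integral_zero:
  fixes w w' :: "'a::euclidean_space \<Rightarrow> real" and X :: "'a \<Rightarrow> 'a"
  assumes X: "\<And>x s. X (x + s *\<^sub>R X x) = X x"
    and pres: "\<And>s. distr lborel borel (\<lambda>x. x + s *\<^sub>R X x) = lborel"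
    and Xc: "continuous_on UNIV X"
    and w: "continuous_on UNIV w" and K: "compact K" "\<And>x. x \<notin> K \<Longrightarrow> w x = 0"
    and d: "\<And>x. ((\<lambda>s. w (x + s *\<^sub>R X x)) has_real_derivative w' x) (at 0)"
    and w': "continuous_on UNIV w'"
  shows "integrable lborel w'" "integral\<^sup>L lborel w' = 0"
proof -
  have w'0: "w' x = 0" if "x \<notin> K" for x
  proof -
    have "open ((\<lambda>s::real. x + s *\<^sub>R X x) -` (- K))"
      using K(1) by (intro open_vimage continuous_intros) (auto simp: compact_imp_closed)
    moreover have "(0::real) \<in> (\<lambda>s::real. x + s *\<^sub>R X x) -` (- K)"
      using that by simp
    ultimately obtain e where e: "e > 0" "ball (0::real) e \<subseteq> (\<lambda>s::real. x + s *\<^sub>R X x) -` (- K)"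
      by (meson open_contains_ball)
    then have e': "x + s *\<^sub>R X x \<notin> K" if "\<bar>s\<bar> < e" for s
      using that by (auto simp: subset_eq)
    have "((\<lambda>s. w (x + s *\<^sub>R X x)) has_real_derivative 0) (at 0)"
      by (rule has_field_derivative_transform_within[where f="\<lambda>_. 0" and d=e])
         (use e(1) e' K in \<open>auto simp: dist_real_def\<close>)
    then show ?thesis using d DERIV_unique by blast
  qed
  show int: "integrable lborel w'"
    by (rule lborel_integral_compact_support[OF w' K(1) w'0])
  have "bounded (w' ` K)"
    by (intro compact_imp_bounded compact_continuous_image continuous_on_subset[OF w'] K) auto
  then obtain M where M: "M > 0" "\<And>x. x \<in> K \<Longrightarrow> \<bar>w' x\<bar> \<le> M"
    by (auto simp: bounded_pos)
  have M': "\<bar>w' x\<bar> \<le> M" for x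
    using M w'0[of x] by (cases "x \<in> K") auto
  \<comment> \<open>Restarting the flow at \<open>x + r X(x)\<close> turns the derivative at time 0
    of that point into the derivative at time \<open>r\<close> of \<open>x\<close>.\<close>
  have dS: "((\<lambda>s. w (x + s *\<^sub>R X x)) has_real_derivative w' (x + r *\<^sub>R X x)) (at r)" for x r
  proof -
    have "((\<lambda>s. w ((x + r *\<^sub>R X x) + s *\<^sub>R X x)) has_real_derivative w' (x + r *\<^sub>R X x)) (at (r - r))"
      using d[of "x + r *\<^sub>R X x"] by (simp add: X)
    then have "((\<lambda>s. w ((x + r *\<^sub>R X x) + (s - r) *\<^sub>R X x)) has_real_derivative w' (x + r *\<^sub>R X x) * 1) (at r)"
      by (intro DERIV_chain2[where g="\<lambda>s. s - r" and f="\<lambda>s. w ((x + r *\<^sub>R X x) + s *\<^sub>R X x)"])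
         (auto intro!: derivative_eq_intros)
    then show ?thesis by (simp add: algebra_simps)
  qed
  \<comment> \<open>All points that the flow carries into \<open>K\<close> within time 1: a common
    compact support for the difference quotients.\<close>
  define K' where "K' = (\<lambda>(y, s). y - s *\<^sub>R X y) ` (K \<times> {0..1::real})"
  have K': "compact K'"
    unfolding K'_def
    by (intro compact_continuous_image compact_Times K compact_Icc)
       (auto simp: case_prod_beta intro!: continuous_intros continuous_on_compose2[OF Xc])
  have inK': "x \<in> K'" if "x + s *\<^sub>R X x \<in> K" "0 \<le> s" "s \<le> 1" for x s
    unfolding K'_def image_iff
    by (rule bexI[of _ "(x + s *\<^sub>R X x, s)"]) (use that X in auto)
  define s where "s n = 1 / real (Suc n)" for n
  have s: "s n > 0" "s n \<le> 1" for n by (auto simp: s_def)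
  have s0: "s \<longlonglongrightarrow> 0" unfolding s_def by (rule LIMSEQ_inverse_real_of_nat[unfolded inverse_eq_divide])
  define D where "D n x = (w (x + s n *\<^sub>R X x) - w x) / s n" for n x
  have wint: "integrable lborel w"
    by (rule lborel_integral_compact_support[OF w K])
  have [measurable]: "w \<in> borel_measurable borel" "X \<in> borel_measurable borel"
    "w' \<in> borel_measurable borel"
    using w Xc w' by (auto intro: borel_measurable_continuous_onI)
  have wsint: "integrable lborel (\<lambda>x. w (x + r *\<^sub>R X x))"
    and wseq: "integral\<^sup>L lborel (\<lambda>x. w (x + r *\<^sub>R X x)) = integral\<^sup>L lborel w" for r
  proof -
    have "integrable (distr lborel borel (\<lambda>x. x + r *\<^sub>R X x)) w" using wint pres by simp
    then show "integrable lborel (\<lambda>x. w (x + r *\<^sub>R X x))" by (subst (asm) integrable_distr_eq) auto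
    have "integral\<^sup>L (distr lborel borel (\<lambda>x. x + r *\<^sub>R X x)) w = integral\<^sup>L lborel (\<lambda>x. w (x + r *\<^sub>R X x))"
      by (subst integral_distr) auto
    then show "integral\<^sup>L lborel (\<lambda>x. w (x + r *\<^sub>R X x)) = integral\<^sup>L lborel w" using pres by simp
  qed
  have D0: "integral\<^sup>L lborel (D n) = 0" for n
    unfolding D_def using wint wsint wseq by simp
  have "(\<lambda>n. integral\<^sup>L lborel (D n)) \<longlonglongrightarrow> integral\<^sup>L lborel w'"
  proof (rule integral_dominated_convergence[where w="\<lambda>x. M * indicator K' x"])
    show "w' \<in> borel_measurable lborel" by simp
    show "D n \<in> borel_measurable lborel" for n unfolding D_def by measurable
    show "integrable lborel (\<lambda>x. M * indicator K' x)"
      using K' by (intro integrable_mult_right integrable_real_indicator)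
        (auto simp: borel_compact less_top[symmetric] compact_imp_bounded
           dest: emeasure_bounded_finite[OF compact_imp_bounded])
    show "AE x in lborel. (\<lambda>n. D n x) \<longlonglongrightarrow> w' x"
    proof (rule AE_I2)
      fix x
      have "((\<lambda>h. (w (x + h *\<^sub>R X x) - w x) / h) \<longlongrightarrow> w' x) (at 0)"
        using d[of x] by (simp add: DERIV_def)
      moreover have "filterlim s (at 0) sequentially"
      proof (rule filterlim_atI[OF s0])
        show "\<forall>\<^sub>F n in sequentially. s n \<noteq> 0"
          using s(1) by (intro always_eventually allI) (metis less_irrefl)
      qed
      ultimately show "(\<lambda>n. D n x) \<longlonglongrightarrow> w' x"
        unfolding D_def by (rule filterlim_compose)
    qed
    show "AE x in lborel. norm (D n x) \<le> M * indicator K' x" for n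
    proof (rule AE_I2)
      fix x
      \<comment> \<open>By the mean value theorem a difference quotient is a value of
        \<open>w'\<close>, hence bounded by \<open>M\<close>.\<close>
      obtain r where r: "0 < r" "r < s n" "w (x + s n *\<^sub>R X x) - w (x + 0 *\<^sub>R X x) = (s n - 0) * w' (x + r *\<^sub>R X x)"
        using MVT2[OF s(1)[of n], of "\<lambda>s. w (x + s *\<^sub>R X x)" "\<lambda>r. w' (x + r *\<^sub>R X x)"] dS by blast
      then have eq: "D n x = w' (x + r *\<^sub>R X x)"
        using s(1)[of n] by (simp add: D_def field_simps)
      show "norm (D n x) \<le> M * indicator K' x"
      proof (cases "x \<in> K'")
        case False
        then have "x + r *\<^sub>R X x \<notin> K" using inK' r s(2)[of n] by fastforce
        then show ?thesis using False eq w'0 by simp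
      qed (use eq M' in simp)
    qed
  qed
  then show "integral\<^sup>L lborel w' = 0" by (simp add: D0 LIMSEQ_const_iff)
qed

lemma directional_integral_zero:
  fixes w w' :: "'a::euclidean_space \<Rightarrow> real"
  assumes w: "C1_on UNIV w G" and K: "compact K" "\<And>x. x \<notin> K \<Longrightarrow> w x = 0"
  shows "integrable lborel (\<lambda>x. inner (G x) b)" "integral\<^sup>L lborel (\<lambda>x. inner (G x) b) = 0"
proof -
  have d: "((\<lambda>s. w (x + s *\<^sub>R b)) has_real_derivative inner (G x) b) (at 0)" for x
  proof -
    have L: "((\<lambda>s::real. x + s *\<^sub>R b) has_derivative (\<lambda>s. s *\<^sub>R b)) (at 0)"
      by (auto intro!: derivative_eq_intros)
    show ?thesis
      using has_derivative_compose[OF L, of w "inner (G x)"] C1_on_deriv[OF w, of x]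
      by (simp add: has_field_derivative_def mult.commute[of _ "inner (G x) b"])
  qed
  have p: "distr lborel borel (\<lambda>x. x + s *\<^sub>R b) = lborel" for s
    using lborel_distr_plus[of "s *\<^sub>R b"] by (simp add: add.commute[of _ "s *\<^sub>R b"])
  note * = flow_integral_zero[where X="\<lambda>_. b", OF _ p _ C1_on_cont[OF w] K d]
  show "integrable lborel (\<lambda>x. inner (G x) b)" "integral\<^sup>L lborel (\<lambda>x. inner (G x) b) = 0"
    by (auto intro!: * continuous_intros C1_on_cont_grad[OF w])
qed

text \<open>A step along the field moves the base point by a multiple of \<open>bvec i\<close>, and
  this changes the \<open>t\<close>-coefficient by a multiple of
  \<open>inner (rotJ (bvec i)) (bvec i) = 0\<close>.\<close>

lemma hX_flow: "hX i (g + s *\<^sub>R hX i g) = hX i g"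
  by (simp add: hX_eq inner_add_left)

lemma continuous_hX: "continuous_on UNIV (hX i)"
  unfolding hX_eq[abs_def]
  by (intro continuous_intros bounded_linear.continuous_on[OF bounded_linear_rotJ]) auto

lemma nn_integral_lborel_shift:
  fixes c :: "'a::euclidean_space"
  assumes [measurable]: "f \<in> borel_measurable borel"
  shows "(\<integral>\<^sup>+ x. f (x + c) \<partial>lborel) = integral\<^sup>N lborel f"
  by (subst (2) lborel_distr_plus[of c, symmetric], subst nn_integral_distr) (auto simp: add.commute)

text \<open>The map is a shear: on each vertical line it is a translation by an amount depending on
  \<open>z\<close> only, and on the base it is a constant translation. Fubini reduces both to
  translation invariance.\<close>

lemma hX_preserves: "distr lborel borel (\<lambda>g::'n::finite heis. g + s *\<^sub>R hX i g) = lborel"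
proof (rule measure_eqI)
  fix A :: "'n::finite heis set" assume "A \<in> sets (distr lborel borel (\<lambda>g::'n heis. g + s *\<^sub>R hX i g))"
  then have A[measurable]: "A \<in> sets borel" by simp
  have [measurable]: "hX i \<in> borel_measurable borel"
    by (rule borel_measurable_continuous_onI[OF continuous_hX])
  have [measurable]: "rotJ \<in> borel_measurable borel"
    by (rule borel_measurable_continuous_onI[OF linear_continuous_on[OF bounded_linear_rotJ]])
  define c where "c z = - s * inner (rotJ z) (bvec i) / 2" for z :: "'n horiz"
  have [measurable]: "c \<in> borel_measurable borel" unfolding c_def by measurable
  have m: "(\<lambda>g. indicator A (g + s *\<^sub>R hX i g) :: ennreal) \<in> borel_measurable (lborel \<Otimes>\<^sub>M lborel)"
    unfolding lborel_prod by measurable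
  have "emeasure (distr lborel borel (\<lambda>g. g + s *\<^sub>R hX i g)) A
     = (\<integral>\<^sup>+ g. indicator A g \<partial>distr lborel borel (\<lambda>g. g + s *\<^sub>R hX i g))"
    by simp
  also have "\<dots> = (\<integral>\<^sup>+ g. indicator A (g + s *\<^sub>R hX i g) \<partial>lborel)"
    by (subst nn_integral_distr) auto
  also have "\<dots> = (\<integral>\<^sup>+ z. \<integral>\<^sup>+ t. indicator A (z + s *\<^sub>R bvec i, t + c z) \<partial>lborel \<partial>lborel)"
    using lborel.nn_integral_fst[OF m] by (simp add: lborel_prod hX_eq c_def)
  also have "\<dots> = (\<integral>\<^sup>+ z. \<integral>\<^sup>+ t. indicator A (z + s *\<^sub>R bvec i, t) \<partial>lborel \<partial>lborel)"
    by (intro nn_integral_cong nn_integral_lborel_shift) simp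
  also have "\<dots> = (\<integral>\<^sup>+ z. \<integral>\<^sup>+ t. indicator A (z, t) \<partial>lborel \<partial>lborel)"
    by (rule nn_integral_lborel_shift) simp
  also have "\<dots> = (\<integral>\<^sup>+ g. indicator A g \<partial>(lborel \<Otimes>\<^sub>M lborel))"
    by (rule lborel.nn_integral_fst) (simp add: lborel_prod)
  also have "\<dots> = emeasure lborel A"
    by (simp add: lborel_prod)
  finally show "emeasure (distr lborel borel (\<lambda>g. g + s *\<^sub>R hX i g)) A = emeasure lborel A" .
qed simp

section \<open>A lower bound for the horizontal perimeter\<close>

lemma C1_grad_zero:
  assumes "C1_on UNIV f G" "closed K" "\<And>x. x \<notin> K \<Longrightarrow> f x = 0" "x \<notin> K"
  shows "G x = 0"
proof -
  have "(f has_derivative (\<lambda>v. 0)) (at x)"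
    by (rule has_derivative_transform_within_open[where f="\<lambda>_. 0" and s="-K"]) (use assms in auto)
  then have "inner (G x) = (\<lambda>v. 0)"
    using has_derivative_unique[OF C1_on_deriv[OF assms(1), of x]] by auto
  then have "inner (G x) (G x) = 0" by metis
  then show ?thesis by simp
qed

lemma compactly_supported_inI:
  assumes "compact C" "\<And>g. g \<notin> C \<Longrightarrow> f g = 0"
  shows "compactly_supported_in UNIV f"
proof -
  have "{g. f g \<noteq> 0} \<subseteq> C" using assms by auto
  then have "bounded {g. f g \<noteq> 0}" using assms bounded_subset compact_imp_bounded by blast
  then show ?thesis by (simp add: compactly_supported_in_def compact_closure)
qed

lemma horizontal_test_fieldsI:
  fixes \<zeta> :: "'n + 'n \<Rightarrow> 'n::finite heis \<Rightarrow> real"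
  assumes G: "\<And>i. C1_on UNIV (\<zeta> i) (G i)" and C: "compact C" "\<And>i g. g \<notin> C \<Longrightarrow> \<zeta> i g = 0"
    and n: "\<And>g. (\<Sum>i\<in>UNIV. (\<zeta> i g)\<^sup>2) \<le> 1"
  shows "\<zeta> \<in> horizontal_test_fields UNIV"
proof -
  have Xd: "Xd j (\<zeta> i) g = inner (G i g) (hX j g)" and Xdiff: "X_differentiable j (\<zeta> i) g" for i j g
    using Xd_eq[OF G] by auto
  have "Xd j (\<zeta> i) g = 0" if "g \<notin> C" for i j g
    using C1_grad_zero[OF G compact_imp_closed[OF C(1)] C(2) that] by (simp add: Xd)
  then have "compactly_supported_in UNIV (Xd j (\<zeta> i))" "compactly_supported_in UNIV (\<zeta> i)" for i j
    using C by (auto intro!: compactly_supported_inI)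
  moreover have "continuous_on UNIV (Xd j (\<zeta> i))" for i j
    unfolding Xd[abs_def] by (intro continuous_intros continuous_hX C1_on_cont_grad[OF G])
  ultimately show ?thesis
    unfolding horizontal_test_fields_def using C1_on_cont[OF G] Xdiff n by simp
qed

lemma set_lebesgue_integral_lborel:
  fixes f :: "'a::euclidean_space \<Rightarrow> real"
  assumes "F \<in> sets borel" "f \<in> borel_measurable borel"
  shows "set_lebesgue_integral lebesgue F f = set_lebesgue_integral lborel F f"
  unfolding set_lebesgue_integral_def using assms by (intro integral_completion borel_measurable_scaleR borel_measurable_indicator) auto

lemma H_perimeter_upper:
  fixes E :: "'n::finite heis set"
  assumes "\<zeta> \<in> horizontal_test_fields UNIV" "E \<in> sets borel"
  shows "ereal (set_lebesgue_integral lborel E (\<lambda>g. \<Sum>i\<in>UNIV. Xd i (\<zeta> i) g)) \<le> H_perimeter E UNIV"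
proof -
  have "(\<lambda>g. \<Sum>i\<in>UNIV. Xd i (\<zeta> i) g) \<in> borel_measurable borel"
    using assms(1) unfolding horizontal_test_fields_def
    by (intro borel_measurable_continuous_onI continuous_intros) auto
  from set_lebesgue_integral_lborel[OF assms(2) this] show ?thesis
    unfolding H_perimeter_def by (intro SUP_upper2[OF assms(1)]) simp
qed

text \<open>\<open>tent\<close>, \<open>ramp\<close> and \<open>ramp_primitive\<close> form a chain of derivatives; \<open>ramp_primitive\<close> is exactly
  \<open>x\<close> for \<open>x \<ge> 1\<close>, so that integrals of \<open>ramp\<close> over long intervals are explicit.\<close>

definition tent :: "real \<Rightarrow> real" where
  "tent x = max 0 (x + 1) - 2 * max 0 x + max 0 (x - 1)"

definition ramp :: "real \<Rightarrow> real" where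
  "ramp x = (pos2 (x + 1) - 2 * pos2 x + pos2 (x - 1)) / 2"

definition ramp_primitive :: "real \<Rightarrow> real" where
  "ramp_primitive x = ((max 0 (x + 1))^3 - 2 * (max 0 x)^3 + (max 0 (x - 1))^3) / 6"

lemma max0_cube_deriv: "((\<lambda>x::real. (max 0 x)^3) has_real_derivative 3 * pos2 x) (at x)"
proof -
  have "(\<lambda>x::real. (max 0 x)^3) = (\<lambda>x. x * pos2 x)"
    by (auto simp: fun_eq_iff pos2_def max_def power3_eq_cube power2_eq_square)
  moreover have "((\<lambda>x::real. x * pos2 x) has_real_derivative 1 * pos2 x + (2 * max 0 x) * x) (at x)"
    by (intro DERIV_mult DERIV_ident pos2_deriv)
  moreover have "1 * pos2 x + (2 * max 0 x) * x = 3 * pos2 x"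
    by (auto simp: pos2_def max_def power2_eq_square)
  ultimately show ?thesis by metis
qed

lemma DERIV_shift':
  "(\<And>x::real. (f has_real_derivative f' x) (at x)) \<Longrightarrow> ((\<lambda>x. f (x + c)) has_real_derivative f' (x + c)) (at x)"
  by (rule DERIV_shift[THEN iffD1])

lemma ramp_deriv: "(ramp has_real_derivative tent x) (at x)"
proof -
  have "((\<lambda>x. (pos2 (x + 1) - 2 * pos2 x + pos2 (x - 1)) / 2) has_real_derivative
     (2 * max 0 (x + 1) - 2 * (2 * max 0 x) + 2 * max 0 (x - 1)) / 2) (at x)"
    using DERIV_shift'[OF pos2_deriv, of 1 x] DERIV_shift'[OF pos2_deriv, of "-1" x]
    by (intro DERIV_cdivide DERIV_add DERIV_diff DERIV_cmult pos2_deriv) simp_all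
  then show ?thesis by (simp add: ramp_def[abs_def] tent_def diff_divide_distrib add_divide_distrib)
qed

lemma ramp_primitive_deriv: "(ramp_primitive has_real_derivative ramp x) (at x)"
proof -
  have "((\<lambda>x. ((max 0 (x + 1))^3 - 2 * (max 0 x)^3 + (max 0 (x - 1))^3) / 6) has_real_derivative
     (3 * pos2 (x + 1) - 2 * (3 * pos2 x) + 3 * pos2 (x - 1)) / 6) (at x)"
    using DERIV_shift'[OF max0_cube_deriv, of 1 x] DERIV_shift'[OF max0_cube_deriv, of "-1" x]
    by (intro DERIV_cdivide DERIV_add DERIV_diff DERIV_cmult max0_cube_deriv) simp_all
  then show ?thesis by (simp add: ramp_primitive_def[abs_def] ramp_def diff_divide_distrib add_divide_distrib)
qed

lemma tent_cont: "continuous_on A tent"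
  unfolding tent_def[abs_def] by (intro continuous_intros)

lemma tent_nonneg: "0 \<le> tent x"
  by (auto simp: tent_def max_def)

lemma ramp_mono: "x \<le> y \<Longrightarrow> ramp x \<le> ramp y"
  by (rule DERIV_nonneg_imp_nondecreasing[of x y ramp]) (use ramp_deriv tent_nonneg in blast)+

lemma ramp_eqs:
  "x \<le> -1 \<Longrightarrow> ramp x = 0" "1 \<le> x \<Longrightarrow> ramp x = 1"
  "x \<le> -1 \<Longrightarrow> ramp_primitive x = 0" "1 \<le> x \<Longrightarrow> ramp_primitive x = x"
  by (auto simp: ramp_def ramp_primitive_def pos2_def max_def power2_eq_square power3_eq_cube algebra_simps)

lemma ramp_bounds: "0 \<le> ramp x" "ramp x \<le> 1"
  using ramp_mono[of x "max x 1"] ramp_eqs(2)[of "max x 1"]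
    ramp_mono[of "min x (-1)" x] ramp_eqs(1)[of "min x (-1)"] by auto

section \<open>Vector fields and the divergence theorem\<close>

definition C1_field :: "('a::euclidean_space \<Rightarrow> 'a) \<Rightarrow> ('a \<Rightarrow> 'a \<Rightarrow> 'a) \<Rightarrow> bool" where
  "C1_field a Ga \<longleftrightarrow> (\<forall>b\<in>Basis. C1_on UNIV (\<lambda>z. inner (a z) b) (Ga b))"

definition divg :: "('a::euclidean_space \<Rightarrow> 'a \<Rightarrow> 'a) \<Rightarrow> 'a \<Rightarrow> real" where
  "divg Ga z = (\<Sum>b\<in>Basis. inner (Ga b z) b)"

lemma C1_field_D: "C1_field a Ga \<Longrightarrow> b \<in> Basis \<Longrightarrow> C1_on UNIV (\<lambda>z. inner (a z) b) (Ga b)"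
  by (simp add: C1_field_def)

lemma C1_field_cont: 
  assumes "C1_field a Ga" shows "continuous_on A a" "continuous_on A (divg Ga)"
proof -
  have "continuous_on A (\<lambda>z. \<Sum>b\<in>Basis. inner (a z) b *\<^sub>R b)"
    by (intro continuous_intros continuous_on_subset[OF C1_on_cont[OF C1_field_D[OF assms]]]) auto
  then show "continuous_on A a" by (simp add: euclidean_representation)
  show "continuous_on A (divg Ga)"
    unfolding divg_def[abs_def]
    by (intro continuous_intros continuous_on_subset[OF C1_on_cont_grad[OF C1_field_D[OF assms]]]) auto
qed

lemma C1_field_zero:
  assumes "C1_field a Ga" "closed K" "\<And>z. z \<notin> K \<Longrightarrow> a z = 0" "z \<notin> K"
  shows "b \<in> Basis \<Longrightarrow> Ga b z = 0" "divg Ga z = 0"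
proof -
  show *: "Ga b z = 0" if "b \<in> Basis" for b
    by (rule C1_grad_zero[OF C1_field_D[OF assms(1) that] assms(2) _ assms(4)]) (use assms(3) in auto)
  then show "divg Ga z = 0" by (simp add: divg_def)
qed

text \<open>The product \<open>w a\<close> has compact support in \<open>A\<close> and extends by
  zero, so \<open>w\<close> has to be differentiable in the open set only. This is what makes graphs
  admissible whose slope is unbounded at the boundary sphere.\<close>

lemma field_ibp:
  fixes a :: "'a::euclidean_space \<Rightarrow> 'a"
  assumes a: "C1_field a Ga" and A: "open A" and K: "compact K" "K \<subseteq> A"
    and a0: "\<And>z. z \<notin> K \<Longrightarrow> a z = 0" and w: "C1_on A w W"
  defines "f \<equiv> \<lambda>z. indicator A z * (w z * divg Ga z + inner (a z) (W z))"
  shows "integrable lborel f" "integral\<^sup>L lborel f = 0"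
proof -
  define G where "G b z = (if z \<in> K then w z *\<^sub>R Ga b z + inner (a z) b *\<^sub>R W z else 0)" for b z
  define p where "p b z = indicator A z * (w z * inner (a z) b)" for b z
  have p: "C1_on UNIV (p b) (G b)" if b: "b \<in> Basis" for b
  proof -
    have "C1_on A (\<lambda>z. w z * inner (a z) b) (\<lambda>z. w z *\<^sub>R Ga b z + inner (a z) b *\<^sub>R W z)"
      by (intro C1_on_mult w C1_on_subset[OF C1_field_D[OF a b]]) auto
    then have "C1_on A (p b) (\<lambda>z. w z *\<^sub>R Ga b z + inner (a z) b *\<^sub>R W z)"
      using has_derivative_transform_within_open[OF _ A, of "\<lambda>z. w z * inner (a z) b" _ _ UNIV "p b"]
      unfolding C1_on_def p_def by simp
    from C1_on_extend[OF this A compact_imp_closed[OF K(1)] K(2)]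
    show ?thesis unfolding G_def[abs_def] by (simp add: p_def a0)
  qed
  have f: "f = (\<lambda>z. \<Sum>b\<in>Basis. inner (G b z) b)"
  proof
    fix z
    show "f z = (\<Sum>b\<in>Basis. inner (G b z) b)"
    proof (cases "z \<in> K")
      case True
      have "(\<Sum>b\<in>Basis. inner (G b z) b) = (\<Sum>b\<in>Basis. w z * inner (Ga b z) b + inner (a z) b * inner (W z) b)"
        using True by (simp add: G_def inner_add_left)
      also have "\<dots> = w z * divg Ga z + inner (a z) (W z)"
        by (simp add: sum.distrib divg_def sum_distrib_left euclidean_inner[of "a z" "W z"])
      finally show ?thesis using True K(2) by (auto simp: f_def)
    next
      case False
      then show ?thesis
        using C1_field_zero(2)[OF a compact_imp_closed[OF K(1)] a0 False] a0
        by (simp add: G_def f_def)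
    qed
  qed
  have z: "p b z = 0" if "z \<notin> K" for b z using a0 that by (simp add: p_def)
  note d = directional_integral_zero[OF p K(1) z]
  show "integrable lborel f" unfolding f by (intro Bochner_Integration.integrable_sum d)
  show "integral\<^sup>L lborel f = 0" unfolding f
    by (subst Bochner_Integration.integral_sum) (auto simp: d)
qed

section \<open>The region between two graphs\<close>

lemma open_between_graphs:
  assumes "continuous_on (ball 0 R) u" "continuous_on (ball 0 R) v"
  shows "open (between_graphs R u v)"
proof -
  have c: "continuous_on (ball 0 R \<times> UNIV) (\<lambda>g. u (fst g))" "continuous_on (ball 0 R \<times> UNIV) (\<lambda>g. v (fst g))"
    by (auto intro!: continuous_on_compose2[OF assms(1)] continuous_on_compose2[OF assms(2)] continuous_intros)
  have o: "open (ball (0::'a horiz) R \<times> (UNIV::real set))" by (intro open_Times) auto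
  have "continuous_on (ball 0 R \<times> UNIV) (\<lambda>g. u (fst g) - snd g)"
    "continuous_on (ball 0 R \<times> UNIV) (\<lambda>g. v (fst g) + snd g)"
    by (intro continuous_intros c)+
  from this[THEN continuous_on_open_vimage[OF o, THEN iffD1], rule_format, OF open_greaterThan]
  have "open (((\<lambda>g. u (fst g) - snd g) -` {0<..} \<inter> (ball 0 R \<times> UNIV)) \<inter>
     ((\<lambda>g. v (fst g) + snd g) -` {0<..} \<inter> (ball 0 R \<times> UNIV)))" by (rule open_Int)
  also have "\<dots> = between_graphs R u v"
    by (auto simp: between_graphs_def)
  finally show ?thesis .
qed

text \<open>Fubini followed by the fundamental theorem of calculus in the
  \<open>t\<close>-direction, with \<open>p z\<close> as antiderivative.\<close>

lemma between_graphs_lborel_integral: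
  fixes f :: "'n::finite heis \<Rightarrow> real"
  assumes F: "between_graphs R u v \<in> sets borel"
    and int: "set_integrable lborel (between_graphs R u v) f"
    and le: "\<And>z. z \<in> ball 0 R \<Longrightarrow> - v z \<le> u z"
    and d: "\<And>z t. z \<in> ball 0 R \<Longrightarrow> (p z has_real_derivative f (z, t)) (at t)"
    and c: "\<And>z. z \<in> ball 0 R \<Longrightarrow> continuous_on UNIV (\<lambda>t. f (z, t))"
  shows "set_lebesgue_integral lborel (between_graphs R u v) f =
    (LINT z|lborel. indicator (ball 0 R) z * (p z (u z) - p z (- v z)))"
proof -
  let ?F = "between_graphs R u v"
  have "integrable (lborel \<Otimes>\<^sub>M lborel) (\<lambda>g. indicator ?F g *\<^sub>R f g)"
    using int by (simp add: set_integrable_def lborel_prod)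
  from lborel_pair.integral_fst'[OF this]
  have "set_lebesgue_integral lborel ?F f = (LINT z|lborel. LINT t|lborel. indicator ?F (z, t) *\<^sub>R f (z, t))"
    by (simp add: set_lebesgue_integral_def lborel_prod)
  also have "\<dots> = (LINT z|lborel. indicator (ball 0 R) z * (p z (u z) - p z (- v z)))"
  proof (rule Bochner_Integration.integral_cong[OF refl])
    fix z :: "'n horiz"
    show "(LINT t|lborel. indicator ?F (z, t) *\<^sub>R f (z, t)) = indicator (ball 0 R) z * (p z (u z) - p z (- v z))"
    proof (cases "z \<in> ball 0 R")
      case True
      have [measurable]: "(\<lambda>t. f (z, t)) \<in> borel_measurable borel"
        by (rule borel_measurable_continuous_onI[OF c[OF True]])
      have "(LINT t|lborel. indicator ?F (z, t) *\<^sub>R f (z, t)) = (LINT t|lborel. indicator {- v z .. u z} t *\<^sub>R f (z, t))"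
      proof (rule integral_cong_AE)
        show "AE t in lborel. indicator ?F (z, t) *\<^sub>R f (z, t) = indicator {- v z .. u z} t *\<^sub>R f (z, t)"
          using AE_lborel_singleton[of "u z"] AE_lborel_singleton[of "- v z"]
          by eventually_elim (use True in \<open>auto simp: between_graphs_def indicator_def\<close>)
        show "(\<lambda>t. indicator ?F (z, t) *\<^sub>R f (z, t)) \<in> borel_measurable lborel"
          using F by measurable
      qed measurable
      also have "\<dots> = p z (u z) - p z (- v z)"
        using le[OF True] d[OF True] continuous_on_subset[OF c[OF True]]
        by (intro integral_FTC_atLeastAtMost)
           (auto intro: has_field_derivative_at_within
            simp flip: has_real_derivative_iff_has_vector_derivative)
      finally show ?thesis using True by simp
    next
      case False
      then have "indicator ?F (z, t) = (0::real)" for t by (auto simp: between_graphs_def)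
      then show ?thesis using False by simp
    qed
  qed
  finally show ?thesis .
qed

lemma integrable_supported:
  fixes f :: "'a::euclidean_space \<Rightarrow> real"
  assumes "compact K" "K \<subseteq> A" "continuous_on K f" "\<And>z. z \<in> A \<Longrightarrow> z \<notin> K \<Longrightarrow> f z = 0"
  shows "integrable lborel (\<lambda>z. indicator A z * f z)"
proof -
  have "(\<lambda>z. indicator A z * f z) = (\<lambda>z. indicator K z *\<^sub>R f z)"
    using assms(2,4) by (auto simp: fun_eq_iff indicator_def)
  then show ?thesis using borel_integrable_compact[OF assms(1,3)] by simp
qed

lemma between_graphs_bounded:
  assumes "\<And>z. z \<in> ball 0 R \<Longrightarrow> u z \<le> M" "\<And>z. z \<in> ball 0 R \<Longrightarrow> v z \<le> M"
  shows "between_graphs R u v \<subseteq> cball 0 R \<times> {- M..M}"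
  using assms by (fastforce simp: between_graphs_def)

lemma compact_annulus: "compact {g::'n::finite heis. (norm (fst g))\<^sup>2 \<le> c \<and> (snd g)\<^sup>2 \<le> d}"
proof -
  have "{g::'n heis. (norm (fst g))\<^sup>2 \<le> c \<and> (snd g)\<^sup>2 \<le> d} \<subseteq> cball 0 (sqrt \<bar>c\<bar>) \<times> cball 0 (sqrt \<bar>d\<bar>)"
    by (auto simp: intro!: real_le_rsqrt)
  then have "bounded {g::'n heis. (norm (fst g))\<^sup>2 \<le> c \<and> (snd g)\<^sup>2 \<le> d}"
    by (rule bounded_subset[rotated]) (intro bounded_Times bounded_cball)
  moreover have "closed {g::'n heis. (norm (fst g))\<^sup>2 \<le> c \<and> (snd g)\<^sup>2 \<le> d}"
    by (intro closed_Collect_conj closed_Collect_le continuous_intros)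
  ultimately show ?thesis by (simp add: compact_eq_bounded_closed)
qed

text \<open>The test field is \<open>\<theta> * \<kappa>\<close> times
  \<open>z / R + b + s * (a - b)\<close>: \<open>s\<close> rises from 0 to 1 across the midpoint
  surface, \<open>\<kappa>\<close> gives compact support and \<open>\<theta>\<close> restores the
  norm bound. The divergence \<open>DIM / R\<close> of \<open>z / R\<close> yields the volume term.
  Outside the ball \<open>z / R\<close> exceeds norm 1 before \<open>\<kappa>\<close> has switched
  it off, which is the reason for the margin \<open>\<delta>\<close>.\<close>

lemma H_perimeter_lower_bound_aux:
  fixes u v :: "'n::finite horiz \<Rightarrow> real" and M R \<delta> :: real
  assumes R: "R > 0"
    and u: "C1_on (ball 0 R) u Du" and v: "C1_on (ball 0 R) v Dv"
    and u0: "\<And>z. z \<in> ball 0 R \<Longrightarrow> 0 \<le> u z" and v0: "\<And>z. z \<in> ball 0 R \<Longrightarrow> 0 \<le> v z"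
    and pos: "\<And>z. z \<in> ball 0 R \<Longrightarrow> 0 < u z + v z"
    and uM: "\<And>z. z \<in> ball 0 R \<Longrightarrow> u z \<le> M" and vM: "\<And>z. z \<in> ball 0 R \<Longrightarrow> v z \<le> M"
    and K: "compact K" "K \<subseteq> ball 0 R"
    and a: "C1_field a Ga" "\<And>z. z \<notin> K \<Longrightarrow> a z = 0"
    and b: "C1_field b Gb" "\<And>z. z \<notin> K \<Longrightarrow> b z = 0"
    and na: "\<And>z. z \<in> ball 0 R \<Longrightarrow> norm (z /\<^sub>R R + a z) \<le> 1"
    and nb: "\<And>z. z \<in> ball 0 R \<Longrightarrow> norm (z /\<^sub>R R + b z) \<le> 1"
    and \<delta>: "\<delta> > 0"
  defines "F \<equiv> between_graphs R u v"
  shows "ereal ((real DIM('n horiz) / R * measure lborel F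
     + (LINT z|lborel. indicator (ball 0 R) z * (u z * divg Ga z - inner (a z) (rotJ z) / 2))
     + (LINT z|lborel. indicator (ball 0 R) z * (v z * divg Gb z + inner (b z) (rotJ z) / 2)))
     / sqrt (1 + \<delta> / R\<^sup>2)) \<le> H_perimeter F UNIV"
proof -
  let ?B = "ball (0::'n horiz) R"
  have M0: "0 \<le> M" using u0[of 0] uM[of 0] R by auto
  have oF: "open F" unfolding F_def
    using u v by (intro open_between_graphs C1_on_cont)
  have FB: "fst g \<in> ?B" if "g \<in> F" for g using that by (auto simp: F_def between_graphs_def)
  have Fbd: "F \<subseteq> cball 0 R \<times> {- M..M}" unfolding F_def by (rule between_graphs_bounded[OF uM vM])
  have "bounded F" by (rule bounded_subset[OF _ Fbd]) (intro bounded_Times, auto)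
  then have Ffin: "emeasure lborel F < \<infinity>" by (rule emeasure_bounded_finite)
  have [measurable]: "F \<in> sets borel" using oF by simp
  define N where "N = real DIM('n horiz)"
  \<comment> \<open>The midpoint surface of the two graphs, along which the field switches.\<close>
  define \<tau> where "\<tau> z = 1 / 2 * (u z - v z)" for z
  define D where "D z = (1 / 2) *\<^sub>R (Du z - Dv z)" for z
  have \<tau>: "C1_on ?B \<tau> D" unfolding \<tau>_def D_def by (intro C1_on_cmult C1_on_diff u v)
  \<comment> \<open>By compactness the vertical gap over \<open>K\<close> is at least
    \<open>2 * \<epsilon>\<close>, so the layer of half-width \<open>\<epsilon>\<close> around
    \<open>\<tau>\<close> lies between the graphs. Outside \<open>K\<close> both corrections vanish
    and there is nothing to switch.\<close>
  obtain \<epsilon> where \<epsilon>: "\<epsilon> > 0" "\<And>z. z \<in> K \<Longrightarrow> 2 * \<epsilon> \<le> u z + v z"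
  proof (cases "K = {}")
    case True then show ?thesis using that[of 1] by simp
  next
    case False
    have "continuous_on K (\<lambda>z. u z + v z)"
      using C1_on_cont[OF u] C1_on_cont[OF v] K(2) by (intro continuous_intros) (auto intro: continuous_on_subset)
    then obtain z where z: "z \<in> K" "\<And>y. y \<in> K \<Longrightarrow> u z + v z \<le> u y + v y"
      using continuous_attains_inf[OF K(1) False] by blast
    show ?thesis
    proof (rule that[of "(u z + v z) / 2"])
      show "0 < (u z + v z) / 2" using pos[OF subsetD[OF K(2) z(1)]] by simp
      show "2 * ((u z + v z) / 2) \<le> u y + v y" if "y \<in> K" for y using z(2)[OF that] by simp
    qed
  qed
  define x where "x g = 1 / \<epsilon> * (snd g - \<tau> (fst g))" for g :: "'n heis"
  define s where "s g = ramp (x g)" for g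
  define Gs where "Gs g = tent (x g) *\<^sub>R ((1 / \<epsilon>) *\<^sub>R ((0, 1) - (D (fst g), 0)) :: 'n heis)" for g :: "'n heis"
  have s: "C1_on (?B \<times> UNIV) s Gs"
    unfolding s_def Gs_def x_def
    by (intro C1_on_compose[where h=ramp and h'=tent] C1_on_cmult C1_on_diff C1_on_snd C1_on_fst \<tau> ramp_deriv tent_cont)
  define q where "q e g = inner (a (fst g) - b (fst g)) e * s g" for e :: "'n horiz" and g
  define Gq where "Gq e g = inner (a (fst g) - b (fst g)) e *\<^sub>R Gs g + s g *\<^sub>R (Ga e (fst g) - Gb e (fst g), 0 :: real)"
    for e :: "'n horiz" and g
  have q: "C1_on (?B \<times> UNIV) (q e) (Gq e)" if e: "e \<in> Basis" for e
  proof -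
    have "C1_on UNIV (\<lambda>z. inner (a z - b z) e) (\<lambda>z. Ga e z - Gb e z)"
      unfolding inner_diff_left by (intro C1_on_diff C1_field_D[OF a(1)] C1_field_D[OF b(1)] e)
    from C1_on_subset[OF C1_on_fst_UNIV[OF this], of "?B \<times> UNIV"] show ?thesis
      unfolding q_def Gq_def by (intro C1_on_mult s) auto
  qed
  have q0: "q e g = 0" if "g \<notin> K \<times> UNIV" for e g
    using that a(2) b(2) by (cases g) (auto simp: q_def)
  have q': "\<exists>G. C1_on UNIV (q e) G" if e: "e \<in> Basis" for e
    using C1_on_extend[OF q[OF e] _ _ _ q0] K compact_imp_closed[OF K(1)]
    by (blast intro: open_Times closed_Times)
  define \<eta> where "\<eta> e g = (1 / R) * inner e (fst g) + (inner (b (fst g)) e + q e g)" for e g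
  define G\<eta> where "G\<eta> e g = (1 / R) *\<^sub>R (e, 0 :: real) + ((Gb e (fst g), 0) + Gq e g)" for e g
  have lin: "C1_on UNIV (\<lambda>g. inner e (fst g)) (\<lambda>g. (e, 0))" for e :: "'n horiz"
    using C1_on_fst_UNIV[OF C1_on_inner[of UNIV e]] .
  have \<eta>: "C1_on (?B \<times> UNIV) (\<eta> e) (G\<eta> e)" if e: "e \<in> Basis" for e
    unfolding \<eta>_def G\<eta>_def
    by (intro C1_on_add C1_on_cmult q e C1_on_subset[OF lin]
        C1_on_subset[OF C1_on_fst_UNIV[OF C1_field_D[OF b(1) e]]]) auto
  have \<eta>': "\<exists>G. C1_on UNIV (\<eta> e) G" if e: "e \<in> Basis" for e
  proof -
    obtain G where "C1_on UNIV (q e) G" using q'[OF e] by blast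
    from C1_on_add[OF C1_on_cmult[OF lin] C1_on_add[OF C1_on_fst_UNIV[OF C1_field_D[OF b(1) e]] this]]
    show ?thesis unfolding \<eta>_def by blast
  qed
  \<comment> \<open>The inner \<open>pos2\<close> terms vanish on the cylinder containing
    \<open>F\<close>, so \<open>\<kappa>\<close> is 1 there. One of them reaches 1 as soon as the
    point leaves the slightly larger cylinder \<open>C\<close>.\<close>
  define \<kappa> where "\<kappa> g = pos2 (1 - (pos2 ((1 / \<delta>) * ((norm (fst g))\<^sup>2 - R\<^sup>2)) + pos2 (snd g * snd g - M\<^sup>2)))"
    for g :: "'n heis"
  have \<kappa>': "\<exists>G. C1_on UNIV \<kappa> G"
  proof -
    have "C1_on UNIV (\<lambda>g::'n heis. (norm (fst g))\<^sup>2) (\<lambda>g. (2 *\<^sub>R fst g, 0))"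
      by (rule C1_on_fst_UNIV[OF C1_on_norm_square])
    from C1_on_pos2[OF C1_on_diff[OF C1_on_const[of _ 1] C1_on_add[OF
        C1_on_pos2[OF C1_on_cmult[OF C1_on_diff[OF this C1_on_const[of _ "R\<^sup>2"]], of "1 / \<delta>"]]
        C1_on_pos2[OF C1_on_diff[OF C1_on_mult[OF C1_on_snd C1_on_snd] C1_on_const[of _ "M\<^sup>2"]]]]]]
    show ?thesis unfolding \<kappa>_def by blast
  qed
  have \<kappa>01: "0 \<le> \<kappa> g" "\<kappa> g \<le> 1" for g
    using pos2_mono[of "1 - (pos2 ((1 / \<delta>) * ((norm (fst g))\<^sup>2 - R\<^sup>2)) + pos2 (snd g * snd g - M\<^sup>2))" 1]
      add_nonneg_nonneg[OF pos2_nonneg pos2_nonneg,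
        of "(1 / \<delta>) * ((norm (fst g))\<^sup>2 - R\<^sup>2)" "snd g * snd g - M\<^sup>2"]
    unfolding \<kappa>_def pos2_one by (simp_all only: pos2_nonneg)
  define C where "C = {g::'n heis. (norm (fst g))\<^sup>2 \<le> R\<^sup>2 + \<delta> \<and> (snd g)\<^sup>2 \<le> M\<^sup>2 + 1}"
  have C: "compact C" unfolding C_def by (rule compact_annulus)
  have \<kappa>0: "\<kappa> g = 0" if "g \<notin> C" for g
  proof -
    have "1 \<le> pos2 ((1 / \<delta>) * ((norm (fst g))\<^sup>2 - R\<^sup>2)) + pos2 (snd g * snd g - M\<^sup>2)"
    proof (cases "(norm (fst g))\<^sup>2 \<le> R\<^sup>2 + \<delta>")
      case True
      then have "1 \<le> snd g * snd g - M\<^sup>2" using that by (auto simp: C_def power2_eq_square)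
      from pos2_mono[OF this, unfolded pos2_one] show ?thesis
        using pos2_nonneg[of "(1 / \<delta>) * ((norm (fst g))\<^sup>2 - R\<^sup>2)"] by linarith
    next
      case False
      then have "1 \<le> (1 / \<delta>) * ((norm (fst g))\<^sup>2 - R\<^sup>2)" using \<delta> by (simp add: field_simps)
      from pos2_mono[OF this, unfolded pos2_one] show ?thesis
        using pos2_nonneg[of "snd g * snd g - M\<^sup>2"] by linarith
    qed
    then show ?thesis by (simp add: \<kappa>_def)
  qed
  have \<kappa>1: "\<kappa> g = 1" if "g \<in> F" for g
  proof -
    have "g \<in> cball 0 R \<times> {- M..M}" using Fbd that by blast
    then have "norm (fst g) \<le> R" "\<bar>snd g\<bar> \<le> M" by (auto simp: mem_Times_iff)
    then have "(norm (fst g))\<^sup>2 \<le> R\<^sup>2" "snd g * snd g \<le> M\<^sup>2"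
      using abs_le_square_iff[of "snd g" M] abs_le_square_iff[of "norm (fst g)" R] M0 R
      by (simp_all add: power2_eq_square)
    then show ?thesis using \<delta> by (simp add: \<kappa>_def pos2_0 mult_nonneg_nonpos divide_nonpos_pos)
  qed
  \<comment> \<open>On \<open>C\<close> the field \<open>z / R\<close> has norm at most
    \<open>sqrt (1 + \<delta> / R\<^sup>2)\<close>; dividing by this bound costs nothing in the
    limit \<open>\<delta> \<rightarrow> 0\<close>.\<close>
  define \<theta> where "\<theta> = 1 / sqrt (1 + \<delta> / R\<^sup>2)"
  have \<theta>0: "\<theta> > 0" using \<delta> R by (auto simp: \<theta>_def intro!: add_pos_nonneg)
  define \<zeta> where "\<zeta> i g = \<theta> * (\<kappa> g * \<eta> (bvec i) g)" for i g
  have \<zeta>': "\<exists>G. C1_on UNIV (\<zeta> i) G" for i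
  proof -
    obtain G1 where "C1_on UNIV \<kappa> G1" using \<kappa>' by blast
    moreover obtain G2 where "C1_on UNIV (\<eta> (bvec i)) G2" using \<eta>'[OF bvec_Basis] by blast
    ultimately have "C1_on UNIV \<kappa> G1" "C1_on UNIV (\<eta> (bvec i)) G2" .
    from C1_on_cmult[OF C1_on_mult[OF this]] show ?thesis unfolding \<zeta>_def by blast
  qed
  then obtain G where G: "\<And>i. C1_on UNIV (\<zeta> i) (G i)" by metis
  \<comment> \<open>Over the ball the field is a convex combination of the two admissible fields;
    outside it only \<open>z / R\<close> is left, and the bound on \<open>C\<close> applies.\<close>
  have \<eta>norm: "(\<Sum>i\<in>UNIV. (\<kappa> g * \<eta> (bvec i) g)\<^sup>2) \<le> 1 + \<delta> / R\<^sup>2" for g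
  proof -
    define y where "y = fst g /\<^sub>R R + b (fst g) + s g *\<^sub>R (a (fst g) - b (fst g))"
    have "\<eta> (bvec i) g = inner y (bvec i)" for i
      unfolding \<eta>_def q_def y_def
      by (simp add: inner_add_left inner_commute[of "fst g"] divide_inverse)
    then have eq: "(\<Sum>i\<in>UNIV. (\<kappa> g * \<eta> (bvec i) g)\<^sup>2) = (\<kappa> g * norm y)\<^sup>2"
      by (simp add: power_mult_distrib sum_distrib_left[symmetric] sum_bvec_square)
    show ?thesis
    proof (cases "fst g \<in> ?B")
      case True
      have "y = (1 - s g) *\<^sub>R (fst g /\<^sub>R R + b (fst g)) + s g *\<^sub>R (fst g /\<^sub>R R + a (fst g))"
        by (simp add: y_def algebra_simps)
      then have "norm y \<le> (1 - s g) * norm (fst g /\<^sub>R R + b (fst g)) + s g * norm (fst g /\<^sub>R R + a (fst g))"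
        using ramp_bounds[of "x g"] norm_triangle_ineq[of "(1 - s g) *\<^sub>R (fst g /\<^sub>R R + b (fst g))"
            "s g *\<^sub>R (fst g /\<^sub>R R + a (fst g))"] by (simp add: s_def)
      also have "\<dots> \<le> (1 - s g) * 1 + s g * 1"
        using ramp_bounds[of "x g"] na[OF True] nb[OF True]
        by (intro add_mono mult_left_mono) (auto simp: s_def)
      finally have "norm y \<le> 1" by simp
      then have "\<kappa> g * norm y \<le> 1 * 1" using \<kappa>01[of g] by (intro mult_mono) auto
      then have "(\<kappa> g * norm y)\<^sup>2 \<le> 1" using \<kappa>01[of g] by (simp add: power_le_one)
      also have "1 \<le> 1 + \<delta> / R\<^sup>2" using \<delta> by simp
      finally show ?thesis using eq by simp
    next
      case False
      then have "fst g \<notin> K" using K by auto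
      then have y: "norm y = norm (fst g) / R" using R by (simp add: y_def a b divide_inverse)
      show ?thesis
      proof (cases "g \<in> C")
        case True
        have "(\<kappa> g * norm y)\<^sup>2 \<le> (1 * norm y)\<^sup>2" using \<kappa>01[of g] by (intro power_mono mult_right_mono) auto
        also have "\<dots> \<le> (R\<^sup>2 + \<delta>) / R\<^sup>2"
          using True unfolding y by (auto simp: C_def power_divide intro!: divide_right_mono)
        finally show ?thesis using eq R by (simp add: field_simps)
      next
        case False
        then show ?thesis using \<kappa>0 \<delta> by simp
      qed
    qed
  qed
  have test: "\<zeta> \<in> horizontal_test_fields UNIV"
  proof (rule horizontal_test_fieldsI[OF G C])
    show "\<zeta> i g = 0" if "g \<notin> C" for i g using \<kappa>0[OF that] by (simp add: \<zeta>_def)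
    show "(\<Sum>i\<in>UNIV. (\<zeta> i g)\<^sup>2) \<le> 1" for g
    proof -
      have "(\<Sum>i\<in>UNIV. (\<zeta> i g)\<^sup>2) = \<theta>\<^sup>2 * (\<Sum>i\<in>UNIV. (\<kappa> g * \<eta> (bvec i) g)\<^sup>2)"
        unfolding \<zeta>_def power_mult_distrib[of \<theta>] by (simp add: sum_distrib_left)
      also have "\<dots> \<le> \<theta>\<^sup>2 * (1 + \<delta> / R\<^sup>2)" by (intro mult_left_mono \<eta>norm) auto
      also have "\<dots> = 1" using \<delta> R by (simp add: \<theta>_def power_divide add_pos_nonneg add_nonneg_eq_0_iff)
      finally show ?thesis .
    qed
  qed
  \<comment> \<open>Contribution of the derivative of \<open>s\<close>: the horizontal gradient of
    \<open>t - \<tau>\<close> is \<open>- (D + rotJ z / 2)\<close>.\<close>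
  define c where "c z = inner (a z - b z) (D z + rotJ z /\<^sub>R 2)" for z
  define da where "da = divg Ga"
  define db where "db = divg Gb"
  define H where "H g = db (fst g) + (s g * (da (fst g) - db (fst g)) - tent (x g) / \<epsilon> * c (fst g))"
    for g
  have XdF: "(\<Sum>i\<in>UNIV. Xd i (\<zeta> i) g) = \<theta> * (N / R + H g)" if g: "g \<in> F" for g
  proof -
    have cF: "C1_on F (\<zeta> i) (\<lambda>g. \<theta> *\<^sub>R G\<eta> (bvec i) g)" for i
    proof -
      have sub: "F \<subseteq> ?B \<times> UNIV" using FB by (metis SigmaI UNIV_I prod.collapse subsetI)
      from C1_on_cmult[OF C1_on_subset[OF \<eta>[OF bvec_Basis] sub], of \<theta> i]
      have 1: "C1_on F (\<lambda>g. \<theta> * \<eta> (bvec i) g) (\<lambda>g. \<theta> *\<^sub>R G\<eta> (bvec i) g)" .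
      have "(\<zeta> i has_derivative inner (\<theta> *\<^sub>R G\<eta> (bvec i) y)) (at y)" if "y \<in> F" for y
        by (rule has_derivative_transform_within_open[OF C1_on_deriv[OF 1 that] oF that])
           (simp add: \<zeta>_def \<kappa>1)
      then show ?thesis using C1_on_cont_grad[OF 1] by (simp add: C1_on_def)
    qed
    have "Xd i (\<zeta> i) g = \<theta> * inner (G\<eta> (bvec i) g) (hX i g)" for i
      using Xd_eq(1)[OF cF g] by simp
    also have "inner (G\<eta> (bvec i) g) (hX i g) = 1 / R + (inner (Gb (bvec i) (fst g)) (bvec i)
      + (s g * (inner (Ga (bvec i) (fst g)) (bvec i) - inner (Gb (bvec i) (fst g)) (bvec i))
       - tent (x g) / \<epsilon> * (inner (a (fst g) - b (fst g)) (bvec i) * inner (D (fst g) + rotJ (fst g) /\<^sub>R 2) (bvec i))))" for i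
      by (simp add: G\<eta>_def Gq_def Gs_def hX_eq inner_add_left inner_diff_left inner_Basis algebra_simps
          add_divide_distrib diff_divide_distrib)
    finally have eq: "Xd i (\<zeta> i) g = \<theta> * (1 / R + (inner (Gb (bvec i) (fst g)) (bvec i)
      + (s g * (inner (Ga (bvec i) (fst g)) (bvec i) - inner (Gb (bvec i) (fst g)) (bvec i))
       - tent (x g) / \<epsilon> * (inner (a (fst g) - b (fst g)) (bvec i) * inner (D (fst g) + rotJ (fst g) /\<^sub>R 2) (bvec i)))))" for i .
    have sda: "(\<Sum>i\<in>UNIV. inner (Ga (bvec i) z) (bvec i)) = da z"
      and sdb: "(\<Sum>i\<in>UNIV. inner (Gb (bvec i) z) (bvec i)) = db z" for z
      using sum_bvec[of "\<lambda>e. inner (Ga e z) e"] sum_bvec[of "\<lambda>e. inner (Gb e z) e"]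
      by (auto simp: da_def db_def divg_def)
    have sN: "(\<Sum>i\<in>(UNIV::('n + 'n) set). 1 / R) = N / R"
      using sum_bvec[where f="\<lambda>e::'n horiz. 1 / R"] by (simp add: N_def del: sum_constant) simp
    show ?thesis
      unfolding eq sum_distrib_left[symmetric] sum.distrib sum_subtractf sda sdb sN
        sum_bvec_inner H_def c_def ..
  qed
  have Xint: "integrable lborel (\<lambda>g. \<Sum>i\<in>UNIV. Xd i (\<zeta> i) g)"
  proof (rule lborel_integral_compact_support[OF _ C])
    have "Xd i (\<zeta> i) = (\<lambda>g. inner (G i g) (hX i g))" for i
      using Xd_eq(1)[OF G] by (auto simp: fun_eq_iff)
    then show "continuous_on UNIV (\<lambda>g. \<Sum>i\<in>UNIV. Xd i (\<zeta> i) g)"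
      by (auto intro!: continuous_intros continuous_hX C1_on_cont_grad[OF G])
    show "(\<Sum>i\<in>UNIV. Xd i (\<zeta> i) g) = 0" if "g \<notin> C" for g
    proof (rule sum.neutral, rule ballI)
      fix i
      have "G i g = 0"
        by (rule C1_grad_zero[OF G compact_imp_closed[OF C] _ that]) (simp add: \<zeta>_def \<kappa>0)
      then show "Xd i (\<zeta> i) g = 0" using Xd_eq(1)[OF G, of g i] by simp
    qed
  qed
  have XFint: "set_integrable lborel F (\<lambda>g. \<Sum>i\<in>UNIV. Xd i (\<zeta> i) g)"
    unfolding set_integrable_def using Xint by (intro integrable_mult_indicator) auto
  have cint: "set_integrable lborel F (\<lambda>g. N / R)"
    unfolding set_integrable_def using Ffin by (intro integrable_scaleR_left integrable_real_indicator) auto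
  have Hint: "set_integrable lborel F H"
  proof -
    have "set_integrable lborel F (\<lambda>g. (\<Sum>i\<in>UNIV. Xd i (\<zeta> i) g) / \<theta> - N / R)"
      using XFint cint by (intro set_integral_diff set_integrable_divide) auto
    moreover have "(\<Sum>i\<in>UNIV. Xd i (\<zeta> i) g) / \<theta> - N / R = H g" if "g \<in> F" for g
      using XdF[OF that] \<theta>0 by simp
    ultimately show ?thesis by (simp cong: set_integrable_cong)
  qed
  have XF: "set_lebesgue_integral lborel F (\<lambda>g. \<Sum>i\<in>UNIV. Xd i (\<zeta> i) g)
     = \<theta> * (N / R * measure lborel F + set_lebesgue_integral lborel F H)"
  proof -
    have "set_lebesgue_integral lborel F (\<lambda>g. \<Sum>i\<in>UNIV. Xd i (\<zeta> i) g)
      = set_lebesgue_integral lborel F (\<lambda>g. \<theta> * (N / R + H g))"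
      using XdF by (intro set_lebesgue_integral_cong) auto
    also have "\<dots> = \<theta> * (set_lebesgue_integral lborel F (\<lambda>g. N / R) + set_lebesgue_integral lborel F H)"
      using cint Hint by (simp add: set_integral_add)
    also have "set_lebesgue_integral lborel F (\<lambda>g. N / R) = N / R * measure lborel F"
      using Ffin by (simp add: set_lebesgue_integral_def)
    finally show ?thesis .
  qed
  \<comment> \<open>Antiderivative of \<open>H\<close> in \<open>t\<close>. At the upper graph
    \<open>ramp_primitive\<close> has become the identity and at the lower one it is 0, so the layer
    width \<open>\<epsilon>\<close> drops out of the difference.\<close>
  define p where "p z t = db z * t + (\<epsilon> * ramp_primitive (x (z, t)) * (da z - db z) - ramp (x (z, t)) * c z)" for z t
  have xd: "((\<lambda>t. x (z, t)) has_real_derivative 1 / \<epsilon>) (at t)" for z t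
    unfolding x_def using \<epsilon>(1) by (auto intro!: derivative_eq_intros)
  have pd: "(p z has_real_derivative H (z, t)) (at t)" for z t
  proof -
    have 1: "((\<lambda>t. ramp_primitive (x (z, t))) has_real_derivative ramp (x (z, t)) * (1 / \<epsilon>)) (at t)"
      by (rule DERIV_chain2[OF ramp_primitive_deriv xd])
    have 2: "((\<lambda>t. ramp (x (z, t))) has_real_derivative tent (x (z, t)) * (1 / \<epsilon>)) (at t)"
      by (rule DERIV_chain2[OF ramp_deriv xd])
    show ?thesis unfolding p_def
      by (rule derivative_eq_intros 1 2 refl)+ (use \<epsilon>(1) in \<open>simp add: H_def s_def\<close>)
  qed
  have Hc: "continuous_on UNIV (\<lambda>t. H (z, t))" for z
  proof -
    have "continuous_on UNIV (\<lambda>t. x (z, t))" unfolding x_def fst_conv snd_conv by (intro continuous_intros)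
    moreover have "continuous_on UNIV ramp"
      by (meson DERIV_isCont continuous_at_imp_continuous_on ramp_deriv)
    ultimately show ?thesis unfolding H_def s_def fst_conv
      by (intro continuous_intros continuous_on_compose2[OF tent_cont[of UNIV]]
          continuous_on_compose2[where f="\<lambda>t. x (z, t)" and g=ramp and t=UNIV]) (use \<epsilon>(1) in auto)
  qed
  have dz: "da z = 0" "db z = 0" "c z = 0" if "z \<notin> K" for z
    using C1_field_zero(2)[OF a(1) compact_imp_closed[OF K(1)] a(2) that]
      C1_field_zero(2)[OF b(1) compact_imp_closed[OF K(1)] b(2) that] a(2) b(2) that
    by (auto simp: da_def db_def c_def)
  have pdiff: "p z (u z) - p z (- v z) = da z * (u z - \<tau> z) + db z * (v z + \<tau> z) - c z" if z: "z \<in> ?B" for z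
  proof (cases "z \<in> K")
    case True
    have "1 \<le> x (z, u z)" "x (z, - v z) \<le> -1"
      using \<epsilon>(1) \<epsilon>(2)[OF True] by (auto simp: x_def \<tau>_def field_simps)
    then show ?thesis using \<epsilon>(1)
      by (simp add: p_def ramp_eqs) (simp add: x_def algebra_simps)
  qed (simp add: p_def dz)
  have "set_lebesgue_integral lborel F H = (LINT z|lborel. indicator ?B z * (p z (u z) - p z (- v z)))"
    unfolding F_def
  proof (rule between_graphs_lborel_integral)
    show "between_graphs R u v \<in> sets borel" using oF by (simp add: F_def)
    show "set_integrable lborel (between_graphs R u v) H" using Hint by (simp add: F_def)
    show "- v z \<le> u z" if "z \<in> ?B" for z using u0 v0 that by fastforce
  qed (use pd Hc in auto)
  \<comment> \<open>The graphs are separated from the midpoint surface: each of the last two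
    integrands is the divergence of a compactly supported field and integrates to zero.\<close>
  also have "\<dots> = (LINT z|lborel. indicator ?B z * (u z * da z - inner (a z) (rotJ z) / 2)
      + indicator ?B z * (v z * db z + inner (b z) (rotJ z) / 2)
      - indicator ?B z * (\<tau> z * da z + inner (a z) (D z)) + indicator ?B z * (\<tau> z * db z + inner (b z) (D z)))"
  proof (intro Bochner_Integration.integral_cong refl)
    fix z
    show "indicator ?B z * (p z (u z) - p z (- v z)) = indicator ?B z * (u z * da z - inner (a z) (rotJ z) / 2)
      + indicator ?B z * (v z * db z + inner (b z) (rotJ z) / 2)
      - indicator ?B z * (\<tau> z * da z + inner (a z) (D z)) + indicator ?B z * (\<tau> z * db z + inner (b z) (D z))"
    proof (cases "z \<in> ?B")
      case True
      then show ?thesis unfolding pdiff[OF True] c_def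
        by (simp add: inner_diff_left inner_add_right algebra_simps)
    qed simp
  qed
  also have "\<dots> = (LINT z|lborel. indicator ?B z * (u z * da z - inner (a z) (rotJ z) / 2))
      + (LINT z|lborel. indicator ?B z * (v z * db z + inner (b z) (rotJ z) / 2))"
  proof -
    note ia = field_ibp[OF a(1) open_ball K a(2) \<tau>, folded da_def]
    note ib = field_ibp[OF b(1) open_ball K b(2) \<tau>, folded db_def]
    have cJ: "continuous_on K rotJ" by (rule linear_continuous_on[OF bounded_linear_rotJ])
    have "integrable lborel (\<lambda>z. indicator ?B z * (u z * da z - inner (a z) (rotJ z) / 2))"
      unfolding da_def
      by (intro integrable_supported[OF K] continuous_intros cJ C1_field_cont[OF a(1)]
           continuous_on_subset[OF C1_on_cont[OF u] K(2)])
         (use dz(1) a(2) in \<open>auto simp: da_def\<close>)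
    moreover have "integrable lborel (\<lambda>z. indicator ?B z * (v z * db z + inner (b z) (rotJ z) / 2))"
      unfolding db_def
      by (intro integrable_supported[OF K] continuous_intros cJ C1_field_cont[OF b(1)]
           continuous_on_subset[OF C1_on_cont[OF v] K(2)])
         (use dz(2) b(2) in \<open>auto simp: db_def\<close>)
    ultimately show ?thesis using ia ib by simp
  qed
  finally have HF: "set_lebesgue_integral lborel F H =
     (LINT z|lborel. indicator ?B z * (u z * da z - inner (a z) (rotJ z) / 2))
      + (LINT z|lborel. indicator ?B z * (v z * db z + inner (b z) (rotJ z) / 2))" .
  have "ereal (\<theta> * (N / R * measure lborel F + set_lebesgue_integral lborel F H)) \<le> H_perimeter F UNIV"
    using H_perimeter_upper[OF test, of F] unfolding XF by simp
  moreover have "\<theta> * (X + (Y + Z)) = (X + Y + Z) / sqrt (1 + \<delta> / R\<^sup>2)" for X Y Z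
    by (simp add: \<theta>_def)
  ultimately show ?thesis unfolding HF N_def da_def db_def by simp
qed

text \<open>The margin enters only through the factor
  \<open>1 / sqrt (1 + \<delta> / R\<^sup>2)\<close>, which tends to 1.\<close>

lemma H_perimeter_lower_bound:
  fixes u v :: "'n::finite horiz \<Rightarrow> real" and M R :: real
  assumes R: "R > 0"
    and u: "C1_on (ball 0 R) u Du" and v: "C1_on (ball 0 R) v Dv"
    and u0: "\<And>z. z \<in> ball 0 R \<Longrightarrow> 0 \<le> u z" and v0: "\<And>z. z \<in> ball 0 R \<Longrightarrow> 0 \<le> v z"
    and pos: "\<And>z. z \<in> ball 0 R \<Longrightarrow> 0 < u z + v z"
    and uM: "\<And>z. z \<in> ball 0 R \<Longrightarrow> u z \<le> M" and vM: "\<And>z. z \<in> ball 0 R \<Longrightarrow> v z \<le> M"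
    and K: "compact K" "K \<subseteq> ball 0 R"
    and a: "C1_field a Ga" "\<And>z. z \<notin> K \<Longrightarrow> a z = 0"
    and b: "C1_field b Gb" "\<And>z. z \<notin> K \<Longrightarrow> b z = 0"
    and na: "\<And>z. z \<in> ball 0 R \<Longrightarrow> norm (z /\<^sub>R R + a z) \<le> 1"
    and nb: "\<And>z. z \<in> ball 0 R \<Longrightarrow> norm (z /\<^sub>R R + b z) \<le> 1"
  shows "ereal (real DIM('n horiz) / R * measure lborel (between_graphs R u v)
     + (LINT z|lborel. indicator (ball 0 R) z * (u z * divg Ga z - inner (a z) (rotJ z) / 2))
     + (LINT z|lborel. indicator (ball 0 R) z * (v z * divg Gb z + inner (b z) (rotJ z) / 2)))
     \<le> H_perimeter (between_graphs R u v) UNIV" (is "ereal ?X \<le> ?P")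
proof (rule tendsto_upperbound)
  show "((\<lambda>\<delta>. ereal (?X / sqrt (1 + \<delta> / R\<^sup>2))) \<longlongrightarrow> ereal ?X) (at_right 0)"
    using R by (auto intro!: tendsto_eq_intros)
  show "\<forall>\<^sub>F \<delta> in at_right 0. ereal (?X / sqrt (1 + \<delta> / R\<^sup>2)) \<le> ?P"
    unfolding eventually_at_right_field
    using H_perimeter_lower_bound_aux[OF assms] by (intro exI[of _ 1]) auto
qed simp

section \<open>The calibrating field and its perturbations\<close>

definition admissible_field ::
    "real \<Rightarrow> 'n horiz set \<Rightarrow> ('n::finite horiz \<Rightarrow> 'n horiz) \<Rightarrow> ('n horiz \<Rightarrow> 'n horiz \<Rightarrow> 'n horiz) \<Rightarrow> bool" where
  "admissible_field R K a Ga \<longleftrightarrow> compact K \<and> K \<subseteq> ball 0 R \<and> C1_field a Ga \<and> (\<forall>z. z \<notin> K \<longrightarrow> a z = 0) \<and>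
     (\<forall>z\<in>ball 0 R. norm (z /\<^sub>R R + a z) \<le> 1)"

text \<open>The sign \<open>\<sigma>\<close> is \<open>1\<close> for the upper and \<open>-1\<close> for the lower graph.\<close>

definition graph_pairing ::
    "real \<Rightarrow> real \<Rightarrow> ('n::finite horiz \<Rightarrow> real) \<Rightarrow> ('n horiz \<Rightarrow> 'n horiz) \<Rightarrow> ('n horiz \<Rightarrow> 'n horiz \<Rightarrow> 'n horiz) \<Rightarrow> real" where
  "graph_pairing \<sigma> R u a Ga =
     (LINT z|lborel. indicator (ball 0 R) z * (u z * divg Ga z - \<sigma> * inner (a z) (rotJ z) / 2))"

text \<open>For \<open>norm z = R * sin s\<close> with \<open>0 < s \<le> pi / 2\<close> this is the
  cotangent of \<open>s\<close>. It is the coefficient for which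
  \<open>z - slope R z *\<^sub>R rotJ z\<close> has length \<open>R\<close>.\<close>

definition slope :: "real \<Rightarrow> 'a::real_normed_vector \<Rightarrow> real" where
  "slope R z = sqrt (R\<^sup>2 / (norm z)\<^sup>2 - 1)"

lemma slope_square: 
  assumes "norm z \<le> R" "z \<noteq> 0" shows "(slope R z)\<^sup>2 = R\<^sup>2 / (norm z)\<^sup>2 - 1" "0 \<le> slope R z"
proof -
  have "(norm z)\<^sup>2 \<le> R\<^sup>2" using assms by (intro power_mono) auto
  then have "1 \<le> R\<^sup>2 / (norm z)\<^sup>2" using assms by (simp add: field_simps)
  then show "(slope R z)\<^sup>2 = R\<^sup>2 / (norm z)\<^sup>2 - 1" "0 \<le> slope R z" by (auto simp: slope_def)
qed

lemma slope_norm_square: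
  assumes "norm z \<le> R" shows "slope R z * (norm z)\<^sup>2 = norm z * sqrt (R\<^sup>2 - (norm z)\<^sup>2)"
proof (cases "z = 0")
  case False
  have "R\<^sup>2 / (norm z)\<^sup>2 - 1 = (R\<^sup>2 - (norm z)\<^sup>2) / (norm z)\<^sup>2" using False by (simp add: field_simps)
  then show ?thesis using False by (simp add: slope_def real_sqrt_divide power2_eq_square)
qed simp

text \<open>The weight \<open>(norm z)\<^sup>2 * (R\<^sup>2 - (norm z)\<^sup>2)\<close> vanishes at
  the centre, near which \<open>slope\<close> is unbounded, and at the sphere, where
  \<open>slope\<close> is not differentiable. The cutoff avoids both places and tends to 1 in the
  rest of the ball as \<open>m\<close> grows.\<close>

definition collar :: "real \<Rightarrow> real \<Rightarrow> 'a::real_normed_vector \<Rightarrow> real" where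
  "collar R m z = smoothstep (m * ((norm z)\<^sup>2 * (R\<^sup>2 - (norm z)\<^sup>2)) - 1)"

definition collar_set :: "real \<Rightarrow> real \<Rightarrow> 'a::real_normed_vector set" where
  "collar_set R m = {z. 1 \<le> m * ((norm z)\<^sup>2 * (R\<^sup>2 - (norm z)\<^sup>2))}"

lemma collar_set:
  fixes R m :: real
  assumes "R > 0" "m > 0"
  shows "compact (collar_set R m :: 'a::euclidean_space set)" "collar_set R m \<subseteq> ball (0::'a) R - {0}"
proof -
  show s: "collar_set R m \<subseteq> ball (0::'a) R - {0}"
  proof
    fix z :: 'a assume z: "z \<in> collar_set R m"
    then have "z \<noteq> 0" by (auto simp: collar_set_def)
    moreover have "norm z < R"
    proof (rule ccontr)
      assume "\<not> norm z < R"
      then have "R\<^sup>2 - (norm z)\<^sup>2 \<le> 0" using assms by (simp add: power_mono)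
      then have "m * ((norm z)\<^sup>2 * (R\<^sup>2 - (norm z)\<^sup>2)) \<le> 0"
        using assms by (intro mult_nonneg_nonpos) auto
      then show False using z by (simp add: collar_set_def)
    qed
    ultimately show "z \<in> ball 0 R - {0}" by simp
  qed
  have "closed (collar_set R m :: 'a set)"
    unfolding collar_set_def by (intro closed_Collect_le continuous_intros)
  moreover have "bounded (collar_set R m :: 'a set)"
    by (rule bounded_subset[OF bounded_ball[of 0 R]]) (use s in auto)
  ultimately show "compact (collar_set R m :: 'a set)" by (simp add: compact_eq_bounded_closed)
qed

lemma collar_bounds: "0 \<le> collar R m z" "collar R m z \<le> 1"
  by (auto simp: collar_def smoothstep_bounds)

lemma collar_0: "z \<notin> collar_set R m \<Longrightarrow> collar R m z = 0"
  by (auto simp: collar_def collar_set_def intro: smoothstep_0)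

lemma collar_1: "2 \<le> m * ((norm z)\<^sup>2 * (R\<^sup>2 - (norm z)\<^sup>2)) \<Longrightarrow> collar R m z = 1"
  by (auto simp: collar_def intro: smoothstep_1)

text \<open>The function depends on \<open>(norm z)\<^sup>2\<close> alone, so its gradient is a
  multiple of \<open>z\<close>. This radial form makes the rotated field divergence free in
  \<open>calib_field_C1\<close>.\<close>

lemma C1_on_collar_slope:
  fixes R m :: real
  assumes R: "R > 0" and m: "m > 0"
  shows "\<exists>Q. C1_on UNIV (\<lambda>z::'a::euclidean_space. collar R m z * slope R z) (\<lambda>z. Q z *\<^sub>R z)"
proof -
  define h where "h w = smoothstep (m * (w * (R\<^sup>2 - w)) - 1) * sqrt (R\<^sup>2 / w - 1)" for w
  define S where "S x = 4 * max 0 (1 - pos2 x) * max 0 x" for x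
  define h' where "h' w = smoothstep (m * (w * (R\<^sup>2 - w)) - 1) * (inverse (sqrt (R\<^sup>2 / w - 1)) / 2 * (- (R\<^sup>2 / w\<^sup>2)))
     + (S (m * (w * (R\<^sup>2 - w)) - 1) * (m * (R\<^sup>2 - 2 * w))) * sqrt (R\<^sup>2 / w - 1)" for w
  let ?A = "ball (0::'a) R - {0}"
  have A: "(norm z)\<^sup>2 \<in> {0<..<R\<^sup>2}" if "z \<in> ?A" for z
    using that by (auto simp: power_strict_mono)
  have pos: "0 < R\<^sup>2 / w - 1" if "w \<in> {0<..<R\<^sup>2}" for w using that by (simp add: field_simps)
  have hd: "(h has_real_derivative h' w) (at w)" if w: "w \<in> {0<..<R\<^sup>2}" for w
  proof -
    have 1: "((\<lambda>w. m * (w * (R\<^sup>2 - w)) - 1) has_real_derivative m * (R\<^sup>2 - 2 * w)) (at w)"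
      by (auto intro!: derivative_eq_intros)
    have 2: "((\<lambda>w. smoothstep (m * (w * (R\<^sup>2 - w)) - 1)) has_real_derivative
       S (m * (w * (R\<^sup>2 - w)) - 1) * (m * (R\<^sup>2 - 2 * w))) (at w)"
      unfolding S_def by (rule DERIV_chain2[OF smoothstep_deriv 1])
    have 3: "((\<lambda>w. R\<^sup>2 / w - 1) has_real_derivative - (R\<^sup>2 / w\<^sup>2)) (at w)"
      using w by (auto intro!: derivative_eq_intros simp: power2_eq_square)
    have 4: "((\<lambda>w. sqrt (R\<^sup>2 / w - 1)) has_real_derivative inverse (sqrt (R\<^sup>2 / w - 1)) / 2 * (- (R\<^sup>2 / w\<^sup>2))) (at w)"
      by (rule DERIV_chain2[OF DERIV_real_sqrt 3]) (rule pos[OF w])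
    show ?thesis unfolding h_def h'_def by (rule DERIV_mult'[OF 2 4])
  qed
  have Sc: "continuous_on B S" for B unfolding S_def by (rule smoothstep_deriv_cont)
  have sc: "continuous_on B smoothstep" for B
    by (meson DERIV_isCont continuous_at_imp_continuous_on smoothstep_deriv)
  have h'c: "continuous_on {0<..<R\<^sup>2} h'"
    unfolding h'_def
    by (intro continuous_intros continuous_on_compose2[OF Sc[of UNIV]] continuous_on_compose2[OF sc[of UNIV]])
       (use pos in force)+
  have sub: "(\<lambda>z. (norm z)\<^sup>2) ` ?A \<subseteq> {0<..<R\<^sup>2}" by (intro image_subsetI A)
  have "C1_on ?A (\<lambda>z. h ((norm z)\<^sup>2)) (\<lambda>z. h' ((norm z)\<^sup>2) *\<^sub>R (2 *\<^sub>R z))"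
    by (rule C1_on_compose[where f="\<lambda>z. (norm z)\<^sup>2" and h=h and h'=h'])
       (use A hd in \<open>auto intro: C1_on_norm_square continuous_on_subset[OF h'c sub]\<close>)
  then have "C1_on UNIV (\<lambda>z::'a. h ((norm z)\<^sup>2)) (\<lambda>z. if z \<in> collar_set R m then h' ((norm z)\<^sup>2) *\<^sub>R (2 *\<^sub>R z) else 0)"
  proof (rule C1_on_extend)
    show "h ((norm z)\<^sup>2) = 0" if "z \<notin> collar_set R m" for z :: 'a
      using collar_0[OF that] by (auto simp: collar_def h_def)
  qed (use collar_set[OF R m] compact_imp_closed in auto)
  moreover have "(\<lambda>z. h ((norm z)\<^sup>2)) = (\<lambda>z::'a. collar R m z * slope R z)"
    by (auto simp: h_def collar_def slope_def)
  moreover have "(\<lambda>z::'a. if z \<in> collar_set R m then h' ((norm z)\<^sup>2) *\<^sub>R (2 *\<^sub>R z) else 0) =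
     (\<lambda>z. (if z \<in> collar_set R m then 2 * h' ((norm z)\<^sup>2) else 0) *\<^sub>R z)"
    by (auto simp: fun_eq_iff)
  ultimately show ?thesis
    by (intro exI[of _ "\<lambda>z. if z \<in> collar_set R m then 2 * h' ((norm z)\<^sup>2) else 0"]) simp
qed

text \<open>The linear map \<open>rotJ\<close> is antisymmetric and so has divergence zero; what
  remains is the derivative of the coefficient along \<open>rotJ z\<close>, which vanishes for
  radial coefficients.\<close>

lemma C1_field_rotJ:
  fixes q :: "'n::finite horiz \<Rightarrow> real"
  assumes "C1_on UNIV q Gq"
  shows "C1_field (\<lambda>z. (c * q z) *\<^sub>R rotJ z) (\<lambda>b z. c *\<^sub>R (q z *\<^sub>R (- rotJ b) + inner (- rotJ b) z *\<^sub>R Gq z))"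
    "divg (\<lambda>b z. c *\<^sub>R (q z *\<^sub>R (- rotJ b) + inner (- rotJ b) z *\<^sub>R Gq z)) z = c * inner (Gq z) (rotJ z)"
proof -
  have i: "inner (rotJ z) b = inner (- rotJ b) z" for z b :: "'n horiz"
    by (simp add: rotJ_def inner_prod_def inner_commute)
  have eq: "inner ((c * q z) *\<^sub>R rotJ z) b = c * (q z * inner (- rotJ b) z)" for z b
    unfolding inner_scaleR_left i by simp
  show "C1_field (\<lambda>z. (c * q z) *\<^sub>R rotJ z) (\<lambda>b z. c *\<^sub>R (q z *\<^sub>R (- rotJ b) + inner (- rotJ b) z *\<^sub>R Gq z))"
    unfolding C1_field_def eq by (intro ballI C1_on_cmult C1_on_mult assms C1_on_inner)
  have "inner (c *\<^sub>R (q z *\<^sub>R (- rotJ b) + inner (- rotJ b) z *\<^sub>R Gq z)) b = c * (inner (Gq z) b * inner (rotJ z) b)" for b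
    unfolding i[of z b] inner_scaleR_left inner_add_left inner_minus_left by (simp add: inner_rotJ_left[of b b])
  then show "divg (\<lambda>b z. c *\<^sub>R (q z *\<^sub>R (- rotJ b) + inner (- rotJ b) z *\<^sub>R Gq z)) z = c * inner (Gq z) (rotJ z)"
    unfolding divg_def sum_distrib_left euclidean_inner[of "Gq z" "rotJ z"] by (intro sum.cong refl)
qed

text \<open>The unit horizontal outer normal of the extremal graph over the ball of radius
  \<open>R\<close>.\<close>

definition calib :: "real \<Rightarrow> real \<Rightarrow> 'n::finite horiz \<Rightarrow> 'n horiz" where
  "calib \<sigma> R z = (1 / R) *\<^sub>R (z - (\<sigma> * slope R z) *\<^sub>R rotJ z)"

definition calib_field :: "real \<Rightarrow> real \<Rightarrow> real \<Rightarrow> 'n::finite horiz \<Rightarrow> 'n horiz" where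
  "calib_field \<sigma> R m z = (- \<sigma> / R * (collar R m z * slope R z)) *\<^sub>R rotJ z"

text \<open>The vectors \<open>z\<close> and \<open>rotJ z\<close> are orthogonal, so squared
  lengths add. With the full slope they add up to exactly 1, and the cutoff only shortens the
  rotational part.\<close>

lemma calib_field_norm:
  assumes R: "R > 0" and \<sigma>: "\<sigma>\<^sup>2 = 1" and z: "z \<in> ball 0 R"
  shows "norm (z /\<^sub>R R + calib_field \<sigma> R m z) \<le> 1"
proof (cases "z = 0")
  case False
  let ?q = "collar R m z * slope R z"
  have "(norm (z /\<^sub>R R + calib_field \<sigma> R m z))\<^sup>2 = (norm z)\<^sup>2 / R\<^sup>2 + \<sigma>\<^sup>2 / R\<^sup>2 * ?q\<^sup>2 * (norm z)\<^sup>2"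
    unfolding calib_field_def power2_norm_eq_inner
    by (simp add: inner_add_left inner_add_right power2_eq_square power_mult_distrib divide_inverse algebra_simps)
  also have "\<dots> \<le> (norm z)\<^sup>2 / R\<^sup>2 + 1 / R\<^sup>2 * (slope R z)\<^sup>2 * (norm z)\<^sup>2"
  proof -
    have "?q\<^sup>2 \<le> (1 * slope R z)\<^sup>2"
      using collar_bounds[of R m z] slope_square(2)[of z R] z False
      by (intro power_mono mult_right_mono) auto
    then show ?thesis using \<sigma> by (auto intro!: mult_right_mono divide_right_mono)
  qed
  also have "\<dots> = 1"
    using slope_square(1)[of z R] z False R by (simp add: field_simps)
  finally show ?thesis by (simp add: abs_square_le_1)
qed (simp add: calib_field_def)

lemma calib_norm:
  assumes R: "R > 0" and \<sigma>: "\<sigma>\<^sup>2 = 1" and z: "z \<in> ball 0 R" "z \<noteq> 0"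
  shows "norm (calib \<sigma> R z) = 1"
proof -
  have "(norm (calib \<sigma> R z))\<^sup>2 = (norm z)\<^sup>2 / R\<^sup>2 + \<sigma>\<^sup>2 / R\<^sup>2 * (slope R z)\<^sup>2 * (norm z)\<^sup>2"
    unfolding calib_def power2_norm_eq_inner
    by (simp add: inner_diff_left inner_diff_right power2_eq_square power_mult_distrib divide_inverse algebra_simps)
  also have "\<dots> = 1"
    using slope_square(1)[of z R] z R \<sigma> by (simp add: field_simps)
  finally show ?thesis using power2_eq_imp_eq[of "norm (calib \<sigma> R z)" 1] by simp
qed

lemma calib_field_C1:
  assumes R: "R > 0" and m: "m > 0"
  shows "\<exists>Ga. C1_field (calib_field \<sigma> R m :: 'n::finite horiz \<Rightarrow> 'n horiz) Ga \<and> (\<forall>z. divg Ga z = 0)"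
proof -
  obtain Q where Q: "C1_on UNIV (\<lambda>z::'n horiz. collar R m z * slope R z) (\<lambda>z. Q z *\<^sub>R z)"
    using C1_on_collar_slope[OF R m] by blast
  from C1_field_rotJ[OF Q, of "- \<sigma> / R"] show ?thesis
    unfolding calib_field_def[abs_def] by (intro exI conjI allI) auto
qed

lemma admissible_calib_field:
  assumes "R > 0" "m > 0" "\<sigma>\<^sup>2 = 1" "C1_field (calib_field \<sigma> R m) Ga"
  shows "admissible_field R (collar_set R m) (calib_field \<sigma> R m) Ga"
  unfolding admissible_field_def using collar_set[OF assms(1,2)] assms calib_field_norm[OF assms(1,3)]
  by (auto simp: calib_field_def collar_0)

text \<open>The limiting value of the pairing: with the full slope,
  \<open>- \<sigma> * inner a (rotJ z) / 2\<close> equals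
  \<open>slope R z * (norm z)\<^sup>2 / (2 * R)\<close>, which is
  \<open>norm z * sqrt (R\<^sup>2 - (norm z)\<^sup>2) / (2 * R)\<close>.\<close>

definition profile_term :: "real \<Rightarrow> 'n::finite itself \<Rightarrow> real" where
  "profile_term R _ = (LINT z|lborel. indicator (ball 0 R) z * (norm (z::'n horiz) * sqrt (R\<^sup>2 - (norm z)\<^sup>2))) / (2 * R)"

text \<open>The sign enters as \<open>\<sigma>\<^sup>2 = 1\<close>, so both graphs have the same
  limit. At every point of the ball other than the centre the cutoff is eventually 1, and the
  integrands are dominated by the one without cutoff.\<close>

lemma calib_field_pairing:
  assumes R: "R > 0" and \<sigma>: "\<sigma>\<^sup>2 = 1"
  shows "(\<lambda>n. LINT z|lborel. indicator (ball 0 R) z *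
      (- \<sigma> * inner (calib_field \<sigma> R (real (Suc n)) z) (rotJ (z::'n::finite horiz)) / 2))
    \<longlonglongrightarrow> profile_term R TYPE('n)"
proof -
  let ?B = "ball (0::'n horiz) R"
  define f where "f z = norm z * sqrt (R\<^sup>2 - (norm z)\<^sup>2)" for z :: "'n horiz"
  define c where "c n z = collar R (real (Suc n)) z" for n and z :: "'n horiz"
  have fc: "continuous_on A f" for A unfolding f_def by (intro continuous_intros)
  have f0: "0 \<le> f z" if "z \<in> ?B" for z
    using that by (auto simp: f_def intro!: mult_nonneg_nonneg power_mono)
  have fint: "integrable lborel (\<lambda>z. indicator ?B z * f z)"
  proof -
    have "integrable lborel (\<lambda>z. indicator (cball 0 R) z *\<^sub>R f z)"
      by (rule borel_integrable_compact[OF compact_cball fc])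
    then have "set_integrable lborel (cball 0 R) f" by (simp add: set_integrable_def)
    then have "set_integrable lborel ?B f" by (rule set_integrable_subset) auto
    then show ?thesis by (simp add: set_integrable_def)
  qed
  have [measurable]: "f \<in> borel_measurable borel" by (rule borel_measurable_continuous_onI[OF fc])
  have [measurable]: "?B \<in> sets borel" by simp
  have [measurable]: "c n \<in> borel_measurable borel" for n
    unfolding c_def collar_def smoothstep_def pos2_def by measurable
  have eq: "indicator ?B z * (- \<sigma> * inner (calib_field \<sigma> R (real (Suc n)) z) (rotJ z) / 2)
      = indicator ?B z * (c n z * f z) / (2 * R)" for n z
  proof (cases "z \<in> ?B")
    case True
    have "- \<sigma> * inner (calib_field \<sigma> R (real (Suc n)) z) (rotJ z) / 2
       = \<sigma>\<^sup>2 / (2 * R) * collar R (real (Suc n)) z * (slope R z * (norm z)\<^sup>2)"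
      by (simp add: calib_field_def dot_square_norm power2_eq_square del: of_nat_Suc)
    then show ?thesis using slope_norm_square[of z R] True \<sigma> by (simp add: f_def c_def)
  qed simp
  have "(\<lambda>n. LINT z|lborel. indicator ?B z * (c n z * f z)) \<longlonglongrightarrow> (LINT z|lborel. indicator ?B z * f z)"
  proof (rule integral_dominated_convergence[OF _ _ fint])
    show "(\<lambda>z. indicator ?B z * f z) \<in> borel_measurable lborel"
      "(\<lambda>z. indicator ?B z * (c n z * f z)) \<in> borel_measurable lborel" for n
      by measurable
    show "AE z in lborel. (\<lambda>n. indicator ?B z * (c n z * f z)) \<longlonglongrightarrow> indicator ?B z * f z"
      using AE_lborel_singleton[of 0]
    proof eventually_elim
      case (elim z)
      show ?case
      proof (cases "z \<in> ?B")
        case True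
        have "0 < (norm z)\<^sup>2 * (R\<^sup>2 - (norm z)\<^sup>2)"
          using True elim by (auto intro!: mult_pos_pos power_strict_mono)
        then obtain N where N: "2 < real N * ((norm z)\<^sup>2 * (R\<^sup>2 - (norm z)\<^sup>2))"
          using reals_Archimedean3 by blast
        have "\<forall>\<^sub>F n in sequentially. indicator ?B z * (c n z * f z) = indicator ?B z * f z"
          using eventually_ge_at_top[of N]
        proof eventually_elim
          case (elim n)
          have "real N * ((norm z)\<^sup>2 * (R\<^sup>2 - (norm z)\<^sup>2)) \<le> real (Suc n) * ((norm z)\<^sup>2 * (R\<^sup>2 - (norm z)\<^sup>2))"
            using elim \<open>0 < (norm z)\<^sup>2 * (R\<^sup>2 - (norm z)\<^sup>2)\<close> by (intro mult_right_mono) auto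
          then have "c n z = 1" unfolding c_def using N by (intro collar_1) simp
          then show ?case by simp
        qed
        then show ?thesis by (rule tendsto_eventually)
      qed simp
    qed
    show "AE z in lborel. norm (indicator ?B z * (c n z * f z)) \<le> indicator ?B z * f z" for n
    proof (rule AE_I2)
      fix z
      show "norm (indicator ?B z * (c n z * f z)) \<le> indicator ?B z * f z"
        using f0[of z] collar_bounds[of R "real (Suc n)" z]
        by (auto simp: c_def abs_mult mult_left_le_one_le simp del: of_nat_Suc split: split_indicator)
    qed
  qed
  then have "(\<lambda>n. (LINT z|lborel. indicator ?B z * (c n z * f z)) / (2 * R)) \<longlonglongrightarrow> (LINT z|lborel. indicator ?B z * f z) / (2 * R)"
    using R by (intro tendsto_divide tendsto_const) auto
  then show ?thesis unfolding eq profile_term_def f_def[symmetric] by simp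
qed

text \<open>The graph occurs in the pairing only as a factor of the divergence, which is zero
  here.\<close>

lemma graph_pairing_calib:
  fixes u :: "'n::finite horiz \<Rightarrow> real"
  assumes "\<And>z. divg Ga z = 0"
  shows "graph_pairing \<sigma> R u (calib_field \<sigma> R m) Ga = (LINT z|lborel. indicator (ball 0 R) z *
      (- \<sigma> * inner (calib_field \<sigma> R m z) (rotJ (z::'n horiz)) / 2))"
  by (simp add: graph_pairing_def assms)

lemma pairing_approx:
  fixes u :: "'n::finite horiz \<Rightarrow> real"
  assumes R: "R > 0" and \<sigma>: "\<sigma>\<^sup>2 = 1" and c: "c < profile_term R TYPE('n)"
  shows "\<exists>K a Ga. admissible_field R K a Ga \<and> c < graph_pairing \<sigma> R u a Ga"
proof -
  have "\<forall>\<^sub>F n in sequentially. c < (LINT z|lborel. indicator (ball 0 R) z *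
      (- \<sigma> * inner (calib_field \<sigma> R (real (Suc n)) z) (rotJ (z::'n horiz)) / 2))"
    by (rule order_tendstoD(1)[OF calib_field_pairing[OF R \<sigma>] c])
  then obtain n where n: "c < (LINT z|lborel. indicator (ball 0 R) z *
      (- \<sigma> * inner (calib_field \<sigma> R (real (Suc n)) z) (rotJ (z::'n horiz)) / 2))"
    by (auto simp: eventually_sequentially)
  obtain Ga where Ga: "C1_field (calib_field \<sigma> R (real (Suc n)) :: 'n horiz \<Rightarrow> 'n horiz) Ga" "\<And>z. divg Ga z = 0"
    using calib_field_C1[OF R, of "real (Suc n)" \<sigma>] by auto
  have "admissible_field R (collar_set R (real (Suc n))) (calib_field \<sigma> R (real (Suc n))) Ga"
    by (rule admissible_calib_field[OF R _ \<sigma> Ga(1)]) simp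
  moreover have "c < graph_pairing \<sigma> R u (calib_field \<sigma> R (real (Suc n))) Ga"
    unfolding graph_pairing_calib[OF Ga(2)] by (rule n)
  ultimately show ?thesis by blast
qed

lemma slope_cont: "continuous_on (ball 0 R - {0}) (slope R :: 'a::real_normed_vector \<Rightarrow> real)"
  unfolding slope_def[abs_def] by (intro continuous_intros) auto

text \<open>Where the graph is not calibrated, pushing the field towards the actual normal of the graph
  increases the pairing without violating the norm constraint.\<close>

lemma pairing_strict:
  fixes u :: "'n::finite horiz \<Rightarrow> real"
  assumes R: "R > 0" and \<sigma>: "\<sigma>\<^sup>2 = 1" and u: "C1_on (ball 0 R) u Du"
    and z0: "z0 \<in> ball 0 R" "z0 \<noteq> 0"
    and na: "inner (- (Du z0 + (\<sigma> / 2) *\<^sub>R rotJ z0)) (calib \<sigma> R z0) < norm (Du z0 + (\<sigma> / 2) *\<^sub>R rotJ z0)"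
  shows "\<exists>K a Ga. admissible_field R K a Ga \<and> profile_term R TYPE('n) < graph_pairing \<sigma> R u a Ga"
proof -
  let ?B = "ball (0::'n horiz) R"
  define m where "m z = - (Du z + (\<sigma> / 2) *\<^sub>R rotJ z)" for z
  define y where "y = m z0"
  define \<zeta> where "\<zeta> = calib \<sigma> R z0"
  \<comment> \<open>Points from the calibrating normal to the true unit normal of the graph. It
    makes an obtuse angle with \<open>\<zeta>\<close>, so a small step along it shortens the field,
    and it pairs positively with \<open>y\<close>.\<close>
  define w where "w = y /\<^sub>R norm y - \<zeta>"
  have n\<zeta>: "norm \<zeta> = 1" unfolding \<zeta>_def by (rule calib_norm[OF R \<sigma> z0])
  have y\<zeta>: "inner y \<zeta> < norm y"     unfolding y_def m_def norm_minus_cancel \<zeta>_def by (rule na)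
  have y0: "norm y > 0" using y\<zeta> by (cases "y = 0") auto
  have w\<zeta>: "inner w \<zeta> < 0"
    using y\<zeta> y0 n\<zeta> by (simp add: w_def inner_diff_left norm_eq_1 field_simps)
  have "inner (y /\<^sub>R norm y) y = norm y" using y0 by (simp add: dot_square_norm power2_eq_square)
  then have wy: "inner w y > 0"
    using y\<zeta> unfolding w_def inner_diff_left by (simp add: inner_commute[of y \<zeta>])
  have w0: "norm w > 0" using wy by auto
  have cJ: "continuous_on A rotJ" for A :: "'n horiz set" by (rule linear_continuous_on[OF bounded_linear_rotJ])
  let ?A = "?B - {0}"
  have oA: "open ?A" by auto
  define c where "c = - inner w \<zeta> / 2"
  have c0: "c > 0" using w\<zeta> by (simp add: c_def)
  have "continuous_on ?A (\<lambda>z. inner w (calib \<sigma> R z))"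
    unfolding calib_def by (intro continuous_intros cJ slope_cont)
  then have o1: "open ((\<lambda>z. inner w (calib \<sigma> R z)) -` {..< - c} \<inter> ?A)"
    by (rule continuous_on_open_vimage[OF oA, THEN iffD1, rule_format]) simp
  have "continuous_on ?A (\<lambda>z. inner w (m z))"
    unfolding m_def by (intro continuous_intros cJ continuous_on_subset[OF C1_on_cont_grad[OF u]]) auto
  then have o2: "open ((\<lambda>z. inner w (m z)) -` {0<..} \<inter> ?A)"
    by (rule continuous_on_open_vimage[OF oA, THEN iffD1, rule_format]) simp
  have "z0 \<in> ((\<lambda>z. inner w (calib \<sigma> R z)) -` {..< - c} \<inter> ?A) \<inter> ((\<lambda>z. inner w (m z)) -` {0<..} \<inter> ?A)"
    using z0 w\<zeta> wy by (auto simp: c_def \<zeta>_def y_def)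
  then obtain r where r: "r > 0"
    and rs: "cball z0 r \<subseteq> ((\<lambda>z. inner w (calib \<sigma> R z)) -` {..< - c} \<inter> ?A) \<inter> ((\<lambda>z. inner w (m z)) -` {0<..} \<inter> ?A)"
    using open_contains_cball open_Int[OF o1 o2] by meson
  have rA: "cball z0 r \<subseteq> ?A" and rB: "cball z0 r \<subseteq> ?B" using rs by auto
  have r1: "inner w (calib \<sigma> R z) < - c" "inner w (m z) > 0" if "z \<in> cball z0 r" for z using rs that by auto
  define \<beta> where "\<beta> z = pos2 (r\<^sup>2 - ((norm z)\<^sup>2 - (2 * inner z0 z - (norm z0)\<^sup>2)))" for z
  have \<beta>_eq: "\<beta> z = pos2 (r\<^sup>2 - (norm (z - z0))\<^sup>2)" for z
    unfolding \<beta>_def power2_norm_eq_inner by (simp add: inner_diff_left inner_diff_right inner_commute algebra_simps)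
  obtain G\<beta> where G\<beta>: "C1_on UNIV \<beta> G\<beta>"
    using C1_on_pos2[OF C1_on_diff[OF C1_on_const[of _ "r\<^sup>2"] C1_on_diff[OF C1_on_norm_square
       C1_on_diff[OF C1_on_cmult[OF C1_on_inner[of _ z0], where c=2] C1_on_const[of _ "(norm z0)\<^sup>2"]]]]]
    unfolding \<beta>_def by blast
  have \<beta>0: "\<beta> z = 0" if "z \<notin> cball z0 r" for z
    using that r by (auto simp: \<beta>_eq dist_norm norm_minus_commute intro!: power_mono)
  have \<beta>pos: "\<beta> z > 0" if "z \<in> ball z0 r" for z
  proof -
    have "(norm (z - z0))\<^sup>2 < r\<^sup>2" using that by (intro power_strict_mono) (auto simp: dist_norm norm_minus_commute)
    then show ?thesis using pos2_nonneg[of "r\<^sup>2 - (norm (z - z0))\<^sup>2"] pos2_eq_0[of "r\<^sup>2 - (norm (z - z0))\<^sup>2"]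
      unfolding \<beta>_eq by linarith
  qed
  have \<beta>r: "0 \<le> \<beta> z" "\<beta> z \<le> pos2 (r\<^sup>2)" for z by (auto simp: \<beta>_eq intro: pos2_mono)
  \<comment> \<open>Chosen so that \<open>\<delta> * \<beta> z * (norm w)\<^sup>2\<close> is at most
    \<open>2 * c\<close>. The linear term \<open>2 * inner w (calib \<sigma> R z)\<close>, which is
    below \<open>- 2 * c\<close> on the small ball, then outweighs it and the norm stays at most
    1.\<close>
  define \<delta> where "\<delta> = 2 * c / (pos2 (r\<^sup>2) * (norm w)\<^sup>2)"
  have pr: "pos2 (r\<^sup>2) > 0" using r by (simp add: pos2_def)
  have \<delta>0: "\<delta> > 0" using c0 w0 pr by (auto simp: \<delta>_def)
  have ne: "cball z0 r \<noteq> {}" using r by simp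
  have "continuous_on (cball z0 r) (\<lambda>z. (norm z)\<^sup>2 * (R\<^sup>2 - (norm z)\<^sup>2))" by (intro continuous_intros)
  from continuous_attains_inf[OF compact_cball ne this]
  obtain z1 where z1: "z1 \<in> cball z0 r"
    "\<And>z. z \<in> cball z0 r \<Longrightarrow> (norm z1)\<^sup>2 * (R\<^sup>2 - (norm z1)\<^sup>2) \<le> (norm z)\<^sup>2 * (R\<^sup>2 - (norm z)\<^sup>2)"
    by auto
  define e where "e = (norm z1)\<^sup>2 * (R\<^sup>2 - (norm z1)\<^sup>2)"
  have "z1 \<in> ?A" using z1(1) rA by blast
  then have "norm z1 < R" "z1 \<noteq> 0" by auto
  then have e0: "e > 0" unfolding e_def using power_strict_mono[of "norm z1" R 2] by simp
  \<comment> \<open>From this index on the cutoff equals 1 on the small ball, where the field is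
    then exactly \<open>calib\<close> plus the perturbation.\<close>
  obtain N where N: "2 < real N * e" using reals_Archimedean3[OF e0] by blast
  have col1: "collar R (real (Suc n)) z = 1" if "n \<ge> N" "z \<in> cball z0 r" for n z
  proof (rule collar_1)
    have "real N * e \<le> real (Suc n) * ((norm z)\<^sup>2 * (R\<^sup>2 - (norm z)\<^sup>2))"
      using that z1(2)[OF that(2)] e0 by (intro mult_mono) (auto simp: e_def)
    then show "2 \<le> real (Suc n) * ((norm z)\<^sup>2 * (R\<^sup>2 - (norm z)\<^sup>2))" using N by linarith
  qed
  define p :: "'n horiz \<Rightarrow> 'n horiz" where "p z = (\<delta> * \<beta> z) *\<^sub>R w" for z
  define Gp where "Gp b z = (\<delta> * inner w b) *\<^sub>R G\<beta> z" for b z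
  have p: "C1_field p Gp"
    unfolding C1_field_def
  proof
    fix b :: "'n horiz"
    have "(\<lambda>z. inner (p z) b) = (\<lambda>z. (\<delta> * inner w b) * \<beta> z)" by (auto simp: p_def)
    then show "C1_on UNIV (\<lambda>z. inner (p z) b) (Gp b)" unfolding Gp_def by (simp add: C1_on_cmult[OF G\<beta>])
  qed
  have p0: "p z = 0" if "z \<notin> cball z0 r" for z using \<beta>0[OF that] by (simp add: p_def)
  define I where "I = (LINT z|lborel. indicator ?B z * (u z * divg Gp z - \<sigma> * inner (p z) (rotJ z) / 2))"
  have Iint: "integrable lborel (\<lambda>z. indicator ?B z * (u z * divg Gp z - \<sigma> * inner (p z) (rotJ z) / 2))"
    by (intro integrable_supported[OF compact_cball rB] continuous_intros cJ C1_field_cont[OF p]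
         continuous_on_subset[OF C1_on_cont[OF u] rB])
       (use p0 C1_field_zero(2)[OF p closed_cball p0] in simp_all)
  have I: "I > 0"
  proof -
    note ib = field_ibp[OF p open_ball compact_cball rB p0 u]
    \<comment> \<open>Subtracting an integral that vanishes by parts replaces the pairing of
      \<open>p\<close> by the integral of \<open>inner (p z) (m z)\<close>, which is nonnegative
      everywhere and positive inside the small ball.\<close>
    have "I = (LINT z|lborel. indicator ?B z * (u z * divg Gp z - \<sigma> * inner (p z) (rotJ z) / 2)
        - indicator ?B z * (u z * divg Gp z + inner (p z) (Du z)))"
      using ib Iint by (simp add: I_def)
    also have "\<dots> = (LINT z|lborel. indicator ?B z * inner (p z) (m z))"
      by (intro Bochner_Integration.integral_cong refl)
         (auto simp: m_def inner_add_right algebra_simps split: split_indicator)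
    also have "\<dots> > 0"
    proof (rule ccontr)
      let ?f = "\<lambda>z. indicator ?B z * inner (p z) (m z)"
      assume neg: "\<not> ?thesis"
      have nn: "0 \<le> ?f z" for z
      proof (cases "z \<in> cball z0 r")
        case True
        then show ?thesis using r1(2)[OF True] \<beta>r(1)[of z] \<delta>0 by (simp add: p_def)
      qed (simp add: p0)
      have fi: "integrable lborel ?f"
        unfolding m_def
        by (intro integrable_supported[OF compact_cball rB] continuous_intros cJ C1_field_cont[OF p]
             continuous_on_subset[OF C1_on_cont_grad[OF u] rB]) (auto simp: p0)
      have "integral\<^sup>L lborel ?f = 0"
        using neg Bochner_Integration.integral_nonneg[of lborel ?f, OF nn] by linarith
      then have "AE z in lborel. ?f z = 0"
        using integral_nonneg_eq_0_iff_AE[OF fi] nn by simp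
      moreover have "?f z \<noteq> 0" if "z \<in> ball z0 r" for z
      proof -
        have "z \<in> cball z0 r" using that by auto
        then show ?thesis using r1(2)[of z] \<beta>pos[OF that] \<delta>0 rB by (auto simp: p_def)
      qed
      ultimately have "AE z in lborel. z \<notin> ball z0 r" by (auto elim!: eventually_mono)
      then have "emeasure lborel (ball z0 r) = 0"
        by (subst (asm) AE_iff_measurable[where N="ball z0 r"]) auto
      then show False using r content_ball_pos[of r z0] by (simp add: measure_def)
    qed
    finally show ?thesis .
  qed
  have "\<forall>\<^sub>F n in sequentially. profile_term R TYPE('n) - I < (LINT z|lborel. indicator ?B z *
      (- \<sigma> * inner (calib_field \<sigma> R (real (Suc n)) z) (rotJ (z::'n horiz)) / 2)) \<and> n \<ge> N"
    using I by (intro eventually_conj eventually_ge_at_top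
        order_tendstoD(1)[OF calib_field_pairing[OF R \<sigma>]]) simp
  \<comment> \<open>The cutoff costs the calibrating field less than the gain
    \<open>I\<close>.\<close>
  then obtain n where n: "profile_term R TYPE('n) - I < (LINT z|lborel. indicator ?B z *
      (- \<sigma> * inner (calib_field \<sigma> R (real (Suc n)) z) (rotJ (z::'n horiz)) / 2))" and nN: "n \<ge> N"
    by (auto simp: eventually_sequentially)
  define M where "M = real (Suc n)"
  have M: "M > 0" by (simp add: M_def)
  obtain Ga where Ga: "C1_field (calib_field \<sigma> R M :: 'n horiz \<Rightarrow> 'n horiz) Ga" "\<And>z. divg Ga z = 0"
    using calib_field_C1[OF R M, of \<sigma>] by auto
  define a where "a z = calib_field \<sigma> R M z + p z" for z
  define Gb where "Gb b z = Ga b z + Gp b z" for b z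
  have a: "C1_field a Gb" using Ga(1) p
    unfolding C1_field_def a_def Gb_def inner_add_left by (auto intro: C1_on_add)
  have db: "divg Gb z = divg Gp z" for z
    using Ga(2)[of z] by (simp add: divg_def Gb_def inner_add_left sum.distrib)
  have "admissible_field R (collar_set R M \<union> cball z0 r) a Gb"
    unfolding admissible_field_def
  proof (intro conjI allI impI ballI)
    show "compact (collar_set R M \<union> cball z0 r)" using collar_set[OF R M] by auto
    show "collar_set R M \<union> cball z0 r \<subseteq> ball 0 R" using collar_set[OF R M] rB by auto
    show "a z = 0" if "z \<notin> collar_set R M \<union> cball z0 r" for z
      using that p0 collar_0[of z R M] by (auto simp: a_def calib_field_def)
    show "norm (z /\<^sub>R R + a z) \<le> 1" if z: "z \<in> ball 0 R" for z
    proof (cases "z \<in> cball z0 r")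
      case False
      then show ?thesis using calib_field_norm[OF R \<sigma> z, of M] p0 by (simp add: a_def)
    next
      case True
      have "z \<in> ?A" using rA True by blast
      then have zz: "z \<in> ?B" "z \<noteq> 0" by auto
      have eq: "z /\<^sub>R R + a z = calib \<sigma> R z + p z"
        using col1[OF nN True] by (simp add: a_def calib_field_def calib_def M_def divide_inverse algebra_simps del: of_nat_Suc)
      have "(norm (calib \<sigma> R z + p z))\<^sup>2 = (norm (calib \<sigma> R z))\<^sup>2 + (\<delta> * \<beta> z) * (2 * inner w (calib \<sigma> R z) + (\<delta> * \<beta> z) * (norm w)\<^sup>2)"
        unfolding p_def power2_norm_eq_inner
        by (simp add: inner_add_left inner_add_right inner_commute algebra_simps)
      also have "\<dots> \<le> 1 + 0"
      proof (intro add_mono mult_nonneg_nonpos)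
        have "(\<delta> * \<beta> z) * (norm w)\<^sup>2 \<le> (\<delta> * pos2 (r\<^sup>2)) * (norm w)\<^sup>2"
          using \<beta>r[of z] \<delta>0 by (intro mult_right_mono mult_left_mono) auto
        also have "\<dots> = 2 * c" using pr w0 r by (simp add: \<delta>_def)
        finally show "2 * inner w (calib \<sigma> R z) + (\<delta> * \<beta> z) * (norm w)\<^sup>2 \<le> 0"
          using r1(1)[OF True] by linarith
      qed (use \<delta>0 \<beta>r calib_norm[OF R \<sigma> zz] in auto)
      finally show ?thesis unfolding eq by (simp add: abs_square_le_1)
    qed
  qed (rule a)
  moreover have "profile_term R TYPE('n) < graph_pairing \<sigma> R u a Gb"
  proof -
    have "integrable lborel (\<lambda>z. indicator ?B z * (- \<sigma> * inner (calib_field \<sigma> R M z) (rotJ z) / 2))"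
      using collar_set[OF R M]
      by (intro integrable_supported[of "collar_set R M"] continuous_intros cJ C1_field_cont[OF Ga(1)])
         (auto simp: calib_field_def collar_0)
    moreover have "graph_pairing \<sigma> R u a Gb = (LINT z|lborel. indicator ?B z * (- \<sigma> * inner (calib_field \<sigma> R M z) (rotJ z) / 2)
       + indicator ?B z * (u z * divg Gp z - \<sigma> * inner (p z) (rotJ z) / 2))"
      unfolding graph_pairing_def db
      by (intro Bochner_Integration.integral_cong refl)
         (auto simp: a_def inner_add_left algebra_simps add_divide_distrib split: split_indicator)
    moreover have "profile_term R TYPE('n) - I < (LINT z|lborel. indicator ?B z * (- \<sigma> * inner (calib_field \<sigma> R M z) (rotJ z) / 2))"
      using n unfolding M_def .
    ultimately show ?thesis using Iint by (simp add: I_def[symmetric])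
  qed
  ultimately show ?thesis by blast
qed

section \<open>The extremal profile\<close>

text \<open>The profile \<open>u_o\<close> dilated by \<open>R\<close>, as a function of the radius;
  see \<open>prof_scale\<close> and \<open>u_o_eq\<close>.\<close>

definition prof :: "real \<Rightarrow> real \<Rightarrow> real" where
  "prof R r = R\<^sup>2 * pi / 8 + r / 4 * sqrt (R\<^sup>2 - r\<^sup>2) - R\<^sup>2 / 4 * arcsin (r / R)"

lemma square_less: "\<bar>r\<bar> < R \<Longrightarrow> r\<^sup>2 < (R::real)\<^sup>2"
  using power_strict_mono[of "\<bar>r\<bar>" R 2] by simp

lemma prof_deriv:
  assumes "\<bar>r\<bar> < R"
  shows "(prof R has_real_derivative - r\<^sup>2 / (2 * sqrt (R\<^sup>2 - r\<^sup>2))) (at r)"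
proof -
  have R: "R > 0" using assms by linarith
  have p: "0 < R\<^sup>2 - r\<^sup>2" using square_less[OF assms] by simp
  define S where "S = sqrt (R\<^sup>2 - r\<^sup>2)"
  have S: "S > 0" "S\<^sup>2 = R\<^sup>2 - r\<^sup>2" using p by (auto simp: S_def)
  have i: "-1 < r / R" "r / R < 1" using assms R by (auto simp: field_simps)
  have q: "sqrt (1 - (r / R)\<^sup>2) = S / R"
  proof -
    have "1 - (r / R)\<^sup>2 = (R\<^sup>2 - r\<^sup>2) / R\<^sup>2" using R by (simp add: field_simps)
    then show ?thesis using R by (simp add: real_sqrt_divide S_def)
  qed
  have 1: "((\<lambda>r. R\<^sup>2 - r\<^sup>2) has_real_derivative - 2 * r) (at r)" by (auto intro!: derivative_eq_intros)
  have 2: "((\<lambda>r. sqrt (R\<^sup>2 - r\<^sup>2)) has_real_derivative inverse S / 2 * (- 2 * r)) (at r)"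
    unfolding S_def by (rule DERIV_chain2[OF DERIV_real_sqrt[OF p] 1])
  have 3: "((\<lambda>r. r / R) has_real_derivative 1 / R) (at r)" using R by (auto intro!: derivative_eq_intros)
  have 4: "((\<lambda>r. arcsin (r / R)) has_real_derivative inverse (sqrt (1 - (r / R)\<^sup>2)) * (1 / R)) (at r)"
    by (rule DERIV_chain2[OF DERIV_arcsin[OF i] 3])
  have d3: "((\<lambda>r. r / 4) has_real_derivative 1 / 4) (at r)" by (auto intro!: derivative_eq_intros)
  have "(prof R has_real_derivative (1 / 4 * S + inverse S / 2 * (- 2 * r) * (r / 4)) - R\<^sup>2 / 4 * (inverse (S / R) * (1 / R))) (at r)"
    unfolding prof_def[abs_def] q[symmetric] S_def[symmetric]
    using DERIV_diff[OF DERIV_add[OF DERIV_const[of "R\<^sup>2 * pi / 8"] DERIV_mult'[OF d3 2]] DERIV_cmult[OF 4, of "R\<^sup>2 / 4"]]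
    by (rule DERIV_cong) (simp add: S_def)
  moreover have "(1 / 4 * S + inverse S / 2 * (- 2 * r) * (r / 4)) - R\<^sup>2 / 4 * (inverse (S / R) * (1 / R)) = - r\<^sup>2 / (2 * S)"
  proof -
    have "R\<^sup>2 / 4 * (inverse (S / R) * (1 / R)) = (S\<^sup>2 + r\<^sup>2) / (4 * S)" using R S by (simp add: field_simps power2_eq_square)
    then show ?thesis using S(1) by (simp add: field_simps power2_eq_square)
  qed
  ultimately show ?thesis by (simp add: S_def)
qed

lemma prof_cont: "R > 0 \<Longrightarrow> continuous_on {-R..R} (prof R)"
  unfolding prof_def[abs_def] by (intro continuous_intros) (auto simp: field_simps)

lemma prof_ends: "R > 0 \<Longrightarrow> prof R R = 0" "R > 0 \<Longrightarrow> prof R 0 = R\<^sup>2 * pi / 8"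
  by (auto simp: prof_def)

lemma prof_strict_antimono:
  assumes "0 \<le> r" "r < s" "s \<le> R"
  shows "prof R s < prof R r"
proof (rule DERIV_neg_imp_decreasing_open[OF assms(2)])
  show "\<exists>y. (prof R has_real_derivative y) (at x) \<and> y < 0" if "r < x" "x < s" for x
  proof (intro exI conjI)
    have x: "\<bar>x\<bar> < R" using that assms by auto
    show "(prof R has_real_derivative - x\<^sup>2 / (2 * sqrt (R\<^sup>2 - x\<^sup>2))) (at x)" by (rule prof_deriv[OF x])
    show "- x\<^sup>2 / (2 * sqrt (R\<^sup>2 - x\<^sup>2)) < 0"
      using square_less[OF x] that assms by (intro divide_neg_pos) auto
  qed
  show "continuous_on {r..s} (prof R)"
    using continuous_on_subset[OF prof_cont[of R], of "{r..s}"] assms by auto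
qed

lemma prof_pos: "0 \<le> r \<Longrightarrow> r < R \<Longrightarrow> 0 < prof R r"
  using prof_strict_antimono[of r R R] prof_ends[of R] by auto

lemma prof_nonneg: "0 < R \<Longrightarrow> 0 \<le> r \<Longrightarrow> r \<le> R \<Longrightarrow> 0 \<le> prof R r"
  using prof_pos[of r R] prof_ends[of R] by (cases "r = R") auto

definition uprof :: "real \<Rightarrow> 'n::finite horiz \<Rightarrow> real" where
  "uprof R z = prof R (norm z)"

definition uprof_grad :: "real \<Rightarrow> 'n::finite horiz \<Rightarrow> 'n horiz" where
  "uprof_grad R z = - (norm z / (2 * sqrt (R\<^sup>2 - (norm z)\<^sup>2))) *\<^sub>R z"

lemma uprof_0: "R > 0 \<Longrightarrow> uprof R (0 :: 'n::finite horiz) = pi * R\<^sup>2 / 8"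
  using prof_ends(2)[of R] by (simp add: uprof_def mult.commute)

lemma radial_deriv_0:
  fixes f :: "real \<Rightarrow> real"
  assumes "(f has_real_derivative 0) (at 0)"
  shows "((\<lambda>z::'a::real_normed_vector. f (norm z)) has_derivative (\<lambda>v. 0)) (at 0)"
proof -
  have "((\<lambda>h. (f h - f 0) / h) \<longlongrightarrow> 0) (at 0)" using assms by (simp add: DERIV_def)
  moreover have "filterlim (norm :: 'a \<Rightarrow> real) (at 0) (at 0)"
    by (rule filterlim_atI) (auto intro!: tendsto_eq_intros simp: eventually_at_filter)
  ultimately have "((\<lambda>z::'a. (f (norm z) - f 0) / norm z) \<longlongrightarrow> 0) (at 0)"
    by (rule filterlim_compose)
  then have "((\<lambda>z::'a. norm ((f (norm z) - f 0) / norm z)) \<longlongrightarrow> 0) (at 0)"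
    by (rule tendsto_norm_zero)
  then show ?thesis by (simp add: has_derivative_at)
qed

lemma uprof_C1: "C1_on (ball 0 R) (uprof R) (uprof_grad R)"
  unfolding C1_on_def
proof safe
  fix z :: "'a horiz" assume z: "z \<in> ball 0 R"
  show "(uprof R has_derivative inner (uprof_grad R z)) (at z)"
  proof (cases "z = 0")
    case True
    have "((\<lambda>z::'a horiz. prof R (norm z)) has_derivative (\<lambda>v. 0)) (at 0)"
      using prof_deriv[of 0 R] z le_less_trans[OF norm_ge_zero[of z], of R] by (intro radial_deriv_0) auto
    moreover have "inner (uprof_grad R z) = (\<lambda>v. 0)" using True by (auto simp: uprof_grad_def)
    ultimately show ?thesis using True by (simp add: uprof_def[abs_def])
  next
    case False
    have 1: "(norm has_derivative (\<lambda>v. inner v (sgn z))) (at z)"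
      by (rule has_derivative_norm[OF False])
    have 2: "(prof R has_derivative (\<lambda>h. h * (- (norm z)\<^sup>2 / (2 * sqrt (R\<^sup>2 - (norm z)\<^sup>2))))) (at (norm z))"
      using prof_deriv[of "norm z" R] z by (auto simp: has_field_derivative_def elim!: has_derivative_eq_rhs)
    have "((\<lambda>z. prof R (norm z)) has_derivative (\<lambda>v. inner v (sgn z) * (- (norm z)\<^sup>2 / (2 * sqrt (R\<^sup>2 - (norm z)\<^sup>2))))) (at z)"
      by (rule has_derivative_compose[OF 1 2])
    moreover have "(\<lambda>v. inner v (sgn z) * (- (norm z)\<^sup>2 / (2 * sqrt (R\<^sup>2 - (norm z)\<^sup>2)))) = inner (uprof_grad R z)"
      using False by (simp add: uprof_grad_def sgn_div_norm inner_commute[of z] power2_eq_square fun_eq_iff)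
    ultimately show ?thesis by (simp add: uprof_def[abs_def])
  qed
next
  show "continuous_on (ball 0 R) (uprof_grad R :: 'a horiz \<Rightarrow> _)"
    unfolding uprof_grad_def[abs_def] by (intro continuous_intros) (use square_less[of "norm _" R] in force)
qed

lemma uprof_cont: "R > 0 \<Longrightarrow> continuous_on (cball 0 R) (uprof R)"
  unfolding uprof_def[abs_def]
proof (rule continuous_on_compose2[OF prof_cont[of R]])
  assume "R > 0"
  show "norm ` cball (0::'a horiz) R \<subseteq> {- R..R}"
  proof clarify
    fix z :: "'a horiz" assume "z \<in> cball 0 R"
    then have "norm z \<le> R" by simp
    moreover have "- R \<le> norm z" using norm_ge_zero[of z] \<open>R > 0\<close> by linarith
    ultimately show "norm z \<in> {- R..R}" by simp
  qed
qed (auto intro: continuous_intros)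

subsection \<open>The classes \<open>C\<^sup>k\<close>\<close>

text \<open>Derivatives at points of an open set depend only on the values in it. This lets the
  \<open>frechet_derivative\<close> in the recursion be replaced by explicit formulas, as
  \<open>Cn_on_SucI\<close> does.\<close>

lemma Cn_on_cong:
  assumes "open U" "\<And>x. x \<in> U \<Longrightarrow> f x = g x"
  shows "Cn_on k f U \<longleftrightarrow> Cn_on k g U"
  using assms(2)
proof (induction k arbitrary: f g)
  case 0
  then show ?case by (auto intro: continuous_on_eq)
next
  case (Suc k)
  have hd: "(f has_derivative D) (at x) \<longleftrightarrow> (g has_derivative D) (at x)" if "x \<in> U" for x D
    using has_derivative_transform_within_open[of f D x UNIV U g]
      has_derivative_transform_within_open[of g D x UNIV U f] assms(1) that Suc.prems by auto
  have "f differentiable_on U \<longleftrightarrow> g differentiable_on U"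
    unfolding differentiable_on_def using hd assms(1)
    by (simp add: at_within_open_NO_MATCH differentiable_def)
  moreover have "frechet_derivative f (at x) = frechet_derivative g (at x)" if "x \<in> U" for x
    unfolding frechet_derivative_def using hd[OF that] by simp
  then have "Cn_on k (\<lambda>x. frechet_derivative f (at x) b) U \<longleftrightarrow> Cn_on k (\<lambda>x. frechet_derivative g (at x) b) U" for b
    by (intro Suc.IH) simp
  ultimately show ?case by simp
qed

lemma Cn_on_SucI:
  assumes U: "open U" and d: "\<And>x. x \<in> U \<Longrightarrow> (f has_derivative f' x) (at x)"
    and f': "\<And>b. b \<in> Basis \<Longrightarrow> Cn_on k (\<lambda>x. f' x b) U"
  shows "Cn_on (Suc k) f U"
proof -
  have "f differentiable_on U"
    unfolding differentiable_on_def using d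
    by (meson differentiable_def has_derivative_at_withinI)
  moreover have "frechet_derivative f (at x) = f' x" if "x \<in> U" for x
    using frechet_derivative_at[OF d[OF that]] by simp
  then have "Cn_on k (\<lambda>x. frechet_derivative f (at x) b) U \<longleftrightarrow> Cn_on k (\<lambda>x. f' x b) U" for b
    by (intro Cn_on_cong[OF U]) simp
  ultimately show ?thesis using f' by simp
qed

lemma Cn_on_Suc_imp: "Cn_on (Suc k) f U \<Longrightarrow> Cn_on k f U"
proof (induction k arbitrary: f)
  case 0
  then show ?case by (auto intro: differentiable_imp_continuous_on)
next
  case (Suc k)
  then have "\<forall>b\<in>Basis. Cn_on k (\<lambda>x. frechet_derivative f (at x) b) U" by (metis Cn_on.simps(2))
  moreover have "f differentiable_on U" using Suc.prems by simp
  ultimately show ?case by simp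
qed

lemma Cn_on_le: "Cn_on k f U \<Longrightarrow> m \<le> k \<Longrightarrow> Cn_on m f U"
  by (induction k) (auto simp: le_Suc_eq dest: Cn_on_Suc_imp simp del: Cn_on.simps)

lemma C_on_numeral_iff: "C_on (numeral k) f U \<longleftrightarrow> Cn_on (numeral k) f U"
  by (auto simp: C_on_def numeral_eq_enat intro: Cn_on_le)

lemma C1_on_if_Cn_on:
  assumes "open U" "Cn_on (Suc k) f U"
  shows "C1_on U f (\<lambda>x. \<Sum>b\<in>Basis. frechet_derivative f (at x) b *\<^sub>R b)"
  unfolding C1_on_def
proof safe
  fix x assume x: "x \<in> U"
  then have "f differentiable (at x)"
    using assms by (simp add: differentiable_on_def at_within_open_NO_MATCH)
  then have D: "(f has_derivative frechet_derivative f (at x)) (at x)"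
    by (simp add: frechet_derivative_works)
  have "frechet_derivative f (at x) v = inner (\<Sum>b\<in>Basis. frechet_derivative f (at x) b *\<^sub>R b) v" for v
  proof -
    interpret bounded_linear "frechet_derivative f (at x)" by (rule has_derivative_bounded_linear[OF D])
    have "frechet_derivative f (at x) v = frechet_derivative f (at x) (\<Sum>b\<in>Basis. inner v b *\<^sub>R b)"
      by (simp add: euclidean_representation)
    also have "\<dots> = (\<Sum>b\<in>Basis. inner v b * frechet_derivative f (at x) b)" by (simp add: sum scaleR)
    finally show ?thesis by (simp add: inner_sum_left inner_commute[of v] mult.commute)
  qed
  then show "(f has_derivative inner (\<Sum>b\<in>Basis. frechet_derivative f (at x) b *\<^sub>R b)) (at x)"
    using D by (metis ext)
next
  have "continuous_on U (\<lambda>x. frechet_derivative f (at x) b)" if "b \<in> Basis" for b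
    using Cn_on_le[of k _ U 0] assms(2) that by auto
  then show "continuous_on U (\<lambda>x. \<Sum>b\<in>Basis. frechet_derivative f (at x) b *\<^sub>R b)"
    by (intro continuous_intros) auto
qed

text \<open>At \<open>z = 0\<close> the quotient by \<open>norm z\<close> is \<open>0\<close>, which is the correct value.\<close>

definition uprof_hess :: "real \<Rightarrow> 'n::finite horiz \<Rightarrow> 'n horiz \<Rightarrow> 'n horiz \<Rightarrow> real" where
  "uprof_hess R z b v = - (R\<^sup>2 / (2 * sqrt (R\<^sup>2 - (norm z)\<^sup>2) * (R\<^sup>2 - (norm z)\<^sup>2)) * (inner z v * inner z b / norm z)
     + norm z / (2 * sqrt (R\<^sup>2 - (norm z)\<^sup>2)) * inner v b)"

lemma uprof_hess:
  assumes z: "z \<in> ball 0 R"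
  shows "((\<lambda>z. inner (uprof_grad R z) b) has_derivative uprof_hess R z b) (at z)"
proof -
  define q where "q r = r / (2 * sqrt (R\<^sup>2 - r\<^sup>2))" for r
  have p: "0 < R\<^sup>2 - (norm z)\<^sup>2" using square_less[of "norm z" R] z by simp
  have eq: "(\<lambda>z. inner (uprof_grad R z) b) = (\<lambda>z. - (q (norm z) * inner z b))"
    by (auto simp: uprof_grad_def q_def)
  show ?thesis
  proof (cases "z = 0")
    case True
    have R: "R > 0" using z by (simp add: le_less_trans[OF norm_ge_zero])
    \<comment> \<open>The gradient is of second order at the centre, so its derivative there is
      zero.\<close>
    have "((\<lambda>z. q (norm z) * inner z b) has_derivative (\<lambda>v. 0)) (at 0)"
      unfolding has_derivative_at
    proof (intro conjI)
      have "isCont (\<lambda>h::'a horiz. q (norm h) * norm b) 0"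
        unfolding q_def using R by (intro continuous_intros) auto
      then have "((\<lambda>h::'a horiz. q (norm h) * norm b) \<longlongrightarrow> q (norm (0::'a horiz)) * norm b) (at 0)"
        by (rule isContD)
      then have l: "((\<lambda>h::'a horiz. q (norm h) * norm b) \<longlongrightarrow> 0) (at 0)" by (simp add: q_def)
      show "(\<lambda>h. norm (q (norm (0 + h)) * inner (0 + h) b - q (norm (0::'a horiz)) * inner 0 b - 0) / norm h) \<midarrow>0\<rightarrow> 0"
      proof (rule Lim_null_comparison[OF _ l], unfold eventually_at, intro exI conjI ballI impI)
        fix h :: "'a horiz" assume h: "h \<noteq> 0 \<and> dist h 0 < R"
        have "0 \<le> q (norm h)" using h square_less[of "norm h" R] by (auto simp: q_def)
        then have "norm (q (norm h) * inner h b) \<le> q (norm h) * (norm h * norm b)"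
          by (simp add: abs_mult mult_left_mono Cauchy_Schwarz_ineq2)
        then show "norm (norm (q (norm (0 + h)) * inner (0 + h) b - q (norm (0::'a horiz)) * inner 0 b - 0) / norm h) \<le> q (norm h) * norm b"
          using h by (simp add: divide_le_eq algebra_simps)
      qed (rule R)
    qed simp
    then have "((\<lambda>z. - (q (norm z) * inner z b)) has_derivative (\<lambda>v. - 0)) (at 0)"
      by (rule has_derivative_minus)
    moreover have "uprof_hess R z b = (\<lambda>v. - 0)" using True by (auto simp: uprof_hess_def)
    ultimately show ?thesis using True eq by simp
  next
    case False
    let ?r = "norm z"
    define S where "S = sqrt (R\<^sup>2 - ?r\<^sup>2)"
    have S: "S > 0" "S * S = R\<^sup>2 - ?r\<^sup>2" using p by (auto simp: S_def)
    have 0: "((\<lambda>r. R\<^sup>2 - r\<^sup>2) has_real_derivative - 2 * ?r) (at ?r)" by (auto intro!: derivative_eq_intros)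
    have 1: "((\<lambda>r. sqrt (R\<^sup>2 - r\<^sup>2)) has_real_derivative inverse S / 2 * (- 2 * ?r)) (at ?r)"
      unfolding S_def by (rule DERIV_chain2[OF DERIV_real_sqrt[OF p] 0])
    have "(q has_real_derivative (1 * (2 * S) - ?r * (2 * (inverse S / 2 * (- 2 * ?r)))) / ((2 * S) * (2 * S))) (at ?r)"
      unfolding q_def[abs_def]
      using DERIV_divide[OF DERIV_ident DERIV_cmult[OF 1, of 2]] S unfolding S_def by auto
    moreover have "(1 * (2 * S) - ?r * (2 * (inverse S / 2 * (- 2 * ?r)))) / ((2 * S) * (2 * S)) = R\<^sup>2 / (2 * S * (S * S))"
    proof -
      have "(1 * (2 * S) - ?r * (2 * (inverse S / 2 * (- 2 * ?r)))) / ((2 * S) * (2 * S)) = (S * S + ?r\<^sup>2) / (2 * S * (S * S))"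
        using S(1) by (simp add: field_simps power2_eq_square)
      then show ?thesis by (simp add: S(2))
    qed
    ultimately have q': "(q has_derivative (\<lambda>h. h * (R\<^sup>2 / (2 * S * (R\<^sup>2 - ?r\<^sup>2))))) (at ?r)"
      unfolding S(2)[symmetric] by (simp only: has_field_derivative_def mult_commute_abs)
    have n: "(norm has_derivative (\<lambda>v. inner v (sgn z))) (at z)" by (rule has_derivative_norm[OF False])
    have "((\<lambda>z. - (q (norm z) * inner z b)) has_derivative
        (\<lambda>v. - (q ?r * inner v b + (inner v (sgn z) * (R\<^sup>2 / (2 * S * (R\<^sup>2 - ?r\<^sup>2)))) * inner z b))) (at z)"
      by (intro has_derivative_minus has_derivative_mult has_derivative_compose[OF n q']
          has_derivative_inner_left has_derivative_ident)
    moreover have "(\<lambda>v. - (q ?r * inner v b + (inner v (sgn z) * (R\<^sup>2 / (2 * S * (R\<^sup>2 - ?r\<^sup>2)))) * inner z b)) = uprof_hess R z b"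
    proof
      fix v
      have "inner v (sgn z) = inner z v / norm z"
        by (simp add: sgn_div_norm inner_commute[of v z] divide_inverse)
      then show "- (q ?r * inner v b + (inner v (sgn z) * (R\<^sup>2 / (2 * S * (R\<^sup>2 - ?r\<^sup>2)))) * inner z b) = uprof_hess R z b v"
        by (simp add: uprof_hess_def q_def S_def[symmetric] mult_ac)
    qed
    ultimately show ?thesis using eq by simp
  qed
qed

text \<open>The delicate factor \<open>inner z v * inner z b / norm z\<close> is homogeneous of
  degree one, hence tends to 0 at the centre; the other factors are continuous in the open
  ball.\<close>

lemma uprof_hess_cont: "continuous_on (ball 0 R) (\<lambda>z. uprof_hess R z b v)"
proof -
  have p: "R\<^sup>2 \<noteq> (norm z)\<^sup>2" if "norm z < R" for z :: "'a horiz"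
    using square_less[of "norm z" R] that by simp
  have c: "continuous_on (ball 0 R) (\<lambda>z::'a horiz. inner z v * inner z b / norm z)"
    unfolding continuous_on_def
  proof
    fix z :: "'a horiz"
    show "((\<lambda>z. inner z v * inner z b / norm z) \<longlongrightarrow> inner z v * inner z b / norm z) (at z within ball 0 R)"
    proof (cases "z = 0")
      case False
      then show ?thesis by (intro tendsto_intros) auto
    next
      case True
      have "((\<lambda>z::'a horiz. norm z * norm v * norm b) \<longlongrightarrow> norm (0::'a horiz) * norm v * norm b) (at 0 within ball 0 R)"
        by (intro tendsto_intros)
      then have l: "((\<lambda>z::'a horiz. norm z * norm v * norm b) \<longlongrightarrow> 0) (at 0 within ball 0 R)" by simp
      have "((\<lambda>z. inner z v * inner z b / norm z) \<longlongrightarrow> 0) (at 0 within ball 0 R)"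
      proof (rule Lim_null_comparison[OF always_eventually l], rule allI)
        fix z :: "'a horiz"
        have "\<bar>inner z v * inner z b\<bar> \<le> (norm z * norm v) * (norm z * norm b)"
          unfolding abs_mult by (intro mult_mono Cauchy_Schwarz_ineq2) auto
        then show "norm (inner z v * inner z b / norm z) \<le> norm z * norm v * norm b"
          by (cases "z = 0") (auto simp: divide_le_eq algebra_simps)
      qed
      then show ?thesis using True by simp
    qed
  qed
  show ?thesis
    unfolding uprof_hess_def by (intro continuous_intros c) (simp_all add: p)
qed

lemma uprof_Cn: "Cn_on 2 (uprof R) (ball 0 R)"
  unfolding numeral_2_eq_2
proof (rule Cn_on_SucI)
  show "(uprof R has_derivative inner (uprof_grad R z)) (at z)" if "z \<in> ball 0 R" for z :: "'a horiz"
    using C1_on_deriv[OF uprof_C1 that] .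
  show "Cn_on (Suc 0) (\<lambda>z. inner (uprof_grad R z) b) (ball 0 R)" for b :: "'a horiz"
    by (rule Cn_on_SucI[OF _ uprof_hess]) (auto intro: uprof_hess_cont)
qed simp

lemma uprof_pos: "z \<in> ball 0 R \<Longrightarrow> 0 < uprof R z"
  by (auto simp: uprof_def intro: prof_pos)

lemma graph_profile_uprof: "R > 0 \<Longrightarrow> graph_profile R (uprof R)"
  unfolding graph_profile_def using uprof_Cn[of R] uprof_cont[of R] prof_nonneg[of R] prof_ends[of R]
  by (auto simp: C_on_numeral_iff uprof_def)

subsection \<open>Rigidity of the equality case\<close>

text \<open>Assumption \<open>al\<close> is the equality case of the Cauchy-Schwarz inequality: the
  horizontal normal of the graph is a nonnegative multiple of \<open>calib\<close>. It is exploited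
  in the single direction \<open>T\<close>, whose integral curves are half circles of diameter
  \<open>R\<close> from the centre to the sphere. They pass through every point of the ball, and at
  their end points \<open>u\<close> and \<open>uprof\<close> are both 0.\<close>

lemma calibrated_eq_uprof:
  fixes u :: "'n::finite horiz \<Rightarrow> real"
  assumes R: "R > 0" and \<sigma>: "\<sigma>\<^sup>2 = 1" and u: "C1_on (ball 0 R) u Du"
    and uc: "continuous_on (cball 0 R) u" and us: "\<And>z. z \<in> sphere 0 R \<Longrightarrow> u z = 0"
    and al: "\<And>z. z \<in> ball 0 R \<Longrightarrow> z \<noteq> 0 \<Longrightarrow>
      norm (Du z + (\<sigma> / 2) *\<^sub>R rotJ z) \<le> inner (- (Du z + (\<sigma> / 2) *\<^sub>R rotJ z)) (calib \<sigma> R z)"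
    and z: "z \<in> cball 0 R"
  shows "u z = uprof R z"
proof -
  define w where "w z = u z - uprof R z" for z
  define Dw where "Dw z = Du z - uprof_grad R z" for z
  have w: "C1_on (ball 0 R) w Dw" unfolding w_def Dw_def by (intro C1_on_diff u uprof_C1)
  have wc: "continuous_on (cball 0 R) w" unfolding w_def by (intro continuous_intros uc uprof_cont R)
  have w0: "w z = 0" if "z \<in> sphere 0 R" for z
    using us[OF that] that prof_ends(1)[OF R] by (simp add: w_def uprof_def)
  \<comment> \<open>Orthogonal to \<open>calib\<close>, hence annihilated by the horizontal normal
    of every calibrated graph; scaled so as to be the velocity of the curve \<open>\<gamma>\<close>
    below.\<close>
  define T where "T z = slope R z *\<^sub>R z + \<sigma> *\<^sub>R rotJ z" for z :: "'n horiz"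
  have DwT: "inner (Dw z) (T z) = 0" if z: "z \<in> ball 0 R" "z \<noteq> 0" for z
  proof -
    define m where "m = - (Du z + (\<sigma> / 2) *\<^sub>R rotJ z)"
    have nm: "norm m \<le> inner m (calib \<sigma> R z)" using al[OF z] unfolding m_def norm_minus_cancel .
    \<comment> \<open>Expanding the square shows that alignment leaves no room between
      \<open>m\<close> and \<open>norm m\<close> times the calibrating vector.\<close>
    have "(norm (norm m *\<^sub>R calib \<sigma> R z - m))\<^sup>2 = 2 * norm m * (norm m - inner m (calib \<sigma> R z))"
    proof -
      have "inner (calib \<sigma> R z) (calib \<sigma> R z) = 1" using calib_norm[OF R \<sigma> z] by (simp add: norm_eq_1)
      then have "inner (norm m *\<^sub>R calib \<sigma> R z - m) (norm m *\<^sub>R calib \<sigma> R z - m)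
         = (norm m)\<^sup>2 + inner m m - 2 * norm m * inner m (calib \<sigma> R z)"
        by (simp add: inner_diff_left inner_diff_right inner_commute[of "calib \<sigma> R z" m]
              power2_eq_square right_diff_distrib)
      then show ?thesis
        unfolding power2_norm_eq_inner[of "norm m *\<^sub>R calib \<sigma> R z - m"] dot_square_norm power2_eq_square
        by algebra
    qed
    also have "\<dots> \<le> 0" using nm by (intro mult_nonneg_nonpos) auto
    finally have meq: "m = norm m *\<^sub>R calib \<sigma> R z" by simp
    have "inner (calib \<sigma> R z) (T z) = 0"
      using \<sigma> by (simp add: calib_def T_def inner_diff_left inner_add_right power2_eq_square algebra_simps)
    then have mT: "inner m (T z) = 0" by (subst meq) simp
    have Du: "Du z = - m - (\<sigma> / 2) *\<^sub>R rotJ z" by (simp add: m_def)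
    \<comment> \<open>The normal contributes nothing, so the derivative along \<open>T\<close> comes
      from \<open>rotJ z\<close> alone. The extremal profile is found to have the same
      value.\<close>
    have "inner (Du z) (T z) = - (\<sigma> / 2) * inner (rotJ z) (T z)"
      unfolding Du inner_diff_left inner_minus_left mT by simp
    also have "\<dots> = - (\<sigma> * \<sigma> / 2) * (norm z)\<^sup>2"
      by (simp add: T_def inner_add_right dot_square_norm)
    also have "\<dots> = - (norm z)\<^sup>2 / 2" using \<sigma> by (simp add: power2_eq_square)
    finally have 1: "inner (Du z) (T z) = - (norm z)\<^sup>2 / 2" .
    have "0 < R\<^sup>2 - (norm z)\<^sup>2" using square_less[of "norm z" R] z by simp
    moreover have "inner (uprof_grad R z) (T z) = - (norm z / (2 * sqrt (R\<^sup>2 - (norm z)\<^sup>2))) * (slope R z * (norm z)\<^sup>2)"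
      by (simp add: uprof_grad_def T_def inner_add_right dot_square_norm)
    moreover have "slope R z * (norm z)\<^sup>2 = norm z * sqrt (R\<^sup>2 - (norm z)\<^sup>2)"
      using z by (intro slope_norm_square) simp
    moreover have "- (r / (2 * S)) * (r * S) = - r\<^sup>2 / 2" if "0 < S" for r S :: real
      using that by (simp add: power2_eq_square)
    ultimately have "inner (uprof_grad R z) (T z) = - (norm z)\<^sup>2 / 2"
      by (metis real_sqrt_gt_0_iff)
    then show ?thesis using 1 by (simp add: Dw_def inner_diff_left)
  qed
  txt \<open>Along this curve, a horizontal geodesic from the centre to the boundary, \<open>w\<close> is constant.\<close>
  define \<gamma> where "\<gamma> e s = (R * sin s) *\<^sub>R (cos s *\<^sub>R e + (\<sigma> * sin s) *\<^sub>R rotJ e)" for e :: "'n horiz" and s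
  have n\<gamma>: "norm (\<gamma> e s) = R * \<bar>sin s\<bar>" if "norm e = 1" for e s
  proof -
    have "(norm (cos s *\<^sub>R e + (\<sigma> * sin s) *\<^sub>R rotJ e))\<^sup>2 = ((cos s)\<^sup>2 + \<sigma>\<^sup>2 * (sin s)\<^sup>2) * (norm e)\<^sup>2"
      unfolding power2_norm_eq_inner by (simp add: inner_add_left inner_add_right power2_eq_square algebra_simps)
    then have "norm (cos s *\<^sub>R e + (\<sigma> * sin s) *\<^sub>R rotJ e) = 1"
      using \<sigma> that power2_eq_imp_eq[of "norm (cos s *\<^sub>R e + (\<sigma> * sin s) *\<^sub>R rotJ e)" 1] by simp
    then show ?thesis using R by (simp add: \<gamma>_def abs_mult)
  qed
  have const: "w (\<gamma> e s1) = 0" if e: "norm e = 1" and s1: "0 \<le> s1" "s1 < pi / 2" for e s1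
  proof -
    have "w (\<gamma> e (pi / 2)) = w (\<gamma> e s1)"
    proof (rule DERIV_isconst_end[OF s1(2)])
      have "continuous_on {s1..pi / 2} (\<gamma> e)" unfolding \<gamma>_def by (intro continuous_intros)
      then show "continuous_on {s1..pi / 2} (\<lambda>s. w (\<gamma> e s))"
        using n\<gamma>[OF e] R by (intro continuous_on_compose2[OF wc]) (auto simp: mult_le_cancel_left1)
      show "((\<lambda>s. w (\<gamma> e s)) has_real_derivative 0) (at s)" if s: "s1 < s" "s < pi / 2" for s
      proof -
        have sp: "0 < sin s" "0 < cos s" using s s1 by (auto intro: sin_gt_zero cos_gt_zero)
        have "sin s < sin (pi / 2)" using s s1 by (intro sin_monotone_2pi) auto
        then have b: "\<gamma> e s \<in> ball 0 R" "\<gamma> e s \<noteq> 0" using n\<gamma>[OF e, of s] R sp by auto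
        have "slope R (\<gamma> e s) = cos s / sin s"
        proof -
          have "R\<^sup>2 / (norm (\<gamma> e s))\<^sup>2 - 1 = (cos s / sin s)\<^sup>2"
            unfolding n\<gamma>[OF e] power_divide cos_squared_eq using R sp
            by (simp add: power_mult_distrib diff_divide_distrib)
          then show ?thesis using sp by (simp add: slope_def)
        qed
        then have T: "T (\<gamma> e s) = (R * sin s) *\<^sub>R ((- sin s) *\<^sub>R e + (\<sigma> * cos s) *\<^sub>R rotJ e)
             + (R * cos s) *\<^sub>R (cos s *\<^sub>R e + (\<sigma> * sin s) *\<^sub>R rotJ e)"
        proof -
          assume sl: "slope R (\<gamma> e s) = cos s / sin s"
          have 1: "(cos s / sin s) *\<^sub>R \<gamma> e s = (R * cos s) *\<^sub>R (cos s *\<^sub>R e + (\<sigma> * sin s) *\<^sub>R rotJ e)"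
            unfolding \<gamma>_def using sp by simp
          have "\<sigma> *\<^sub>R rotJ (\<gamma> e s) = (R * sin s) *\<^sub>R ((\<sigma> * cos s) *\<^sub>R rotJ e - (\<sigma> * \<sigma> * sin s) *\<^sub>R e)"
            unfolding \<gamma>_def by (simp add: scaleR_add_right scaleR_diff_right mult_ac)
          also have "\<sigma> * \<sigma> * sin s = sin s" using \<sigma> by (simp add: power2_eq_square)
          finally show ?thesis unfolding T_def sl 1 by (simp add: add.commute)
        qed
        have "(\<gamma> e has_vector_derivative T (\<gamma> e s)) (at s)"
        proof -
          have 1: "((\<lambda>s. R * sin s) has_real_derivative R * cos s) (at s)"
            by (auto intro!: derivative_eq_intros)
          have 2: "((\<lambda>s. \<sigma> * sin s) has_real_derivative \<sigma> * cos s) (at s)"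
            by (auto intro!: derivative_eq_intros)
          have "((\<lambda>s. cos s *\<^sub>R e + (\<sigma> * sin s) *\<^sub>R rotJ e) has_vector_derivative
             ((cos s *\<^sub>R 0 + (- sin s) *\<^sub>R e) + ((\<sigma> * sin s) *\<^sub>R 0 + (\<sigma> * cos s) *\<^sub>R rotJ e))) (at s)"
            by (intro has_vector_derivative_add has_vector_derivative_scaleR DERIV_cos 2 has_vector_derivative_const)
          from has_vector_derivative_scaleR[OF 1 this] show ?thesis
            unfolding T unfolding \<gamma>_def by simp
        qed
        then have g: "(\<gamma> e has_derivative (\<lambda>h. h *\<^sub>R T (\<gamma> e s))) (at s)"
          by (simp add: has_vector_derivative_def)
        have "((\<lambda>s. w (\<gamma> e s)) has_derivative (\<lambda>h. inner (Dw (\<gamma> e s)) (h *\<^sub>R T (\<gamma> e s)))) (at s)"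
          by (rule has_derivative_compose[OF g C1_on_deriv[OF w b(1)]])
        then show ?thesis using DwT[OF b] by (simp add: has_field_derivative_def mult_zero_left[abs_def])
      qed
    qed
    moreover have "w (\<gamma> e (pi / 2)) = 0" using n\<gamma>[OF e, of "pi / 2"] R by (intro w0) simp
    ultimately show ?thesis by simp
  qed
  have "w z = 0"
  proof (cases "norm z = R")
    case True
    then show ?thesis by (intro w0) simp
  next
    case False
    then have zR: "norm z < R" using z by simp
    show ?thesis
    proof (cases "z = 0")
      case True
      obtain e :: "'n horiz" where "norm e = 1" by (rule vector_choose_size[of 1]) simp_all
      \<comment> \<open>Every curve starts at the centre, so any unit vector will do.\<close>
      then show ?thesis using const[of e 0] True by (simp add: \<gamma>_def)
    next
      case z0: False
      \<comment> \<open>Solves \<open>\<gamma> e s = z\<close>: the radius determines the parameter,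
        and turning \<open>z / norm z\<close> back by the angle \<open>s\<close> gives the initial
        direction \<open>e\<close>.\<close>
      define s where "s = arcsin (norm z / R)"
      have b: "0 \<le> norm z / R" "norm z / R < 1" using zR R by auto
      have s: "sin s = norm z / R" "0 \<le> s" "s < pi / 2"
        using b arcsin_less_mono[of "norm z / R" 1] unfolding s_def by (auto intro!: arcsin_nonneg sin_arcsin)
      define e where "e = (1 / norm z) *\<^sub>R (cos s *\<^sub>R z - (\<sigma> * sin s) *\<^sub>R rotJ z)"
      have "(norm (cos s *\<^sub>R z - (\<sigma> * sin s) *\<^sub>R rotJ z))\<^sup>2 = ((cos s)\<^sup>2 + \<sigma>\<^sup>2 * (sin s)\<^sup>2) * (norm z)\<^sup>2"
        unfolding power2_norm_eq_inner by (simp add: inner_diff_left inner_diff_right power2_eq_square algebra_simps)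
      then have "(norm (cos s *\<^sub>R z - (\<sigma> * sin s) *\<^sub>R rotJ z))\<^sup>2 = (norm z)\<^sup>2"
        using \<sigma> by simp
      then have "norm (cos s *\<^sub>R z - (\<sigma> * sin s) *\<^sub>R rotJ z) = norm z"
        by (rule power2_eq_imp_eq) simp_all
      then have ne: "norm e = 1" using z0 by (simp add: e_def)
      have "\<gamma> e s = ((cos s)\<^sup>2 + \<sigma>\<^sup>2 * (sin s)\<^sup>2) *\<^sub>R z"
        using R z0 s(1) unfolding \<gamma>_def e_def by (simp add: power2_eq_square algebra_simps)
      then have "\<gamma> e s = z" using \<sigma> by simp
      then show ?thesis using const[OF ne s(2,3)] by simp
    qed
  qed
  then show ?thesis by (simp add: w_def)
qed

section \<open>An upper bound for the perimeter of the extremal set\<close>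

text \<open>The components of a test field are differentiable only along the frame, so the Euclidean
  divergence theorem does not apply to \<open>f * \<zeta>\<close>. The flow of \<open>hX i\<close>
  needs nothing beyond that one directional derivative.\<close>

lemma heis_ibp:
  fixes f \<zeta> :: "'n::finite heis \<Rightarrow> real"
  assumes f: "C1_on UNIV f G" and K: "compact K" "\<And>g. g \<notin> K \<Longrightarrow> f g = 0"
    and \<zeta>: "continuous_on UNIV \<zeta>" "\<And>g. X_differentiable i \<zeta> g" "continuous_on UNIV (Xd i \<zeta>)"
  shows "integrable lborel (\<lambda>g. f g * Xd i \<zeta> g)" "integrable lborel (\<lambda>g. \<zeta> g * inner (G g) (hX i g))"
    "(LINT g|lborel. f g * Xd i \<zeta> g) = - (LINT g|lborel. \<zeta> g * inner (G g) (hX i g))"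
proof -
  have G0: "G g = 0" if "g \<notin> K" for g using C1_grad_zero[OF f compact_imp_closed[OF K(1)] K(2) that] .
  note fc = C1_on_cont[OF f] and Gc = C1_on_cont_grad[OF f]
  show i1: "integrable lborel (\<lambda>g. f g * Xd i \<zeta> g)"
    by (rule lborel_integral_compact_support[OF _ K(1)]) (auto simp: K(2) intro!: continuous_intros fc \<zeta>)
  show i2: "integrable lborel (\<lambda>g. \<zeta> g * inner (G g) (hX i g))"
    by (rule lborel_integral_compact_support[OF _ K(1)])
       (auto simp: G0 intro!: continuous_intros Gc continuous_hX \<zeta>)
  have d: "((\<lambda>s. f (g + s *\<^sub>R hX i g) * \<zeta> (g + s *\<^sub>R hX i g)) has_real_derivative
     f g * Xd i \<zeta> g + \<zeta> g * inner (G g) (hX i g)) (at 0)" for g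
  proof -
    have "((\<lambda>s. \<zeta> (g + s *\<^sub>R hX i g)) has_real_derivative Xd i \<zeta> g) (at 0)"
      using \<zeta>(2)[of g] unfolding X_differentiable_def Xd_def
      by (simp add: DERIV_deriv_iff_field_differentiable)
    from DERIV_mult'[OF C1_on_Xd[OF f UNIV_I, of g i] this] show ?thesis by (simp add: mult.commute)
  qed
  have "integral\<^sup>L lborel (\<lambda>g. f g * Xd i \<zeta> g + \<zeta> g * inner (G g) (hX i g)) = 0"
    by (rule flow_integral_zero(2)[where X="hX i" and w="\<lambda>g. f g * \<zeta> g" and K=K, OF hX_flow hX_preserves continuous_hX _ K(1) _ d])
       (auto simp: K(2) intro!: continuous_intros fc Gc continuous_hX \<zeta>)
  then show "(LINT g|lborel. f g * Xd i \<zeta> g) = - (LINT g|lborel. \<zeta> g * inner (G g) (hX i g))"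
    using i1 i2 by simp
qed

definition smoothstep' :: "real \<Rightarrow> real" where
  "smoothstep' x = 4 * max 0 (1 - pos2 x) * max 0 x"

lemma smoothstep'_nonneg: "0 \<le> smoothstep' x"
  by (simp add: smoothstep'_def)

lemma smoothstep'_0: "x \<le> 0 \<or> 1 \<le> x \<Longrightarrow> smoothstep' x = 0"
  using pos2_mono[of 1 x] by (auto simp: smoothstep'_def)

lemma smoothstep'_cont: "continuous_on A smoothstep'"
  unfolding smoothstep'_def[abs_def] by (rule smoothstep_deriv_cont)

text \<open>The integrand is, up to orientation, the derivative of a step from 0 to 1. Its mass is
  therefore at most 1 for every layer width \<open>\<epsilon>\<close>.\<close>

lemma nn_integral_smoothstep':
  assumes \<epsilon>: "\<epsilon> > 0" and \<sigma>: "\<sigma> = 1 \<or> \<sigma> = -1"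
  shows "(\<integral>\<^sup>+ t. ennreal (smoothstep' ((u + \<sigma> * t) / \<epsilon> - 1) / \<epsilon>) \<partial>lborel) \<le> 1"
proof -
  \<comment> \<open>For \<open>\<bar>t\<bar> > L\<close> the argument of \<open>smoothstep'\<close>
    lies outside the interval from 0 to 1, so the integrand vanishes.\<close>
  define L where "L = \<bar>u\<bar> + 2 * \<epsilon>"
  define F where "F t = \<sigma> * smoothstep ((u + \<sigma> * t) / \<epsilon> - 1)" for t
  have F: "(F has_real_derivative smoothstep' ((u + \<sigma> * t) / \<epsilon> - 1) / \<epsilon>) (at t)" for t
  proof -
    have "((\<lambda>t. (u + \<sigma> * t) / \<epsilon> - 1) has_real_derivative \<sigma> / \<epsilon>) (at t)"
      using \<epsilon> by (auto intro!: derivative_eq_intros)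
    from DERIV_cmult[OF DERIV_chain2[OF smoothstep_deriv[of "(u + \<sigma> * t) / \<epsilon> - 1", folded smoothstep'_def] this], of \<sigma>]
    show ?thesis using \<sigma> unfolding F_def[abs_def] by (elim DERIV_cong) auto
  qed
  have "((\<lambda>t. smoothstep' ((u + \<sigma> * t) / \<epsilon> - 1) / \<epsilon>) has_integral (F L - F (- L))) {- L..L}"
    using F \<epsilon> by (intro fundamental_theorem_of_calculus)
      (auto simp: L_def has_real_derivative_iff_has_vector_derivative[symmetric] intro: has_field_derivative_at_within)
  then have "(\<integral>\<^sup>+ t. ennreal (smoothstep' ((u + \<sigma> * t) / \<epsilon> - 1) / \<epsilon>) * indicator {- L..L} t \<partial>lborel) = ennreal (F L - F (- L))"
    using \<epsilon> smoothstep'_nonneg by (intro nn_integral_has_integral_lebesgue') auto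
  moreover have "(\<integral>\<^sup>+ t. ennreal (smoothstep' ((u + \<sigma> * t) / \<epsilon> - 1) / \<epsilon>) \<partial>lborel)
    = (\<integral>\<^sup>+ t. ennreal (smoothstep' ((u + \<sigma> * t) / \<epsilon> - 1) / \<epsilon>) * indicator {- L..L} t \<partial>lborel)"
  proof (rule nn_integral_cong)
    fix t
    show "ennreal (smoothstep' ((u + \<sigma> * t) / \<epsilon> - 1) / \<epsilon>) = ennreal (smoothstep' ((u + \<sigma> * t) / \<epsilon> - 1) / \<epsilon>) * indicator {- L..L} t"
    proof (cases "t \<in> {- L..L}")
      case False
      have "(u + \<sigma> * t) / \<epsilon> - 1 \<le> 0 \<or> 1 \<le> (u + \<sigma> * t) / \<epsilon> - 1"
        using False \<sigma> \<epsilon> by (auto simp: L_def field_simps abs_if split: if_splits)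
      from smoothstep'_0[OF this] show ?thesis by simp
    qed simp
  qed
  moreover have "F L - F (- L) \<le> 1"
    using \<sigma> smoothstep_bounds by (auto simp: F_def algebra_simps add_increasing2 intro: add_mono order_trans)
  ultimately show ?thesis by (simp add: ennreal_le_1)
qed

text \<open>The gradient of the profile is radial and hence orthogonal to \<open>rotJ z\<close>; the
  two squared lengths combine over the denominator
  \<open>R\<^sup>2 - (norm z)\<^sup>2\<close>.\<close>

lemma uprof_grad_rotJ:
  assumes z: "z \<in> ball 0 R" and \<sigma>: "\<sigma>\<^sup>2 = 1"
  shows "norm (uprof_grad R z + (\<sigma> / 2) *\<^sub>R rotJ z) = R * norm z / (2 * sqrt (R\<^sup>2 - (norm z)\<^sup>2))"
proof -
  have R: "R > 0" using z le_less_trans[OF norm_ge_zero[of z], of R] by simp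
  define S where "S = sqrt (R\<^sup>2 - (norm z)\<^sup>2)"
  have S: "S > 0" "S * S = R\<^sup>2 - (norm z)\<^sup>2" using square_less[of "norm z" R] z by (auto simp: S_def)
  define a where "a = - (norm z / (2 * S))"
  have ug: "uprof_grad R z = a *\<^sub>R z" by (simp add: uprof_grad_def a_def S_def)
  have "(norm (uprof_grad R z + (\<sigma> / 2) *\<^sub>R rotJ z))\<^sup>2 = (a\<^sup>2 + \<sigma>\<^sup>2 / 4) * (norm z)\<^sup>2"
    unfolding power2_norm_eq_inner ug
    by (simp add: inner_add_left inner_add_right power2_eq_square distrib_right)
  also have "a\<^sup>2 + \<sigma>\<^sup>2 / 4 = ((norm z)\<^sup>2 + S * S) / (2 * S)\<^sup>2"
    using S(1) \<sigma> by (simp add: a_def power_divide power2_eq_square field_simps)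
  also have "\<dots> = R\<^sup>2 / (2 * S)\<^sup>2" unfolding S(2) by simp
  also have "R\<^sup>2 / (2 * S)\<^sup>2 * (norm z)\<^sup>2 = (R * norm z / (2 * S))\<^sup>2"
    by (simp add: power_divide power_mult_distrib)
  finally have "(norm (uprof_grad R z + (\<sigma> / 2) *\<^sub>R rotJ z))\<^sup>2 = (R * norm z / (2 * S))\<^sup>2" .
  moreover have "0 \<le> R * norm z / (2 * S)" using R S(1) by simp
  ultimately show ?thesis unfolding S_def[symmetric] by (rule power2_eq_imp_eq[OF _ norm_ge_zero])
qed

definition extremal :: "real \<Rightarrow> 'n::finite heis set" where
  "extremal R = between_graphs R (uprof R) (uprof R)"

lemma open_extremal: "open (extremal R)"
  unfolding extremal_def by (intro open_between_graphs C1_on_cont[OF uprof_C1])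

text \<open>The indicator of the extremal set is approximated by \<open>f \<epsilon>\<close>, which
  falls from 1 to 0 in a layer of width \<open>\<epsilon>\<close> just inside each graph.
  Integration by parts moves the derivative to \<open>f \<epsilon>\<close>. There each graph
  contributes its horizontal normal, whose length \<open>mm\<close> depends on \<open>z\<close>
  only, times a density of mass at most 1 on every vertical line. The two graphs together give
  \<open>2 * mm\<close>, the integrand of the hypothesis.\<close>

lemma test_field_integral_le:
  fixes \<zeta> :: "'n + 'n \<Rightarrow> 'n::finite heis \<Rightarrow> real"
  assumes R: "R > 0" and \<zeta>: "\<zeta> \<in> horizontal_test_fields UNIV"
    and P: "(\<integral>\<^sup>+ z. ennreal (R * norm z / sqrt (R\<^sup>2 - (norm z)\<^sup>2)) * indicator (ball (0::'n horiz) R) z \<partial>lborel) \<le> ennreal P"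
    and P0: "P \<ge> 0"
  shows "set_lebesgue_integral lborel (extremal R) (\<lambda>g. \<Sum>i\<in>UNIV. Xd i (\<zeta> i) g) \<le> P"
proof -
  let ?B = "ball (0::'n horiz) R"
  define D where "D g = (\<Sum>i\<in>UNIV. Xd i (\<zeta> i) g)" for g
  have \<zeta>c: "continuous_on UNIV (\<zeta> i)" and \<zeta>d: "X_differentiable j (\<zeta> i) g" and \<zeta>dc: "continuous_on UNIV (Xd j (\<zeta> i))"
    and \<zeta>n: "sqrt (\<Sum>i\<in>UNIV. (\<zeta> i g)\<^sup>2) \<le> 1" and \<zeta>s: "compactly_supported_in UNIV (Xd j (\<zeta> i))" for i j g
    using \<zeta> unfolding horizontal_test_fields_def by blast+
  have Dc: "continuous_on UNIV D" unfolding D_def by (intro continuous_intros \<zeta>dc)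
  have Dint: "integrable lborel D"
  proof -
    have "integrable lborel (Xd i (\<zeta> i))" for i
    proof (rule lborel_integral_compact_support[OF \<zeta>dc])
      show "compact (closure {g. Xd i (\<zeta> i) g \<noteq> 0})"
        using \<zeta>s[of i i] unfolding compactly_supported_in_def by blast
      show "Xd i (\<zeta> i) g = 0" if "g \<notin> closure {g. Xd i (\<zeta> i) g \<noteq> 0}" for g
        using that closure_subset[of "{g. Xd i (\<zeta> i) g \<noteq> 0}"] by blast
    qed
    then show ?thesis unfolding D_def by (intro Bochner_Integration.integrable_sum) auto
  qed
  define M where "M = prof R 0"
  have uM: "uprof R z \<le> M" if "z \<in> cball 0 R" for z :: "'n horiz"
    using prof_strict_antimono[of 0 "norm z" R] that by (cases "z = 0") (auto simp: uprof_def M_def)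
  define mm where "mm z = R * norm z / (2 * sqrt (R\<^sup>2 - (norm z)\<^sup>2))" for z :: "'n horiz"
  have mm0: "0 \<le> mm z" if "z \<in> ?B" for z
    using R that square_less[of "norm z" R] by (auto simp: mm_def)
  define S where "S \<epsilon> x = smoothstep ((1 / \<epsilon>) * x - 1)" for \<epsilon> x :: real
  define f where "f \<epsilon> g = indicator ?B (fst g) * (S \<epsilon> (uprof R (fst g) - snd g) * S \<epsilon> (uprof R (fst g) + snd g))"
    for \<epsilon> and g :: "'n heis"
  have S01: "0 \<le> S \<epsilon> x" "S \<epsilon> x \<le> 1" for \<epsilon> x by (auto simp: S_def smoothstep_bounds)
  have S0: "S \<epsilon> x = 0" if "x \<le> \<epsilon>" "\<epsilon> > 0" for \<epsilon> x
    using that by (auto simp: S_def field_simps intro!: smoothstep_0)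
  have S1: "S \<epsilon> x = 1" if "2 * \<epsilon> \<le> x" "\<epsilon> > 0" for \<epsilon> x
    using that by (auto simp: S_def field_simps intro!: smoothstep_1)
  have fle: "(LINT g|lborel. f \<epsilon> g * D g) \<le> P \<and> continuous_on UNIV (f \<epsilon>)" if \<epsilon>: "\<epsilon> > 0" for \<epsilon>
  proof -
    let ?A = "?B \<times> (UNIV :: real set)"
    define p where "p g = uprof R (fst g) - snd g" for g :: "'n heis"
    define q where "q g = uprof R (fst g) + snd g" for g :: "'n heis"
    define Gu where "Gu g = (uprof_grad R (fst g), 0::real)" for g :: "'n heis"
    define s where "s x = smoothstep' ((1 / \<epsilon>) * x - 1)" for x
    have u: "C1_on ?A (\<lambda>g. uprof R (fst g)) Gu"
      unfolding Gu_def by (rule C1_on_fst[OF uprof_C1])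
    have Sp: "C1_on ?A (\<lambda>g. S \<epsilon> (p g)) (\<lambda>g. s (p g) *\<^sub>R ((1 / \<epsilon>) *\<^sub>R (Gu g - (0, 1)) - 0))"
      unfolding S_def s_def p_def
      by (rule C1_on_compose[where h=smoothstep and h'=smoothstep'])
         (intro C1_on_diff C1_on_cmult C1_on_const u C1_on_snd smoothstep'_cont
            smoothstep_deriv[folded smoothstep'_def])+
    have Sq: "C1_on ?A (\<lambda>g. S \<epsilon> (q g)) (\<lambda>g. s (q g) *\<^sub>R ((1 / \<epsilon>) *\<^sub>R (Gu g + (0, 1)) - 0))"
      unfolding S_def s_def q_def
      by (rule C1_on_compose[where h=smoothstep and h'=smoothstep'])
         (intro C1_on_diff C1_on_add C1_on_cmult C1_on_const u C1_on_snd smoothstep'_cont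
            smoothstep_deriv[folded smoothstep'_def])+
    define G where "G g = S \<epsilon> (p g) *\<^sub>R (s (q g) *\<^sub>R ((1 / \<epsilon>) *\<^sub>R (Gu g + (0, 1)) - 0))
       + S \<epsilon> (q g) *\<^sub>R (s (p g) *\<^sub>R ((1 / \<epsilon>) *\<^sub>R (Gu g - (0, 1)) - 0))" for g
    have oA: "open ?A" by (intro open_Times) auto
    have fA: "C1_on ?A (f \<epsilon>) G"
    proof -
      have 1: "C1_on ?A (\<lambda>g. S \<epsilon> (p g) * S \<epsilon> (q g)) G"
        unfolding G_def by (rule C1_on_mult[OF Sp Sq])
      have "(f \<epsilon> has_derivative inner (G g)) (at g)" if "g \<in> ?A" for g
        by (rule has_derivative_transform_within_open[OF C1_on_deriv[OF 1 that] oA that])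
           (auto simp: f_def p_def q_def)
      then show ?thesis using C1_on_cont_grad[OF 1] by (simp add: C1_on_def)
    qed
    \<comment> \<open>The cutoffs vanish up to vertical distance \<open>\<epsilon>\<close> from
      either graph. This keeps the support away from the sphere, where \<open>uprof_grad\<close> is
      singular.\<close>
    define K where "K = {g \<in> cball (0::'n horiz) R \<times> UNIV. \<bar>snd g\<bar> + \<epsilon> \<le> uprof R (fst g)}"
    have Kc: "closed K" unfolding K_def
    proof (rule continuous_on_closed_Collect_le)
      show "continuous_on (cball (0::'n horiz) R \<times> UNIV) (\<lambda>g. uprof R (fst g))"
        by (intro continuous_on_compose2[OF uprof_cont[OF R]] continuous_intros) auto
    qed (auto intro!: continuous_intros closed_Times)
    have "K \<subseteq> cball 0 R \<times> {- M..M}"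
    proof
      fix g assume g: "g \<in> K"
      then have "uprof R (fst g) \<le> M" by (intro uM) (auto simp: K_def mem_Times_iff)
      then show "g \<in> cball 0 R \<times> {- M..M}" using g \<epsilon> by (auto simp: K_def mem_Times_iff)
    qed
    then have "bounded K" by (rule bounded_subset[rotated]) (auto intro: bounded_Times)
    then have K: "compact K" using Kc by (simp add: compact_eq_bounded_closed)
    have KA: "K \<subseteq> ?A"
    proof
      fix g assume g: "g \<in> K"
      then have "norm (fst g) \<le> R" "0 < uprof R (fst g)" using \<epsilon> by (auto simp: K_def mem_Times_iff)
      moreover have "norm (fst g) \<noteq> R" using \<open>0 < uprof R (fst g)\<close> prof_ends(1)[OF R] by (auto simp: uprof_def)
      ultimately show "g \<in> ?A" by (auto simp: mem_Times_iff)
    qed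
    have f0: "f \<epsilon> g = 0" if "g \<notin> K" for g
    proof (cases "fst g \<in> ?B")
      case True
      then have "uprof R (fst g) < \<bar>snd g\<bar> + \<epsilon>" using that by (auto simp: K_def mem_Times_iff)
      then have "uprof R (fst g) - snd g \<le> \<epsilon> \<or> uprof R (fst g) + snd g \<le> \<epsilon>" by linarith
      then show ?thesis using S0[OF _ \<epsilon>] by (auto simp: f_def)
    qed (simp add: f_def)
    define G' where "G' g = (if g \<in> K then G g else 0)" for g
    have fU: "C1_on UNIV (f \<epsilon>) G'"
      unfolding G'_def by (rule C1_on_extend[OF fA oA Kc KA f0])
    note ibp = heis_ibp[OF fU K f0 \<zeta>c \<zeta>d \<zeta>dc]
    define h where "h g = (\<Sum>i\<in>UNIV. \<zeta> i g * inner (G' g) (hX i g))" for g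
    have hint: "integrable lborel h" unfolding h_def by (intro Bochner_Integration.integrable_sum ibp)
    have eq: "(LINT g|lborel. f \<epsilon> g * D g) = - (LINT g|lborel. h g)"
      unfolding D_def h_def sum_distrib_left
      by (simp add: Bochner_Integration.integral_sum ibp sum_negf)
    \<comment> \<open>Cauchy-Schwarz against a test field of norm at most 1. Bounding the
      undifferentiated cutoff by 1 leaves one layer density per graph.\<close>
    have hbd: "ennreal (norm (h g)) \<le> ennreal (mm (fst g)) * indicator ?B (fst g)
        * (ennreal (smoothstep' ((uprof R (fst g) + (-1) * snd g) / \<epsilon> - 1) / \<epsilon>)
         + ennreal (smoothstep' ((uprof R (fst g) + 1 * snd g) / \<epsilon> - 1) / \<epsilon>))" for g
    proof (cases "g \<in> K")
      case False
      then show ?thesis by (simp add: h_def G'_def)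
    next
      case True
      then have z: "fst g \<in> ?B" using KA by auto
      define y where "y = (S \<epsilon> (p g) * s (q g) / \<epsilon>) *\<^sub>R (uprof_grad R (fst g) + (-1 / 2) *\<^sub>R rotJ (fst g))
        + (S \<epsilon> (q g) * s (p g) / \<epsilon>) *\<^sub>R (uprof_grad R (fst g) + (1 / 2) *\<^sub>R rotJ (fst g))"
      have yi: "inner (G' g) (hX i g) = inner y (bvec i)" for i
        using True by (simp add: G'_def G_def Gu_def hX_eq y_def inner_add_left inner_diff_left algebra_simps
            add_divide_distrib diff_divide_distrib)
      have s0: "0 \<le> s x" for x by (simp add: s_def smoothstep'_nonneg)
      have "norm y \<le> (S \<epsilon> (p g) * s (q g) / \<epsilon>) * mm (fst g) + (S \<epsilon> (q g) * s (p g) / \<epsilon>) * mm (fst g)"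
        unfolding y_def mm_def
        using norm_triangle_ineq uprof_grad_rotJ[OF z, of "-1"] uprof_grad_rotJ[OF z, of 1] S01 s0 \<epsilon>
        by (intro order_trans[OF norm_triangle_ineq]) (simp add: abs_mult)
      also have "\<dots> \<le> (1 * s (q g) / \<epsilon>) * mm (fst g) + (1 * s (p g) / \<epsilon>) * mm (fst g)"
        using S01 s0 \<epsilon> mm0[OF z] by (intro add_mono mult_right_mono divide_right_mono) auto
      finally have ny: "norm y \<le> mm (fst g) * (s (p g) / \<epsilon> + s (q g) / \<epsilon>)" by (simp add: algebra_simps)
      have "\<bar>h g\<bar> \<le> sqrt (\<Sum>i\<in>UNIV. (\<zeta> i g)\<^sup>2) * sqrt (\<Sum>i\<in>UNIV. (inner y (bvec i))\<^sup>2)"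
      proof -
        have "\<bar>h g\<bar> \<le> (\<Sum>i\<in>UNIV. \<bar>\<zeta> i g\<bar> * \<bar>inner y (bvec i)\<bar>)"
          unfolding h_def yi abs_mult[symmetric] by (rule sum_abs)
        also have "\<dots> \<le> L2_set (\<lambda>i. \<zeta> i g) UNIV * L2_set (\<lambda>i. inner y (bvec i)) UNIV"
          by (rule L2_set_mult_ineq)
        finally show ?thesis by (simp add: L2_set_def)
      qed
      also have "\<dots> = sqrt (\<Sum>i\<in>UNIV. (\<zeta> i g)\<^sup>2) * norm y" by (simp add: sum_bvec_square)
      also have "\<dots> \<le> 1 * norm y" by (intro mult_right_mono \<zeta>n) auto
      finally have "\<bar>h g\<bar> \<le> mm (fst g) * (s (p g) / \<epsilon> + s (q g) / \<epsilon>)" using ny by simp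
      then have "ennreal (norm (h g)) \<le> ennreal (mm (fst g) * (s (p g) / \<epsilon> + s (q g) / \<epsilon>))"
        by (intro ennreal_leI) simp
      also have "\<dots> = ennreal (mm (fst g)) * (ennreal (s (p g) / \<epsilon>) + ennreal (s (q g) / \<epsilon>))"
        using mm0[OF z] s0 \<epsilon> by (simp add: ennreal_mult' ennreal_plus)
      finally show ?thesis using z by (simp add: s_def p_def q_def)
    qed
    have [measurable]: "mm \<in> borel_measurable borel" unfolding mm_def by measurable
    have [measurable]: "smoothstep' \<in> borel_measurable borel"
      by (rule borel_measurable_continuous_onI[OF smoothstep'_cont])
    have [measurable]: "?B \<in> sets borel" by simp
    \<comment> \<open>Outside the closed ball \<open>uprof\<close> involves \<open>arcsin\<close>
      beyond 1; setting it to 0 there gives a measurable function without changing the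
      bound.\<close>
    define U where "U z = indicator (cball 0 R) z *\<^sub>R uprof R z" for z :: "'n horiz"
    have [measurable]: "U \<in> borel_measurable borel"
      unfolding U_def by (rule borel_measurable_continuous_on_indicator[OF _ uprof_cont[OF R]]) simp
    have hbd': "ennreal (norm (h g)) \<le> ennreal (mm (fst g)) * indicator ?B (fst g)
        * (ennreal (smoothstep' ((U (fst g) + (-1) * snd g) / \<epsilon> - 1) / \<epsilon>)
         + ennreal (smoothstep' ((U (fst g) + 1 * snd g) / \<epsilon> - 1) / \<epsilon>))" for g
      using hbd[of g] by (cases "fst g \<in> ?B") (auto simp: U_def)
    have "ennreal (LINT g|lborel. f \<epsilon> g * D g) \<le> ennreal (norm (LINT g|lborel. h g))"
      unfolding eq by (intro ennreal_leI) simp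
    also have "\<dots> \<le> (\<integral>\<^sup>+ g. ennreal (norm (h g)) \<partial>lborel)"
      by (rule integral_norm_bound_ennreal[OF hint])
    also have "\<dots> \<le> (\<integral>\<^sup>+ g. ennreal (mm (fst g)) * indicator ?B (fst g)
        * (ennreal (smoothstep' ((U (fst g) + (-1) * snd g) / \<epsilon> - 1) / \<epsilon>)
         + ennreal (smoothstep' ((U (fst g) + 1 * snd g) / \<epsilon> - 1) / \<epsilon>)) \<partial>(lborel \<Otimes>\<^sub>M lborel))"
      unfolding lborel_prod by (intro nn_integral_mono hbd')
    also have "\<dots> = (\<integral>\<^sup>+ z. (\<integral>\<^sup>+ t. ennreal (mm z) * indicator ?B z
        * (ennreal (smoothstep' ((U z + (-1) * t) / \<epsilon> - 1) / \<epsilon>)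
         + ennreal (smoothstep' ((U z + 1 * t) / \<epsilon> - 1) / \<epsilon>)) \<partial>lborel) \<partial>lborel)"
      by (subst lborel.nn_integral_fst[symmetric]) auto
    also have "\<dots> \<le> (\<integral>\<^sup>+ z. ennreal (mm z) * indicator ?B z * (1 + 1) \<partial>lborel)"
    proof (intro nn_integral_mono)
      fix z
      have "(\<integral>\<^sup>+ t. ennreal (mm z) * indicator ?B z
        * (ennreal (smoothstep' ((U z + (-1) * t) / \<epsilon> - 1) / \<epsilon>)
         + ennreal (smoothstep' ((U z + 1 * t) / \<epsilon> - 1) / \<epsilon>)) \<partial>lborel)
        = ennreal (mm z) * indicator ?B z * ((\<integral>\<^sup>+ t. ennreal (smoothstep' ((U z + (-1) * t) / \<epsilon> - 1) / \<epsilon>) \<partial>lborel)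
          + (\<integral>\<^sup>+ t. ennreal (smoothstep' ((U z + 1 * t) / \<epsilon> - 1) / \<epsilon>) \<partial>lborel))"
        by (subst nn_integral_cmult, measurable) (subst nn_integral_add, auto)
      also have "\<dots> \<le> ennreal (mm z) * indicator ?B z * (1 + 1)"
        by (intro mult_left_mono add_mono nn_integral_smoothstep'[OF \<epsilon>]) auto
      finally show "(\<integral>\<^sup>+ t. ennreal (mm z) * indicator ?B z
        * (ennreal (smoothstep' ((U z + (-1) * t) / \<epsilon> - 1) / \<epsilon>)
         + ennreal (smoothstep' ((U z + 1 * t) / \<epsilon> - 1) / \<epsilon>)) \<partial>lborel) \<le> ennreal (mm z) * indicator ?B z * (1 + 1)" .
    qed
    also have "\<dots> = (\<integral>\<^sup>+ z. ennreal (R * norm z / sqrt (R\<^sup>2 - (norm z)\<^sup>2)) * indicator ?B z \<partial>lborel)"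
    proof (intro nn_integral_cong)
      fix z
      show "ennreal (mm z) * indicator ?B z * (1 + 1) = ennreal (R * norm z / sqrt (R\<^sup>2 - (norm z)\<^sup>2)) * indicator ?B z"
      proof (cases "z \<in> ?B")
        case True
        have "ennreal (mm z) * 2 = ennreal (mm z * 2)" using mm0[OF True] by (simp add: ennreal_mult)
        also have "mm z * 2 = R * norm z / sqrt (R\<^sup>2 - (norm z)\<^sup>2)" by (simp add: mm_def)
        finally show ?thesis using True by simp
      qed simp
    qed
    also have "\<dots> \<le> ennreal P" by (rule P)
    finally show ?thesis using P0 C1_on_cont[OF fU] by (simp add: ennreal_le_iff)
  qed
  define \<epsilon> where "\<epsilon> n = 1 / real (Suc n)" for n
  have \<epsilon>: "\<epsilon> n > 0" for n by (simp add: \<epsilon>_def)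
  have \<epsilon>0: "\<epsilon> \<longlonglongrightarrow> 0" unfolding \<epsilon>_def by (rule LIMSEQ_inverse_real_of_nat[unfolded inverse_eq_divide])
  have lim: "(\<lambda>n. LINT g|lborel. f (\<epsilon> n) g * D g) \<longlonglongrightarrow> (LINT g|lborel. indicator (extremal R) g * D g)"
  proof (rule integral_dominated_convergence[where w="\<lambda>g. norm (D g)"])
    have [measurable]: "D \<in> borel_measurable borel" by (rule borel_measurable_continuous_onI[OF Dc])
    have [measurable]: "extremal R \<in> sets borel" by (simp add: open_extremal)
    show "(\<lambda>g. indicator (extremal R) g * D g) \<in> borel_measurable lborel" by measurable
    have [measurable]: "?B \<in> sets borel" by simp
    show "(\<lambda>g. f (\<epsilon> n) g * D g) \<in> borel_measurable lborel" for n
    proof -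
      have [measurable]: "f (\<epsilon> n) \<in> borel_measurable borel"
        using fle[OF \<epsilon>] by (intro borel_measurable_continuous_onI) blast
      show ?thesis by measurable
    qed
    show "integrable lborel (\<lambda>g. norm (D g))" using Dint by simp
    show "AE g in lborel. norm (f (\<epsilon> n) g * D g) \<le> norm (D g)" for n
    proof (rule AE_I2)
      fix g
      have "\<bar>f (\<epsilon> n) g\<bar> \<le> 1"
        using S01 by (auto simp: f_def abs_mult intro!: mult_le_one split: split_indicator)
      then show "norm (f (\<epsilon> n) g * D g) \<le> norm (D g)" by (simp add: abs_mult mult_left_le_one_le)
    qed
    show "AE g in lborel. (\<lambda>n. f (\<epsilon> n) g * D g) \<longlonglongrightarrow> indicator (extremal R) g * D g"
    proof (rule AE_I2)
      fix g :: "'n heis"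
      show "(\<lambda>n. f (\<epsilon> n) g * D g) \<longlonglongrightarrow> indicator (extremal R) g * D g"
      proof (cases "g \<in> extremal R")
        case True
        then have g: "fst g \<in> ?B" "0 < uprof R (fst g) - snd g" "0 < uprof R (fst g) + snd g"
          by (auto simp: extremal_def between_graphs_def)
        have e2: "(\<lambda>n. 2 * \<epsilon> n) \<longlonglongrightarrow> 0" using tendsto_mult[OF tendsto_const \<epsilon>0, of 2] by simp
        have "\<forall>\<^sub>F n in sequentially. f (\<epsilon> n) g * D g = indicator (extremal R) g * D g"
          using order_tendstoD(2)[OF e2 g(2)] order_tendstoD(2)[OF e2 g(3)]
          by eventually_elim (use True g(1) in \<open>simp add: f_def S1 \<epsilon>\<close>)
        then show ?thesis by (rule tendsto_eventually)
      next
        case False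
        have "f (\<epsilon> n) g = 0" for n
        proof (cases "fst g \<in> ?B")
          case True
          then have "uprof R (fst g) - snd g \<le> 0 \<or> uprof R (fst g) + snd g \<le> 0"
            using False by (cases g) (auto simp: extremal_def between_graphs_def)
          then show ?thesis using S0[OF _ \<epsilon>[of n]] \<epsilon>[of n] by (auto simp: f_def)
        qed (simp add: f_def)
        then show ?thesis using False by simp
      qed
    qed
  qed
  have "(LINT g|lborel. indicator (extremal R) g * D g) \<le> P"
    by (rule LIMSEQ_le_const2[OF lim]) (use fle \<epsilon> in blast)
  then show ?thesis by (simp add: set_lebesgue_integral_def D_def)
qed

lemma H_perimeter_extremal_le:
  assumes R: "R > 0"
    and P: "(\<integral>\<^sup>+ z. ennreal (R * norm z / sqrt (R\<^sup>2 - (norm z)\<^sup>2)) * indicator (ball (0::'n::finite horiz) R) z \<partial>lborel) \<le> ennreal P"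
    and P0: "P \<ge> 0"
  shows "H_perimeter (extremal R :: 'n heis set) UNIV \<le> ereal P"
  unfolding H_perimeter_def
proof (rule SUP_least)
  fix \<zeta> :: "'n + 'n \<Rightarrow> 'n heis \<Rightarrow> real" assume \<zeta>: "\<zeta> \<in> horizontal_test_fields UNIV"
  have "(\<lambda>g. \<Sum>i\<in>UNIV. Xd i (\<zeta> i) g) \<in> borel_measurable borel"
    using \<zeta> unfolding horizontal_test_fields_def
    by (intro borel_measurable_continuous_onI continuous_intros) auto
  from set_lebesgue_integral_lborel[OF _ this, of "extremal R"] test_field_integral_le[OF R \<zeta> P P0]
  show "ereal (set_lebesgue_integral lebesgue (extremal R) (\<lambda>g. \<Sum>i\<in>UNIV. Xd i (\<zeta> i) g)) \<le> ereal P"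
    by (simp add: open_extremal)
qed

section \<open>Radial integrals\<close>

text \<open>Polar coordinates in terms of \<open>w = (norm z)\<^sup>2\<close>: the ball of squared radius \<open>w\<close> has volume
  \<open>unit_ball_vol (2 n) * w ^ n\<close>.\<close>

abbreviation ball_vol :: "'n::finite itself \<Rightarrow> real" where
  "ball_vol _ \<equiv> unit_ball_vol (2 * real CARD('n))"

lemma emeasure_sublevel:
  fixes w :: real assumes "0 \<le> w"
  shows "emeasure lborel {z::'n::finite horiz. (norm z)\<^sup>2 \<le> w} = ennreal (ball_vol TYPE('n) * w ^ CARD('n))"
    "emeasure lborel {z::'n horiz. (norm z)\<^sup>2 < w} = ennreal (ball_vol TYPE('n) * w ^ CARD('n))"
proof -
  have p: "sqrt w ^ (CARD('n) + CARD('n)) = w ^ CARD('n)"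
    using assms by (simp add: power_add power_mult_distrib[symmetric])
  have "{z::'n horiz. (norm z)\<^sup>2 \<le> w} = cball 0 (sqrt w)"
    using assms by (auto simp: real_le_rsqrt sqrt_ge_absD dest: real_sqrt_le_mono)
  then show "emeasure lborel {z::'n::finite horiz. (norm z)\<^sup>2 \<le> w} = ennreal (ball_vol TYPE('n) * w ^ CARD('n))"
    using emeasure_cball[of "sqrt w" "0::'n horiz"] p assms by simp
  have "{z::'n horiz. (norm z)\<^sup>2 < w} = ball 0 (sqrt w)"
  proof -
    have "norm z < sqrt w \<longleftrightarrow> (norm z)\<^sup>2 < w" for z :: "'n horiz"
      using real_sqrt_less_iff[of "(norm z)\<^sup>2" w] by simp
    then show ?thesis by (auto simp: ball_def)
  qed
  then show "emeasure lborel {z::'n horiz. (norm z)\<^sup>2 < w} = ennreal (ball_vol TYPE('n) * w ^ CARD('n))"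
    using emeasure_ball[of "sqrt w" "0::'n horiz"] p assms by simp
qed

lemma ball_vol_nonneg: "0 \<le> ball_vol TYPE('n::finite)"
  by (simp add: unit_ball_vol_nonneg)

text \<open>The image of Lebesgue measure on the ball under \<open>(norm z)\<^sup>2\<close> and the
  measure with the stated density agree on all rays \<open>{x<..}\<close>. Both are finite there, so
  they are equal as measures.\<close>

lemma nn_integral_radial:
  fixes F :: "real \<Rightarrow> ennreal"
  assumes F[measurable]: "F \<in> borel_measurable borel" and R: "R > 0"
  shows "(\<integral>\<^sup>+ z. F ((norm z)\<^sup>2) * indicator (ball (0::'n::finite horiz) R) z \<partial>lborel)
    = (\<integral>\<^sup>+ w. F w * (ennreal (real CARD('n) * ball_vol TYPE('n) * w ^ (CARD('n) - 1)) * indicator {0..R\<^sup>2} w) \<partial>lborel)"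
proof -
  let ?n = "CARD('n)" and ?\<omega> = "ball_vol TYPE('n)"
  define D where "D w = ennreal (real ?n * ?\<omega> * w ^ (?n - 1)) * indicator {0..R\<^sup>2} w" for w :: real
  define M1 where "M1 = distr (density lborel (indicator (ball (0::'n horiz) R))) borel (\<lambda>z. (norm z)\<^sup>2)"
  define M2 where "M2 = density lborel D"
  have n: "?n > 0" by simp
  have [measurable]: "D \<in> borel_measurable borel" unfolding D_def by measurable
  have [measurable]: "ball (0::'n horiz) R \<in> sets borel" by simp
  have ball: "{z::'n horiz. norm z < R} = {z. (norm z)\<^sup>2 < R\<^sup>2}"
    using R by (auto intro: power_strict_mono power_less_imp_less_base)
  have e1: "emeasure M1 {x<..} = emeasure lborel {z::'n horiz. x < (norm z)\<^sup>2 \<and> (norm z)\<^sup>2 < R\<^sup>2}" for x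
  proof -
    have "emeasure M1 {x<..} = emeasure (density lborel (indicator (ball (0::'n horiz) R))) {z. x < (norm z)\<^sup>2}"
      unfolding M1_def by (subst emeasure_distr) (auto simp: vimage_def)
    also have "\<dots> = (\<integral>\<^sup>+ z. indicator (ball (0::'n horiz) R) z * indicator {z. x < (norm z)\<^sup>2} z \<partial>lborel)"
      by (subst emeasure_density) auto
    also have "\<dots> = (\<integral>\<^sup>+ z. indicator {z::'n horiz. x < (norm z)\<^sup>2 \<and> (norm z)\<^sup>2 < R\<^sup>2} z \<partial>lborel)"
      using ball by (intro nn_integral_cong) (auto simp: indicator_def set_eq_iff)
    finally show ?thesis by simp
  qed
  have e2: "emeasure M2 {x<..} = (\<integral>\<^sup>+ w. D w * indicator {x<..} w \<partial>lborel)" for x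
    unfolding M2_def by (subst emeasure_density) auto
  have eq: "emeasure M1 {x<..} = emeasure M2 {x<..}" for x
  proof (cases "R\<^sup>2 \<le> x")
    case True
    then have e: "{z::'n horiz. x < (norm z)\<^sup>2 \<and> (norm z)\<^sup>2 < R\<^sup>2} = {}" by auto
    have d: "D w * indicator {x<..} w = 0" for w using True by (auto simp: D_def indicator_def)
    show ?thesis unfolding e1 e2 e d by simp
  next
    case False
    define y where "y = max 0 x"
    have y: "0 \<le> y" "y < R\<^sup>2" using False R by (auto simp: y_def)
    have dF: "((\<lambda>w. real ?n * ?\<omega> * w ^ (?n - 1)) has_integral (?\<omega> * (R\<^sup>2) ^ ?n - ?\<omega> * y ^ ?n)) {y..R\<^sup>2}"
      using y by (intro fundamental_theorem_of_calculus)
        (auto simp: has_real_derivative_iff_has_vector_derivative[symmetric] intro!: derivative_eq_intros)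
    have "emeasure M2 {x<..} = (\<integral>\<^sup>+ w. ennreal (real ?n * ?\<omega> * w ^ (?n - 1)) * indicator {y..R\<^sup>2} w \<partial>lborel)"
      unfolding e2
    proof (rule nn_integral_cong_AE)
      show "AE w in lborel. D w * indicator {x<..} w = ennreal (real ?n * ?\<omega> * w ^ (?n - 1)) * indicator {y..R\<^sup>2} w"
        using AE_lborel_singleton[of x] AE_lborel_singleton[of 0]
        by eventually_elim (auto simp: D_def y_def indicator_def)
    qed
    also have "\<dots> = ennreal (?\<omega> * (R\<^sup>2) ^ ?n - ?\<omega> * y ^ ?n)"
      by (rule nn_integral_has_integral_lebesgue'[OF _ dF]) (use y ball_vol_nonneg[where 'n='n] in auto)
    finally have m2: "emeasure M2 {x<..} = ennreal (?\<omega> * (R\<^sup>2) ^ ?n - ?\<omega> * y ^ ?n)" .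
    have "emeasure M1 {x<..} = emeasure lborel ({z::'n horiz. (norm z)\<^sup>2 < R\<^sup>2} - {z. (norm z)\<^sup>2 \<le> x})"
      unfolding e1 by (rule arg_cong[where f="emeasure lborel"]) auto
    also have "\<dots> = emeasure lborel {z::'n horiz. (norm z)\<^sup>2 < R\<^sup>2} - emeasure lborel {z::'n horiz. (norm z)\<^sup>2 \<le> x}"
    proof (rule emeasure_Diff)
      show "emeasure lborel {z::'n horiz. (norm z)\<^sup>2 \<le> x} \<noteq> \<infinity>"
      proof (cases "0 \<le> x")
        case True
        then show ?thesis using emeasure_sublevel(1)[OF True, where 'n='n] by simp
      next
        case False
        then have e: "{z::'n horiz. (norm z)\<^sup>2 \<le> x} = {}" by (auto dest: order_trans[OF zero_le_power2])
        show ?thesis unfolding e by simp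
      qed
      show "{z::'n horiz. (norm z)\<^sup>2 \<le> x} \<subseteq> {z. (norm z)\<^sup>2 < R\<^sup>2}" using False by auto
    qed auto
    also have "emeasure lborel {z::'n horiz. (norm z)\<^sup>2 \<le> x} = ennreal (?\<omega> * y ^ ?n)"
    proof (cases "0 \<le> x")
      case True
      then show ?thesis using emeasure_sublevel(1)[OF True, where 'n='n] by (simp add: y_def)
    next
      case False
      then have e: "{z::'n horiz. (norm z)\<^sup>2 \<le> x} = {}" by (auto dest: order_trans[OF zero_le_power2])
      show ?thesis unfolding e using False n by (simp add: y_def)
    qed
    also have "emeasure lborel {z::'n horiz. (norm z)\<^sup>2 < R\<^sup>2} = ennreal (?\<omega> * (R\<^sup>2) ^ ?n)"
      by (rule emeasure_sublevel(2)) simp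
    also have "ennreal (?\<omega> * (R\<^sup>2) ^ ?n) - ennreal (?\<omega> * y ^ ?n) = ennreal (?\<omega> * (R\<^sup>2) ^ ?n - ?\<omega> * y ^ ?n)"
      using y ball_vol_nonneg[where 'n='n] by (intro ennreal_minus mult_nonneg_nonneg) auto
    finally show ?thesis by (simp add: m2)
  qed
  have "M1 = M2"
  proof (rule measure_eqI_lessThan)
    show "emeasure M1 {x<..} < \<infinity>" for x
    proof -
      have "emeasure M1 {x<..} \<le> emeasure lborel {z::'n horiz. (norm z)\<^sup>2 < R\<^sup>2}"
        unfolding e1 by (intro emeasure_mono) auto
      also have "\<dots> < \<infinity>" by (subst emeasure_sublevel(2)) auto
      finally show ?thesis .
    qed
  qed (auto simp: M1_def M2_def eq[unfolded M1_def M2_def])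
  then have "integral\<^sup>N M1 F = integral\<^sup>N M2 F" by simp
  moreover have "integral\<^sup>N M1 F = (\<integral>\<^sup>+ z. F ((norm z)\<^sup>2) * indicator (ball (0::'n horiz) R) z \<partial>lborel)"
    unfolding M1_def by (subst nn_integral_distr, simp, simp)
      (subst nn_integral_density, auto simp: mult.commute intro!: nn_integral_cong)
  moreover have "integral\<^sup>N M2 F = (\<integral>\<^sup>+ w. F w * D w \<partial>lborel)"
    unfolding M2_def by (subst nn_integral_density) (auto simp: mult.commute)
  ultimately show ?thesis by (simp add: D_def)
qed

section \<open>Beta integrals for the pairing, the perimeter and the volume\<close>

lemma nn_integral_beta:
  fixes a b c :: real
  assumes a: "a > 0" and b: "b > 0" and c: "c > 0"
  shows "(\<integral>\<^sup>+ w. ennreal (w powr (a - 1) * (c - w) powr (b - 1)) * indicator {0..c} w \<partial>lborel)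
    = ennreal (c powr (a + b - 1) * Beta a b)"
proof -
  have "(\<integral>\<^sup>+ w. ennreal (w powr (a - 1) * (c - w) powr (b - 1)) * indicator {0..c} w \<partial>lborel)
    = ennreal \<bar>c\<bar> * (\<integral>\<^sup>+ x. ennreal ((0 + c * x) powr (a - 1) * (c - (0 + c * x)) powr (b - 1)) * indicator {0..c} (0 + c * x) \<partial>lborel)"
    using c by (subst nn_integral_real_affine[where c=c and t=0]) auto
  also have "(\<integral>\<^sup>+ x. ennreal ((0 + c * x) powr (a - 1) * (c - (0 + c * x)) powr (b - 1)) * indicator {0..c} (0 + c * x) \<partial>lborel)
    = (\<integral>\<^sup>+ x. ennreal (c powr (a + b - 2)) * (ennreal (x powr (a - 1) * (1 - x) powr (b - 1)) * indicator {0..1} x) \<partial>lborel)"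
  proof (rule nn_integral_cong)
    fix x
    show "ennreal ((0 + c * x) powr (a - 1) * (c - (0 + c * x)) powr (b - 1)) * indicator {0..c} (0 + c * x)
      = ennreal (c powr (a + b - 2)) * (ennreal (x powr (a - 1) * (1 - x) powr (b - 1)) * indicator {0..1} x)"
    proof (cases "x \<in> {0..1}")
      case True
      have "c - c * x = c * (1 - x)" by (simp add: algebra_simps)
      then have x2: "(c - (0 + c * x)) powr (b - 1) = c powr (b - 1) * (1 - x) powr (b - 1)"
        using True c by (simp only: add_0) (auto simp: powr_mult)
      have x1: "(0 + c * x) powr (a - 1) = c powr (a - 1) * x powr (a - 1)"
        using True c by (simp add: powr_mult)
      have "(0 + c * x) powr (a - 1) * (c - (0 + c * x)) powr (b - 1)
        = (c powr (a - 1) * c powr (b - 1)) * (x powr (a - 1) * (1 - x) powr (b - 1))"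
        unfolding x1 x2 by simp
      also have "c powr (a - 1) * c powr (b - 1) = c powr (a + b - 2)"
        by (simp add: powr_add[symmetric] algebra_simps)
      finally have e: "(0 + c * x) powr (a - 1) * (c - (0 + c * x)) powr (b - 1)
        = c powr (a + b - 2) * (x powr (a - 1) * (1 - x) powr (b - 1))" .
      have "c * x \<le> c" using True c by (simp add: mult_left_le)
      then have "c * x \<in> {0..c}" using True c by simp
      then show ?thesis unfolding e using True by (simp add: ennreal_mult)
    next
      case False
      then have "c * x \<notin> {0..c}" using c by (auto simp: zero_le_mult_iff)
      then show ?thesis using False by simp
    qed
  qed
  also have "\<dots> = ennreal (c powr (a + b - 2)) * ennreal (Beta a b)"
    by (subst nn_integral_cmult, simp)
       (subst nn_integral_has_integral_lebesgue'[OF _ has_integral_Beta_real[OF a b]], auto)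
  also have "ennreal \<bar>c\<bar> * (ennreal (c powr (a + b - 2)) * ennreal (Beta a b)) = ennreal (c * c powr (a + b - 2) * Beta a b)"
    using c by (simp add: ennreal_mult' mult.assoc)
  also have "c * c powr (a + b - 2) = c powr (a + b - 1)"
    using c powr_add[of c 1 "a + b - 2"] by (simp add: algebra_simps)
  finally show ?thesis .
qed

lemma nn_integral_beta_cmult:
  assumes "a > 0" "b > 0" "R > 0"
  shows "(\<integral>\<^sup>+ w. ennreal k * (ennreal (w powr (a - 1) * (R\<^sup>2 - w) powr (b - 1)) * indicator {0..R\<^sup>2} w) \<partial>lborel)
    = ennreal k * ennreal ((R\<^sup>2) powr (a + b - 1) * Beta a b)"
  using assms by (simp add: nn_integral_cmult nn_integral_beta)

lemma beta_nonneg: "a > 0 \<Longrightarrow> b > 0 \<Longrightarrow> 0 < Beta a (b::real)"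
  by (simp add: Beta_def Gamma_real_pos)

lemma R_powr: "R > 0 \<Longrightarrow> (R\<^sup>2) powr (real m / 2) = R ^ m"
  using powr_realpow[of R 2] powr_realpow[of R m] by (simp add: powr_powr flip: powr_numeral)

lemma profile_term_nn:
  assumes R: "R > 0"
  shows "(\<integral>\<^sup>+ z. ennreal (norm z * sqrt (R\<^sup>2 - (norm z)\<^sup>2)) * indicator (ball (0::'n::finite horiz) R) z \<partial>lborel)
    = ennreal (real CARD('n) * ball_vol TYPE('n) * (R ^ (2 * CARD('n) + 2) * Beta (real CARD('n) + 1 / 2) (3 / 2)))"
proof -
  let ?n = "CARD('n)" and ?c = "real CARD('n) * ball_vol TYPE('n)"
  have n: "?n > 0" by simp
  have c: "0 \<le> ?c" using ball_vol_nonneg[where 'n='n] by simp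
  have "(\<integral>\<^sup>+ z. ennreal (norm z * sqrt (R\<^sup>2 - (norm z)\<^sup>2)) * indicator (ball (0::'n horiz) R) z \<partial>lborel)
    = (\<integral>\<^sup>+ z. ennreal (sqrt ((norm z)\<^sup>2) * sqrt (R\<^sup>2 - (norm z)\<^sup>2)) * indicator (ball (0::'n horiz) R) z \<partial>lborel)"
    by simp
  also have "\<dots> = (\<integral>\<^sup>+ w. ennreal (sqrt w * sqrt (R\<^sup>2 - w)) * (ennreal (?c * w ^ (?n - 1)) * indicator {0..R\<^sup>2} w) \<partial>lborel)"
    by (rule nn_integral_radial[OF _ R]) measurable
  also have "\<dots> = (\<integral>\<^sup>+ w. ennreal ?c * (ennreal (w powr ((real ?n + 1 / 2) - 1) * (R\<^sup>2 - w) powr (3 / 2 - 1)) * indicator {0..R\<^sup>2} w) \<partial>lborel)"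
  proof (rule nn_integral_cong_AE)
    show "AE w in lborel. ennreal (sqrt w * sqrt (R\<^sup>2 - w)) * (ennreal (?c * w ^ (?n - 1)) * indicator {0..R\<^sup>2} w)
      = ennreal ?c * (ennreal (w powr ((real ?n + 1 / 2) - 1) * (R\<^sup>2 - w) powr (3 / 2 - 1)) * indicator {0..R\<^sup>2} w)"
      using AE_lborel_singleton[of 0]
    proof eventually_elim
      case (elim w)
      show ?case
      proof (cases "w \<in> {0..R\<^sup>2}")
        case True
        then have w: "0 < w" "w \<le> R\<^sup>2" using elim by auto
        have r: "real (?n - 1) = real ?n - 1" using n by simp
        have "sqrt w * w ^ (?n - 1) = w powr (1 / 2) * w powr (real (?n - 1))"
          by (simp only: powr_realpow[OF w(1)] powr_half_sqrt[OF less_imp_le[OF w(1)]])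
        also have "\<dots> = w powr ((real ?n + 1 / 2) - 1)"
          unfolding r by (simp add: powr_add[symmetric] algebra_simps)
        finally have p: "sqrt w * w ^ (?n - 1) = w powr ((real ?n + 1 / 2) - 1)" .
        have q: "sqrt (R\<^sup>2 - w) = (R\<^sup>2 - w) powr (3 / 2 - 1)" using w by (simp add: powr_half_sqrt)
        have "ennreal (sqrt w * sqrt (R\<^sup>2 - w)) * ennreal (?c * w ^ (?n - 1)) = ennreal (?c * ((sqrt w * w ^ (?n - 1)) * sqrt (R\<^sup>2 - w)))"
          using w c by (subst ennreal_mult[symmetric]) (auto simp: mult_ac)
        also have "\<dots> = ennreal ?c * ennreal (w powr ((real ?n + 1 / 2) - 1) * (R\<^sup>2 - w) powr (3 / 2 - 1))"
          unfolding p q using c by (intro ennreal_mult) auto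
        finally show ?thesis using True by simp
      qed simp
    qed
  qed
  also have "\<dots> = ennreal ?c * ennreal ((R\<^sup>2) powr ((real ?n + 1 / 2) + 3 / 2 - 1) * Beta (real ?n + 1 / 2) (3 / 2))"
    by (rule nn_integral_beta_cmult[OF _ _ R]) auto
  also have "(real ?n + 1 / 2) + 3 / 2 - 1 = real (2 * ?n + 2) / 2" by simp
  finally show ?thesis using c by (simp only: R_powr[OF R]) (simp add: ennreal_mult')
qed

lemma profile_term_eq:
  assumes R: "R > 0"
  shows "profile_term R TYPE('n::finite) = real CARD('n) * ball_vol TYPE('n) * (R ^ (2 * CARD('n) + 1) * Beta (real CARD('n) + 1 / 2) (3 / 2)) / 2"
proof -
  let ?I = "real CARD('n) * ball_vol TYPE('n) * (R ^ (2 * CARD('n) + 2) * Beta (real CARD('n) + 1 / 2) (3 / 2))"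
  have I0: "0 \<le> ?I" using R ball_vol_nonneg[where 'n='n] beta_nonneg[of "real CARD('n) + 1 / 2" "3 / 2"] by simp
  have [measurable]: "ball (0::'n horiz) R \<in> sets borel" by simp
  have "(LINT z|lborel. indicator (ball 0 R) z * (norm (z::'n horiz) * sqrt (R\<^sup>2 - (norm z)\<^sup>2))) = ?I"
  proof (subst integral_eq_nn_integral)
    show "AE z in lborel. 0 \<le> indicator (ball 0 R) z * (norm (z::'n horiz) * sqrt (R\<^sup>2 - (norm z)\<^sup>2))"
      using R by (intro AE_I2) (auto simp: indicator_def intro!: mult_nonneg_nonneg power_mono)
    have "(\<integral>\<^sup>+ z. ennreal (indicator (ball 0 R) z * (norm (z::'n horiz) * sqrt (R\<^sup>2 - (norm z)\<^sup>2))) \<partial>lborel) = ennreal ?I"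
      unfolding profile_term_nn[OF R, symmetric] by (intro nn_integral_cong) (auto simp: indicator_def)
    then show "enn2real (\<integral>\<^sup>+ z. ennreal (indicator (ball 0 R) z * (norm (z::'n horiz) * sqrt (R\<^sup>2 - (norm z)\<^sup>2))) \<partial>lborel) = ?I"
      using I0 by simp
  qed measurable
  then show ?thesis using R by (simp add: profile_term_def)
qed

lemma slope_integral_nn:
  assumes R: "R > 0"
  shows "(\<integral>\<^sup>+ z. ennreal (R * norm z / sqrt (R\<^sup>2 - (norm z)\<^sup>2)) * indicator (ball (0::'n::finite horiz) R) z \<partial>lborel)
    = ennreal (real CARD('n) * ball_vol TYPE('n) * (R ^ (2 * CARD('n) + 1) * Beta (real CARD('n) + 1 / 2) (1 / 2)))"
proof -
  let ?n = "CARD('n)" and ?c = "R * (real CARD('n) * ball_vol TYPE('n))"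
  have n: "?n > 0" by simp
  have c: "0 \<le> ?c" using R ball_vol_nonneg[where 'n='n] by simp
  have "(\<integral>\<^sup>+ z. ennreal (R * norm z / sqrt (R\<^sup>2 - (norm z)\<^sup>2)) * indicator (ball (0::'n horiz) R) z \<partial>lborel)
    = (\<integral>\<^sup>+ z. ennreal (R * sqrt ((norm z)\<^sup>2) / sqrt (R\<^sup>2 - (norm z)\<^sup>2)) * indicator (ball (0::'n horiz) R) z \<partial>lborel)"
    by simp
  also have "\<dots> = (\<integral>\<^sup>+ w. ennreal (R * sqrt w / sqrt (R\<^sup>2 - w)) * (ennreal (real CARD('n) * ball_vol TYPE('n) * w ^ (?n - 1)) * indicator {0..R\<^sup>2} w) \<partial>lborel)"
    by (rule nn_integral_radial[OF _ R]) measurable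
  also have "\<dots> = (\<integral>\<^sup>+ w. ennreal ?c * (ennreal (w powr ((real ?n + 1 / 2) - 1) * (R\<^sup>2 - w) powr (1 / 2 - 1)) * indicator {0..R\<^sup>2} w) \<partial>lborel)"
  proof (rule nn_integral_cong_AE)
    show "AE w in lborel. ennreal (R * sqrt w / sqrt (R\<^sup>2 - w)) * (ennreal (real CARD('n) * ball_vol TYPE('n) * w ^ (?n - 1)) * indicator {0..R\<^sup>2} w)
      = ennreal ?c * (ennreal (w powr ((real ?n + 1 / 2) - 1) * (R\<^sup>2 - w) powr (1 / 2 - 1)) * indicator {0..R\<^sup>2} w)"
      using AE_lborel_singleton[of 0] AE_lborel_singleton[of "R\<^sup>2"]
    proof eventually_elim
      case (elim w)
      show ?case
      proof (cases "w \<in> {0..R\<^sup>2}")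
        case True
        then have w: "0 < w" "w < R\<^sup>2" using elim by auto
        have r: "real (?n - 1) = real ?n - 1" using n by simp
        have "sqrt w * w ^ (?n - 1) = w powr (1 / 2) * w powr (real (?n - 1))"
          by (simp only: powr_realpow[OF w(1)] powr_half_sqrt[OF less_imp_le[OF w(1)]])
        also have "\<dots> = w powr ((real ?n + 1 / 2) - 1)"
          unfolding r by (simp add: powr_add[symmetric] algebra_simps)
        finally have p: "sqrt w * w ^ (?n - 1) = w powr ((real ?n + 1 / 2) - 1)" .
        have q: "1 / sqrt (R\<^sup>2 - w) = (R\<^sup>2 - w) powr (1 / 2 - 1)"
          using w by (simp add: powr_half_sqrt[symmetric] powr_minus_divide)
        have "ennreal (R * sqrt w / sqrt (R\<^sup>2 - w)) * ennreal (real CARD('n) * ball_vol TYPE('n) * w ^ (?n - 1)) = ennreal (?c * ((sqrt w * w ^ (?n - 1)) * (1 / sqrt (R\<^sup>2 - w))))"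
          using w R c ball_vol_nonneg[where 'n='n] by (subst ennreal_mult[symmetric]) (auto simp: mult_ac)
        also have "\<dots> = ennreal ?c * ennreal (w powr ((real ?n + 1 / 2) - 1) * (R\<^sup>2 - w) powr (1 / 2 - 1))"
          unfolding p q using c by (intro ennreal_mult) auto
        finally show ?thesis using True by simp
      qed simp
    qed
  qed
  also have "\<dots> = ennreal ?c * ennreal ((R\<^sup>2) powr ((real ?n + 1 / 2) + 1 / 2 - 1) * Beta (real ?n + 1 / 2) (1 / 2))"
    by (rule nn_integral_beta_cmult[OF _ _ R]) auto
  also have "(real ?n + 1 / 2) + 1 / 2 - 1 = real (2 * ?n) / 2" by simp
  finally show ?thesis using c by (simp only: R_powr[OF R]) (simp add: ennreal_mult'[symmetric] mult_ac)
qed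

text \<open>Expresses the thickness \<open>2 * prof\<close> as an integral over the squared radii
  beyond \<open>w0\<close>, ready for an exchange of integrals. The integrand blows up at
  \<open>R\<^sup>2\<close>, hence the fundamental theorem with derivatives in the interior
  only.\<close>

lemma prof_sqrt_integral:
  assumes R: "R > 0" and w0: "0 \<le> w0" "w0 \<le> R\<^sup>2"
  shows "(\<integral>\<^sup>+ w. ennreal (sqrt w / (2 * sqrt (R\<^sup>2 - w))) * indicator {w0..R\<^sup>2} w \<partial>lborel) = ennreal (2 * prof R (sqrt w0))"
proof -
  have d: "((\<lambda>w. - 2 * prof R (sqrt w)) has_real_derivative sqrt w / (2 * sqrt (R\<^sup>2 - w))) (at w)"
    if w: "w \<in> {w0<..<R\<^sup>2}" for w
  proof -
    have w': "0 < w" "w < R\<^sup>2" using w w0 by auto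
    have "sqrt w < R" using w' R real_less_lsqrt[of R w] by (simp add: power2_eq_square)
    then have "(prof R has_real_derivative - (sqrt w)\<^sup>2 / (2 * sqrt (R\<^sup>2 - (sqrt w)\<^sup>2))) (at (sqrt w))"
      using w' by (intro prof_deriv) auto
    from DERIV_cmult[OF DERIV_chain2[OF this DERIV_real_sqrt[OF w'(1)]], of "- 2"]
    show ?thesis using w' by (elim DERIV_cong) (simp add: field_simps)
  qed
  have "((\<lambda>w. sqrt w / (2 * sqrt (R\<^sup>2 - w))) has_integral (- 2 * prof R (sqrt (R\<^sup>2)) - (- 2 * prof R (sqrt w0)))) {w0..R\<^sup>2}"
  proof (rule fundamental_theorem_of_calculus_interior[OF w0(2)])
    show "continuous_on {w0..R\<^sup>2} (\<lambda>w. - 2 * prof R (sqrt w))"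
    proof (intro continuous_intros continuous_on_compose2[OF prof_cont[OF R]] image_subsetI)
      fix w assume w: "w \<in> {w0..R\<^sup>2}"
      then have "sqrt w \<le> sqrt (R\<^sup>2)" by (intro real_sqrt_le_mono) simp
      moreover have "0 \<le> sqrt w" using w w0 by simp
      moreover have "- R \<le> 0" "sqrt (R\<^sup>2) = R" using R by auto
      ultimately have "- R \<le> sqrt w" "sqrt w \<le> R" by linarith+
      then show "sqrt w \<in> {- R..R}" by simp
    qed
  qed (use d in \<open>auto simp: has_real_derivative_iff_has_vector_derivative[symmetric]\<close>)
  then have "(\<integral>\<^sup>+ w. ennreal (sqrt w / (2 * sqrt (R\<^sup>2 - w))) * indicator {w0..R\<^sup>2} w \<partial>lborel) = ennreal (- 2 * prof R (sqrt (R\<^sup>2)) - (- 2 * prof R (sqrt w0)))"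
    using w0 by (intro nn_integral_has_integral_lebesgue') auto
  then show ?thesis using prof_ends(1)[OF R] R by simp
qed

text \<open>The thickness over \<open>z\<close> is an integral over \<open>w\<close> from
  \<open>(norm z)\<^sup>2\<close> to \<open>R\<^sup>2\<close>. After Fubini the inner integral is
  the volume of the ball of squared radius \<open>w\<close>, and a Beta integral remains;
  \<open>arcsin\<close> never has to be integrated.\<close>

lemma emeasure_extremal:
  assumes R: "R > 0"
  shows "emeasure lborel (extremal R :: 'n::finite heis set) =
    ennreal (ball_vol TYPE('n) / 2 * (R ^ (2 * CARD('n) + 2) * Beta (real CARD('n) + 3 / 2) (1 / 2)))"
proof -
  let ?n = "CARD('n)" and ?c = "ball_vol TYPE('n) / 2"
  have n: "?n > 0" by simp
  have c: "0 \<le> ?c" using ball_vol_nonneg[where 'n='n] by simp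
  have eS: "(extremal R :: 'n heis set) \<in> sets (lborel \<Otimes>\<^sub>M lborel)"
    unfolding lborel_prod by (simp add: open_extremal)
  define f where "f w = ennreal (sqrt w / (2 * sqrt (R\<^sup>2 - w)))" for w
  have [measurable]: "f \<in> borel_measurable borel" unfolding f_def by measurable
  have [measurable]: "ball (0::'n horiz) R \<in> sets borel" by simp
  have ball: "z \<in> ball 0 R \<longleftrightarrow> (norm z)\<^sup>2 < R\<^sup>2" for z :: "'n horiz"
    using R by (auto intro: power_strict_mono power_less_imp_less_base)
  have "emeasure lborel (extremal R :: 'n heis set) = emeasure (lborel \<Otimes>\<^sub>M lborel) (extremal R :: 'n heis set)"
    by (simp add: lborel_prod)
  also have "\<dots> = (\<integral>\<^sup>+ z. emeasure lborel (Pair z -` (extremal R :: 'n heis set)) \<partial>lborel)"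
    by (rule lborel.emeasure_pair_measure_alt[OF eS])
  also have "\<dots> = (\<integral>\<^sup>+ z. (\<integral>\<^sup>+ w. f w * (indicator {0..R\<^sup>2} w * indicator {z::'n horiz. (norm z)\<^sup>2 \<le> w} z) \<partial>lborel) \<partial>lborel)"
  proof (rule nn_integral_cong_AE)
    have "AE z in lebesgue. z \<notin> sphere (0::'n horiz) R"
      by (intro AE_not_in) (simp add: negligible_iff_null_sets[symmetric] negligible_sphere)
    then have "AE z in lborel. z \<notin> sphere (0::'n horiz) R" by (simp add: AE_completion_iff)
    then show "AE z in lborel. emeasure lborel (Pair z -` (extremal R :: 'n heis set))
       = (\<integral>\<^sup>+ w. f w * (indicator {0..R\<^sup>2} w * indicator {z::'n horiz. (norm z)\<^sup>2 \<le> w} z) \<partial>lborel)"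
    proof (rule AE_mp, intro AE_I2 impI)
      fix z :: "'n horiz" assume "z \<notin> sphere 0 R"
      then have zs: "(norm z)\<^sup>2 \<noteq> R\<^sup>2" using R by (auto simp: power2_eq_iff_nonneg)
      show "emeasure lborel (Pair z -` (extremal R :: 'n heis set))
       = (\<integral>\<^sup>+ w. f w * (indicator {0..R\<^sup>2} w * indicator {z::'n horiz. (norm z)\<^sup>2 \<le> w} z) \<partial>lborel)"
    proof (cases "z \<in> ball 0 R")
      case True
      then have w0: "0 \<le> (norm z)\<^sup>2" "(norm z)\<^sup>2 \<le> R\<^sup>2" using ball[of z] by auto
      have "Pair z -` extremal R = {- uprof R z <..< uprof R z}"
        using True by (auto simp: extremal_def between_graphs_def)
      then have "emeasure lborel (Pair z -` extremal R) = ennreal (2 * prof R (sqrt ((norm z)\<^sup>2)))"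
        using uprof_pos[OF True] by (simp add: uprof_def)
      also have "\<dots> = (\<integral>\<^sup>+ w. f w * indicator {(norm z)\<^sup>2..R\<^sup>2} w \<partial>lborel)"
        unfolding f_def by (rule prof_sqrt_integral[OF R w0, symmetric])
      also have "\<dots> = (\<integral>\<^sup>+ w. f w * (indicator {0..R\<^sup>2} w * indicator {z::'n horiz. (norm z)\<^sup>2 \<le> w} z) \<partial>lborel)"
        using w0 by (intro nn_integral_cong) (auto simp: indicator_def dest: order_trans[OF zero_le_power2[of "norm z"]])
      finally show ?thesis by simp
    next
      case False
      then have "Pair z -` (extremal R :: 'n heis set) = {}" by (auto simp: extremal_def between_graphs_def)
      moreover have "f w * (indicator {0..R\<^sup>2} w * indicator {z::'n horiz. (norm z)\<^sup>2 \<le> w} z) = 0" for w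
        using False ball[of z] zs by (auto simp: indicator_def)
      ultimately show ?thesis by (simp only: emeasure_empty nn_integral_const mult_zero_left)
    qed
    qed
  qed
  also have "\<dots> = (\<integral>\<^sup>+ w. (\<integral>\<^sup>+ z. f w * (indicator {0..R\<^sup>2} w * indicator {z::'n horiz. (norm z)\<^sup>2 \<le> w} z) \<partial>lborel) \<partial>lborel)"
  proof (rule lborel_pair.Fubini'[symmetric])
    have "{p::'n horiz \<times> real. (norm (fst p))\<^sup>2 \<le> snd p} \<in> sets borel"
      by (intro borel_closed closed_Collect_le continuous_intros)
    then have [measurable]: "{p::'n horiz \<times> real. (norm (fst p))\<^sup>2 \<le> snd p} \<in> sets (lborel \<Otimes>\<^sub>M lborel)"
      unfolding lborel_prod by simp
    have "(\<lambda>p::'n horiz \<times> real. f (snd p) * (indicator {0..R\<^sup>2} (snd p) * indicator {p::'n horiz \<times> real. (norm (fst p))\<^sup>2 \<le> snd p} p)) \<in> borel_measurable (lborel \<Otimes>\<^sub>M lborel)"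
      by measurable
    also have "(\<lambda>p::'n horiz \<times> real. f (snd p) * (indicator {0..R\<^sup>2} (snd p) * indicator {p::'n horiz \<times> real. (norm (fst p))\<^sup>2 \<le> snd p} p))
      = (\<lambda>(z, w). f w * (indicator {0..R\<^sup>2} w * indicator {z::'n horiz. (norm z)\<^sup>2 \<le> w} z))"
      by (auto simp: fun_eq_iff indicator_def)
    finally show "(\<lambda>(z, w). f w * (indicator {0..R\<^sup>2} w * indicator {z::'n horiz. (norm z)\<^sup>2 \<le> w} z)) \<in> borel_measurable (lborel \<Otimes>\<^sub>M lborel)" .
  qed
  also have "\<dots> = (\<integral>\<^sup>+ w. ennreal ?c * (ennreal (w powr ((real ?n + 3 / 2) - 1) * (R\<^sup>2 - w) powr (1 / 2 - 1)) * indicator {0..R\<^sup>2} w) \<partial>lborel)"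
  proof (rule nn_integral_cong_AE)
    show "AE w in lborel. (\<integral>\<^sup>+ z. f w * (indicator {0..R\<^sup>2} w * indicator {z::'n horiz. (norm z)\<^sup>2 \<le> w} z) \<partial>lborel)
      = ennreal ?c * (ennreal (w powr ((real ?n + 3 / 2) - 1) * (R\<^sup>2 - w) powr (1 / 2 - 1)) * indicator {0..R\<^sup>2} w)"
      using AE_lborel_singleton[of 0] AE_lborel_singleton[of "R\<^sup>2"]
    proof eventually_elim
      case (elim w)
      show ?case
      proof (cases "w \<in> {0..R\<^sup>2}")
        case True
        then have w: "0 < w" "w < R\<^sup>2" using elim by auto
        have "(\<integral>\<^sup>+ z. f w * (indicator {0..R\<^sup>2} w * indicator {z::'n horiz. (norm z)\<^sup>2 \<le> w} z) \<partial>lborel)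
          = f w * emeasure lborel {z::'n horiz. (norm z)\<^sup>2 \<le> w}"
          using True by (simp add: nn_integral_cmult)
        also have "\<dots> = ennreal (sqrt w / (2 * sqrt (R\<^sup>2 - w)) * (ball_vol TYPE('n) * w ^ ?n))"
        proof -
          have "emeasure lborel {z::'n horiz. (norm z)\<^sup>2 \<le> w} = ennreal (ball_vol TYPE('n) * w ^ ?n)"
            using w by (intro emeasure_sublevel) simp
          moreover have "0 \<le> sqrt w / (2 * sqrt (R\<^sup>2 - w))" using w by simp
          ultimately show ?thesis by (simp only: f_def ennreal_mult')
        qed
        also have "sqrt w / (2 * sqrt (R\<^sup>2 - w)) * (ball_vol TYPE('n) * w ^ ?n) = ?c * ((sqrt w * w ^ ?n) * (1 / sqrt (R\<^sup>2 - w)))"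
          by simp
        also have "sqrt w * w ^ ?n = w powr (1 / 2) * w powr (real ?n)"
          using w by (simp add: powr_half_sqrt powr_realpow)
        also have "\<dots> = w powr ((real ?n + 3 / 2) - 1)"
          by (simp add: powr_add[symmetric] algebra_simps)
        also have "1 / sqrt (R\<^sup>2 - w) = (R\<^sup>2 - w) powr (1 / 2 - 1)"
          using w by (simp add: powr_half_sqrt[symmetric] powr_minus_divide)
        finally show ?thesis using True by (simp only: ennreal_mult'[OF c] indicator_simps mult_1_right mult_1_left)
      qed simp
    qed
  qed
  also have "\<dots> = ennreal ?c * ennreal ((R\<^sup>2) powr ((real ?n + 3 / 2) + 1 / 2 - 1) * Beta (real ?n + 3 / 2) (1 / 2))"
    by (rule nn_integral_beta_cmult[OF _ _ R]) auto
  also have "(real ?n + 3 / 2) + 1 / 2 - 1 = real (2 * ?n + 2) / 2" by simp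
  finally show ?thesis by (simp only: R_powr[OF R] ennreal_mult'[OF c])
qed

section \<open>Topology of the extremal set\<close>

lemma prof_scale:
  assumes "R > 0" "0 \<le> r"
  shows "prof R (R * r) = R\<^sup>2 * prof 1 r"
proof -
  have "R\<^sup>2 - (R * r)\<^sup>2 = R\<^sup>2 * (1 - r\<^sup>2)" by (simp add: power_mult_distrib algebra_simps)
  then have "sqrt (R\<^sup>2 - (R * r)\<^sup>2) = R * sqrt (1 - r\<^sup>2)" using assms by (simp add: real_sqrt_mult)
  then show ?thesis using assms by (simp add: prof_def power2_eq_square algebra_simps)
qed

lemma u_o_eq: "u_o = uprof 1"
  by (auto simp: fun_eq_iff u_o_def uprof_def prof_def)

lemma uprof_scale: "R > 0 \<Longrightarrow> uprof R (R *\<^sub>R z) = R\<^sup>2 * uprof 1 z"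
  using prof_scale[of R "norm z"] by (simp add: uprof_def)

lemma E_o_eq: "E_o = extremal 1"
  by (simp add: E_o_def extremal_def u_o_eq)

lemma dilation_image:
  assumes "R > 0"
  shows "dilation R ` A = {g. (fst g /\<^sub>R R, snd g / R\<^sup>2) \<in> A}"
proof (intro subset_antisym subsetI)
  fix g assume "g \<in> dilation R ` A"
  then obtain z t where "g = dilation R (z, t)" "(z, t) \<in> A" by auto
  then show "g \<in> {g. (fst g /\<^sub>R R, snd g / R\<^sup>2) \<in> A}"
    using assms by (simp add: dilation_def)
next
  fix g assume "g \<in> {g. (fst g /\<^sub>R R, snd g / R\<^sup>2) \<in> A}"
  then have "(fst g /\<^sub>R R, snd g / R\<^sup>2) \<in> A" by simp
  then show "g \<in> dilation R ` A" by (rule rev_image_eqI) (use assms in \<open>simp add: dilation_def\<close>)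
qed

lemma uprof_div: "R > 0 \<Longrightarrow> uprof R z = R\<^sup>2 * uprof 1 (z /\<^sub>R R)"
  using uprof_scale[of R "z /\<^sub>R R"] by simp

lemma dilation_extremal:
  assumes "R > 0"
  shows "dilation R ` extremal 1 = extremal R"
proof (rule set_eqI)
  fix g :: "'a heis"
  obtain z t where g: "g = (z, t)" by (cases g)
  have "norm (z /\<^sub>R R) < 1 \<longleftrightarrow> norm z < R" 
  proof -
    have "norm (z /\<^sub>R R) = norm z / R" using assms by (simp add: divide_inverse)
    then show ?thesis using assms by (simp add: pos_divide_less_eq)
  qed
  moreover have "- uprof 1 (z /\<^sub>R R) < t / R\<^sup>2 \<longleftrightarrow> - uprof R z < t" "t / R\<^sup>2 < uprof 1 (z /\<^sub>R R) \<longleftrightarrow> t < uprof R z"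
    unfolding uprof_div[OF assms, of z] using assms
    by (simp_all add: pos_less_divide_eq pos_divide_less_eq mult.commute)
  ultimately show "g \<in> dilation R ` extremal 1 \<longleftrightarrow> g \<in> extremal R"
    unfolding dilation_image[OF assms] g by (simp add: extremal_def between_graphs_def)
qed

lemma frontier_extremal:
  assumes R: "R > 0"
  shows "frontier (extremal R) = {(z, t). norm z \<le> R \<and> (t = uprof R z \<or> t = - uprof R z)}"
    "closure (extremal R) = {(z, t). norm z \<le> R \<and> \<bar>t\<bar> \<le> uprof R z}"
proof -
  let ?C = "{g \<in> cball 0 R \<times> (UNIV::real set). \<bar>snd g\<bar> \<le> uprof R (fst g)}"
  have C: "closed ?C"
  proof (rule continuous_on_closed_Collect_le)
    show "continuous_on (cball 0 R \<times> UNIV) (\<lambda>g. uprof R (fst g))"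
      by (intro continuous_on_compose2[OF uprof_cont[OF R]] continuous_intros) auto
  qed (auto intro!: continuous_intros closed_Times)
  have "closure (extremal R) \<subseteq> ?C"
    using C by (intro closure_minimal) (auto simp: extremal_def between_graphs_def)
  moreover have "?C \<subseteq> closure (extremal R)"
  proof
    fix g assume g: "g \<in> ?C"
    obtain z t where gzt: "g = (z, t)" by (cases g)
    have z: "norm z \<le> R" "\<bar>t\<bar> \<le> uprof R z" using g gzt by auto
    \<comment> \<open>Shrinking by \<open>\<theta> < 1\<close> moves a point of the closed region
      strictly inside: off the axis the profile grows strictly towards the centre, and on the axis
      the height itself decreases.\<close>
    have in_E: "(\<theta> *\<^sub>R z, \<theta> * t) \<in> extremal R" if th: "0 < \<theta>" "\<theta> < 1" for \<theta>
    proof -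
      have n: "norm (\<theta> *\<^sub>R z) = \<theta> * norm z" using th by simp
      have "\<bar>\<theta> * t\<bar> < uprof R (\<theta> *\<^sub>R z)"
      proof (cases "z = 0")
        case True
        have "\<bar>\<theta> * t\<bar> \<le> \<theta> * uprof R z" using th z by (simp add: abs_mult)
        also have "\<dots> < 1 * uprof R z"
          using th R uprof_pos[of z R] True by (intro mult_strict_right_mono) auto
        finally show ?thesis using True by simp
      next
        case False
        have "\<bar>\<theta> * t\<bar> \<le> \<bar>t\<bar>" using th by (simp add: abs_mult mult_left_le_one_le)
        also have "\<dots> \<le> uprof R z" by (rule z)
        also have "\<dots> < uprof R (\<theta> *\<^sub>R z)"
          unfolding uprof_def n using th z False by (intro prof_strict_antimono) auto
        finally show ?thesis .
      qed
      moreover have "norm (\<theta> *\<^sub>R z) < R"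
      proof (cases "z = 0")
        case False
        then have "\<theta> * norm z < 1 * norm z" using th by (intro mult_strict_right_mono) auto
        then show ?thesis unfolding n using z(1) by linarith
      qed (use R in simp)
      ultimately show ?thesis by (auto simp: extremal_def between_graphs_def)
    qed
    have "g \<in> closure (extremal R)"
    proof (rule Lim_in_closed_set[of _ "\<lambda>\<theta>. (\<theta> *\<^sub>R z, \<theta> * t)" "at_left 1"])
      show "\<forall>\<^sub>F \<theta> in at_left 1. (\<theta> *\<^sub>R z, \<theta> * t) \<in> closure (extremal R)"
        unfolding eventually_at_left_field by (intro exI[of _ 0]) (auto intro: subsetD[OF closure_subset in_E])
      have "((\<lambda>\<theta>. (\<theta> *\<^sub>R z, \<theta> * t)) \<longlongrightarrow> (1 *\<^sub>R z, 1 * t)) (at_left 1)"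
        by (intro tendsto_intros)
      then show "((\<lambda>\<theta>. (\<theta> *\<^sub>R z, \<theta> * t)) \<longlongrightarrow> g) (at_left 1)" by (simp add: gzt)
    qed auto
    then show "g \<in> closure (extremal R)" .
  qed
  ultimately have cl: "closure (extremal R) = ?C" by blast
  show "closure (extremal R) = {(z, t). norm z \<le> R \<and> \<bar>t\<bar> \<le> uprof R z}" unfolding cl by auto
  have nn: "0 \<le> uprof R z" if "norm z \<le> R" for z using prof_nonneg[OF R, of "norm z"] that by (simp add: uprof_def)
  have pos: "norm z < R" if "norm z \<le> R" "0 < uprof R z" for z
    using that prof_ends(1)[OF R] by (cases "norm z = R") (auto simp: uprof_def)
  have iff: "(z, t) \<in> ?C - extremal R \<longleftrightarrow> norm z \<le> R \<and> (t = uprof R z \<or> t = - uprof R z)" for z t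
  proof
    assume h: "(z, t) \<in> ?C - extremal R"
    then have z: "norm z \<le> R" "\<bar>t\<bar> \<le> uprof R z" by auto
    have "\<not> \<bar>t\<bar> < uprof R z"
    proof
      assume "\<bar>t\<bar> < uprof R z"
      then have "norm z < R" using pos[OF z(1)] by linarith
      then show False using h \<open>\<bar>t\<bar> < uprof R z\<close> by (simp add: extremal_def between_graphs_def abs_less_iff)
    qed
    then show "norm z \<le> R \<and> (t = uprof R z \<or> t = - uprof R z)" using z by linarith
  next
    assume h: "norm z \<le> R \<and> (t = uprof R z \<or> t = - uprof R z)"
    then show "(z, t) \<in> ?C - extremal R" using nn[of z] by (auto simp: extremal_def between_graphs_def)
  qed
  show "frontier (extremal R) = {(z, t). norm z \<le> R \<and> (t = uprof R z \<or> t = - uprof R z)}"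
    unfolding frontier_def interior_open[OF open_extremal] cl
  proof (rule set_eqI)
    fix g
    show "g \<in> ?C - extremal R \<longleftrightarrow> g \<in> {(z, t). norm z \<le> R \<and> (t = uprof R z \<or> t = - uprof R z)}"
      using iff[of "fst g" "snd g"] by (simp add: case_prod_unfold)
  qed
qed

lemma uprof_le: "norm z \<le> R \<Longrightarrow> uprof R z \<le> prof R 0"
  using prof_strict_antimono[of 0 "norm z" R] by (cases "z = 0") (auto simp: uprof_def)

lemma bounded_extremal: "bounded (extremal R)"
proof -
  have "extremal R \<subseteq> cball 0 R \<times> {- prof R 0..prof R 0}"
    unfolding extremal_def by (rule between_graphs_bounded) (auto intro: uprof_le)
  then show ?thesis by (rule bounded_subset[rotated]) (intro bounded_Times, auto)
qed

lemma reflect_measure: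
  fixes E :: "'n::finite heis set"
  assumes "E \<in> sets borel"
  shows "emeasure lborel ((\<lambda>(z, t). (z, - t)) ` E) = emeasure lborel E"
proof -
  have eS[measurable]: "E \<in> sets (lborel \<Otimes>\<^sub>M lborel)" using assms unfolding lborel_prod by simp
  have [measurable]: "(\<lambda>(z, t). (z, - t)) \<in> measurable (lborel \<Otimes>\<^sub>M lborel) (lborel \<Otimes>\<^sub>M (lborel :: real measure))"
    by measurable
  have eq: "(\<lambda>(z, t). (z, - t)) ` E = {g :: 'n heis. (fst g, - snd g) \<in> E}"
    by (force simp: image_iff)
  have S[measurable]: "{g :: 'n heis. (fst g, - snd g) \<in> E} \<in> sets (lborel \<Otimes>\<^sub>M lborel)"
  proof -
    have "{g \<in> space (lborel \<Otimes>\<^sub>M lborel). (fst g, - snd g) \<in> E} \<in> sets (lborel \<Otimes>\<^sub>M (lborel :: real measure))"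
      by measurable
    then show ?thesis by (simp add: space_pair_measure)
  qed
  have "emeasure lborel {g :: 'n heis. (fst g, - snd g) \<in> E} = (\<integral>\<^sup>+ z. emeasure lborel (Pair z -` {g :: 'n heis. (fst g, - snd g) \<in> E}) \<partial>lborel)"
    using lborel.emeasure_pair_measure_alt[OF S] unfolding lborel_prod .
  also have "\<dots> = (\<integral>\<^sup>+ z. emeasure lborel (Pair z -` E) \<partial>lborel)"
  proof (rule nn_integral_cong)
    fix z :: "'n horiz"
    have m: "Pair z -` E \<in> sets borel"
      using sets_Pair1[OF eS, of z] by simp
    have "Pair z -` {g :: 'n heis. (fst g, - snd g) \<in> E} = (\<lambda>t. - t) -` (Pair z -` E) \<inter> space lborel" by auto
    also have "emeasure lborel \<dots> = emeasure (distr lborel borel uminus) (Pair z -` E)"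
      using m by (subst emeasure_distr) auto
    also have "\<dots> = emeasure lborel (Pair z -` E)" by (simp add: lborel_distr_uminus)
    finally show "emeasure lborel (Pair z -` {g :: 'n heis. (fst g, - snd g) \<in> E}) = emeasure lborel (Pair z -` E)" .
  qed
  also have "\<dots> = emeasure lborel E"
    using lborel.emeasure_pair_measure_alt[OF eS] unfolding lborel_prod by simp
  finally show ?thesis by (simp add: eq)
qed

lemma extremal_class_E:
  assumes R: "R > 0"
  shows "(extremal R :: 'n::finite heis set) \<in> class_E"
proof -
  let ?E = "extremal R :: 'n heis set"
  have oU: "open (upper_half :: 'n heis set)" and oL: "open (lower_half :: 'n heis set)"
    unfolding upper_half_def lower_half_def case_prod_unfold
    by (intro open_Collect_less continuous_intros)+
  have "(\<lambda>(z, t). (z, - t)) ` (?E \<inter> upper_half) = ?E \<inter> lower_half"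
  proof (intro subset_antisym subsetI)
    fix g assume "g \<in> ?E \<inter> lower_half"
    then have "(fst g, - snd g) \<in> ?E \<inter> upper_half"
      by (simp add: extremal_def between_graphs_def upper_half_def lower_half_def case_prod_unfold)
    then show "g \<in> (\<lambda>(z, t). (z, - t)) ` (?E \<inter> upper_half)"
      by (rule rev_image_eqI) simp
  qed (auto simp: extremal_def between_graphs_def upper_half_def lower_half_def)
  then have "emeasure lborel (?E \<inter> lower_half) = emeasure lborel ((\<lambda>(z, t). (z, - t)) ` (?E \<inter> upper_half))"
    by simp
  also have "\<dots> = emeasure lborel (?E \<inter> upper_half)"
    by (intro reflect_measure sets.Int borel_open oU open_extremal)
  finally have m: "emeasure lebesgue (?E \<inter> upper_half) = emeasure lebesgue (?E \<inter> lower_half)"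
    using oU oL open_extremal[of R, where 'a='n] by simp
  have e0: "uprof R z = 0" if "norm z = R" for z :: "'n horiz"
    using prof_ends(1)[OF R] that by (simp add: uprof_def)
  have nn: "0 \<le> uprof R z" if "norm z \<le> R" for z :: "'n horiz"
    using prof_nonneg[OF R, of "norm z"] that by (simp add: uprof_def)
  have lt: "norm z < R" if "norm z \<le> R" "uprof R z \<noteq> 0" for z :: "'n horiz"
    using e0[of z] that by (cases "norm z = R") auto
  have u: "frontier ?E \<inter> upper_half = {(z, t) \<in> upper_half. norm z < R \<and> t = uprof R z}"
    unfolding frontier_extremal(1)[OF R] upper_half_def using nn lt by fastforce
  have l: "frontier ?E \<inter> lower_half = {(z, t) \<in> lower_half. norm z < R \<and> t = - uprof R z}"
    unfolding frontier_extremal(1)[OF R] lower_half_def using nn lt by fastforce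
  have d: "{z \<in> ball 0 R. uprof R z = 0} \<inter> {z \<in> ball 0 R. uprof R z = 0} = ({} :: 'n horiz set)"
    using uprof_pos by fastforce
  show ?thesis
    unfolding class_E_def using m u l d graph_profile_uprof[OF R, where 'a='n] R
    by (auto simp: extremal_def intro!: exI[of _ R] exI[of _ "uprof R"])
qed

section \<open>The variational problem\<close>

lemma perimeter_pairing:
  fixes u v :: "'n::finite horiz \<Rightarrow> real"
  assumes R: "R > 0" and u: "C1_on (ball 0 R) u Du" "graph_profile R u"
    and v: "C1_on (ball 0 R) v Dv" "graph_profile R v"
    and pos: "\<And>z. z \<in> ball 0 R \<Longrightarrow> 0 < u z + v z"
    and a: "admissible_field R Ka a Ga" and b: "admissible_field R Kb b Gb"
  shows "ereal (real (2 * CARD('n)) / R * measure lborel (between_graphs R u v) + graph_pairing 1 R u a Ga + graph_pairing (-1) R v b Gb)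
    \<le> H_perimeter (between_graphs R u v) UNIV"
proof -
  have cu: "continuous_on (cball 0 R) u" "continuous_on (cball 0 R) v"
    and nn: "\<And>z. z \<in> cball 0 R \<Longrightarrow> 0 \<le> u z" "\<And>z. z \<in> cball 0 R \<Longrightarrow> 0 \<le> v z"
    using u v by (auto simp: graph_profile_def)
  have "bounded (u ` cball 0 R)" "bounded (v ` cball 0 R)"
    by (intro compact_imp_bounded compact_continuous_image cu compact_cball)+
  then obtain Mu Mv where M: "\<forall>x\<in>u ` cball 0 R. norm x \<le> Mu" "\<forall>x\<in>v ` cball 0 R. norm x \<le> Mv"
    unfolding bounded_iff by blast
  have Ma: "u z \<le> max Mu Mv" "v z \<le> max Mu Mv" if "z \<in> ball 0 R" for z
  proof -
    have "z \<in> cball 0 R" using that by simp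
    then have "norm (u z) \<le> Mu" "norm (v z) \<le> Mv" using M by blast+
    then show "u z \<le> max Mu Mv" "v z \<le> max Mu Mv" by auto
  qed
  have "ereal (real DIM('n horiz) / R * measure lborel (between_graphs R u v)
     + (LINT z|lborel. indicator (ball 0 R) z * (u z * divg Ga z - inner (a z) (rotJ z) / 2))
     + (LINT z|lborel. indicator (ball 0 R) z * (v z * divg Gb z + inner (b z) (rotJ z) / 2)))
     \<le> H_perimeter (between_graphs R u v) UNIV"
    by (rule H_perimeter_lower_bound[OF R u(1) v(1) _ _ pos Ma, of "Ka \<union> Kb"])
       (use a b nn in \<open>auto simp: admissible_field_def\<close>)
  then show ?thesis by (simp add: graph_pairing_def)
qed

text \<open>The inequality follows by approximating both pairings. In the equality case a graph that
  fails to be calibrated at one point would gain a fixed amount over \<open>profile_term\<close>,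
  and the other graph can be approximated with a smaller loss, which contradicts the upper bound. So
  both graphs are calibrated and rigidity applies.\<close>

lemma perimeter_ge:
  fixes u v :: "'n::finite horiz \<Rightarrow> real"
  assumes R: "R > 0" and u: "graph_profile R u" and v: "graph_profile R v"
    and pos: "\<And>z. z \<in> ball 0 R \<Longrightarrow> 0 < u z + v z"
  defines "X \<equiv> real (2 * CARD('n)) / R * measure lborel (between_graphs R u v) + 2 * profile_term R TYPE('n)"
    and "P \<equiv> H_perimeter (between_graphs R u v) UNIV"
  shows "ereal X \<le> P" "P \<le> ereal X \<Longrightarrow> between_graphs R u v = extremal R"
proof -
  let ?V = "real (2 * CARD('n)) / R * measure lborel (between_graphs R u v)"
  let ?p = "profile_term R TYPE('n)"
  obtain Du where Du: "C1_on (ball 0 R) u Du"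
    using C1_on_if_Cn_on[of "ball 0 R" 1 u] u by (auto simp: graph_profile_def C_on_numeral_iff numeral_2_eq_2)
  obtain Dv where Dv: "C1_on (ball 0 R) v Dv"
    using C1_on_if_Cn_on[of "ball 0 R" 1 v] v by (auto simp: graph_profile_def C_on_numeral_iff numeral_2_eq_2)
  have pp: "ereal (?V + graph_pairing 1 R u a Ga + graph_pairing (-1) R v b Gb) \<le> P"
    if "admissible_field R Ka a Ga" "admissible_field R Kb b Gb" for Ka Kb a b Ga Gb
    unfolding P_def by (rule perimeter_pairing[OF R Du u Dv v _ that]) (rule pos)
  have s: "(1::real)\<^sup>2 = 1" "(-1::real)\<^sup>2 = 1" by auto
  have approx: "ereal (?V + ?p + ?p - e) < P" if "e > 0" for e
  proof -
    obtain K a Ga where a: "admissible_field R K a Ga" "?p - e / 2 < graph_pairing 1 R u a Ga"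
      using pairing_approx[OF R s(1), of "?p - e / 2" u] \<open>e > 0\<close> by auto
    obtain L b Gb where b: "admissible_field R L b Gb" "?p - e / 2 < graph_pairing (-1) R v b Gb"
      using pairing_approx[OF R s(2), of "?p - e / 2" v] \<open>e > 0\<close> by auto
    have "?V + ?p + ?p - e < ?V + graph_pairing 1 R u a Ga + graph_pairing (-1) R v b Gb"
      using a b by linarith
    then have "ereal (?V + ?p + ?p - e) < ereal (?V + graph_pairing 1 R u a Ga + graph_pairing (-1) R v b Gb)" by simp
    also note pp[OF a(1) b(1)]
    finally show ?thesis .
  qed
  show X: "ereal X \<le> P"
  proof (rule ccontr)
    assume "\<not> ?thesis"
    then have lt: "P < ereal X" by simp
    moreover have "P \<noteq> - \<infinity>" using approx[of 1] by auto
    ultimately obtain p where p: "P = ereal p" by (cases P) auto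
    then show False using approx[of "X - p"] lt by (simp add: X_def)
  qed
  assume le: "P \<le> ereal X"
  have u': "u z = uprof R z" if z: "z \<in> cball 0 R" for z
  proof (rule calibrated_eq_uprof[OF R s(1) Du _ _ _ z])
    fix z assume z: "z \<in> ball 0 R" "z \<noteq> (0::'n horiz)"
    show "norm (Du z + (1 / 2) *\<^sub>R rotJ z) \<le> inner (- (Du z + (1 / 2) *\<^sub>R rotJ z)) (calib 1 R z)"
    proof (rule ccontr)
      assume "\<not> ?thesis"
      then obtain K a Ga where a: "admissible_field R K a Ga" "?p < graph_pairing 1 R u a Ga"
        using pairing_strict[OF R s(1) Du z] by auto
      \<comment> \<open>The gain on the upper graph is the error allowed on the lower one.\<close>
      define e where "e = graph_pairing 1 R u a Ga - ?p"
      obtain L b Gb where b: "admissible_field R L b Gb" "?p - e < graph_pairing (-1) R v b Gb"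
        using pairing_approx[OF R s(2), of "?p - e" v] a by (auto simp: e_def)
      have "X < ?V + graph_pairing 1 R u a Ga + graph_pairing (-1) R v b Gb"
        using b by (simp add: X_def e_def)
      then have "ereal X < ereal (?V + graph_pairing 1 R u a Ga + graph_pairing (-1) R v b Gb)" by simp
      also note pp[OF a(1) b(1)]
      finally show False using le by simp
    qed
  qed (use u in \<open>auto simp: graph_profile_def\<close>)
  have v': "v z = uprof R z" if z: "z \<in> cball 0 R" for z
  proof (rule calibrated_eq_uprof[OF R s(2) Dv _ _ _ z])
    fix z assume z: "z \<in> ball 0 R" "z \<noteq> (0::'n horiz)"
    show "norm (Dv z + (-1 / 2) *\<^sub>R rotJ z) \<le> inner (- (Dv z + (-1 / 2) *\<^sub>R rotJ z)) (calib (-1) R z)"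
    proof (rule ccontr)
      assume "\<not> ?thesis"
      then obtain K b Gb where b: "admissible_field R K b Gb" "?p < graph_pairing (-1) R v b Gb"
        using pairing_strict[OF R s(2) Dv z] by auto
      define e where "e = graph_pairing (-1) R v b Gb - ?p"
      obtain L a Ga where a: "admissible_field R L a Ga" "?p - e < graph_pairing 1 R u a Ga"
        using pairing_approx[OF R s(1), of "?p - e" u] b by (auto simp: e_def)
      have "X < ?V + graph_pairing 1 R u a Ga + graph_pairing (-1) R v b Gb"
        using a by (simp add: X_def e_def)
      then have "ereal X < ereal (?V + graph_pairing 1 R u a Ga + graph_pairing (-1) R v b Gb)" by simp
      also note pp[OF a(1) b(1)]
      finally show False using le by simp
    qed
  qed (use v in \<open>auto simp: graph_profile_def\<close>)
  show "between_graphs R u v = extremal R"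
    unfolding extremal_def between_graphs_def using u' v' by auto
qed

section \<open>Constants and the comparison of radii\<close>

lemma bernoulli_le: "0 < x \<Longrightarrow> real (Suc m) * x - real m \<le> x ^ Suc m"
proof (induction m)
  case (Suc m)
  have "real (Suc (Suc m)) * x - real (Suc m) \<le> x * (real (Suc m) * x - real m)"
  proof -
    have "x * (real (Suc m) * x - real m) - (real (Suc (Suc m)) * x - real (Suc m)) = real (Suc m) * (x - 1)\<^sup>2"
      by (simp add: power2_eq_square algebra_simps)
    moreover have "0 \<le> real (Suc m) * (x - 1)\<^sup>2" by simp
    ultimately show ?thesis by linarith
  qed
  also have "\<dots> \<le> x * x ^ Suc m" using Suc by (intro mult_left_mono) auto
  finally show ?case by simp
qed simp

lemma bernoulli_less:
  assumes "0 < x" "x \<noteq> 1" "m > 0"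
  shows "real (Suc m) * x - real m < x ^ Suc m"
proof -
  obtain k where m: "m = Suc k" using \<open>m > 0\<close> by (cases m) auto
  have "real (Suc m) * x - real m < x * (real (Suc k) * x - real k)"
  proof -
    have "x * (real (Suc k) * x - real k) - (real (Suc m) * x - real m) = real (Suc k) * (x - 1)\<^sup>2"
      by (simp add: m power2_eq_square algebra_simps)
    moreover have "0 < real (Suc k) * (x - 1)\<^sup>2" using assms by simp
    ultimately show ?thesis by linarith
  qed
  also have "\<dots> \<le> x * x ^ Suc k" using assms by (intro mult_left_mono bernoulli_le) auto
  finally show ?thesis by (simp add: m)
qed

text \<open>The volume of \<open>extremal 1\<close>; see \<open>extremal_volume\<close>.\<close>

definition volume_const :: "'n::finite itself \<Rightarrow> real" where
  "volume_const _ = ball_vol TYPE('n) / 2 * Beta (real CARD('n) + 3 / 2) (1 / 2)"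

lemma volume_const_pos: "volume_const TYPE('n::finite) > 0"
  unfolding volume_const_def by (intro mult_pos_pos beta_nonneg) auto

text \<open>Pairing, perimeter and volume produce three different Beta values. The recursions
  express them all by the one occurring in the volume, so that a single constant survives in the
  comparison.\<close>

lemma beta_half_eqs:
  "Beta (real n + 1 / 2) (1 / 2) = (2 * real n + 2) / (2 * real n + 1) * Beta (real n + 3 / 2) (1 / 2)"
  "Beta (real n + 1 / 2) (3 / 2) = Beta (real n + 3 / 2) (1 / 2) / (2 * real n + 1)"
proof -
  have nz: "real n + 1 / 2 \<notin> \<int>\<^sub>\<le>\<^sub>0" "(1 / 2 :: real) \<notin> \<int>\<^sub>\<le>\<^sub>0"
    using nonpos_Ints_nonpos[of "real n + 1 / 2"] nonpos_Ints_nonpos[of "1 / 2 :: real"] by auto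
  have 1: "(real n + 1) * Beta (real n + 3 / 2) (1 / 2) = (real n + 1 / 2) * Beta (real n + 1 / 2) (1 / 2)"
    using Beta_plus1_left[OF nz(1), of "1 / 2"] by (simp add: add.assoc)
  have 2: "(real n + 1) * Beta (real n + 1 / 2) (3 / 2) = 1 / 2 * Beta (real n + 1 / 2) (1 / 2)"
    using Beta_plus1_right[OF nz(2), of "real n + 1 / 2"] by (simp add: algebra_simps)
  show 3: "Beta (real n + 1 / 2) (1 / 2) = (2 * real n + 2) / (2 * real n + 1) * Beta (real n + 3 / 2) (1 / 2)"
    using 1 by (simp add: field_simps)
  have "real n + 1 > 0" by simp
  then have "Beta (real n + 1 / 2) (3 / 2) = 1 / 2 * Beta (real n + 1 / 2) (1 / 2) / (real n + 1)"
    using 2 by (simp add: field_simps)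
  also have "\<dots> = Beta (real n + 3 / 2) (1 / 2) / (2 * real n + 1)"
    unfolding 3 by (simp add: divide_simps) (simp add: algebra_simps)
  finally show "Beta (real n + 1 / 2) (3 / 2) = Beta (real n + 3 / 2) (1 / 2) / (2 * real n + 1)" .
qed

lemma extremal_volume:
  "R > 0 \<Longrightarrow> emeasure lborel (extremal R :: 'n::finite heis set) = ennreal (volume_const TYPE('n) * R ^ (2 * CARD('n) + 2))"
  using emeasure_extremal[of R, where 'n='n] by (simp add: volume_const_def mult_ac)

lemma profile_term_const:
  assumes "R > 0"
  shows "2 * profile_term R TYPE('n::finite) = 2 * real CARD('n) / (2 * real CARD('n) + 1) * volume_const TYPE('n) * R ^ (2 * CARD('n) + 1)"
  unfolding profile_term_eq[OF assms] beta_half_eqs volume_const_def by (simp add: field_simps)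

lemma extremal_perimeter_le:
  assumes R: "R > 0"
  shows "H_perimeter (extremal R :: 'n::finite heis set) UNIV \<le>
    ereal (2 * real CARD('n) * (2 * real CARD('n) + 2) / (2 * real CARD('n) + 1) * volume_const TYPE('n) * R ^ (2 * CARD('n) + 1))"
    (is "_ \<le> ereal ?P")
proof (rule H_perimeter_extremal_le[OF R])
  have "real CARD('n) * ball_vol TYPE('n) * (R ^ (2 * CARD('n) + 1) * Beta (real CARD('n) + 1 / 2) (1 / 2)) = ?P"
    unfolding beta_half_eqs volume_const_def by (simp add: divide_simps)
  then show "(\<integral>\<^sup>+ z. ennreal (R * norm z / sqrt (R\<^sup>2 - (norm z)\<^sup>2)) * indicator (ball (0::'n::finite horiz) R) z \<partial>lborel) \<le> ennreal ?P"
    unfolding slope_integral_nn[OF R, where 'n='n] by simp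
  show "0 \<le> ?P" using R volume_const_pos[where 'n='n] by (intro mult_nonneg_nonneg divide_nonneg_nonneg) auto
qed

text \<open>\<open>X\<close> is the lower bound for a competitor of radius \<open>r\<close>, and
  \<open>P\<close> is its value at \<open>r = R\<close>. With \<open>x = r / R\<close> the
  difference is a positive multiple of \<open>x ^ (2 n + 2) - ((2 n + 2) * x - (2 n + 1))\<close>,
  the gap between a power and its tangent at 1.\<close>

lemma candidate_perimeter:
  assumes R: "R > 0" and r: "r > 0" and n: "n > 0" and k: "k > 0"
  defines "P \<equiv> 2 * real n * (2 * real n + 2) / (2 * real n + 1) * k * R ^ (2 * n + 1)"
    and "X \<equiv> real (2 * n) / r * (k * R ^ (2 * n + 2)) + 2 * real n / (2 * real n + 1) * k * r ^ (2 * n + 1)"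
  shows "P \<le> X" "r \<noteq> R \<Longrightarrow> P < X"
proof -
  let ?m = "2 * n + 1"
  define x where "x = r / R"
  have x: "x > 0" "r = R * x" using R r by (auto simp: x_def)
  define c where "c = 2 * real n / (2 * real n + 1) * k * R ^ ?m / x"
  have c: "c > 0" using R x n k by (auto simp: c_def intro!: mult_pos_pos divide_pos_pos)
  have "X - P = c * (x ^ Suc ?m - (real (Suc ?m) * x - real ?m))"
  proof -
    \<comment> \<open>The powers are treated as independent unknowns: \<open>a = 2 n\<close>,
      \<open>A = R ^ (2 n + 1)\<close>, \<open>y = x ^ (2 n + 1)\<close>.\<close>
    have "a / (R * x) * (k * (R * A)) + a / (a + 1) * k * (A * y) - a * (a + 2) / (a + 1) * k * A
      = a / (a + 1) * k * A / x * (x * y - ((a + 2) * x - (a + 1)))" if "0 < a" for a A y :: real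
      using R x(1) that by (simp add: divide_simps) (simp add: algebra_simps)
    from this[of "2 * real n" "R ^ ?m" "x ^ ?m"] show ?thesis
      using n unfolding X_def P_def c_def x(2) by (simp add: power_mult_distrib algebra_simps)
  qed
  then have eq: "X = P + c * (x ^ Suc ?m - (real (Suc ?m) * x - real ?m))" by simp
  show "P \<le> X" unfolding eq using bernoulli_le[OF x(1), of ?m] c by (simp add: mult_nonneg_nonneg)
  assume "r \<noteq> R"
  then have "x \<noteq> 1" using R by (auto simp: x_def)
  then have "0 < c * (x ^ Suc ?m - (real (Suc ?m) * x - real ?m))"
    using bernoulli_less[OF x(1) _, of ?m] c by (intro mult_pos_pos) auto
  then show "P < X" unfolding eq by linarith
qed

text \<open>No competitor lies below \<open>?P\<close>, by the comparison of radii. The extremal set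
  does not lie above it, by the smoothing estimate. A competitor that attains \<open>?P\<close> must
  have radius \<open>R\<close>, and then the equality case identifies it.\<close>

theorem extremal_unique_minimizer:
  fixes E :: "'n::finite heis set"
  assumes R: "R > 0" and V: "V = volume_const TYPE('n) * R ^ (2 * CARD('n) + 2)"
  shows "is_arg_min (\<lambda>F. H_perimeter F UNIV) (\<lambda>F. F \<in> class_E \<and> emeasure lebesgue F = ennreal V) E \<longleftrightarrow> E = extremal R"
proof -
  let ?P = "2 * real CARD('n) * (2 * real CARD('n) + 2) / (2 * real CARD('n) + 1) * volume_const TYPE('n) * R ^ (2 * CARD('n) + 1)"
  have V0: "V > 0" unfolding V using R volume_const_pos[where 'n='n] by simp
  have main: "ereal ?P \<le> H_perimeter F UNIV \<and> (H_perimeter F UNIV \<le> ereal ?P \<longrightarrow> F = extremal R)"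
    if F: "F \<in> class_E" "emeasure lebesgue F = ennreal V" for F :: "'n heis set"
  proof -
    obtain r u v where r: "r > 0" and u: "graph_profile r u" and v: "graph_profile r v"
      and d: "{z \<in> ball 0 r. u z = 0} \<inter> {z \<in> ball 0 r. v z = 0} = {}" and Fe: "F = between_graphs r u v"
      using F(1) unfolding class_E_def by blast
    have nn: "0 \<le> u z" "0 \<le> v z" if "z \<in> ball 0 r" for z
      using u v that by (auto simp: graph_profile_def)
    have pos: "0 < u z + v z" if "z \<in> ball 0 r" for z
      using nn[OF that] d that by (cases "u z = 0"; cases "v z = 0") (auto simp: add_pos_nonneg add_nonneg_pos)
    have cu: "continuous_on (ball 0 r) u" "continuous_on (ball 0 r) v"
      using u v by (auto simp: graph_profile_def intro: continuous_on_subset)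
    have "F \<in> sets borel" unfolding Fe using open_between_graphs[OF cu] by simp
    then have "emeasure lborel F = ennreal V" using F(2) by simp
    then have mF: "measure lborel F = V" using V0 by (simp add: measure_def)
    have n: "CARD('n) > 0" by simp
    note cp = candidate_perimeter[OF R r n volume_const_pos[where 'n='n]]
    have pg: "ereal (real (2 * CARD('n)) / r * (volume_const TYPE('n) * R ^ (2 * CARD('n) + 2))
         + 2 * real CARD('n) / (2 * real CARD('n) + 1) * volume_const TYPE('n) * r ^ (2 * CARD('n) + 1)) \<le> H_perimeter F UNIV"
      "H_perimeter F UNIV \<le> ereal (real (2 * CARD('n)) / r * (volume_const TYPE('n) * R ^ (2 * CARD('n) + 2))
         + 2 * real CARD('n) / (2 * real CARD('n) + 1) * volume_const TYPE('n) * r ^ (2 * CARD('n) + 1)) \<Longrightarrow> F = extremal r"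
      using perimeter_ge[OF r u v, folded Fe, unfolded mF profile_term_const[OF r] V] pos by auto
    show ?thesis
    proof (intro conjI impI)
      have "ereal ?P \<le> ereal (real (2 * CARD('n)) / r * (volume_const TYPE('n) * R ^ (2 * CARD('n) + 2))
         + 2 * real CARD('n) / (2 * real CARD('n) + 1) * volume_const TYPE('n) * r ^ (2 * CARD('n) + 1))"
        using cp(1) by simp
      also note pg(1)
      finally show P: "ereal ?P \<le> H_perimeter F UNIV" .
      assume le: "H_perimeter F UNIV \<le> ereal ?P"
      have rR: "r = R"
      proof (rule ccontr)
        assume "r \<noteq> R"
        then have "ereal ?P < ereal (real (2 * CARD('n)) / r * (volume_const TYPE('n) * R ^ (2 * CARD('n) + 2))
           + 2 * real CARD('n) / (2 * real CARD('n) + 1) * volume_const TYPE('n) * r ^ (2 * CARD('n) + 1))"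
          using cp(2) by simp
        also note pg(1)
        finally show False using le by simp
      qed
      have "H_perimeter F UNIV \<le> ereal (real (2 * CARD('n)) / r * (volume_const TYPE('n) * R ^ (2 * CARD('n) + 2))
         + 2 * real CARD('n) / (2 * real CARD('n) + 1) * volume_const TYPE('n) * r ^ (2 * CARD('n) + 1))"
        using le cp(1) by (auto intro: order_trans)
      from pg(2)[OF this] show "F = extremal R" by (simp add: rR)
    qed
  qed
  have ER: "(extremal R :: 'n heis set) \<in> class_E" "emeasure lebesgue (extremal R :: 'n heis set) = ennreal V"
    using extremal_class_E[OF R] extremal_volume[OF R, where 'n='n] by (auto simp: V open_extremal)
  have PE: "H_perimeter (extremal R :: 'n heis set) UNIV = ereal ?P"
    using extremal_perimeter_le[OF R, where 'n='n] main[OF ER] by (auto intro: antisym)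
  show ?thesis
  proof
    assume "is_arg_min (\<lambda>F. H_perimeter F UNIV) (\<lambda>F. F \<in> class_E \<and> emeasure lebesgue F = ennreal V) E"
    then have E: "E \<in> class_E" "emeasure lebesgue E = ennreal V" and "\<not> H_perimeter (extremal R :: 'n heis set) UNIV < H_perimeter E UNIV"
      using ER unfolding is_arg_min_def by blast+
    then show "E = extremal R" using main[OF E] PE by (simp add: not_less)
  next
    assume E: "E = extremal R"
    have "\<not> H_perimeter F UNIV < H_perimeter (extremal R :: 'n heis set) UNIV"
      if "F \<in> class_E \<and> emeasure lebesgue F = ennreal V" for F :: "'n heis set"
      unfolding PE using main[of F] that by (simp add: not_less)
    then show "is_arg_min (\<lambda>F. H_perimeter F UNIV) (\<lambda>F. F \<in> class_E \<and> emeasure lebesgue F = ennreal V) E"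
      unfolding is_arg_min_def E using ER by blast
  qed
qed

section \<open>Defining functions of the boundary\<close>

text \<open>The boundary away from the poles is \<open>(norm z)\<^sup>2 = height R t\<close>: with \<open>norm z = R * cos \<theta>\<close> the
  profile becomes \<open>t = height_angle R \<theta>\<close>, which is smoothly invertible for \<open>\<bar>\<theta>\<bar> < pi / 2\<close>.\<close>

definition height_angle :: "real \<Rightarrow> real \<Rightarrow> real" where
  "height_angle R \<theta> = R\<^sup>2 * (\<theta> / 4 + sin (2 * \<theta>) / 8)"

lemma height_angle_deriv:
  "(height_angle R has_real_derivative R\<^sup>2 * (cos \<theta>)\<^sup>2 / 2) (at \<theta>)"
proof -
  have "(height_angle R has_real_derivative R\<^sup>2 * (1 / 4 + cos (2 * \<theta>) * 2 / 8)) (at \<theta>)"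
    unfolding height_angle_def[abs_def] by (auto intro!: derivative_eq_intros)
  also have "R\<^sup>2 * (1 / 4 + cos (2 * \<theta>) * 2 / 8) = R\<^sup>2 * (cos \<theta>)\<^sup>2 / 2"
    unfolding cos_double_cos by (simp add: field_simps)
  finally show ?thesis .
qed

lemma height_angle_strict_mono:
  assumes "R > 0" "- (pi / 2) \<le> a" "a < b" "b \<le> pi / 2"
  shows "height_angle R a < height_angle R b"
proof (rule DERIV_pos_imp_increasing_open[OF assms(3)])
  show "\<exists>y. (height_angle R has_real_derivative y) (at x) \<and> 0 < y" if "a < x" "x < b" for x
  proof (intro exI conjI)
    show "(height_angle R has_real_derivative R\<^sup>2 * (cos x)\<^sup>2 / 2) (at x)" by (rule height_angle_deriv)
    show "0 < R\<^sup>2 * (cos x)\<^sup>2 / 2" using cos_gt_zero_pi[of x] that assms by auto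
  qed
  show "continuous_on {a..b} (height_angle R)"
    by (meson DERIV_isCont continuous_at_imp_continuous_on height_angle_deriv)
qed

lemma height_angle_minus: "height_angle R (- \<theta>) = - height_angle R \<theta>"
  by (simp add: height_angle_def algebra_simps)

lemma height_angle_half_pi: "height_angle R (pi / 2) = pi * R\<^sup>2 / 8"
  by (simp add: height_angle_def)

lemma prof_height_angle:
  assumes R: "R > 0" and th: "0 \<le> \<theta>" "\<theta> \<le> pi / 2"
  shows "prof R (R * cos \<theta>) = height_angle R \<theta>"
proof -
  have "R\<^sup>2 - (R * cos \<theta>)\<^sup>2 = (R * sin \<theta>)\<^sup>2" by (simp add: power_mult_distrib sin_squared_eq algebra_simps)
  moreover have "0 \<le> sin \<theta>" using th by (intro sin_ge_zero) auto
  ultimately have s: "sqrt (R\<^sup>2 - (R * cos \<theta>)\<^sup>2) = R * sin \<theta>" using R by simp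
  have "arcsin (cos \<theta>) = arcsin (sin (pi / 2 - \<theta>))" by (simp add: sin_cos_eq)
  also have "\<dots> = pi / 2 - \<theta>" using th by (intro arcsin_sin) auto
  finally have as: "arcsin (R * cos \<theta> / R) = pi / 2 - \<theta>" using R by simp
  show ?thesis unfolding prof_def height_angle_def s as sin_double by (simp add: power2_eq_square field_simps)
qed

section \<open>Inversion of the height along the profile\<close>

definition angle :: "real \<Rightarrow> real \<Rightarrow> real" where
  "angle R t = (THE \<theta>. - (pi / 2) < \<theta> \<and> \<theta> < pi / 2 \<and> height_angle R \<theta> = t)"

lemma angle_unique:
  assumes "R > 0" "- (pi / 2) < \<theta>" "\<theta> < pi / 2"
  shows "angle R (height_angle R \<theta>) = \<theta>"
  unfolding angle_def
proof (rule the_equality)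
  fix \<theta>' assume "- (pi / 2) < \<theta>' \<and> \<theta>' < pi / 2 \<and> height_angle R \<theta>' = height_angle R \<theta>"
  then show "\<theta>' = \<theta>"
    using height_angle_strict_mono[of R \<theta> \<theta>'] height_angle_strict_mono[of R \<theta>' \<theta>] assms
    by (cases \<theta> \<theta>' rule: linorder_cases) auto
qed (use assms in auto)

lemma angle:
  assumes R: "R > 0" and t: "\<bar>t\<bar> < pi * R\<^sup>2 / 8"
  shows "- (pi / 2) < angle R t" "angle R t < pi / 2" "height_angle R (angle R t) = t"
proof -
  have c: "continuous_on {- (pi / 2)..pi / 2} (height_angle R)"
    by (meson DERIV_isCont continuous_at_imp_continuous_on height_angle_deriv)
  have e: "height_angle R (- (pi / 2)) = - (pi * R\<^sup>2 / 8)" by (simp only: height_angle_minus height_angle_half_pi)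
  obtain \<theta> where th: "- (pi / 2) \<le> \<theta>" "\<theta> \<le> pi / 2" "height_angle R \<theta> = t"
  proof -
    have "height_angle R (- (pi / 2)) \<le> t" "t \<le> height_angle R (pi / 2)" "- (pi / 2) \<le> pi / 2"
      using t unfolding e height_angle_half_pi by auto
    from IVT'[OF this c] show ?thesis using that by blast
  qed
  moreover have "\<theta> \<noteq> pi / 2"
  proof
    assume "\<theta> = pi / 2"
    then have "t = height_angle R (pi / 2)" using th(3) by (simp only:)
    then have "t = pi * R\<^sup>2 / 8" unfolding height_angle_half_pi .
    then show False using t by simp
  qed
  moreover have "\<theta> \<noteq> - (pi / 2)"
  proof
    assume "\<theta> = - (pi / 2)"
    then have "t = height_angle R (- (pi / 2))" using th(3) by (simp only:)
    then have "t = - (pi * R\<^sup>2 / 8)" unfolding e .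
    then show False using t by simp
  qed
  ultimately have th': "- (pi / 2) < \<theta>" "\<theta> < pi / 2" by auto
  have "angle R t = \<theta>" using angle_unique[OF R th'] th(3) by simp
  then show "- (pi / 2) < angle R t" "angle R t < pi / 2" "height_angle R (angle R t) = t"
    using th th' by auto
qed

text \<open>The tangent is the convenient coordinate because its \<open>t\<close>-derivative is a
  polynomial in itself, and \<open>height\<close> has derivative \<open>- 4 * tangent\<close>. All
  further derivatives then stay polynomial in \<open>tangent\<close>.\<close>

definition tangent :: "real \<Rightarrow> real \<Rightarrow> real" where
  "tangent R t = tan (angle R t)"

definition height :: "real \<Rightarrow> real \<Rightarrow> real" where
  "height R t = R\<^sup>2 / (1 + (tangent R t)\<^sup>2)"

lemma one_plus_square_pos: "0 < 1 + (x::real)\<^sup>2"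
  by (simp add: add_pos_nonneg)

lemma tangent_deriv:
  assumes R: "R > 0" and t: "\<bar>t\<bar> < pi * R\<^sup>2 / 8"
  shows "(tangent R has_real_derivative 2 * (1 + (tangent R t)\<^sup>2)\<^sup>2 / R\<^sup>2) (at t)"
proof -
  note a = angle[OF R t]
  have c: "cos (angle R t) > 0" using a by (intro cos_gt_zero_pi) auto
  \<comment> \<open>Half the distance from the angle to the nearer end of the interval, so that
    \<open>angle_unique\<close> applies in the whole neighbourhood.\<close>
  define d where "d = min (pi / 2 - angle R t) (angle R t + pi / 2) / 2"
  have d: "d > 0" using a by (auto simp: d_def)
  have "isCont (angle R) (height_angle R (angle R t))"
  proof (rule isCont_inverse_function[OF d, where f="height_angle R" and x="angle R t"])
    show "angle R (height_angle R z) = z" if "\<bar>z - angle R t\<bar> \<le> d" for z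
    proof (rule angle_unique[OF R])
      show "- (pi / 2) < z" "z < pi / 2"
      proof -
        have "d \<le> (pi / 2 - angle R t) / 2" "d \<le> (angle R t + pi / 2) / 2" by (auto simp: d_def)
        moreover have "z - angle R t \<le> d" "angle R t - z \<le> d" using that by auto
        ultimately have "- (pi / 2) < z \<and> z < pi / 2" using a(1,2) by argo
        then show "- (pi / 2) < z" "z < pi / 2" by auto
      qed
    qed
    show "isCont (height_angle R) z" for z using height_angle_deriv DERIV_isCont by blast
  qed
  then have ic: "isCont (angle R) t" using a by simp
  have "(angle R has_real_derivative inverse (R\<^sup>2 * (cos (angle R t))\<^sup>2 / 2)) (at t)"
  proof (rule DERIV_inverse_function[OF height_angle_deriv _ _ _ _ ic])
    show "R\<^sup>2 * (cos (angle R t))\<^sup>2 / 2 \<noteq> 0" using c R by simp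
    show "- (pi * R\<^sup>2 / 8) < t" "t < pi * R\<^sup>2 / 8" using t by auto
    show "height_angle R (angle R y) = y" if "- (pi * R\<^sup>2 / 8) < y" "y < pi * R\<^sup>2 / 8" for y
      using that by (intro angle[OF R]) (auto simp: abs_if)
  qed
  from DERIV_chain2[OF DERIV_tan this] c
  have "(tangent R has_real_derivative inverse ((cos (angle R t))\<^sup>2) * inverse (R\<^sup>2 * (cos (angle R t))\<^sup>2 / 2)) (at t)"
    by (simp add: tangent_def[abs_def])
  also have "inverse ((cos (angle R t))\<^sup>2) * inverse (R\<^sup>2 * (cos (angle R t))\<^sup>2 / 2)
    = 2 * (inverse ((cos (angle R t))\<^sup>2))\<^sup>2 / R\<^sup>2"
  proof -
    have "inverse C * inverse (R\<^sup>2 * C / 2) = 2 * (inverse C)\<^sup>2 / R\<^sup>2" if "C \<noteq> 0" for C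
      using that R by (simp add: field_simps power2_eq_square)
    then show ?thesis using c by simp
  qed
  also have "inverse ((cos (angle R t))\<^sup>2) = 1 + (tangent R t)\<^sup>2"
    using c tan_sec[of "angle R t"] by (simp add: tangent_def power_inverse)
  finally show ?thesis .
qed

lemma height_cos: 
  assumes "R > 0" "\<bar>t\<bar> < pi * R\<^sup>2 / 8"
  shows "height R t = (R * cos (angle R t))\<^sup>2"
proof -
  have c: "cos (angle R t) > 0" using angle[OF assms] by (intro cos_gt_zero_pi) auto
  then have "1 + (tangent R t)\<^sup>2 = 1 / (cos (angle R t))\<^sup>2"
    using tan_sec[of "angle R t"] by (simp add: tangent_def power_inverse divide_inverse)
  then show ?thesis using c by (simp add: height_def power_mult_distrib)
qed

lemma height_bounds: 
  assumes "R > 0" shows "0 < height R t" "height R t \<le> R\<^sup>2"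
proof -
  show "0 < height R t" using assms one_plus_square_pos[of "tangent R t"] by (simp add: height_def)
  have "R\<^sup>2 / (1 + (tangent R t)\<^sup>2) \<le> R\<^sup>2 / 1" by (intro divide_left_mono) (auto simp: one_plus_square_pos)
  then show "height R t \<le> R\<^sup>2" by (simp add: height_def)
qed

lemma height_deriv:
  assumes R: "R > 0" and t: "\<bar>t\<bar> < pi * R\<^sup>2 / 8"
  shows "(height R has_real_derivative - 4 * tangent R t) (at t)"
proof -
  let ?k = "tangent R t"
  note td = tangent_deriv[OF R t]
  have nz: "1 + ?k\<^sup>2 \<noteq> 0" using one_plus_square_pos[of ?k] by simp
  have "((\<lambda>t. R\<^sup>2 / (1 + (tangent R t)\<^sup>2)) has_real_derivative
     (0 * (1 + ?k\<^sup>2) - R\<^sup>2 * (2 * (2 * (1 + ?k\<^sup>2)\<^sup>2 / R\<^sup>2 * ?k))) / ((1 + ?k\<^sup>2) * (1 + ?k\<^sup>2))) (at t)"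
    by (intro DERIV_divide DERIV_const nz) (auto intro!: derivative_eq_intros td)
  moreover have "(0 * (1 + ?k\<^sup>2) - R\<^sup>2 * (2 * (2 * (1 + ?k\<^sup>2)\<^sup>2 / R\<^sup>2 * ?k))) / ((1 + ?k\<^sup>2) * (1 + ?k\<^sup>2)) = - 4 * ?k"
    using nz R by (simp add: power2_eq_square)
  ultimately show ?thesis by (simp add: height_def[abs_def])
qed

text \<open>At height \<open>t\<close> the boundary has radius \<open>R * cos (angle R t)\<close>,
  whose square is \<open>height R t\<close>. Since \<open>prof\<close> is strictly decreasing,
  comparing heights over \<open>z\<close> amounts to comparing radii at \<open>t\<close>.\<close>

lemma uprof_height:
  assumes R: "R > 0" and t: "\<bar>t\<bar> < pi * R\<^sup>2 / 8" and z: "norm z \<le> R"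
  shows "\<bar>t\<bar> < uprof R z \<longleftrightarrow> (norm z)\<^sup>2 < height R t" "\<bar>t\<bar> = uprof R z \<longleftrightarrow> (norm z)\<^sup>2 = height R t"
proof -
  define r where "r = R * cos (angle R t)"
  note a = angle[OF R t]
  have c: "cos (angle R t) > 0" using a by (intro cos_gt_zero_pi) auto
  have r: "0 < r" "r \<le> R" using c R by (auto simp: r_def)
  have "\<bar>t\<bar> = height_angle R \<bar>angle R t\<bar>"
  proof (cases "0 \<le> angle R t")
    case True
    have "0 \<le> height_angle R (angle R t)"
      using height_angle_strict_mono[OF R, of 0 "angle R t"] True a by (cases "angle R t = 0") (auto simp: height_angle_def)
    then show ?thesis using True a by simp
  next
    case False
    then have "height_angle R (angle R t) < height_angle R 0"
      using a by (intro height_angle_strict_mono[OF R]) auto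
    then have "t < 0" using a by (simp add: height_angle_def)
    then show ?thesis using False a height_angle_minus[of R "angle R t"] by simp
  qed
  also have "\<dots> = prof R (R * cos \<bar>angle R t\<bar>)"
    using a by (intro prof_height_angle[symmetric] R) auto
  also have "R * cos \<bar>angle R t\<bar> = r" by (simp add: r_def)
  finally have tr: "\<bar>t\<bar> = prof R r" .
  have h: "height R t = r\<^sup>2" using height_cos[OF R t] by (simp add: r_def)
  consider "norm z < r" | "norm z = r" | "r < norm z" by linarith
  then have "(\<bar>t\<bar> < uprof R z \<longleftrightarrow> (norm z)\<^sup>2 < height R t) \<and> (\<bar>t\<bar> = uprof R z \<longleftrightarrow> (norm z)\<^sup>2 = height R t)"
  proof cases
    case 1
    then have "prof R r < uprof R z" unfolding uprof_def using r by (intro prof_strict_antimono) auto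
    moreover have "(norm z)\<^sup>2 < r\<^sup>2" using 1 by (intro power_strict_mono) auto
    ultimately show ?thesis
      unfolding tr h by auto
  next
    case 2
    then show ?thesis
      unfolding tr h uprof_def by auto
  next
    case 3
    then have "uprof R z < prof R r" unfolding uprof_def using r z by (intro prof_strict_antimono) auto
    moreover have "r\<^sup>2 < (norm z)\<^sup>2" using 3 r by (intro power_strict_mono) auto
    ultimately show ?thesis
      unfolding tr h by auto
  qed
  then show "\<bar>t\<bar> < uprof R z \<longleftrightarrow> (norm z)\<^sup>2 < height R t" "\<bar>t\<bar> = uprof R z \<longleftrightarrow> (norm z)\<^sup>2 = height R t" by blast+
qed

subsection \<open>Away from the poles\<close>

text \<open>Contains the boundary except for the two poles, in particular the equator, where the
  graphs meet and have no finite slope.\<close>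

definition side_dom :: "real \<Rightarrow> 'n::finite heis set" where
  "side_dom R = {g. fst g \<noteq> 0 \<and> \<bar>snd g\<bar> < pi * R\<^sup>2 / 8}"

definition side_fun :: "real \<Rightarrow> 'n::finite heis \<Rightarrow> real" where
  "side_fun R g = (norm (fst g))\<^sup>2 - height R (snd g)"

lemma open_side_dom: "open (side_dom R)"
  unfolding side_dom_def by (intro open_Collect_conj open_Collect_neq open_Collect_less continuous_intros)

lemma side_fun_deriv:
  assumes R: "R > 0" and g: "g \<in> side_dom R"
  shows "(side_fun R has_derivative inner (2 *\<^sub>R fst g, 4 * tangent R (snd g))) (at g)"
proof -
  have t: "\<bar>snd g\<bar> < pi * R\<^sup>2 / 8" using g by (simp add: side_dom_def)
  have 1: "((\<lambda>g::'a heis. (norm (fst g))\<^sup>2) has_derivative inner (2 *\<^sub>R fst g, 0)) (at g)"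
    using C1_on_deriv[OF C1_on_fst_UNIV[OF C1_on_norm_square], of g] by simp
  have 2: "((\<lambda>g::'a heis. height R (snd g)) has_derivative (\<lambda>v. - 4 * tangent R (snd g) * snd v)) (at g)"
    by (rule has_derivative_compose[OF has_derivative_snd[OF has_derivative_ident]
        height_deriv[OF R t, unfolded has_field_derivative_def]])
  show ?thesis unfolding side_fun_def[abs_def]
    by (rule has_derivative_eq_rhs[OF has_derivative_diff[OF 1 2]]) (simp add: fun_eq_iff inner_prod_def)
qed

text \<open>Linear functions plus polynomials in \<open>tangent\<close> form a class closed under
  partial derivatives. The induction therefore runs over the whole class, and smoothness of every
  order follows.\<close>

lemma Cn_on_affine_poly:
  fixes a :: "'n::finite heis"
  assumes R: "R > 0"
  shows "Cn_on m (\<lambda>g. inner a g + poly p (tangent R (snd g))) (side_dom R)"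
proof (induction m arbitrary: a p)
  case 0
  have "isCont (tangent R) t" if "\<bar>t\<bar> < pi * R\<^sup>2 / 8" for t
    using tangent_deriv[OF R that] DERIV_isCont by blast
  then have "continuous_on {t. \<bar>t\<bar> < pi * R\<^sup>2 / 8} (tangent R)"
    by (intro continuous_at_imp_continuous_on) auto
  then have "continuous_on (side_dom R) (\<lambda>g::'n heis. tangent R (snd g))"
    by (rule continuous_on_compose2) (auto simp: side_dom_def intro!: continuous_intros)
  then show ?case by (auto intro!: continuous_intros)
next
  case (Suc m)
  \<comment> \<open>The chain rule: \<open>pderiv p\<close> times
    \<open>2 * (1 + k\<^sup>2)\<^sup>2 / R\<^sup>2\<close>, where \<open>k\<close> stands for the
    tangent.\<close>
  define q where "q = pderiv p * [:1, 0, 1:] * [:1, 0, 1:] * [:2 / R\<^sup>2:]"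
  have d: "((\<lambda>g. inner a g + poly p (tangent R (snd g))) has_derivative
      (\<lambda>v. inner a v + poly q (tangent R (snd g)) * snd v)) (at g)" if g: "g \<in> side_dom R" for g
  proof -
    have t: "\<bar>snd g\<bar> < pi * R\<^sup>2 / 8" using g by (simp add: side_dom_def)
    have "((\<lambda>t. poly p (tangent R t)) has_real_derivative poly (pderiv p) (tangent R (snd g)) * (2 * (1 + (tangent R (snd g))\<^sup>2)\<^sup>2 / R\<^sup>2)) (at (snd g))"
      by (rule DERIV_chain2[OF poly_DERIV tangent_deriv[OF R t]])
    moreover have "poly (pderiv p) (tangent R (snd g)) * (2 * (1 + (tangent R (snd g))\<^sup>2)\<^sup>2 / R\<^sup>2) = poly q (tangent R (snd g))"
      by (simp add: q_def power2_eq_square algebra_simps add_divide_distrib)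
    ultimately have "((\<lambda>t. poly p (tangent R t)) has_derivative (*) (poly q (tangent R (snd g)))) (at (snd g))"
      by (simp add: has_field_derivative_def)
    from has_derivative_compose[OF has_derivative_snd[OF has_derivative_ident] this]
    have "((\<lambda>g. poly p (tangent R (snd g))) has_derivative (\<lambda>v. poly q (tangent R (snd g)) * snd v)) (at g)" .
    then show ?thesis
      by (intro has_derivative_add has_derivative_inner_right has_derivative_ident)
  qed
  show ?case
  proof (rule Cn_on_SucI[OF open_side_dom d])
    fix b :: "'n heis"
    have "(\<lambda>g::'n heis. inner a b + poly q (tangent R (snd g)) * snd b)
      = (\<lambda>g. inner 0 g + poly ([:inner a b:] + smult (snd b) q) (tangent R (snd g)))"
      by (auto simp: mult.commute)
    then show "Cn_on m (\<lambda>g::'n heis. inner a b + poly q (tangent R (snd g)) * snd b) (side_dom R)"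
      using Suc[of 0 "[:inner a b:] + smult (snd b) q"] by simp
  qed
qed

lemma C_on_side_fun:
  assumes R: "R > 0" shows "C_on k (side_fun R :: 'n::finite heis \<Rightarrow> real) (side_dom R)"
  unfolding C_on_def
proof (intro allI impI)
  fix m
  have "Cn_on (Suc m) (side_fun R) (side_dom R :: 'n heis set)"
  proof (rule Cn_on_SucI[OF open_side_dom side_fun_deriv[OF R]])
    fix b :: "'n heis"
    have "(\<lambda>g::'n heis. inner (2 *\<^sub>R fst g, 4 * tangent R (snd g)) b)
      = (\<lambda>g. inner (2 *\<^sub>R fst b, 0) g + poly [:0, 4 * snd b:] (tangent R (snd g)))"
      by (auto simp: inner_prod_def inner_commute fun_eq_iff)
    then show "Cn_on m (\<lambda>g::'n heis. inner (2 *\<^sub>R fst g, 4 * tangent R (snd g)) b) (side_dom R)"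
      using Cn_on_affine_poly[OF R, of m "(2 *\<^sub>R fst b, 0)" "[:0, 4 * snd b:]"] by simp
  qed
  then show "Cn_on m (side_fun R) (side_dom R :: 'n heis set)" by (rule Cn_on_Suc_imp)
qed

lemma side_fun_extremal:
  assumes R: "R > 0" and g: "g \<in> side_dom R"
  shows "g \<in> frontier (extremal R) \<longleftrightarrow> side_fun R g = 0" "g \<in> extremal R \<longleftrightarrow> side_fun R g < 0"
proof -
  obtain z t where gz: "g = (z, t)" by (cases g)
  have t: "\<bar>t\<bar> < pi * R\<^sup>2 / 8" using g by (simp add: side_dom_def gz)
  have le: "norm z \<le> R" if "(norm z)\<^sup>2 \<le> height R t"
  proof (rule power2_le_imp_le)
    show "(norm z)\<^sup>2 \<le> R\<^sup>2" using that height_bounds(2)[OF R, of t] by linarith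
  qed (use R in simp)
  have nn: "0 \<le> uprof R z" if "norm z \<le> R" using prof_nonneg[OF R, of "norm z"] that by (simp add: uprof_def)
  have "g \<in> frontier (extremal R) \<longleftrightarrow> norm z \<le> R \<and> \<bar>t\<bar> = uprof R z"
    unfolding frontier_extremal(1)[OF R] gz using nn by auto
  also have "\<dots> \<longleftrightarrow> (norm z)\<^sup>2 = height R t" using uprof_height(2)[OF R t, of z] le by auto
  finally show "g \<in> frontier (extremal R) \<longleftrightarrow> side_fun R g = 0" by (simp add: side_fun_def gz)
  have "g \<in> extremal R \<longleftrightarrow> norm z < R \<and> \<bar>t\<bar> < uprof R z"
    by (auto simp: extremal_def between_graphs_def gz)
  also have "\<dots> \<longleftrightarrow> (norm z)\<^sup>2 < height R t"
  proof
    assume h: "(norm z)\<^sup>2 < height R t"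
    then have "(norm z)\<^sup>2 < R\<^sup>2" using height_bounds(2)[OF R, of t] by linarith
    then have "norm z < R" using R by (intro power_less_imp_less_base[of "norm z" 2 R]) auto
    then show "norm z < R \<and> \<bar>t\<bar> < uprof R z" using uprof_height(1)[OF R t, of z] h by auto
  qed (use uprof_height(1)[OF R t, of z] in auto)
  finally show "g \<in> extremal R \<longleftrightarrow> side_fun R g < 0" by (simp add: side_fun_def gz)
qed

lemma frechet_nonzero:
  assumes "(f has_derivative D) (at x)" "D v \<noteq> 0"
  shows "frechet_derivative f (at x) \<noteq> (\<lambda>_. 0)"
  using frechet_derivative_at[OF assms(1)] assms(2) by metis

lemma side_defining:
  assumes R: "R > 0"
  shows "defining_function k (frontier (extremal R :: 'n::finite heis set)) (side_dom R) (side_fun R)"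
    "outer_defining_function (extremal R :: 'n heis set) (side_dom R) (side_fun R)"
proof -
  have nz: "frechet_derivative (side_fun R) (at g) \<noteq> (\<lambda>_. 0)" if "g \<in> side_dom R" for g :: "'n heis"
  proof (rule frechet_nonzero[OF side_fun_deriv[OF R that]])
    show "inner (2 *\<^sub>R fst g, 4 * tangent R (snd g)) (fst g, 0) \<noteq> 0"
      using that by (simp add: side_dom_def)
  qed
  show *: "defining_function k (frontier (extremal R :: 'n::finite heis set)) (side_dom R) (side_fun R)" for k
    unfolding defining_function_def using open_side_dom C_on_side_fun[OF R] nz side_fun_extremal(1)[OF R] by blast
  show "outer_defining_function (extremal R :: 'n heis set) (side_dom R) (side_fun R)"
    unfolding outer_defining_function_def using * side_fun_extremal(2)[OF R] by blast
qed

lemma frontier_extremal_side: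
  assumes R: "R > 0" and g: "g \<in> frontier (extremal R :: 'n::finite heis set)"
    and np: "g \<noteq> (0, pi * R\<^sup>2 / 8)" "g \<noteq> (0, - (pi * R\<^sup>2 / 8))"
  shows "g \<in> side_dom R"
proof -
  obtain z t where gz: "g = (z, t)" by (cases g)
  have h: "norm z \<le> R" "t = uprof R z \<or> t = - uprof R z" using g frontier_extremal(1)[OF R] gz by auto
  note u0 = uprof_0[OF R, where 'n='n]
  have z0: "z \<noteq> 0" using h np u0 gz by auto
  have "0 \<le> uprof R z" using prof_nonneg[OF R, of "norm z"] h by (simp add: uprof_def)
  moreover have "uprof R z < pi * R\<^sup>2 / 8"
    unfolding u0[symmetric] unfolding uprof_def using z0 h by (intro prof_strict_antimono) auto
  ultimately show ?thesis using z0 h by (auto simp: side_dom_def gz)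
qed

subsection \<open>Near the poles\<close>

definition cap_dom :: "real \<Rightarrow> real \<Rightarrow> 'n::finite heis set" where
  "cap_dom \<sigma> R = {g. norm (fst g) < R \<and> 0 < \<sigma> * snd g}"

definition cap_fun :: "real \<Rightarrow> real \<Rightarrow> 'n::finite heis \<Rightarrow> real" where
  "cap_fun \<sigma> R g = \<sigma> * snd g - uprof R (fst g)"

lemma open_cap_dom: "open (cap_dom \<sigma> R)"
  unfolding cap_dom_def by (intro open_Collect_conj open_Collect_less continuous_intros)

lemma cap_fun_deriv:
  assumes g: "g \<in> cap_dom \<sigma> R"
  shows "(cap_fun \<sigma> R has_derivative inner (- uprof_grad R (fst g), \<sigma>)) (at g)"
proof -
  have z: "fst g \<in> ball 0 R" using g by (simp add: cap_dom_def)
  have "((\<lambda>g. uprof R (fst g)) has_derivative (\<lambda>v. inner (uprof_grad R (fst g)) (fst v))) (at g)"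
    by (rule has_derivative_compose[OF has_derivative_fst[OF has_derivative_ident] C1_on_deriv[OF uprof_C1 z]])
  then have "((\<lambda>g. \<sigma> * snd g - uprof R (fst g)) has_derivative (\<lambda>v. \<sigma> * snd v - inner (uprof_grad R (fst g)) (fst v))) (at g)"
    by (intro has_derivative_diff has_derivative_mult_right has_derivative_snd has_derivative_ident)
  then show ?thesis unfolding cap_fun_def[abs_def]
    by (rule has_derivative_eq_rhs) (simp add: fun_eq_iff inner_prod_def)
qed

lemma Cn_on_cap_fun: "Cn_on 2 (cap_fun \<sigma> R) (cap_dom \<sigma> R :: 'n::finite heis set)"
  unfolding numeral_2_eq_2
proof (rule Cn_on_SucI[OF open_cap_dom cap_fun_deriv])
  fix b :: "'n heis"
  show "Cn_on (Suc 0) (\<lambda>g. inner (- uprof_grad R (fst g), \<sigma>) b) (cap_dom \<sigma> R)"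
  proof (rule Cn_on_SucI[OF open_cap_dom])
    fix g :: "'n heis" assume g: "g \<in> cap_dom \<sigma> R"
    then have z: "fst g \<in> ball 0 R" by (simp add: cap_dom_def)
    have "((\<lambda>g. inner (uprof_grad R (fst g)) (fst b)) has_derivative (\<lambda>v. uprof_hess R (fst g) (fst b) (fst v))) (at g)"
      by (rule has_derivative_compose[OF has_derivative_fst[OF has_derivative_ident] uprof_hess[OF z]])
    from has_derivative_diff[OF has_derivative_const[of "\<sigma> * snd b"] this]
    have "((\<lambda>g. \<sigma> * snd b - inner (uprof_grad R (fst g)) (fst b)) has_derivative (\<lambda>v. 0 - uprof_hess R (fst g) (fst b) (fst v))) (at g)" .
    moreover have "(\<lambda>g. \<sigma> * snd b - inner (uprof_grad R (fst g)) (fst b)) = (\<lambda>g::'n heis. inner (- uprof_grad R (fst g), \<sigma>) b)"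
      by (cases b) (simp add: fun_eq_iff)
    ultimately show "((\<lambda>g. inner (- uprof_grad R (fst g), \<sigma>) b) has_derivative (\<lambda>v. 0 - uprof_hess R (fst g) (fst b) (fst v))) (at g)"
      by simp
  next
    fix v :: "'n heis"
    show "Cn_on 0 (\<lambda>g. 0 - uprof_hess R (fst g) (fst b) (fst v)) (cap_dom \<sigma> R)"
      unfolding Cn_on.simps
      by (intro continuous_intros continuous_on_compose2[OF uprof_hess_cont[of R "fst b" "fst v"]])
         (auto simp: cap_dom_def)
  qed
qed

lemma cap_defining:
  assumes R: "R > 0" and \<sigma>: "\<sigma> = 1 \<or> \<sigma> = -1"
  shows "outer_defining_function (extremal R :: 'n::finite heis set) (cap_dom \<sigma> R) (cap_fun \<sigma> R)"
proof -
  have nz: "frechet_derivative (cap_fun \<sigma> R) (at g) \<noteq> (\<lambda>_. 0)" if "g \<in> cap_dom \<sigma> R" for g :: "'n heis"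
    by (rule frechet_nonzero[OF cap_fun_deriv[OF that], of "(0, \<sigma>)"]) (use \<sigma> in auto)
  have fr: "g \<in> frontier (extremal R) \<longleftrightarrow> cap_fun \<sigma> R g = 0" "g \<in> extremal R \<longleftrightarrow> cap_fun \<sigma> R g < 0"
    if g: "g \<in> cap_dom \<sigma> R" for g :: "'n heis"
  proof -
    obtain z t where gz: "g = (z, t)" by (cases g)
    have z: "norm z < R" "0 < \<sigma> * t" using g by (auto simp: cap_dom_def gz)
    then have "0 < uprof R z" using uprof_pos[of z R] by simp
    show "g \<in> frontier (extremal R) \<longleftrightarrow> cap_fun \<sigma> R g = 0"
      unfolding frontier_extremal(1)[OF R] gz cap_fun_def using z \<sigma> \<open>0 < uprof R z\<close> by auto
    show "g \<in> extremal R \<longleftrightarrow> cap_fun \<sigma> R g < 0"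
      unfolding gz cap_fun_def extremal_def between_graphs_def using z \<sigma> \<open>0 < uprof R z\<close> by auto
  qed
  show ?thesis
    unfolding outer_defining_function_def defining_function_def C_on_numeral_iff
    using open_cap_dom Cn_on_cap_fun nz fr by blast
qed

lemma pole_in_cap: "R > 0 \<Longrightarrow> \<sigma> = 1 \<or> \<sigma> = -1 \<Longrightarrow> (0, \<sigma> * (pi * R\<^sup>2 / 8)) \<in> cap_dom \<sigma> R"
  by (auto simp: cap_dom_def)

text \<open>The coefficients of order below three in Taylor's formula vanish, which leaves
  \<open>p3 / 6 * s ^ 3\<close>. Division by \<open>\<bar>s\<bar> ^ 3\<close> produces
  \<open>sgn s\<close>, so the limits from the right and from the left are \<open>p3 0 / 6\<close>
  and \<open>- p3 0 / 6\<close>; both equal \<open>L\<close>.\<close>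

lemma abs_cube_not_C3:
  fixes p p1 p2 p3 :: "real \<Rightarrow> real"
  assumes \<epsilon>: "\<epsilon> > 0"
    and d1: "\<And>s. \<bar>s\<bar> < \<epsilon> \<Longrightarrow> (p has_real_derivative p1 s) (at s)"
    and d2: "\<And>s. \<bar>s\<bar> < \<epsilon> \<Longrightarrow> (p1 has_real_derivative p2 s) (at s)"
    and d3: "\<And>s. \<bar>s\<bar> < \<epsilon> \<Longrightarrow> (p2 has_real_derivative p3 s) (at s)"
    and c3: "isCont p3 0"
    and L: "((\<lambda>s. p s / \<bar>s\<bar> ^ 3) \<longlongrightarrow> L) (at 0)"
  shows "L = 0" "p1 0 = 0"
proof -
  have a0: "((\<lambda>s::real. \<bar>s\<bar> ^ m) \<longlongrightarrow> 0) (at 0)" if "m > 0" for m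
    using that by (auto intro!: tendsto_eq_intros simp: power_0_left)
  \<comment> \<open>Smaller powers in the denominator give limit 0; the exponents 0, 1 and 2
    eliminate the value, the slope and the quadratic coefficient in turn.\<close>
  have lim: "((\<lambda>s. p s / \<bar>s\<bar> ^ k) \<longlongrightarrow> 0) (at 0)" if "k < 3" for k
  proof -
    have "((\<lambda>s. (p s / \<bar>s\<bar> ^ 3) * \<bar>s\<bar> ^ (3 - k)) \<longlongrightarrow> L * 0) (at 0)"
      using that by (intro tendsto_mult L a0) auto
    moreover have "\<forall>\<^sub>F s in at 0. (p s / \<bar>s\<bar> ^ 3) * \<bar>s\<bar> ^ (3 - k) = p s / \<bar>s\<bar> ^ k"
    proof (rule eventually_at_topological[THEN iffD2], intro exI[of _ UNIV] conjI ballI impI)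
      fix s :: real assume "s \<noteq> 0"
      have "\<bar>s\<bar> ^ 3 = \<bar>s\<bar> ^ k * \<bar>s\<bar> ^ (3 - k)" using that by (simp add: power_add[symmetric])
      then show "(p s / \<bar>s\<bar> ^ 3) * \<bar>s\<bar> ^ (3 - k) = p s / \<bar>s\<bar> ^ k" using \<open>s \<noteq> 0\<close> by simp
    qed auto
    ultimately show ?thesis by (simp add: tendsto_cong)
  qed
  have "(p \<longlongrightarrow> p 0) (at 0)" using DERIV_isCont[OF d1[of 0]] \<epsilon> by (simp add: isCont_def)
  moreover have "(p \<longlongrightarrow> 0) (at 0)" using lim[of 0] by simp
  ultimately have p0: "p 0 = 0" using LIM_unique by blast
  have "((\<lambda>s. p s / s) \<longlongrightarrow> p1 0) (at 0)" using d1[of 0] \<epsilon> by (simp add: DERIV_def p0)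
  then have "((\<lambda>s. \<bar>p s / s\<bar>) \<longlongrightarrow> \<bar>p1 0\<bar>) (at 0)" by (rule tendsto_rabs)
  moreover have "((\<lambda>s. \<bar>p s / s\<bar>) \<longlongrightarrow> 0) (at 0)" using tendsto_rabs[OF lim[of 1]] by (simp add: abs_divide)
  ultimately show p1: "p1 0 = 0" using LIM_unique by force
  have taylor: "\<exists>\<xi>. \<bar>\<xi>\<bar> \<le> \<bar>s\<bar> \<and> p s = p2 0 / 2 * s\<^sup>2 + p3 \<xi> / 6 * s ^ 3" if s: "\<bar>s\<bar> < \<epsilon>" for s
  proof (cases "s = 0")
    case True then show ?thesis using p0 by auto
  next
    case False
    define diff where "diff m = (if m = 0 then p else if m = 1 then p1 else if m = 2 then p2 else p3)" for m :: nat
    have "\<exists>t. (if s < 0 then s < t \<and> t < 0 else 0 < t \<and> t < s) \<and>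
       p s = (\<Sum>m<3. diff m 0 / fact m * (s - 0) ^ m) + diff 3 t / fact 3 * (s - 0) ^ 3"
    proof (rule Taylor[where a="- \<bar>s\<bar>" and b="\<bar>s\<bar>"])
      show "\<forall>m t. m < 3 \<and> - \<bar>s\<bar> \<le> t \<and> t \<le> \<bar>s\<bar> \<longrightarrow> (diff m has_real_derivative diff (Suc m) t) (at t)"
      proof (intro allI impI)
        fix m :: nat and t assume h: "m < 3 \<and> - \<bar>s\<bar> \<le> t \<and> t \<le> \<bar>s\<bar>"
        then have t: "\<bar>t\<bar> < \<epsilon>" using s by linarith
        from h have "m = 0 \<or> m = 1 \<or> m = 2" by auto
        then show "(diff m has_real_derivative diff (Suc m) t) (at t)"
          using d1[OF t] d2[OF t] d3[OF t] by (auto simp: diff_def)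
      qed
    qed (use False in \<open>auto simp: diff_def\<close>)
    then obtain t where t: "if s < 0 then s < t \<and> t < 0 else 0 < t \<and> t < s"
      "p s = (\<Sum>m<3. diff m 0 / fact m * (s - 0) ^ m) + diff 3 t / fact 3 * (s - 0) ^ 3" by blast
    have "p s = p2 0 / 2 * s\<^sup>2 + p3 t / 6 * s ^ 3"
      using t(2) by (simp add: eval_nat_numeral diff_def p0 p1)
    moreover have "\<bar>t\<bar> \<le> \<bar>s\<bar>" using t(1) by (auto split: if_splits)
    ultimately show ?thesis by blast
  qed
  then obtain \<xi> where \<xi>: "\<And>s. \<bar>s\<bar> < \<epsilon> \<Longrightarrow> \<bar>\<xi> s\<bar> \<le> \<bar>s\<bar>"
    "\<And>s. \<bar>s\<bar> < \<epsilon> \<Longrightarrow> p s = p2 0 / 2 * s\<^sup>2 + p3 (\<xi> s) / 6 * s ^ 3" by metis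
  have ev: "\<forall>\<^sub>F s in at 0. \<bar>s\<bar> < \<epsilon>" using \<epsilon> by (auto simp: eventually_at dist_real_def)
  have "(\<xi> \<longlongrightarrow> 0) (at 0)"
  proof (rule Lim_null_comparison[OF _ a0[of 1]])
    show "\<forall>\<^sub>F s in at 0. norm (\<xi> s) \<le> \<bar>s\<bar> ^ 1" using ev by eventually_elim (use \<xi> in simp)
  qed simp
  then have p3l: "((\<lambda>s. p3 (\<xi> s)) \<longlongrightarrow> p3 0) (at 0)" by (rule isCont_tendsto_compose[OF c3])
  have "((\<lambda>s. p2 0 / 2 + p3 (\<xi> s) / 6 * s) \<longlongrightarrow> p2 0 / 2 + p3 0 / 6 * 0) (at 0)"
    by (intro tendsto_intros p3l) simp_all
  moreover have "((\<lambda>s. p2 0 / 2 + p3 (\<xi> s) / 6 * s) \<longlongrightarrow> 0) (at 0)"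
  proof (rule tendsto_cong[THEN iffD1, OF _ lim[of 2]])
    have "\<forall>\<^sub>F s::real in at 0. s \<noteq> 0" by (simp add: eventually_at_filter)
    then show "\<forall>\<^sub>F s in at 0. p s / \<bar>s\<bar>\<^sup>2 = p2 0 / 2 + p3 (\<xi> s) / 6 * s"
      using ev by eventually_elim (use \<xi>(2) in \<open>simp add: add_divide_distrib power2_eq_square power3_eq_cube\<close>)
  qed simp
  ultimately have p2: "p2 0 = 0" using LIM_unique by fastforce
  have eq: "\<forall>\<^sub>F s in at 0. p s / \<bar>s\<bar> ^ 3 = p3 (\<xi> s) / 6 * sgn s"
  proof -
    have "\<forall>\<^sub>F s::real in at 0. s \<noteq> 0" by (simp add: eventually_at_filter)
    then show ?thesis
      using ev by eventually_elim (use \<xi>(2) p2 in \<open>auto simp: sgn_real_def abs_if power3_eq_cube\<close>)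
  qed
  have p36: "((\<lambda>s. p3 (\<xi> s) / 6) \<longlongrightarrow> p3 0 / 6) (at 0)" using tendsto_divide[OF p3l tendsto_const[of "6::real"]] by simp
  have ne: "at_right (0::real) \<noteq> bot" "at_left (0::real) \<noteq> bot" by auto
  have Lsgn: "((\<lambda>s. p3 (\<xi> s) / 6 * sgn s) \<longlongrightarrow> L) (at 0)" by (rule tendsto_cong[THEN iffD1, OF eq L])
  have "((\<lambda>s. p3 (\<xi> s) / 6 * sgn s) \<longlongrightarrow> p3 0 / 6 * 1) (at_right 0)"
    by (intro tendsto_mult tendsto_mono[OF at_le p36] tendsto_eventually) (auto simp: eventually_at_right_less intro: eventually_mono[OF eventually_at_right_less])
  then have 1: "L = p3 0 / 6" using tendsto_unique[OF ne(1) tendsto_mono[OF at_le Lsgn]] by auto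
  have "((\<lambda>s. p3 (\<xi> s) / 6 * sgn s) \<longlongrightarrow> p3 0 / 6 * (-1)) (at_left 0)"
    by (intro tendsto_mult tendsto_mono[OF at_le p36] tendsto_eventually) (auto simp: eventually_at_left_field intro!: exI[of _ "-1"])
  then have 2: "L = - (p3 0 / 6)" using tendsto_unique[OF ne(2) tendsto_mono[OF at_le Lsgn]] by auto
  show "L = 0" using 1 2 by simp
qed

text \<open>Cauchy's mean value theorem against \<open>s ^ 3\<close>: the factor
  \<open>c\<^sup>2\<close> in the derivative of \<open>prof\<close> cancels that of the cube and
  leaves \<open>1 / (6 * sqrt (R\<^sup>2 - c\<^sup>2))\<close>.\<close>

lemma prof_cubic:
  assumes R: "R > 0"
  shows "((\<lambda>s. (prof R 0 - prof R \<bar>s\<bar>) / \<bar>s\<bar> ^ 3) \<longlongrightarrow> 1 / (6 * R)) (at 0)"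
proof -
  have "\<exists>c. 0 \<le> c \<and> c \<le> \<bar>s\<bar> \<and> (prof R 0 - prof R \<bar>s\<bar>) / \<bar>s\<bar> ^ 3 = 1 / (6 * sqrt (R\<^sup>2 - c\<^sup>2))"
    if s: "s \<noteq> 0" "\<bar>s\<bar> < R" for s
  proof -
    define r where "r = \<bar>s\<bar>"
    have r: "0 < r" "r < R" using s by (auto simp: r_def)
    have "\<exists>c. 0 < c \<and> c < r \<and> (prof R r - prof R 0) * (3 * c\<^sup>2) = (r ^ 3 - 0 ^ 3) * (- c\<^sup>2 / (2 * sqrt (R\<^sup>2 - c\<^sup>2)))"
    proof (rule GMVT'[OF r(1)])
      show "isCont (prof R) z" if "0 \<le> z" "z \<le> r" for z
        using DERIV_isCont[OF prof_deriv[of z R]] that r by auto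
      show "((\<lambda>x. x ^ 3) has_real_derivative 3 * z\<^sup>2) (at z)" for z :: real
        by (auto intro!: derivative_eq_intros)
      show "(prof R has_real_derivative - z\<^sup>2 / (2 * sqrt (R\<^sup>2 - z\<^sup>2))) (at z)" if "0 < z" "z < r" for z
        using that r by (intro prof_deriv) auto
    qed auto
    then obtain c where c: "0 < c" "c < r"
      "(prof R r - prof R 0) * (3 * c\<^sup>2) = (r ^ 3 - 0 ^ 3) * (- c\<^sup>2 / (2 * sqrt (R\<^sup>2 - c\<^sup>2)))" by blast
    have S: "sqrt (R\<^sup>2 - c\<^sup>2) > 0" using square_less[of c R] c r by simp
    have "(prof R 0 - prof R r) / r ^ 3 = 1 / (6 * sqrt (R\<^sup>2 - c\<^sup>2))"
    proof -
      have "(c\<^sup>2 * 3) * ((prof R 0 - prof R r)) = (c\<^sup>2 * 3) * (r ^ 3 / (6 * sqrt (R\<^sup>2 - c\<^sup>2)))"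
        using c(3) S by (simp add: field_simps)
      moreover have "c\<^sup>2 * 3 \<noteq> 0" using c(1) by simp
      ultimately have "prof R 0 - prof R r = r ^ 3 / (6 * sqrt (R\<^sup>2 - c\<^sup>2))"
        using mult_left_cancel by blast
      then show ?thesis using r by simp
    qed
    then show ?thesis using c unfolding r_def[symmetric] by (intro exI[of _ c]) auto
  qed
  then obtain c where c: "\<And>s. s \<noteq> 0 \<Longrightarrow> \<bar>s\<bar> < R \<Longrightarrow> 0 \<le> c s \<and> c s \<le> \<bar>s\<bar> \<and>
      (prof R 0 - prof R \<bar>s\<bar>) / \<bar>s\<bar> ^ 3 = 1 / (6 * sqrt (R\<^sup>2 - (c s)\<^sup>2))" by metis
  have ev: "\<forall>\<^sub>F s in at 0. s \<noteq> 0 \<and> \<bar>s\<bar> < R" using R by (auto simp: eventually_at dist_real_def)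
  have "(c \<longlongrightarrow> 0) (at 0)"
  proof (rule Lim_null_comparison)
    show "\<forall>\<^sub>F s in at 0. norm (c s) \<le> \<bar>s\<bar>" using ev by eventually_elim (use c in fastforce)
    show "((\<lambda>s::real. \<bar>s\<bar>) \<longlongrightarrow> 0) (at 0)" by (auto intro!: tendsto_eq_intros)
  qed
  then have "((\<lambda>s. 1 / (6 * sqrt (R\<^sup>2 - (c s)\<^sup>2))) \<longlongrightarrow> 1 / (6 * sqrt (R\<^sup>2 - 0\<^sup>2))) (at 0)"
    using R by (intro tendsto_intros) auto
  then have "((\<lambda>s. 1 / (6 * sqrt (R\<^sup>2 - (c s)\<^sup>2))) \<longlongrightarrow> 1 / (6 * R)) (at 0)" using R by simp
  moreover have "\<forall>\<^sub>F s in at 0. 1 / (6 * sqrt (R\<^sup>2 - (c s)\<^sup>2)) = (prof R 0 - prof R \<bar>s\<bar>) / \<bar>s\<bar> ^ 3"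
    using ev by eventually_elim (use c in auto)
  ultimately show ?thesis by (rule tendsto_cong[THEN iffD1, rotated])
qed

lemma Cn_line_deriv:
  assumes U: "open U" and f: "Cn_on (Suc k) f U" and x: "x + s *\<^sub>R b \<in> U"
  shows "((\<lambda>s. f (x + s *\<^sub>R b)) has_real_derivative frechet_derivative f (at (x + s *\<^sub>R b)) b) (at s)"
proof -
  have "f differentiable (at (x + s *\<^sub>R b))"
    using f U x by (simp add: differentiable_on_def at_within_open_NO_MATCH)
  then have D: "(f has_derivative frechet_derivative f (at (x + s *\<^sub>R b))) (at (x + s *\<^sub>R b))"
    by (simp add: frechet_derivative_works)
  have L: "((\<lambda>s. x + s *\<^sub>R b) has_derivative (\<lambda>h. h *\<^sub>R b)) (at s)" by (auto intro!: derivative_eq_intros)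
  have "((\<lambda>s. f (x + s *\<^sub>R b)) has_derivative (\<lambda>h. frechet_derivative f (at (x + s *\<^sub>R b)) (h *\<^sub>R b))) (at s)"
    by (rule has_derivative_compose[OF L D])
  moreover have "frechet_derivative f (at (x + s *\<^sub>R b)) (h *\<^sub>R b) = frechet_derivative f (at (x + s *\<^sub>R b)) b * h" for h
    using linear_scale[OF has_derivative_linear[OF D]] by (simp add: mult.commute)
  ultimately show ?thesis by (simp add: has_field_derivative_def)
qed

text \<open>On a horizontal line through the pole a defining function equals the vertical gap to the
  boundary times a value of its \<open>t\<close>-derivative. The gap behaves like
  \<open>\<bar>s\<bar> ^ 3 / (6 * R)\<close>, so \<open>abs_cube_not_C3\<close> makes the
  \<open>t\<close>-derivative vanish at the pole, and the derivative along the line as well. With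
  all basis directions the whole derivative is zero, which a defining function forbids.\<close>

lemma pole_not_C3:
  assumes R: "R > 0" and \<sigma>: "\<sigma> = 1 \<or> \<sigma> = -1"
  shows "\<not> hypersurface_near 3 (frontier (extremal R :: 'n::finite heis set)) (0, \<sigma> * (pi * R\<^sup>2 / 8))"
proof
  let ?T = "pi * R\<^sup>2 / 8"
  let ?g = "(0, \<sigma> * ?T) :: 'n heis"
  assume "hypersurface_near 3 (frontier (extremal R :: 'n heis set)) ?g"
  then obtain U \<phi> where gU: "?g \<in> U" and U: "open U" and C: "Cn_on 3 \<phi> U"
    and nz: "frechet_derivative \<phi> (at ?g) \<noteq> (\<lambda>_. 0)" and S: "frontier (extremal R) \<inter> U = {g \<in> U. \<phi> g = 0}"
    unfolding hypersurface_near_def defining_function_def C_on_numeral_iff by blast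
  define D where "D = frechet_derivative \<phi>"
  have C1: "Cn_on (Suc 2) \<phi> U" using C by (simp add: eval_nat_numeral)
  have C2: "Cn_on (Suc 1) (\<lambda>x. D (at x) b) U" if "b \<in> Basis" for b
    using C1 that unfolding D_def by (simp add: eval_nat_numeral)
  have C3: "Cn_on (Suc 0) (\<lambda>x. frechet_derivative (\<lambda>x. D (at x) b) (at x) b) U" if "b \<in> Basis" for b
    using C2[OF that] that by simp
  obtain e where e: "e > 0" "ball ?g e \<subseteq> U" using U gU open_contains_ball by blast
  have p0T: "prof R 0 = ?T" using prof_ends(2)[OF R] by (simp add: mult.commute)
  define \<epsilon> where "\<epsilon> = min e R"
  have \<epsilon>: "\<epsilon> > 0" using e R by (auto simp: \<epsilon>_def)
  have key: "D (at ?g) (b, 0) = 0 \<and> D (at ?g) (0, 1) = 0" if b: "b \<in> Basis" for b :: "'n horiz"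
  proof -
    have bB: "(b, 0) \<in> (Basis :: 'n heis set)" and tB: "(0, 1) \<in> (Basis :: 'n heis set)"
      using b by (auto simp: Basis_prod_def)
    have nb: "norm b = 1" using b by simp
    define p where "p s = \<phi> (?g + s *\<^sub>R (b, 0))" for s
    define p1 where "p1 s = D (at (?g + s *\<^sub>R (b, 0))) (b, 0)" for s
    define p2 where "p2 s = frechet_derivative (\<lambda>x. D (at x) (b, 0)) (at (?g + s *\<^sub>R (b, 0))) (b, 0)" for s
    define p3 where "p3 s = frechet_derivative (\<lambda>x. frechet_derivative (\<lambda>x. D (at x) (b, 0)) (at x) (b, 0)) (at (?g + s *\<^sub>R (b, 0))) (b, 0)" for s
    have in_U: "?g + s *\<^sub>R (b, 0) \<in> U" if "\<bar>s\<bar> < \<epsilon>" for s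
      using that e(2) nb by (intro subsetD[OF e(2)]) (simp add: dist_norm \<epsilon>_def)
    have 1: "(p has_real_derivative p1 s) (at s)" if "\<bar>s\<bar> < \<epsilon>" for s
      unfolding p_def p1_def D_def by (rule Cn_line_deriv[OF U C1 in_U[OF that]])
    have 2: "(p1 has_real_derivative p2 s) (at s)" if "\<bar>s\<bar> < \<epsilon>" for s
      unfolding p1_def p2_def by (rule Cn_line_deriv[OF U C2[OF bB] in_U[OF that]])
    have 3: "(p2 has_real_derivative p3 s) (at s)" if "\<bar>s\<bar> < \<epsilon>" for s
      unfolding p2_def p3_def by (rule Cn_line_deriv[OF U C3[OF bB] in_U[OF that]])
    have c3: "isCont p3 0"
    proof -
      have "continuous_on U (\<lambda>x. frechet_derivative (\<lambda>x. frechet_derivative (\<lambda>x. D (at x) (b, 0)) (at x) (b, 0)) (at x) (b, 0))"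
        using C3[OF bB] bB by simp
      from this[unfolded continuous_on_eq_continuous_at[OF U]]
      have "isCont (\<lambda>x. frechet_derivative (\<lambda>x. frechet_derivative (\<lambda>x. D (at x) (b, 0)) (at x) (b, 0)) (at x) (b, 0)) ?g"
        using gU by blast
      moreover have "?g + 0 *\<^sub>R (b, 0) = ?g" by simp
      ultimately have "isCont (\<lambda>x. frechet_derivative (\<lambda>x. frechet_derivative (\<lambda>x. D (at x) (b, 0)) (at x) (b, 0)) (at x) (b, 0)) (?g + 0 *\<^sub>R (b, 0))"
        by (simp only:)
      then show ?thesis unfolding p3_def
        by (rule continuous_within_compose3[where g="\<lambda>x. frechet_derivative (\<lambda>x. frechet_derivative (\<lambda>x. D (at x) (b, 0)) (at x) (b, 0)) (at x) (b, 0)"])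
           (intro continuous_intros)
    qed
    \<comment> \<open>The vertical gap between the horizontal hyperplane through the pole and the
      boundary.\<close>
    define d where "d s = prof R 0 - prof R \<bar>s\<bar>" for s
    have dl: "(d \<longlongrightarrow> 0) (at 0)"
    proof -
      have "isCont (prof R) 0" using DERIV_isCont[OF prof_deriv[of 0 R]] R by simp
      then have "((\<lambda>s. prof R \<bar>s\<bar>) \<longlongrightarrow> prof R 0) (at 0)"
        by (rule isCont_tendsto_compose) (auto intro!: tendsto_eq_intros)
      from tendsto_diff[OF tendsto_const[of "prof R 0"] this] show ?thesis by (simp add: d_def[abs_def])
    qed
    \<comment> \<open>Mean value theorem on the vertical segment from the point of the line to the
      boundary point below or above it, where \<open>\<phi>\<close> vanishes.\<close>
    have mvt: "\<exists>\<xi>. 0 \<le> \<xi> \<and> \<xi> \<le> d s \<and> p s = d s * (\<sigma> * D (at (s *\<^sub>R b, \<sigma> * (?T - \<xi>))) (0, 1))"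
      if s: "\<bar>s\<bar> < \<epsilon>" "d s < e - \<bar>s\<bar>" "s \<noteq> 0" for s
    proof -
      have sR: "\<bar>s\<bar> < R" using s by (simp add: \<epsilon>_def)
      have d0: "0 < d s" using prof_strict_antimono[of 0 "\<bar>s\<bar>" R] s sR by (simp add: d_def)
      have seg: "(s *\<^sub>R b, \<sigma> * (?T - \<xi>)) \<in> U" if "0 \<le> \<xi>" "\<xi> \<le> d s" for \<xi>
      proof (rule subsetD[OF e(2)])
        have "dist ?g (s *\<^sub>R b, \<sigma> * (?T - \<xi>)) = norm (s *\<^sub>R b, \<sigma> * \<xi>)"
          using \<sigma> by (auto simp: dist_norm norm_Pair algebra_simps)
        also have "\<dots> \<le> norm (s *\<^sub>R b) + norm (\<sigma> * \<xi>)" by (rule norm_Pair_le)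
        also have "\<dots> < e" using \<sigma> s that nb by auto
        finally show "(s *\<^sub>R b, \<sigma> * (?T - \<xi>)) \<in> ball ?g e" by simp
      qed
      define q where "q \<xi> = \<phi> (s *\<^sub>R b, \<sigma> * (?T - \<xi>))" for \<xi>
      have q: "(q has_real_derivative - \<sigma> * D (at (s *\<^sub>R b, \<sigma> * (?T - \<xi>))) (0, 1)) (at \<xi>)"
        if "0 \<le> \<xi>" "\<xi> \<le> d s" for \<xi>
      proof -
        have "((\<lambda>r. \<phi> ((s *\<^sub>R b, 0) + r *\<^sub>R (0, 1))) has_real_derivative
           frechet_derivative \<phi> (at ((s *\<^sub>R b, 0) + (\<sigma> * (?T - \<xi>)) *\<^sub>R (0, 1))) (0, 1)) (at (\<sigma> * (?T - \<xi>)))"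
          by (rule Cn_line_deriv[OF U C1]) (use seg[OF that] in simp)
        then have f: "((\<lambda>r. \<phi> (s *\<^sub>R b, r)) has_real_derivative D (at (s *\<^sub>R b, \<sigma> * (?T - \<xi>))) (0, 1)) (at (\<sigma> * (?T - \<xi>)))"
          by (simp add: D_def)
        have "((\<lambda>\<xi>. \<sigma> * (?T - \<xi>)) has_real_derivative - \<sigma>) (at \<xi>)" by (auto intro!: derivative_eq_intros)
        from DERIV_chain2[OF f this] show ?thesis by (simp add: q_def[abs_def] mult.commute)
      qed
      obtain \<xi> where \<xi>: "0 < \<xi>" "\<xi> < d s" "q (d s) - q 0 = (d s - 0) * (- \<sigma> * D (at (s *\<^sub>R b, \<sigma> * (?T - \<xi>))) (0, 1))"
        using MVT2[OF d0, of q "\<lambda>\<xi>. - \<sigma> * D (at (s *\<^sub>R b, \<sigma> * (?T - \<xi>))) (0, 1)"] q by auto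
      have "q (d s) = 0"
      proof -
        have "uprof R (s *\<^sub>R b) = ?T - d s" by (simp add: uprof_def d_def p0T nb)
        then have "(s *\<^sub>R b, \<sigma> * (?T - d s)) \<in> frontier (extremal R)"
          unfolding frontier_extremal(1)[OF R] using \<sigma> sR nb by auto
        moreover have "(s *\<^sub>R b, \<sigma> * (?T - d s)) \<in> U" using d0 by (intro seg) auto
        ultimately have "(s *\<^sub>R b, \<sigma> * (?T - d s)) \<in> frontier (extremal R) \<inter> U" by (rule IntI)
        then have "(s *\<^sub>R b, \<sigma> * (?T - d s)) \<in> {g \<in> U. \<phi> g = 0}" unfolding S .
        then show ?thesis by (simp add: q_def)
      qed
      moreover have "q 0 = p s" by (simp add: q_def p_def)
      ultimately show ?thesis using \<xi> by (intro exI[of _ \<xi>]) auto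
    qed
    define good where "good s \<longleftrightarrow> \<bar>s\<bar> < \<epsilon> \<and> d s < e - \<bar>s\<bar> \<and> s \<noteq> 0" for s
    obtain \<xi> where \<xi>: "\<And>s. good s \<Longrightarrow> 0 \<le> \<xi> s \<and> \<xi> s \<le> d s \<and> p s = d s * (\<sigma> * D (at (s *\<^sub>R b, \<sigma> * (?T - \<xi> s))) (0, 1))"
      using mvt unfolding good_def by metis
    have ev: "\<forall>\<^sub>F s in at 0. good s"
    proof -
      have "((\<lambda>s. d s + \<bar>s\<bar>) \<longlongrightarrow> 0 + \<bar>0\<bar>) (at 0)" by (intro tendsto_intros dl)
      then have "\<forall>\<^sub>F s in at 0. d s + \<bar>s\<bar> < e" using e(1) by (intro order_tendstoD) auto
      moreover have "\<forall>\<^sub>F s in at 0. \<bar>s\<bar> < \<epsilon> \<and> s \<noteq> 0" using \<epsilon> by (auto simp: eventually_at dist_real_def)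
      ultimately show ?thesis by eventually_elim (auto simp: good_def)
    qed
    have \<xi>l: "(\<xi> \<longlongrightarrow> 0) (at 0)"
    proof (rule Lim_null_comparison[OF _ dl])
      show "\<forall>\<^sub>F s in at 0. norm (\<xi> s) \<le> d s" using ev by eventually_elim (use \<xi> in fastforce)
    qed
    have "continuous_on U (\<lambda>x. D (at x) (0, 1))" using Cn_on_le[OF C2[OF tB], of 0] by simp
    then have "isCont (\<lambda>x. D (at x) (0, 1)) ?g" using continuous_on_eq_continuous_at[OF U] gU by blast
    moreover have "((\<lambda>s. (s *\<^sub>R b, \<sigma> * (?T - \<xi> s))) \<longlongrightarrow> (0 *\<^sub>R b, \<sigma> * (?T - 0))) (at 0)"
      by (intro tendsto_intros \<xi>l)
    ultimately have Dl: "((\<lambda>s. D (at (s *\<^sub>R b, \<sigma> * (?T - \<xi> s))) (0, 1)) \<longlongrightarrow> D (at ?g) (0, 1)) (at 0)"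
      by (intro isCont_tendsto_compose[where g="\<lambda>x. D (at x) (0, 1)"]) auto
    have "((\<lambda>s. d s / \<bar>s\<bar> ^ 3 * (\<sigma> * D (at (s *\<^sub>R b, \<sigma> * (?T - \<xi> s))) (0, 1))) \<longlongrightarrow> 1 / (6 * R) * (\<sigma> * D (at ?g) (0, 1))) (at 0)"
      unfolding d_def by (intro tendsto_mult prof_cubic[OF R] tendsto_const Dl[unfolded d_def])
    moreover have "\<forall>\<^sub>F s in at 0. d s / \<bar>s\<bar> ^ 3 * (\<sigma> * D (at (s *\<^sub>R b, \<sigma> * (?T - \<xi> s))) (0, 1)) = p s / \<bar>s\<bar> ^ 3"
      using ev by eventually_elim (use \<xi> in simp)
    ultimately have L: "((\<lambda>s. p s / \<bar>s\<bar> ^ 3) \<longlongrightarrow> 1 / (6 * R) * (\<sigma> * D (at ?g) (0, 1))) (at 0)"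
      by (rule tendsto_cong[THEN iffD1, rotated])
    note res = abs_cube_not_C3[OF \<epsilon> 1 2 3 c3 L]
    have "D (at ?g) (0, 1) = 0" using res(1) R \<sigma> by auto
    moreover have "D (at ?g) (b, 0) = 0" using res(2) by (simp add: p1_def)
    ultimately show ?thesis by simp
  qed
  have "\<phi> differentiable_on U" using C1 unfolding Cn_on.simps by blast
  then have "\<phi> differentiable (at ?g)"
    using U gU by (simp add: differentiable_on_def at_within_open_NO_MATCH)
  then have lin: "linear (D (at ?g))" unfolding D_def by (rule linear_frechet_derivative)
  have "D (at ?g) = (\<lambda>_. 0)"
  proof (rule linear_eq_stdbasis[OF lin])
    obtain b0 :: "'n horiz" where b0: "b0 \<in> Basis" using nonempty_Basis by blast
    show "D (at ?g) b = 0" if "b \<in> Basis" for b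
      using that key key[OF b0] by (auto simp: Basis_prod_def)
  qed (simp add: linear_iff)
  then show False using nz by (simp add: D_def)
qed

section \<open>Horizontal mean curvature of the boundary\<close>

lemma C2_gradient:
  fixes \<phi> :: "'a::euclidean_space \<Rightarrow> real"
  assumes U: "open U" and \<phi>: "Cn_on 2 \<phi> U"
  obtains G H where "\<And>x. x \<in> U \<Longrightarrow> (\<phi> has_derivative inner (G x)) (at x)"
    "\<And>x. x \<in> U \<Longrightarrow> (G has_derivative H x) (at x)"
proof -
  define G where "G x = (\<Sum>b\<in>Basis. frechet_derivative \<phi> (at x) b *\<^sub>R b)" for x
  have \<phi>2: "Cn_on (Suc (Suc 0)) \<phi> U" using \<phi> by (simp add: numeral_2_eq_2)
  have "\<exists>h. C1_on U (\<lambda>x. frechet_derivative \<phi> (at x) b) h" if "b \<in> Basis" for b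
    using C1_on_if_Cn_on[OF U, of 0 "\<lambda>x. frechet_derivative \<phi> (at x) b"] \<phi>2 that by auto
  then obtain h where h: "\<And>b. b \<in> Basis \<Longrightarrow> C1_on U (\<lambda>x. frechet_derivative \<phi> (at x) b) (h b)" by metis
  show ?thesis
  proof
    show "(\<phi> has_derivative inner (G x)) (at x)" if "x \<in> U" for x
      using C1_on_deriv[OF C1_on_if_Cn_on[OF U \<phi>2] that] by (simp add: G_def)
    show "(G has_derivative (\<lambda>v. \<Sum>b\<in>Basis. inner (h b x) v *\<^sub>R b)) (at x)" if "x \<in> U" for x
      unfolding G_def by (intro has_derivative_sum has_derivative_scaleR_left C1_on_deriv[OF h that])
  qed
qed

section \<open>The horizontal Hessian and its tangential trace\<close>

definition hor :: "'n::finite horiz \<Rightarrow> 'n horiz \<Rightarrow> 'n heis" where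
  "hor z w = (w, - inner (rotJ z) w / 2)"

lemma hX_hor: "hX i g = hor (fst g) (bvec i)"
  by (simp add: hX_eq hor_def)

lemma hor_linear: "hor z (a + b) = hor z a + hor z b" "hor z (c *\<^sub>R a) = c *\<^sub>R hor z a"
  "hor z (a - b) = hor z a - hor z b"
  by (simp_all add: hor_def inner_add_right inner_diff_right diff_divide_distrib add_divide_distrib)

lemma hor_sum: "hor z (\<Sum>i\<in>I. f i) = (\<Sum>i\<in>I. hor z (f i))"
  by (induction I rule: infinite_finite_induct) (simp_all add: hor_linear, simp_all add: hor_def flip: zero_prod_def)

text \<open>The adjoint of the horizontal lift \<open>hor (fst g)\<close>: applied to a Euclidean
  gradient it gives the vector of the \<open>p\<^sub>i\<close>.\<close>

definition hproj :: "'n::finite heis \<Rightarrow> 'n heis \<Rightarrow> 'n horiz" where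
  "hproj g N = fst N - (snd N / 2) *\<^sub>R rotJ (fst g)"

lemma inner_hor: "inner N (hor (fst g) w) = inner (hproj g N) w"
  by (cases N) (simp add: hor_def hproj_def inner_diff_left)

lemma Xd_has_derivative:
  assumes "(f has_derivative D) (at g)" shows "Xd i f g = D (hX i g)"
proof -
  interpret bounded_linear D by (rule has_derivative_bounded_linear[OF assms])
  have L: "((\<lambda>s::real. g + s *\<^sub>R hX i g) has_derivative (\<lambda>s. s *\<^sub>R hX i g)) (at 0)"
    by (auto intro!: derivative_eq_intros)
  have "((\<lambda>s::real. f (g + s *\<^sub>R hX i g)) has_derivative (\<lambda>s. D (s *\<^sub>R hX i g))) (at 0)"
    using has_derivative_compose[OF L, of f D] assms by simp
  then have "((\<lambda>s::real. f (g + s *\<^sub>R hX i g)) has_real_derivative D (hX i g)) (at 0)"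
    by (simp add: has_field_derivative_def scaleR mult_commute_abs)
  then show ?thesis unfolding Xd_def by (rule DERIV_imp_deriv)
qed

lemma bvec_expand: "(\<Sum>i\<in>UNIV. inner P (bvec i) *\<^sub>R bvec i) = (P :: 'n::finite horiz)"
  using sum_bvec[of "\<lambda>e. inner P e *\<^sub>R e"] by (simp add: euclidean_representation)

definition hess_form :: "('n::finite heis \<Rightarrow> 'n heis) \<Rightarrow> 'n horiz \<Rightarrow> 'n horiz \<Rightarrow> 'n horiz \<Rightarrow> real" where
  "hess_form H z a b = inner (H (hor z a)) (hor z b)"

text \<open>The horizontal mean curvature is a tangential trace of the horizontal Hessian divided by the
  length of the horizontal normal.\<close>

definition hess_trace :: "('n::finite heis \<Rightarrow> 'n heis) \<Rightarrow> 'n horiz \<Rightarrow> 'n horiz \<Rightarrow> real" where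
  "hess_trace H z n = (\<Sum>i\<in>UNIV. hess_form H z (bvec i - inner n (bvec i) *\<^sub>R n) (bvec i - inner n (bvec i) *\<^sub>R n))"

lemma hess_form_linear:
  assumes "linear H"
  shows "hess_form H z (a - b) c = hess_form H z a c - hess_form H z b c"
    "hess_form H z a (b - c) = hess_form H z a b - hess_form H z a c"
    "hess_form H z (r *\<^sub>R a) c = r * hess_form H z a c"
    "hess_form H z a (r *\<^sub>R c) = r * hess_form H z a c"
  by (simp_all add: hess_form_def hor_linear linear_diff[OF assms] linear_scale[OF assms]
      inner_diff_left inner_diff_right)

lemma hess_form_sum:
  assumes "linear H"
  shows "hess_form H z (\<Sum>i\<in>I. f i) c = (\<Sum>i\<in>I. hess_form H z (f i) c)"
    "hess_form H z a (\<Sum>i\<in>I. f i) = (\<Sum>i\<in>I. hess_form H z a (f i))"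
  by (simp_all add: hess_form_def hor_sum linear_sum[OF assms] inner_sum_left inner_sum_right)

text \<open>The projected basis vectors span the complement of \<open>n\<close>, so the normal value
  is removed from the full trace. \<open>hess_trace\<close> is phrased with values on the diagonal
  at tangent vectors because these are what curves in the boundary determine.\<close>

lemma hess_trace_eq:
  assumes H: "linear H" and n: "norm n = 1"
  shows "hess_trace H z n = (\<Sum>i\<in>UNIV. hess_form H z (bvec i) (bvec i)) - hess_form H z n n"
proof -
  let ?Q = "hess_form H z"
  have e: "?Q (bvec i - inner n (bvec i) *\<^sub>R n) (bvec i - inner n (bvec i) *\<^sub>R n)
    = ?Q (bvec i) (bvec i) - ?Q (bvec i) (inner n (bvec i) *\<^sub>R n) - ?Q n (inner n (bvec i) *\<^sub>R bvec i)
      + inner n (bvec i) * inner n (bvec i) * ?Q n n" for i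
    by (simp add: hess_form_linear[OF H] algebra_simps)
  have 1: "(\<Sum>i\<in>UNIV. ?Q (bvec i) (inner n (bvec i) *\<^sub>R n)) = ?Q n n"
  proof -
    have "(\<Sum>i\<in>UNIV. ?Q (bvec i) (inner n (bvec i) *\<^sub>R n)) = (\<Sum>i\<in>UNIV. ?Q (inner n (bvec i) *\<^sub>R bvec i) n)"
      by (simp add: hess_form_linear[OF H])
    also have "\<dots> = ?Q n n" unfolding hess_form_sum(1)[OF H, symmetric] bvec_expand ..
    finally show ?thesis .
  qed
  have 2: "(\<Sum>i\<in>UNIV. ?Q n (inner n (bvec i) *\<^sub>R bvec i)) = ?Q n n"
    unfolding hess_form_sum(2)[OF H, symmetric] bvec_expand ..
  have 3: "(\<Sum>i\<in>UNIV. inner n (bvec i) * inner n (bvec i) * ?Q n n) = ?Q n n"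
    using sum_bvec_inner[of n n] n by (simp add: sum_distrib_right[symmetric] dot_square_norm)
  show ?thesis unfolding hess_trace_def e sum.distrib sum_subtractf 1 2 3 by simp
qed

lemma hp_gradient:
  assumes U: "open U" and x: "x \<in> U" and G: "\<And>x. x \<in> U \<Longrightarrow> (\<phi> has_derivative inner (G x)) (at x)"
  shows "hp \<phi> i x = inner (hproj x (G x)) (bvec i)" "hW \<phi> x = norm (hproj x (G x))"
proof -
  show hp: "hp \<phi> i x = inner (hproj x (G x)) (bvec i)" for i
  proof -
    have "\<phi> differentiable (at x)" using G[OF x] by (auto simp: differentiable_def)
    then have "hp \<phi> i x = Xd i \<phi> x" by (rule hp_eq_Xd)
    also have "\<dots> = inner (G x) (hX i x)" by (rule Xd_has_derivative[OF G[OF x]])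
    finally show ?thesis by (simp add: hX_hor inner_hor)
  qed
  show "hW \<phi> x = norm (hproj x (G x))"
    unfolding hW_def hp by (simp add: sum_bvec_square)
qed

text \<open>The quotient rule for \<open>hp / hW\<close> subtracts the derivative in the normal
  direction; this is the passage from the full trace of the horizontal Hessian to the tangential
  one.\<close>

lemma curvature_eq_hess_trace:
  fixes \<phi> :: "'n::finite heis \<Rightarrow> real"
  assumes U: "open U" "g \<in> U" and G: "\<And>x. x \<in> U \<Longrightarrow> (\<phi> has_derivative inner (G x)) (at x)"
    and H: "(G has_derivative H) (at g)" and P: "hproj g (G g) \<noteq> 0"
  shows "(\<Sum>i\<in>UNIV. Xd i (\<lambda>g'. hp \<phi> i g' / hW \<phi> g') g)
    = hess_trace H (fst g) (hproj g (G g) /\<^sub>R norm (hproj g (G g))) / norm (hproj g (G g))"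
proof -
  define z where "z = fst g"
  define p where "p x = hproj x (G x)" for x
  define P' where "P' = p g"
  define p' where "p' v = fst (H v) - ((snd (G g) / 2) *\<^sub>R rotJ (fst v) + (snd (H v) / 2) *\<^sub>R rotJ z)" for v
  have P0: "norm P' > 0" using P by (simp add: P'_def p_def)
  have lin: "linear H" by (rule has_derivative_linear[OF H])
  have "(p has_derivative p') (at g)"
  proof -
    have 1: "((\<lambda>x. rotJ (fst x)) has_derivative (\<lambda>v. rotJ (fst v))) (at g)"
      by (intro bounded_linear.has_derivative[OF bounded_linear_rotJ] has_derivative_fst has_derivative_ident)
    have 2: "((\<lambda>x. snd (G x) / 2) has_derivative (\<lambda>v. snd (H v) / 2)) (at g)"
      using has_derivative_mult_right[OF has_derivative_snd[OF H], of "1 / 2"] by simp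
    show ?thesis unfolding p_def[abs_def] p'_def[abs_def] hproj_def z_def
      by (intro has_derivative_diff has_derivative_fst[OF H] has_derivative_scaleR 1 2)
  qed
  note pd = this
  \<comment> \<open>The additional term stems from the frame varying with the base point. It is
    antisymmetric in \<open>w\<close> and \<open>w'\<close>, so it vanishes for
    \<open>w = w'\<close>, and the sums \<open>s1\<close> and \<open>s2\<close> involve only such
    values.\<close>
  have p'Q: "inner (p' (hor z w)) w' = hess_form H z w w' - snd (G g) / 2 * inner (rotJ w) w'" for w w'
    by (cases "H (w, - inner (rotJ z) w / 2)")
       (simp add: p'_def hess_form_def hor_def inner_diff_left inner_add_left)
  have lp': "linear p'" by (rule has_derivative_linear[OF pd])
  have X: "Xd i (\<lambda>g'. hp \<phi> i g' / hW \<phi> g') g =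
     (inner (p' (hor z (bvec i))) (bvec i) * norm P' - inner P' (bvec i) * inner (p' (hor z (bvec i))) (sgn P')) / (norm P' * norm P')" for i
  proof -
    have 1: "((\<lambda>x. inner (p x) (bvec i)) has_derivative (\<lambda>v. inner (p' v) (bvec i))) (at g)"
      by (intro has_derivative_inner_left pd)
    have 2: "((\<lambda>x. norm (p x)) has_derivative (\<lambda>v. inner (p' v) (sgn P'))) (at g)"
      by (rule has_derivative_compose[OF pd]) (use P0 in \<open>simp add: P'_def[symmetric] has_derivative_norm\<close>)
    have "((\<lambda>x. inner (p x) (bvec i) / norm (p x)) has_derivative
       (\<lambda>v. (inner (p' v) (bvec i) * norm (p g) - inner (p g) (bvec i) * inner (p' v) (sgn P')) / (norm (p g) * norm (p g)))) (at g)"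
      by (rule has_derivative_divide'[OF 1 2]) (use P0 in \<open>simp add: P'_def\<close>)
    then have "((\<lambda>g'. hp \<phi> i g' / hW \<phi> g') has_derivative
       (\<lambda>v. (inner (p' v) (bvec i) * norm (p g) - inner (p g) (bvec i) * inner (p' v) (sgn P')) / (norm (p g) * norm (p g)))) (at g)"
      by (rule has_derivative_transform_within_open[OF _ U])
         (simp add: hp_gradient[OF U(1) _ G] p_def)
    from Xd_has_derivative[OF this] show ?thesis by (simp add: hX_hor P'_def z_def)
  qed
  define n where "n = P' /\<^sub>R norm P'"
  have nn: "norm n = 1" using P0 by (simp add: n_def)
  have sg: "sgn P' = n" by (simp add: n_def sgn_div_norm)
  have Pn: "P' = norm P' *\<^sub>R n" using P0 by (simp add: n_def)
  have X': "Xd i (\<lambda>g'. hp \<phi> i g' / hW \<phi> g') g =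
     (inner (p' (hor z (bvec i))) (bvec i) - inner n (bvec i) * inner (p' (hor z (bvec i))) n) / norm P'" for i
  proof -
    have "inner P' (bvec i) = norm P' * inner n (bvec i)" by (subst Pn) simp
    then have "Xd i (\<lambda>g'. hp \<phi> i g' / hW \<phi> g') g =
      norm P' * (inner (p' (hor z (bvec i))) (bvec i) - inner n (bvec i) * inner (p' (hor z (bvec i))) n) / (norm P' * norm P')"
      unfolding X sg by (simp only: right_diff_distrib mult_ac)
    then show ?thesis using P0 by simp
  qed
  have s1: "(\<Sum>i\<in>UNIV. inner (p' (hor z (bvec i))) (bvec i)) = (\<Sum>i\<in>UNIV. hess_form H z (bvec i) (bvec i))"
    unfolding p'Q by simp
  have s2: "(\<Sum>i\<in>UNIV. inner n (bvec i) * inner (p' (hor z (bvec i))) n) = hess_form H z n n"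
  proof -
    have "(\<Sum>i\<in>UNIV. inner n (bvec i) * inner (p' (hor z (bvec i))) n)
      = inner (p' (hor z (\<Sum>i\<in>UNIV. inner n (bvec i) *\<^sub>R bvec i))) n"
      by (simp add: hor_sum linear_sum[OF lp'] inner_sum_left hor_linear linear_scale[OF lp'])
    also have "\<dots> = hess_form H z n n" unfolding bvec_expand p'Q by simp
    finally show ?thesis .
  qed
  have "(\<Sum>i\<in>UNIV. Xd i (\<lambda>g'. hp \<phi> i g' / hW \<phi> g') g) = hess_trace H z n / norm P'"
    unfolding X' sum_divide_distrib[symmetric] sum_subtractf s1 s2 hess_trace_eq[OF lin nn] ..
  then show ?thesis unfolding n_def P'_def p_def z_def .
qed

text \<open>Differentiating \<open>\<phi> (\<gamma> s) = 0\<close> once and twice. The second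
  identity ties the Hessian on a tangent vector to the acceleration of the curve, which does not
  depend on the defining function.\<close>

lemma surface_curve_derivs:
  fixes \<phi> :: "'a::euclidean_space \<Rightarrow> real"
  assumes U: "open U" "g \<in> U" and G: "\<And>x. x \<in> U \<Longrightarrow> (\<phi> has_derivative inner (G x)) (at x)"
    and H: "(G has_derivative H) (at g)" and S: "\<And>x. x \<in> S \<Longrightarrow> x \<in> U \<Longrightarrow> \<phi> x = 0"
    and d: "d > 0" and \<gamma>: "\<And>s. \<bar>s\<bar> < d \<Longrightarrow> (\<gamma> has_vector_derivative \<gamma>' s) (at s)" "\<And>s. \<bar>s\<bar> < d \<Longrightarrow> \<gamma> s \<in> S"
    and \<gamma>0: "\<gamma> 0 = g" "\<gamma>' 0 = v" and w: "(\<gamma>' has_vector_derivative w) (at 0)"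
  shows "inner (G g) v = 0" "inner (H v) v + inner (G g) w = 0"
proof -
  have c: "isCont \<gamma> 0" using \<gamma>(1)[of 0] d by (auto intro: has_vector_derivative_continuous)
  have "\<forall>\<^sub>F s in nhds 0. \<gamma> s \<in> U"
    by (rule topological_tendstoD[OF c[unfolded isCont_def tendsto_at_iff_tendsto_nhds] U(1)]) (use U(2) \<gamma>0(1) in simp)
  then obtain e where e: "e > 0" "\<And>s. \<bar>s\<bar> < e \<Longrightarrow> \<gamma> s \<in> U"
    unfolding eventually_nhds_metric by (auto simp: dist_real_def)
  define m where "m = min d e"
  have m: "m > 0" using d e by (simp add: m_def)
  have z: "inner (G (\<gamma> s)) (\<gamma>' s) = 0" if s: "\<bar>s\<bar> < m" for s
  proof -
    have "(\<gamma> has_derivative (\<lambda>h. h *\<^sub>R \<gamma>' s)) (at s)"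
      using \<gamma>(1)[of s] s by (simp add: has_vector_derivative_def m_def)
    from has_derivative_compose[OF this G[OF e(2)]]
    have 1: "((\<lambda>s. \<phi> (\<gamma> s)) has_derivative (\<lambda>h. inner (G (\<gamma> s)) (h *\<^sub>R \<gamma>' s))) (at s)"
      using s by (simp add: m_def)
    have "((\<lambda>s. \<phi> (\<gamma> s)) has_derivative (\<lambda>h. 0)) (at s)"
    proof (rule has_derivative_transform_within_open[where f="\<lambda>_. 0" and s="{-m<..<m}"])
      fix r assume "r \<in> {-m<..<m}"
      then have "\<bar>r\<bar> < d" "\<bar>r\<bar> < e" by (auto simp: m_def)
      then show "0 = \<phi> (\<gamma> r)" using S[OF \<gamma>(2) e(2)] by simp
    qed (use s in auto)
    from has_derivative_unique[OF 1 this] have "(\<lambda>h. inner (G (\<gamma> s)) (h *\<^sub>R \<gamma>' s)) = (\<lambda>h. 0)" .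
    from fun_cong[OF this, of 1] show ?thesis by simp
  qed
  show "inner (G g) v = 0" using z[of 0] m \<gamma>0 by simp
  have \<gamma>d: "(\<gamma> has_derivative (\<lambda>h. h *\<^sub>R v)) (at 0)"
    using \<gamma>(1)[of 0] d \<gamma>0 by (simp add: has_vector_derivative_def)
  have Gd: "((\<lambda>s. G (\<gamma> s)) has_derivative (\<lambda>h. H (h *\<^sub>R v))) (at 0)"
    by (rule has_derivative_compose[OF \<gamma>d]) (use H \<gamma>0 in simp)
  have wd: "(\<gamma>' has_derivative (\<lambda>h. h *\<^sub>R w)) (at 0)" using w by (simp add: has_vector_derivative_def)
  have 1: "((\<lambda>s. inner (G (\<gamma> s)) (\<gamma>' s)) has_derivative (\<lambda>h. inner (G (\<gamma> 0)) (h *\<^sub>R w) + inner (H (h *\<^sub>R v)) (\<gamma>' 0))) (at 0)"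
    by (rule has_derivative_inner[OF Gd wd])
  have "((\<lambda>s. inner (G (\<gamma> s)) (\<gamma>' s)) has_derivative (\<lambda>h. 0)) (at 0)"
    by (rule has_derivative_transform_within_open[where f="\<lambda>_. 0" and s="{-m<..<m}"]) (use z m in auto)
  from has_derivative_unique[OF 1 this]
  have "(\<lambda>h. inner (G (\<gamma> 0)) (h *\<^sub>R w) + inner (H (h *\<^sub>R v)) (\<gamma>' 0)) = (\<lambda>h. 0)" .
  from fun_cong[OF this, of 1] show "inner (H v) v + inner (G g) w = 0" using \<gamma>0 by simp
qed

section \<open>Gradient, Hessian and curves of the boundary off the poles\<close>

definition side_grad :: "real \<Rightarrow> 'n::finite heis \<Rightarrow> 'n heis" where
  "side_grad R g = (2 *\<^sub>R fst g, 4 * tangent R (snd g))"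

definition side_hess :: "real \<Rightarrow> 'n::finite heis \<Rightarrow> 'n heis \<Rightarrow> 'n heis" where
  "side_hess R g v = (2 *\<^sub>R fst v, 8 * (1 + (tangent R (snd g))\<^sup>2)\<^sup>2 / R\<^sup>2 * snd v)"

lemma side_hess:
  assumes R: "R > 0" and g: "g \<in> side_dom R"
  shows "(side_grad R has_derivative side_hess R g) (at g)"
proof -
  have t: "\<bar>snd g\<bar> < pi * R\<^sup>2 / 8" using g by (simp add: side_dom_def)
  have "((\<lambda>g. tangent R (snd g)) has_derivative (\<lambda>v. 2 * (1 + (tangent R (snd g))\<^sup>2)\<^sup>2 / R\<^sup>2 * snd v)) (at g)"
    by (rule has_derivative_compose[OF has_derivative_snd[OF has_derivative_ident]
        tangent_deriv[OF R t, unfolded has_field_derivative_def]])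
  then have "((\<lambda>g. (2 *\<^sub>R fst g, 4 * tangent R (snd g))) has_derivative
     (\<lambda>v. (2 *\<^sub>R fst v, 4 * (2 * (1 + (tangent R (snd g))\<^sup>2)\<^sup>2 / R\<^sup>2 * snd v)))) (at g)"
    by (intro has_derivative_Pair has_derivative_scaleR_right has_derivative_mult_right
        has_derivative_fst has_derivative_ident)
  then show ?thesis
    unfolding side_grad_def[abs_def] side_hess_def[abs_def] by (rule has_derivative_eq_rhs) (simp add: fun_eq_iff)
qed

text \<open>The curve moves in a straight line, with the horizontal component rescaled back to the surface.\<close>

lemma side_curve:
  fixes g v :: "'n::finite heis"
  assumes R: "R > 0" and g: "g \<in> side_dom R" "side_fun R g = 0" and v: "inner (side_grad R g) v = 0"
  obtains \<gamma> \<gamma>' w d where "d > 0" "\<And>s. \<bar>s\<bar> < d \<Longrightarrow> (\<gamma> has_vector_derivative \<gamma>' s) (at s)"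
    "\<And>s. \<bar>s\<bar> < d \<Longrightarrow> \<gamma> s \<in> frontier (extremal R)" "\<gamma> 0 = g" "\<gamma>' 0 = v" "(\<gamma>' has_vector_derivative w) (at 0)"
proof -
  obtain z t where gz: "g = (z, t)" by (cases g)
  obtain y r where vy: "v = (y, r)" by (cases v)
  have z0: "z \<noteq> 0" and t: "\<bar>t\<bar> < pi * R\<^sup>2 / 8" using g by (auto simp: side_dom_def gz)
  have zh: "(norm z)\<^sup>2 = height R t" using g by (simp add: side_fun_def gz)
  define T where "T = pi * R\<^sup>2 / 8"
  define a where "a s = height R (t + s * r)" for s
  define c where "c s = (norm z)\<^sup>2 + (2 * inner z y * s + (norm y)\<^sup>2 * s\<^sup>2)" for s
  have c: "c s = (norm (z + s *\<^sub>R y))\<^sup>2" for s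
    unfolding c_def power2_norm_eq_inner by (simp add: inner_add_left inner_add_right inner_commute power2_eq_square algebra_simps)
  define a' where "a' s = - 4 * tangent R (t + s * r) * r" for s
  define c' where "c' s = 2 * inner z y + 2 * (norm y)\<^sup>2 * s" for s
  define q where "q s = a s / c s" for s
  define q' where "q' s = (a' s * c s - a s * c' s) / (c s * c s)" for s
  \<comment> \<open>The factor that gives the horizontal component the squared norm
    \<open>height\<close> prescribes at the current \<open>t\<close>.\<close>
  define \<rho> where "\<rho> s = sqrt (q s)" for s
  define \<rho>' where "\<rho>' s = inverse (\<rho> s) / 2 * q' s" for s
  have "open {s. z + s *\<^sub>R y \<noteq> 0 \<and> \<bar>t + s * r\<bar> < T}"
    by (intro open_Collect_conj open_Collect_neq open_Collect_less continuous_intros)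
  moreover have "0 \<in> {s. z + s *\<^sub>R y \<noteq> 0 \<and> \<bar>t + s * r\<bar> < T}" using z0 t by (simp add: T_def)
  ultimately obtain d where d: "d > 0" "ball 0 d \<subseteq> {s. z + s *\<^sub>R y \<noteq> 0 \<and> \<bar>t + s * r\<bar> < T}"
    using open_contains_ball by blast
  have ok: "z + s *\<^sub>R y \<noteq> 0" "\<bar>t + s * r\<bar> < pi * R\<^sup>2 / 8" if "\<bar>s\<bar> < d" for s
  proof -
    have "s \<in> ball 0 d" using that by simp
    then show "z + s *\<^sub>R y \<noteq> 0" "\<bar>t + s * r\<bar> < pi * R\<^sup>2 / 8" using d(2) by (auto simp: T_def)
  qed
  have c0: "c s > 0" if "\<bar>s\<bar> < d" for s using ok[OF that] by (simp add: c)
  have a0: "a s > 0" for s using height_bounds(1)[OF R] by (simp add: a_def)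
  have lin: "((\<lambda>s. t + s * r) has_real_derivative r) (at s)" for s by (auto intro!: derivative_eq_intros)
  have ad: "(a has_real_derivative a' s) (at s)" if "\<bar>s\<bar> < d" for s
    unfolding a_def[abs_def] a'_def by (rule DERIV_chain2[OF height_deriv[OF R ok(2)[OF that]] lin])
  have cd: "(c has_real_derivative c' s) (at s)" for s
    unfolding c_def[abs_def] c'_def by (auto intro!: derivative_eq_intros)
  have qd: "(q has_real_derivative q' s) (at s)" if "\<bar>s\<bar> < d" for s
    unfolding q_def[abs_def] q'_def using c0[OF that] by (intro DERIV_divide ad cd that) auto
  have q0: "q s > 0" if "\<bar>s\<bar> < d" for s using c0[OF that] a0 by (simp add: q_def)
  have \<rho>d: "(\<rho> has_real_derivative \<rho>' s) (at s)" if "\<bar>s\<bar> < d" for s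
    unfolding \<rho>_def[abs_def] \<rho>'_def by (rule DERIV_chain2[OF DERIV_real_sqrt[OF q0[OF that]] qd[OF that]])
  have a'd: "(a' has_real_derivative - 4 * (2 * (1 + (tangent R t)\<^sup>2)\<^sup>2 / R\<^sup>2 * r) * r) (at 0)"
  proof -
    have "((\<lambda>s. tangent R (t + s * r)) has_real_derivative 2 * (1 + (tangent R (t + 0 * r))\<^sup>2)\<^sup>2 / R\<^sup>2 * r) (at 0)"
      by (rule DERIV_chain2[OF tangent_deriv[OF R] lin]) (use t in simp)
    from DERIV_cmult_right[OF DERIV_cmult[OF this, of "-4"], of r] show ?thesis by (simp add: a'_def[abs_def] mult.assoc)
  qed
  have c'd: "(c' has_real_derivative 2 * (norm y)\<^sup>2) (at 0)"
    unfolding c'_def[abs_def] by (auto intro!: derivative_eq_intros)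
  have d00: "\<bar>0::real\<bar> < d" using d by simp
  have "\<exists>D. (q' has_real_derivative D) (at 0)"
    unfolding q'_def[abs_def]
    using DERIV_divide[OF DERIV_diff[OF DERIV_mult[OF a'd cd] DERIV_mult[OF ad[OF d00] c'd]] DERIV_mult[OF cd cd]]
      c0[OF d00] by fastforce
  then obtain D where D: "(q' has_real_derivative D) (at 0)" by blast
  have \<rho>00: "\<rho> 0 = 1" using zh[symmetric] z0 by (simp add: \<rho>_def q_def a_def c_def)
  have "((\<lambda>s. inverse (\<rho> s)) has_real_derivative - (inverse (\<rho> 0) * \<rho>' 0 * inverse (\<rho> 0))) (at 0)"
    by (rule DERIV_inverse'[OF \<rho>d[OF d00]]) (simp add: \<rho>00)
  from DERIV_mult[OF DERIV_cdivide[OF this, of 2] D] obtain D' where D': "(\<rho>' has_real_derivative D') (at 0)"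
    unfolding \<rho>'_def[abs_def] by blast
  \<comment> \<open>Tangency of \<open>v\<close> says that numerator and denominator of
    \<open>q\<close> have the same derivative at 0. The rescaling is thus stationary and leaves the
    initial velocity \<open>v\<close> intact.\<close>
  have \<rho>'0: "\<rho>' 0 = 0"
  proof -
    have "2 * inner z y + 4 * tangent R t * r = 0" using v by (simp add: side_grad_def gz vy)
    then have "- 4 * tangent R t * r = 2 * inner z y" by linarith
    then have "a' 0 = c' 0" by (simp add: a'_def c'_def)
    moreover have "a 0 = c 0" using zh by (simp add: a_def c_def)
    ultimately show ?thesis by (simp add: \<rho>'_def q'_def)
  qed
  define \<gamma> where "\<gamma> s = (\<rho> s *\<^sub>R (z + s *\<^sub>R y), t + s * r)" for s
  define \<gamma>' where "\<gamma>' s = (\<rho> s *\<^sub>R y + \<rho>' s *\<^sub>R (z + s *\<^sub>R y), r)" for s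
  have l: "((\<lambda>s. z + s *\<^sub>R y) has_vector_derivative y) (at s)" for s
    by (auto intro!: derivative_eq_intros)
  show ?thesis
  proof
    show "d > 0" by (rule d)
    show "(\<gamma> has_vector_derivative \<gamma>' s) (at s)" if "\<bar>s\<bar> < d" for s
      unfolding \<gamma>_def[abs_def] \<gamma>'_def
      by (intro has_vector_derivative_Pair has_vector_derivative_scaleR \<rho>d[OF that] l)
         (use lin in \<open>simp add: has_real_derivative_iff_has_vector_derivative\<close>)
    show "\<gamma> s \<in> frontier (extremal R)" if s: "\<bar>s\<bar> < d" for s
    proof -
      have \<rho>s: "\<rho> s > 0" using q0[OF s] by (simp add: \<rho>_def)
      have dom: "\<gamma> s \<in> side_dom R" using ok[OF s] \<rho>s by (simp add: side_dom_def \<gamma>_def)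
      have "(norm (\<rho> s *\<^sub>R (z + s *\<^sub>R y)))\<^sup>2 = q s * c s"
        using q0[OF s] by (simp add: power_mult_distrib c \<rho>_def)
      also have "\<dots> = a s" using c0[OF s] by (simp add: q_def)
      finally have "side_fun R (\<gamma> s) = 0" by (simp add: side_fun_def \<gamma>_def a_def)
      then show ?thesis using side_fun_extremal(1)[OF R dom] by simp
    qed
    show "\<gamma> 0 = g" by (simp add: \<gamma>_def \<rho>00 gz)
    show "\<gamma>' 0 = v" by (simp add: \<gamma>'_def \<rho>00 \<rho>'0 vy)
    have "((\<lambda>s. \<rho> s *\<^sub>R y + \<rho>' s *\<^sub>R (z + s *\<^sub>R y)) has_vector_derivative
       (\<rho> 0 *\<^sub>R 0 + \<rho>' 0 *\<^sub>R y) + (\<rho>' 0 *\<^sub>R y + D' *\<^sub>R (z + 0 *\<^sub>R y))) (at 0)"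
      by (intro has_vector_derivative_add has_vector_derivative_scaleR \<rho>d[OF d00] D' l has_vector_derivative_const)
    then show "(\<gamma>' has_vector_derivative ((\<rho> 0 *\<^sub>R 0 + \<rho>' 0 *\<^sub>R y) + (\<rho>' 0 *\<^sub>R y + D' *\<^sub>R (z + 0 *\<^sub>R y)), 0)) (at 0)"
      unfolding \<gamma>'_def[abs_def] by (intro has_vector_derivative_Pair has_vector_derivative_const)
  qed
qed

text \<open>The projection is \<open>2 z - 2 k rotJ z\<close> with \<open>k\<close> the tangent, a
  sum of orthogonal vectors, and on the boundary
  \<open>(norm z)\<^sup>2 * (1 + k\<^sup>2) = R\<^sup>2\<close>.\<close>

lemma side_hproj:
  assumes R: "R > 0" and g: "side_fun R g = 0"
  shows "norm (hproj g (side_grad R g)) = 2 * R"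
proof -
  let ?k = "tangent R (snd g)"
  have "(norm (hproj g (side_grad R g)))\<^sup>2 = 4 * ((norm (fst g))\<^sup>2 * (1 + ?k\<^sup>2))"
    unfolding power2_norm_eq_inner hproj_def side_grad_def
    by (simp add: inner_diff_left inner_diff_right power2_eq_square algebra_simps)
  also have "(norm (fst g))\<^sup>2 * (1 + ?k\<^sup>2) = R\<^sup>2"
    using g one_plus_square_pos[of ?k] by (simp add: side_fun_def height_def)
  finally have "(norm (hproj g (side_grad R g)))\<^sup>2 = (2 * R)\<^sup>2" by (simp add: power2_eq_square)
  then show ?thesis using R by (intro power2_eq_imp_eq[of "norm (hproj g (side_grad R g))" "2 * R"]) auto
qed

text \<open>The Hessian is twice the identity plus \<open>K\<close> times the square of the pairing
  with \<open>rotJ z\<close>. The full trace is \<open>4 n + K * (norm z)\<^sup>2\<close>. The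
  normal value exceeds \<open>K * (norm z)\<^sup>2\<close> by exactly 0: on the boundary its
  \<open>K\<close>-part falls short of it by 2, which the \<open>2 * inner n n\<close> makes
  up.\<close>

lemma side_hess_trace:
  fixes g :: "'n::finite heis"
  assumes R: "R > 0" and g: "g \<in> side_dom R" "side_fun R g = 0"
  shows "hess_trace (side_hess R g) (fst g) (hproj g (side_grad R g) /\<^sub>R (2 * R)) = 4 * real CARD('n)"
proof -
  let ?k = "tangent R (snd g)"
  define z where "z = fst g"
  define K where "K = 2 * (1 + ?k\<^sup>2)\<^sup>2 / R\<^sup>2"
  define n where "n = hproj g (side_grad R g) /\<^sub>R (2 * R)"
  have n: "norm n = 1" using side_hproj[OF R g(2)] R by (simp add: n_def)
  have lin: "linear (side_hess R g)" by (rule has_derivative_linear[OF side_hess[OF R g(1)]])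
  have zz: "(norm z)\<^sup>2 * (1 + ?k\<^sup>2) = R\<^sup>2"
    using g(2) one_plus_square_pos[of ?k] by (simp add: side_fun_def height_def z_def)
  have Q: "hess_form (side_hess R g) z a b = 2 * inner a b + K * (inner (rotJ z) a * inner (rotJ z) b)" for a b
    by (simp add: hess_form_def side_hess_def hor_def K_def)
  have s: "(\<Sum>i\<in>UNIV. hess_form (side_hess R g) z (bvec i) (bvec i)) = 4 * real CARD('n) + K * (norm z)\<^sup>2"
  proof -
    have 1: "(\<Sum>i\<in>(UNIV :: ('n + 'n) set). 2 * inner (bvec i :: 'n horiz) (bvec i)) = 4 * real CARD('n)"
      using sum_bvec[of "\<lambda>e::'n horiz. 2 * inner e e"] by (simp add: inner_Basis)
    have 2: "(\<Sum>i\<in>UNIV. K * (inner (rotJ z) (bvec i) * inner (rotJ z) (bvec i))) = K * (norm z)\<^sup>2"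
      unfolding sum_distrib_left[symmetric] sum_bvec_inner by (simp add: dot_square_norm)
    show ?thesis unfolding Q sum.distrib 1 2 ..
  qed
  have "inner (rotJ z) n = - ?k * (norm z)\<^sup>2 / R"
  proof -
    have "inner (rotJ z) n = inverse (2 * R) * (2 * inner (rotJ z) z - 2 * ?k * inner (rotJ z) (rotJ z))"
      by (simp add: n_def hproj_def side_grad_def z_def inner_diff_right)
    also have "\<dots> = inverse (2 * R) * (- 2 * ?k * (norm z)\<^sup>2)" by (simp only: inner_rotJ dot_square_norm) simp
    also have "inverse (2 * R) * (- 2 * k * x) = - k * x / R" for k x using R by (simp add: field_simps)
    finally show ?thesis .
  qed
  then have "inner (rotJ z) n * inner (rotJ z) n = ?k\<^sup>2 * ((norm z)\<^sup>2)\<^sup>2 / R\<^sup>2"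
    by (simp add: power2_eq_square)
  then have Qn: "hess_form (side_hess R g) z n n = 2 + K * (?k\<^sup>2 * ((norm z)\<^sup>2)\<^sup>2 / R\<^sup>2)"
    unfolding Q using n by (simp add: dot_square_norm)
  have "K * (norm z)\<^sup>2 - K * (?k\<^sup>2 * ((norm z)\<^sup>2)\<^sup>2 / R\<^sup>2) = 2"
  proof -
    define x where "x = (norm z)\<^sup>2"
    define q where "q = 1 + ?k\<^sup>2"
    have xq: "x * q = R\<^sup>2" using zz by (simp add: x_def q_def)
    have R2: "R\<^sup>2 \<noteq> 0" using R by simp
    have "K * x - K * (?k\<^sup>2 * x\<^sup>2 / R\<^sup>2) = K * x * (R\<^sup>2 - ?k\<^sup>2 * x) / R\<^sup>2"
      using R2 by (simp add: field_simps power2_eq_square)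
    also have "R\<^sup>2 - ?k\<^sup>2 * x = x" using xq by (simp add: q_def algebra_simps)
    also have "K * x * x / R\<^sup>2 = 2 * (x * q)\<^sup>2 / (R\<^sup>2 * R\<^sup>2)" by (simp add: K_def q_def power2_eq_square)
    also have "\<dots> = 2" unfolding xq using R2 by (simp add: power2_eq_square)
    finally show ?thesis by (simp add: x_def)
  qed
  then show ?thesis
    unfolding n_def[symmetric] z_def[symmetric] hess_trace_eq[OF lin n] s Qn by simp
qed

text \<open>Every curve in the boundary gives relations for \<open>\<phi>\<close> and for
  \<open>side_fun\<close> alike. Those of first order make the gradients proportional with some
  factor \<open>l\<close>; those of second order make the Hessians proportional on tangent vectors
  with the same \<open>l\<close>. The factor cancels in the curvature once it is known to be
  positive.\<close>

lemma outer_defining_side: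
  fixes \<phi> :: "'n::finite heis \<Rightarrow> real"
  assumes R: "R > 0" and g: "g \<in> side_dom R" "g \<in> frontier (extremal R)"
    and U: "g \<in> U" "outer_defining_function (extremal R) U \<phi>"
  shows "hW \<phi> g \<noteq> 0" "(\<Sum>i\<in>UNIV. Xd i (\<lambda>g'. hp \<phi> i g' / hW \<phi> g') g) = 2 * real CARD('n) / R"
proof -
  have oU: "open U" and C: "Cn_on 2 \<phi> U" and nz: "frechet_derivative \<phi> (at g) \<noteq> (\<lambda>_. 0)"
    and S: "frontier (extremal R) \<inter> U = {g \<in> U. \<phi> g = 0}" and E: "extremal R \<inter> U = {g \<in> U. \<phi> g < 0}"
    using U unfolding outer_defining_function_def defining_function_def C_on_numeral_iff by blast+
  have \<phi>S: "\<phi> x = 0" if "x \<in> frontier (extremal R)" "x \<in> U" for x using S that by blast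
  obtain G H where G: "\<And>x. x \<in> U \<Longrightarrow> (\<phi> has_derivative inner (G x)) (at x)"
    and H: "\<And>x. x \<in> U \<Longrightarrow> (G has_derivative H x) (at x)"
    using C2_gradient[OF oU C] by metis
  have sf: "side_fun R g = 0" using side_fun_extremal(1)[OF R g(1)] g(2) by simp
  define G0 where "G0 = side_grad R g"
  have G0: "(side_fun R has_derivative inner (side_grad R x)) (at x)" if "x \<in> side_dom R" for x :: "'n heis"
    using side_fun_deriv[OF R that] by (simp add: side_grad_def)
  note H0 = side_hess[OF R g(1)]
  have sS: "side_fun R x = 0" if "x \<in> frontier (extremal R)" "x \<in> side_dom R" for x :: "'n heis"
    using side_fun_extremal(1)[OF R that(2)] that(1) by simp
  \<comment> \<open>One curve serves both functions, so the acceleration \<open>w\<close> is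
    shared.\<close>
  have tang: "inner (G g) v = 0 \<and> (\<exists>w. inner (H g v) v + inner (G g) w = 0 \<and> inner (side_hess R g v) v + inner G0 w = 0)"
    if v: "inner G0 v = 0" for v
  proof -
    obtain \<gamma> \<gamma>' w d where c: "d > 0" "\<And>s. \<bar>s\<bar> < d \<Longrightarrow> (\<gamma> has_vector_derivative \<gamma>' s) (at s)"
      "\<And>s. \<bar>s\<bar> < d \<Longrightarrow> \<gamma> s \<in> frontier (extremal R)" "\<gamma> 0 = g" "\<gamma>' 0 = v" "(\<gamma>' has_vector_derivative w) (at 0)"
      using side_curve[OF R g(1) sf v[unfolded G0_def]] by metis
    have "inner (G g) v = 0" "inner (H g v) v + inner (G g) w = 0"
      using surface_curve_derivs[OF oU U(1) G H[OF U(1)] \<phi>S c] by auto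
    moreover have "inner (side_hess R g v) v + inner (side_grad R g) w = 0"
      using surface_curve_derivs(2)[OF open_side_dom g(1) G0 H0 sS c] by auto
    ultimately show ?thesis unfolding G0_def by blast
  qed
  define N where "N = (fst g, 0 :: real)"
  have z0: "fst g \<noteq> 0" using g(1) by (simp add: side_dom_def)
  have G0N: "inner G0 N > 0" using z0 by (simp add: G0_def side_grad_def N_def)
  then have G00: "inner G0 G0 > 0" by auto
  define l where "l = inner (G g) G0 / inner G0 G0"
  have GL: "G g = l *\<^sub>R G0"
  proof -
    define v where "v = G g - l *\<^sub>R G0"
    have v0: "inner G0 v = 0" using G00 by (simp add: v_def inner_diff_right l_def inner_commute)
    then have "inner (G g) v = 0" using tang by blast
    then have "inner v v = 0" using v0 by (simp add: v_def inner_diff_left)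
    then show ?thesis by (simp add: v_def)
  qed
  \<comment> \<open>A step from \<open>g\<close> towards the axis enters the extremal set, where
    \<open>\<phi>\<close> is negative; a negative derivative along \<open>N\<close> would make it
    positive there. This is where the outer orientation is used.\<close>
  have "\<not> inner (G g) N < 0"
  proof
    assume neg: "inner (G g) N < 0"
    define f where "f r = \<phi> (g + r *\<^sub>R N)" for r
    have L: "((\<lambda>r::real. g + r *\<^sub>R N) has_derivative (\<lambda>r. r *\<^sub>R N)) (at 0)" by (auto intro!: derivative_eq_intros)
    have "(f has_derivative (\<lambda>r. inner (G g) (r *\<^sub>R N))) (at 0)"
      unfolding f_def using has_derivative_compose[OF L, of \<phi> "inner (G g)"] G[OF U(1)] by simp
    then have fd: "(f has_real_derivative inner (G g) N) (at 0)"
      by (simp add: has_field_derivative_def mult_commute_abs)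
    obtain d where d: "d > 0" "\<And>h. 0 < h \<Longrightarrow> h < d \<Longrightarrow> f 0 < f (0 - h)"
      using DERIV_neg_dec_left[OF fd neg] by blast
    have "open ((\<lambda>r::real. g + r *\<^sub>R N) -` U)" using oU by (intro open_vimage continuous_intros) auto
    then obtain e where e: "e > 0" "ball 0 e \<subseteq> (\<lambda>r::real. g + r *\<^sub>R N) -` U"
    proof (rule openE)
      show "0 \<in> (\<lambda>r::real. g + r *\<^sub>R N) -` U" using U(1) by simp
    qed
    \<comment> \<open>The bound 1 keeps the shifted point off the axis, hence in
      \<open>side_dom\<close>.\<close>
    define h where "h = min (min d e) 1 / 2"
    have h: "0 < h" "h < d" "h < e" "h < 1" using d e by (auto simp: h_def)
    have "- h \<in> ball 0 e" using h by simp
    then have inU: "g + (- h) *\<^sub>R N \<in> U" using e(2) by blast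
    have dom: "g + (- h) *\<^sub>R N \<in> side_dom R"
    proof -
      have "fst g - h *\<^sub>R fst g = (1 - h) *\<^sub>R fst g" by (simp add: algebra_simps)
      then show ?thesis using g(1) h by (simp add: side_dom_def N_def)
    qed
    have "side_fun R (g + (- h) *\<^sub>R N) < 0"
    proof -
      have "fst g - h *\<^sub>R fst g = (1 - h) *\<^sub>R fst g" by (simp add: algebra_simps)
      then have "(norm (fst g - h *\<^sub>R fst g))\<^sup>2 = (1 - h)\<^sup>2 * (norm (fst g))\<^sup>2" by (simp add: power_mult_distrib)
      also have "\<dots> < 1 * (norm (fst g))\<^sup>2"
        using h z0 by (intro mult_strict_right_mono) (auto simp: power_less_one_iff abs_square_less_1)
      finally show ?thesis using sf by (simp add: side_fun_def N_def)
    qed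
    then have "g + (- h) *\<^sub>R N \<in> extremal R \<inter> U" using side_fun_extremal(2)[OF R dom] inU by simp
    then have "\<phi> (g + (- h) *\<^sub>R N) < 0" unfolding E by simp
    moreover have "\<phi> g = 0" using \<phi>S g(2) U(1) by blast
    ultimately show False using d(2)[OF h(1,2)] by (simp add: f_def)
  qed
  then have "l \<ge> 0" using G0N by (simp add: GL not_less zero_le_mult_iff)
  moreover have "l \<noteq> 0"
  proof
    assume "l = 0"
    then have "inner (G g) = (\<lambda>_. 0)" using GL by (simp add: fun_eq_iff)
    then show False using nz frechet_derivative_at[OF G[OF U(1)]] by simp
  qed
  ultimately have l: "l > 0" by simp
  define P0 where "P0 = hproj g G0"
  have nP0: "norm P0 = 2 * R" unfolding P0_def G0_def by (rule side_hproj[OF R sf])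
  have P: "hproj g (G g) = l *\<^sub>R P0" by (simp add: P0_def GL hproj_def algebra_simps)
  then have nP: "norm (hproj g (G g)) = l * (2 * R)" using l nP0 by simp
  then have Pnz: "hproj g (G g) \<noteq> 0" using l R by auto
  show "hW \<phi> g \<noteq> 0" using hp_gradient(2)[OF oU U(1) G] nP l R by simp
  define n where "n = P0 /\<^sub>R (2 * R)"
  have nn: "norm n = 1" using nP0 R by (simp add: n_def)
  have neq: "hproj g (G g) /\<^sub>R norm (hproj g (G g)) = n" unfolding nP P n_def using l R nP0 by (simp add: field_simps)
  have "hess_trace (H g) (fst g) n = l * hess_trace (side_hess R g) (fst g) n"
    unfolding hess_trace_def sum_distrib_left
  proof (rule sum.cong[OF refl])
    fix i
    \<comment> \<open>The horizontal lift of \<open>w\<close> is tangent to the boundary, since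
      \<open>w\<close> is orthogonal to the horizontal normal.\<close>
    define w where "w = bvec i - inner n (bvec i) *\<^sub>R n"
    have "inner n w = 0" using nn by (simp add: w_def inner_diff_right norm_eq_1)
    then have "inner P0 w = 0" using R by (simp add: n_def)
    then have "inner G0 (hor (fst g) w) = 0" by (simp add: inner_hor P0_def)
    then obtain x where x: "inner (H g (hor (fst g) w)) (hor (fst g) w) + inner (G g) x = 0"
      "inner (side_hess R g (hor (fst g) w)) (hor (fst g) w) + inner G0 x = 0" using tang by blast
    have "inner (H g (hor (fst g) w)) (hor (fst g) w) = - (l * inner G0 x)" using x(1) GL by simp
    also have "\<dots> = l * inner (side_hess R g (hor (fst g) w)) (hor (fst g) w)"
    proof -
      have "inner G0 x = - inner (side_hess R g (hor (fst g) w)) (hor (fst g) w)" using x(2) by linarith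
      then show ?thesis by simp
    qed
    finally show "hess_form (H g) (fst g) (bvec i - inner n (bvec i) *\<^sub>R n) (bvec i - inner n (bvec i) *\<^sub>R n) =
      l * hess_form (side_hess R g) (fst g) (bvec i - inner n (bvec i) *\<^sub>R n) (bvec i - inner n (bvec i) *\<^sub>R n)"
      unfolding w_def[symmetric] hess_form_def .
  qed
  also have "hess_trace (side_hess R g) (fst g) n = 4 * real CARD('n)"
    using side_hess_trace[OF R g(1) sf] by (simp add: n_def P0_def G0_def)
  finally have tr: "hess_trace (H g) (fst g) n = l * (4 * real CARD('n))" .
  have "(\<Sum>i\<in>UNIV. Xd i (\<lambda>g'. hp \<phi> i g' / hW \<phi> g') g) = l * (4 * real CARD('n)) / (l * (2 * R))"
    using curvature_eq_hess_trace[OF oU U(1) G H[OF U(1)] Pnz] unfolding neq tr unfolding nP by simp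
  also have "\<dots> = 2 * real CARD('n) / R" using l R by simp
  finally show "(\<Sum>i\<in>UNIV. Xd i (\<lambda>g'. hp \<phi> i g' / hW \<phi> g') g) = 2 * real CARD('n) / R" .
qed

section \<open>Characteristic points and curvature of the extremal boundary\<close>

lemma side_noncharacteristic:
  fixes g :: "'n::finite heis"
  assumes R: "R > 0" and g: "g \<in> side_dom R" "g \<in> frontier (extremal R)"
  shows "noncharacteristic (extremal R) g" "\<not> characteristic (extremal R) g"
    "H_curv (extremal R) g = 2 * real CARD('n) / R"
proof -
  note od = outer_defining_side[OF R g]
  note s = side_defining(2)[OF R]
  show "noncharacteristic (extremal R) g" unfolding noncharacteristic_def using g od(1)[OF g(1) s] s by blast
  show "\<not> characteristic (extremal R) g" unfolding characteristic_def using od(1) by blast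
  show "H_curv (extremal R) g = 2 * real CARD('n) / R"
    unfolding H_curv_def
  proof (rule the_equality)
    show "\<exists>U \<phi>. g \<in> U \<and> outer_defining_function (extremal R) U \<phi> \<and>
      2 * real CARD('n) / R = (\<Sum>i\<in>UNIV. Xd i (\<lambda>g'. hp \<phi> i g' / hW \<phi> g') g)"
      using g(1) s od(2)[OF g(1) s] by (intro exI[of _ "side_dom R"] exI[of _ "side_fun R"]) auto
  qed (use od(2) in blast)
qed

lemma pole_characteristic:
  assumes R: "R > 0" and \<sigma>: "\<sigma> = 1 \<or> \<sigma> = -1"
  shows "(0, \<sigma> * (pi * R\<^sup>2 / 8)) \<in> frontier (extremal R :: 'n::finite heis set)"
    "characteristic (extremal R :: 'n heis set) (0, \<sigma> * (pi * R\<^sup>2 / 8))"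
proof -
  let ?g = "(0, \<sigma> * (pi * R\<^sup>2 / 8)) :: 'n heis"
  have dom: "?g \<in> cap_dom \<sigma> R" by (rule pole_in_cap[OF R \<sigma>])
  note u0 = uprof_0[OF R, where 'n='n]
  show f: "?g \<in> frontier (extremal R)" unfolding frontier_extremal(1)[OF R] using u0 \<sigma> R by auto
  have "hW (cap_fun \<sigma> R) ?g = norm (hproj ?g (- uprof_grad R (fst ?g), \<sigma>))"
    using hp_gradient(2)[OF open_cap_dom dom cap_fun_deriv] by simp
  also have "\<dots> = 0" by (simp add: hproj_def uprof_grad_def)
  finally show "characteristic (extremal R) ?g"
    unfolding characteristic_def using f dom cap_defining[OF R \<sigma>] by blast
qed

lemma frontier_cases:
  assumes R: "R > 0" and g: "g \<in> frontier (extremal R)"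
  obtains (side) "g \<in> side_dom R" | (pole) \<sigma> :: real where "\<sigma> = 1 \<or> \<sigma> = -1" "g = (0, \<sigma> * (pi * R\<^sup>2 / 8))"
proof (cases "g = (0, 1 * (pi * R\<^sup>2 / 8)) \<or> g = (0, - 1 * (pi * R\<^sup>2 / 8))")
  case True
  then show ?thesis using pole[of 1] pole[of "-1"] by blast
next
  case False
  then show ?thesis using frontier_extremal_side[OF R g] by (intro side) simp
qed

text \<open>Near the pole every noncharacteristic boundary point lies in \<open>side_dom\<close>,
  where the curvature is constant, so the limit is immediate. It remains to see that such points
  accumulate at the pole.\<close>

lemma pole_curvature:
  assumes R: "R > 0" and \<sigma>: "\<sigma> = 1 \<or> \<sigma> = -1"
  shows "has_H_mean_curvature (extremal R :: 'n::finite heis set) (0, \<sigma> * (pi * R\<^sup>2 / 8)) (2 * real CARD('n) / R)"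
proof -
  let ?g = "(0, \<sigma> * (pi * R\<^sup>2 / 8)) :: 'n heis"
  let ?N = "Collect (noncharacteristic (extremal R :: 'n heis set))"
  note u0 = uprof_0[OF R, where 'n='n]
  obtain e :: "'n horiz" where e: "norm e = 1" by (rule vector_choose_size[of 1]) simp_all
  have lim: "?g islimpt ?N"
    unfolding islimpt_sequential
  proof (intro exI conjI)
    \<comment> \<open>Radii decreasing to 0; the shift by two keeps them strictly below
      \<open>R\<close>.\<close>
    define x where "x k = R / real (Suc (Suc k))" for k
    define p where "p k = (x k *\<^sub>R e, \<sigma> * uprof R (x k *\<^sub>R e))" for k
    have x: "0 < x k" "x k < R" for k using R mult_strict_left_mono[of 1 "real (Suc (Suc k))" R] by (simp_all add: x_def divide_less_eq)
    have x0: "x \<longlonglongrightarrow> 0"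
      unfolding x_def using LIMSEQ_Suc[OF LIMSEQ_Suc[OF lim_const_over_n[of R]]] by simp
    have n: "norm (x k *\<^sub>R e) = x k" for k using x[of k] e by simp
    show "\<forall>k. p k \<in> ?N - {?g}"
    proof
      fix k
      have f: "p k \<in> frontier (extremal R)"
        unfolding frontier_extremal(1)[OF R] p_def using x[of k] e \<sigma> by auto
      have nz: "x k *\<^sub>R e \<noteq> 0" using x[of k] e by auto
      then have "p k \<in> side_dom R"
        by (intro frontier_extremal_side[OF R f]) (auto simp: p_def)
      then show "p k \<in> ?N - {?g}" using side_noncharacteristic(1)[OF R _ f] nz by (auto simp: p_def)
    qed
    have "continuous_on (ball 0 R) (uprof R :: 'n horiz \<Rightarrow> real)" by (rule C1_on_cont[OF uprof_C1])
    then have cu: "isCont (uprof R) (0 :: 'n horiz)" using R by (simp add: continuous_on_eq_continuous_at)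
    have "(\<lambda>k. x k *\<^sub>R e) \<longlonglongrightarrow> 0 *\<^sub>R e" by (intro tendsto_intros x0)
    then have xe: "(\<lambda>k. x k *\<^sub>R e) \<longlonglongrightarrow> 0" by simp
    have u: "(\<lambda>k. uprof R (x k *\<^sub>R e)) \<longlonglongrightarrow> uprof R (0 :: 'n horiz)" using isCont_tendsto_compose[OF cu xe] .
    show "p \<longlonglongrightarrow> ?g" unfolding p_def u0[symmetric] by (intro tendsto_intros xe u)
  qed
  have "\<forall>\<^sub>F g in at ?g within ?N. H_curv (extremal R) g = 2 * real CARD('n) / R"
  proof -
    have "open {g :: 'n heis. 0 < \<sigma> * snd g}" by (intro open_Collect_less continuous_intros)
    moreover have "?g \<in> {g :: 'n heis. 0 < \<sigma> * snd g}" using \<sigma> R by auto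
    ultimately have "\<forall>\<^sub>F g in nhds ?g. 0 < \<sigma> * snd g" by (auto simp: eventually_nhds)
    then have "\<forall>\<^sub>F g in at ?g within ?N. 0 < \<sigma> * snd g" by (auto simp: eventually_at_filter elim: eventually_mono)
    moreover have "\<forall>\<^sub>F g in at ?g within ?N. g \<in> ?N \<and> g \<noteq> ?g" by (simp add: eventually_at_filter)
    ultimately show ?thesis
    proof eventually_elim
      case (elim g)
      have f: "g \<in> frontier (extremal R)" using elim by (simp add: noncharacteristic_def)
      from R f have "g \<in> side_dom R"
      proof (cases rule: frontier_cases)
        case (pole \<tau>)
        define T where "T = pi * R\<^sup>2 / 8"
        have "T > 0" using R by (simp add: T_def)
        moreover have "0 < \<sigma> * (\<tau> * T)" using pole(2) elim(1) by (simp add: T_def)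
        ultimately have "\<tau> = \<sigma>" using pole(1) \<sigma> by auto
        then show ?thesis using pole elim by simp
      qed
      then show ?case using side_noncharacteristic(3)[OF R _ f] by simp
    qed
  qed
  then have "(H_curv (extremal R) \<longlongrightarrow> 2 * real CARD('n) / R) (at ?g within ?N)" by (rule tendsto_eventually)
  then show ?thesis unfolding has_H_mean_curvature_def using lim pole_characteristic(2)[OF R \<sigma>] by blast
qed

lemma extremal_constant_curvature:
  assumes R: "R > 0"
  shows "constant_H_mean_curvature (extremal R :: 'n::finite heis set) (2 * real CARD('n) / R)"
  unfolding constant_H_mean_curvature_def
proof (intro conjI ballI)
  fix g :: "'n heis" assume g: "g \<in> frontier (extremal R)"
  from R g show "\<exists>U \<phi>. g \<in> U \<and> outer_defining_function (extremal R) U \<phi>"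
  proof (cases rule: frontier_cases)
    case side
    then show ?thesis using side_defining(2)[OF R] by blast
  next
    case (pole \<sigma>)
    then show ?thesis using cap_defining[OF R pole(1)] pole_in_cap[OF R pole(1)] by blast
  qed
  from R g show "has_H_mean_curvature (extremal R) g (2 * real CARD('n) / R)"
  proof (cases rule: frontier_cases)
    case side
    then show ?thesis using side_noncharacteristic[OF R side g] by (simp add: has_H_mean_curvature_def)
  next
    case (pole \<sigma>)
    then show ?thesis using pole_curvature[OF R pole(1)] by simp
  qed
qed

lemma extremal_characteristic:
  assumes R: "R > 0"
  shows "{g. characteristic (extremal R :: 'n::finite heis set) g} = {(0, pi * R\<^sup>2 / 8), (0, - (pi * R\<^sup>2 / 8))}"
proof (intro subset_antisym subsetI)
  fix g assume "g \<in> {g. characteristic (extremal R :: 'n heis set) g}"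
  then have c: "characteristic (extremal R) g" by simp
  then have f: "g \<in> frontier (extremal R)" by (simp add: characteristic_def)
  from R f show "g \<in> {(0, pi * R\<^sup>2 / 8), (0, - (pi * R\<^sup>2 / 8))}"
  proof (cases rule: frontier_cases)
    case side
    then show ?thesis using side_noncharacteristic(2)[OF R side f] c by simp
  qed auto
next
  fix g :: "'n heis" assume "g \<in> {(0, pi * R\<^sup>2 / 8), (0, - (pi * R\<^sup>2 / 8))}"
  then show "g \<in> {g. characteristic (extremal R) g}"
    using pole_characteristic(2)[OF R, of 1, where 'n='n] pole_characteristic(2)[OF R, of "-1", where 'n='n] by auto
qed

text \<open>Explains the constant in \<open>R\<close>: it is the reciprocal of the volume of
  \<open>extremal 1\<close>. The unit ball contributes \<open>pi powr n / Gamma (n + 1)\<close> and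
  the Beta value \<open>Gamma (n + 3 / 2) * sqrt pi / Gamma (n + 2)\<close>.\<close>

lemma inverse_volume_const:
  fixes Q :: real
  assumes Q: "Q = 2 * real CARD('n::finite) + 2"
  shows "(Q - 2) * Gamma ((Q + 2) / 2) * Gamma ((Q - 2) / 2) / (pi powr ((Q - 1) / 2) * Gamma ((Q + 1) / 2))
    = 1 / volume_const TYPE('n)"
proof -
  define n where "n = real CARD('n)"
  have n: "n > 0" by (simp add: n_def)
  have Q': "(Q + 2) / 2 = n + 2" "(Q - 2) / 2 = n" "(Q - 1) / 2 = n + 1 / 2" "(Q + 1) / 2 = n + 3 / 2" "Q - 2 = 2 * n"
    by (simp_all add: Q n_def field_simps)
  have "n \<notin> \<int>\<^sub>\<le>\<^sub>0" using n by (auto elim!: nonpos_Ints_cases)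
  then have g: "Gamma (n + 1) = n * Gamma n" by (rule Gamma_plus1)
  have p: "pi powr (n + 1 / 2) = pi powr n * sqrt pi" by (simp add: powr_add powr_half_sqrt)
  have "volume_const TYPE('n) = pi powr n / (n * Gamma n) / 2 * (Gamma (n + 3 / 2) * sqrt pi / Gamma (n + 2))"
    unfolding volume_const_def unit_ball_vol_def Beta_def n_def[symmetric] using g
    by (simp add: Gamma_one_half_real add.commute)
  then show ?thesis unfolding Q' p by (simp add: mult_ac)
qed

lemma frontier_dilation_extremal:
  assumes R: "R > 0"
  shows "dilation R ` frontier (extremal 1 :: 'n::finite heis set) = frontier (extremal R)"
proof -
  have "norm (z /\<^sub>R R) \<le> 1 \<longleftrightarrow> norm z \<le> R" for z :: "'n horiz"
  proof -
    have "norm (z /\<^sub>R R) = norm z / R" using R by (simp add: divide_inverse)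
    then show ?thesis using R by simp
  qed
  moreover have "t / R\<^sup>2 = u \<longleftrightarrow> t = R\<^sup>2 * u" "t / R\<^sup>2 = - u \<longleftrightarrow> t = - (R\<^sup>2 * u)" for t u :: real
    using R by (auto simp: field_simps)
  ultimately show ?thesis
    unfolding dilation_image[OF R] frontier_extremal(1)[OF R] frontier_extremal(1)[OF zero_less_one] uprof_div[OF R]
    by (auto simp del: norm_scaleR)
qed

lemma extremal_regularity:
  fixes g :: "'n::finite heis"
  assumes R: "R > 0"
  shows "g \<in> {(0, pi * R\<^sup>2 / 8), (0, - (pi * R\<^sup>2 / 8))} \<Longrightarrow>
      hypersurface_near 2 (frontier (extremal R)) g \<and> \<not> hypersurface_near 3 (frontier (extremal R)) g"
    "g \<in> frontier (extremal R) - {(0, pi * R\<^sup>2 / 8), (0, - (pi * R\<^sup>2 / 8))} \<Longrightarrow>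
      hypersurface_near \<infinity> (frontier (extremal R)) g"
proof -
  have "hypersurface_near 2 (frontier (extremal R)) (0 :: 'n horiz, \<sigma> * (pi * R\<^sup>2 / 8))
      \<and> \<not> hypersurface_near 3 (frontier (extremal R)) (0 :: 'n horiz, \<sigma> * (pi * R\<^sup>2 / 8))"
    if \<sigma>: "\<sigma> = 1 \<or> \<sigma> = -1" for \<sigma> :: real
    using pole_not_C3[OF R \<sigma>] pole_in_cap[OF R \<sigma>] cap_defining[OF R \<sigma>]
    unfolding hypersurface_near_def outer_defining_function_def by blast
  from this[of 1] this[of "-1"]
  show "g \<in> {(0, pi * R\<^sup>2 / 8), (0, - (pi * R\<^sup>2 / 8))} \<Longrightarrow>
      hypersurface_near 2 (frontier (extremal R)) g \<and> \<not> hypersurface_near 3 (frontier (extremal R)) g" by auto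
  assume "g \<in> frontier (extremal R) - {(0, pi * R\<^sup>2 / 8), (0, - (pi * R\<^sup>2 / 8))}"
  then have "g \<in> side_dom R" using frontier_extremal_side[OF R] by blast
  then show "hypersurface_near \<infinity> (frontier (extremal R)) g"
    unfolding hypersurface_near_def using side_defining(1)[OF R] by blast
qed

theorem theorem1p1:
  fixes V Q R :: real and E_R :: "'n::finite heis set"
  assumes Q: "Q = 2 * real CARD('n) + 2"
    and V: "V > 0"
    and R: "R = ((Q - 2) * Gamma ((Q + 2) / 2) * Gamma ((Q - 2) / 2)
                 / (pi powr ((Q - 1) / 2) * Gamma ((Q + 1) / 2))) powr (1 / Q) * V powr (1 / Q)"
    and E_R: "E_R = dilation R ` E_o"
  shows
    "(bounded (E_o :: 'n heis set) \<and> open (E_o :: 'n heis set) \<and>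
      frontier (E_o :: 'n heis set) = {(z, t). norm z \<le> 1 \<and> (t = u_o z \<or> t = - u_o z)}) \<and>
     (\<forall>E. is_arg_min (\<lambda>F. H_perimeter F UNIV)
            (\<lambda>F. F \<in> class_E \<and> emeasure lebesgue F = ennreal V) E \<longleftrightarrow> E = E_R) \<and>
     (bounded E_R \<and> open E_R \<and> frontier E_R = dilation R ` frontier E_o) \<and>
     {g. characteristic E_R g} = {(0, pi * R\<^sup>2 / 8), (0, - (pi * R\<^sup>2 / 8))} \<and>
     (\<forall>g \<in> {(0, pi * R\<^sup>2 / 8), (0, - (pi * R\<^sup>2 / 8))}.
        hypersurface_near 2 (frontier E_R) g \<and> \<not> hypersurface_near 3 (frontier E_R) g) \<and>
     (\<forall>g \<in> frontier E_R - {(0, pi * R\<^sup>2 / 8), (0, - (pi * R\<^sup>2 / 8))}.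
        hypersurface_near \<infinity> (frontier E_R) g) \<and>
     constant_H_mean_curvature E_R ((Q - 2) / R) \<and> (Q - 2) / R > 0"
proof -
  note k = volume_const_pos[where 'n='n]
  \<comment> \<open>In this form the radius is visibly the one for which the extremal set has volume
    \<open>V\<close>, the \<open>Q\<close>-th power of \<open>R\<close> being
    \<open>V / volume_const\<close>.\<close>
  have Re: "R = (V / volume_const TYPE('n)) powr (1 / Q)"
    unfolding R inverse_volume_const[OF Q] using k V by (simp add: powr_mult[symmetric])
  have R0: "R > 0" using k V by (simp add: Re)
  have "R ^ (2 * CARD('n) + 2) = R powr real (2 * CARD('n) + 2)" by (rule powr_realpow[OF R0, symmetric])
  also have "real (2 * CARD('n) + 2) = Q" by (simp add: Q)
  also have "R powr Q = V / volume_const TYPE('n)"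
    unfolding Re powr_powr using k V by (simp add: Q add_eq_0_iff)
  finally have V': "V = volume_const TYPE('n) * R ^ (2 * CARD('n) + 2)" using k by simp
  have E: "E_R = extremal R" unfolding E_R E_o_eq by (rule dilation_extremal[OF R0])
  have H: "(Q - 2) / R = 2 * real CARD('n) / R" by (simp add: Q)
  show ?thesis
    unfolding E H E_o_eq u_o_eq
    by (intro conjI allI ballI bounded_extremal open_extremal frontier_extremal(1)[OF zero_less_one]
        extremal_unique_minimizer[OF R0 V'] frontier_dilation_extremal[OF R0, symmetric]
        extremal_characteristic[OF R0] extremal_regularity(1)[OF R0, THEN conjunct1] extremal_regularity(1)[OF R0, THEN conjunct2]
        extremal_regularity(2)[OF R0] extremal_constant_curvature[OF R0])
      (use R0 in simp_all)
qed

end
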